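(* Set $p=q=m=0$ (so $n\ge1$). With $\phi$, $\varphi$ and the Gaudin algebras as defined in the context, $$\phi\big(\mathcal A_d^{\mathbf w,\boldsymbol\xi}(\mathbf z,\boldsymbol\gamma)\big)=\varphi\big(\mathcal A_{0|n}^{\mathbf z,\boldsymbol\gamma}(\mathbf w,\boldsymbol\xi)\big)$$ as subalgebras of $\mathcal D$.
   Context: Everything is over $\mathbb C$; $d,n\ge1$. $\mathfrak{gl}_d$ has standard basis $e_{ab}$. $\mathfrak{gl}_{0|n}$ is the Lie superalgebra of endomorphisms of the purely odd space $\mathbb C^{0|n}$, with basis $E^i_j$ ($1\le i,j\le n$), all even, $[E^i_j,E^k_l]=\delta_{jk}E^i_l-\delta_{il}E^k_j$. **Parameters.** $1\le d'\le d$, $1\le\ell\le n$; $\mathbf w\in\mathbb C^{d'}$, $\mathbf z\in\mathbb C^\ell$ arbitrary; positive integers $\boldsymbol\xi=(\xi_1,\dots,\xi_{d'})$ with $\sum\xi_a=d$, $\boldsymbol\gamma=(\gamma_1,\dots,\gamma_\ell)$ with $\sum\gamma_i=n$; $d_1=0$, $d_{a+1}=\xi_1+\dots+\xi_a$; $l_1=0$, $l_{i+1}=\gamma_1+\dots+\gamma_i$. **Takiff algebras.** For a Lie (super)algebra $\mathfrak g$, put $t_a=t-a$ and $\mathfrak g(a,\gamma)=\mathfrak g[t_a]/t_a^\gamma\mathfrak g[t_a]$; the class of $A\otimes t_a^k$ is $A\otimes\bar t_a^{\,k}$. $\mathfrak{gl}_d(\mathbf z,\boldsymbol\gamma)=\bigoplus_{i=1}^\ell\mathfrak{gl}_d(z_i,\gamma_i)$,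 $\mathfrak{gl}_{0|n}(\mathbf w,\boldsymbol\xi)=\bigoplus_{a=1}^{d'}\mathfrak{gl}_{0|n}(w_a,\xi_a)$ (external direct sums). **Homomorphisms.** $\mathcal F$ is the exterior (free supercommutative) algebra in odd variables $x^a_i$, $1\le i\le n$, $1\le a\le d$; $\mathcal D\subseteq\mathrm{End}(\mathcal F)$ is generated by multiplications by $x^a_i$ and the odd (left) derivatives $\partial_{x^a_i}$. The superalgebra homomorphisms $\phi:U(\mathfrak{gl}_d(\mathbf z,\boldsymbol\gamma))\to\mathcal D$ and $\varphi:U(\mathfrak{gl}_{0|n}(\mathbf w,\boldsymbol\xi))\to\mathcal D$ are given by $$\phi(e_{ab}\otimes\bar t_{z_j}^{\,k})=-\sum_{r=l_j+1}^{l_{j+1}-k}\partial_{x^b_r}x^a_{r+k}\ (0\le k<\gamma_j),\qquad\varphi(E^i_j\otimes\bar t_{w_a}^{\,k})=\sum_{\alpha=d_a+1}^{d_{a+1}-k}x^{\alpha+k}_i\partial_{x^\alpha_j}\ (0\le k<\xi_a).$$ **Gaudin algebras.** For an algebra $\mathcal A$, $\mathcal A(\!(z^{-1},\partial_z^{-1})\!)$ is the algebra of series $\sum_{j\le s}\sum_{i\le r}a_{ij}z^i\partial_z^j$ ($r,s\in\mathbb Z$, $a_{ij}\in\mathcal A$), with $z,\partial_z$ commuting with $\mathcal A$ and $\partial_z^i f=\sum_{k\ge0}\binom ik f^{(k)}\partial_z^{i-k}$ for $i\in\mathbb Z$, $f\in\mathcal A(\!(z^{-1})\!)$. Fractions are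 expanded in $z^{-1}$. $\mathrm{cdet}(A)=\sum_{\sigma}(-1)^{l(\sigma)}a_{\sigma(1),1}\cdots a_{\sigma(k),k}$. For an $n\times n$ matrix $A$, $\mathrm{Ber}^{(1^n)}(A)=d_1(A)^{-1}\cdots d_n(A)^{-1}$, where $d_i(A)$ is the inverse of the $(i,i)$ entry of the inverse of the upper-left $i\times i$ submatrix of $A$. $\mathrm J_k(\lambda)$ is the $k\times k$ Jordan block with $\lambda$ on the diagonal and $1$ on the superdiagonal; $\mathrm J_{\boldsymbol\xi}(\mathbf w)=\bigoplus_a\mathrm J_{\xi_a}(w_a)$, $\mathrm J_{\boldsymbol\gamma}(\mathbf z)=\bigoplus_i\mathrm J_{\gamma_i}(z_i)$. $\mathcal A_d^{\mathbf w,\boldsymbol\xi}(\mathbf z,\boldsymbol\gamma)\subseteq U(\mathfrak{gl}_d(\mathbf z,\boldsymbol\gamma))$ is generated by all coefficients of the series $a_i(z)$ in $$\mathrm{cdet}\Big[\delta_{ab}\partial_z-\mathrm J_{\boldsymbol\xi}(\mathbf w)_{a,b}-\sum_{i=1}^\ell\sum_{k=0}^{\gamma_i-1}\frac{e_{ab}\otimes\bar t_{z_i}^{\,k}}{(z-z_i)^{k+1}}\Big]_{a,b=1}^d=\partial_z^d+\sum_{i=1}^da_i(z)\partial_z^{i-1}.$$ $\mathcal A_{0|n}^{\mathbf z,\boldsymbol\gamma}(\mathbf w,\boldsymbol\xi)\subseteq U(\mathfrak{gl}_{0|n}(\mathbf w,\boldsymbol\xi))$ is generated by all coefficients of the series $b_i(z)$,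 $i\le-n$, in $$\mathrm{Ber}^{(1^n)}\Big[\delta_{ij}\partial_z-\mathrm J_{\boldsymbol\gamma}(\mathbf z)_{i,j}+\sum_{a=1}^{d'}\sum_{k=0}^{\xi_a-1}\frac{E^i_j\otimes\bar t_{w_a}^{\,k}}{(z-w_a)^{k+1}}\Big]_{i,j=1}^n=\sum_{i\le-n}b_i(z)\partial_z^i.$$ *)

theory Defs
  imports
    "HOL-Algebra.QuotRing"
    "HOL-Algebra.Module"
    "HOL-Combinatorics.Permutations"
    "HOL-Computational_Algebra.Formal_Power_Series"
    "Jordan_Normal_Form.Jordan_Normal_Form"
begin

section \<open>Associative unital algebras over the complex numbers\<close>

text \<open>
  An associative unital complex algebra is an object of the HOL-Algebra record type
  \<open>(complex, 'a) module\<close>; the locale \<open>algebra\<close> is not used because it assumes commutativity.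
  All indices below start at 1, as in the mathematical text, except that entries of
  the matrix type \<open>complex mat\<close> are numbered from 0.
\<close>

definition list_prod :: "('a, 'm) monoid_scheme \<Rightarrow> 'a list \<Rightarrow> 'a" where
  "list_prod R xs = foldr (monoid.mult R) xs \<one>\<^bsub>R\<^esub>"

inductive_set alg_generate :: "(complex, 'a, 'm) module_scheme \<Rightarrow> 'a set \<Rightarrow> 'a set"
  for A S where
    one: "\<one>\<^bsub>A\<^esub> \<in> alg_generate A S"
  | gen: "x \<in> S \<Longrightarrow> x \<in> alg_generate A S"
  | add: "x \<in> alg_generate A S \<Longrightarrow> y \<in> alg_generate A S \<Longrightarrow> x \<oplus>\<^bsub>A\<^esub> y \<in> alg_generate A S"
  | mult: "x \<in> alg_generate A S \<Longrightarrow> y \<in> alg_generate A S \<Longrightarrow> x \<otimes>\<^bsub>A\<^esub> y \<in> alg_generate A S"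
  | smult: "x \<in> alg_generate A S \<Longrightarrow> c \<odot>\<^bsub>A\<^esub> x \<in> alg_generate A S"

definition alg_quot :: "(complex, 'a, 'm) module_scheme \<Rightarrow> 'a set \<Rightarrow> (complex, 'a set) module" where
  "alg_quot A I =
     \<lparr>carrier = carrier (A Quot I), monoid.mult = monoid.mult (A Quot I), one = monoid.one (A Quot I),
      zero = ring.zero (A Quot I), add = ring.add (A Quot I),
      smult = (\<lambda>c C. \<Union>p\<in>C. I +>\<^bsub>A\<^esub> (c \<odot>\<^bsub>A\<^esub> p))\<rparr>"

text \<open>Free algebra on \<open>X\<close>: finitely supported functions on words with letters in \<open>X\<close>.\<close>

definition free_alg :: "'g set \<Rightarrow> (complex, 'g list \<Rightarrow> complex) module" where
  "free_alg X =
     \<lparr>carrier = {p. finite {u. p u \<noteq> 0} \<and> {u. p u \<noteq> 0} \<subseteq> lists X},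
      monoid.mult = (\<lambda>p q u. \<Sum>k\<le>length u. p (take k u) * q (drop k u)),
      one = (\<lambda>u. if u = [] then 1 else 0),
      zero = (\<lambda>u. 0),
      add = (\<lambda>p q u. p u + q u),
      smult = (\<lambda>c p u. c * p u)\<rparr>"

definition free_word :: "'g list \<Rightarrow> 'g list \<Rightarrow> complex" where
  "free_word v = (\<lambda>u. if u = v then 1 else 0)"

definition free_eval :: "(complex, 'a, 'm) module_scheme \<Rightarrow> ('g \<Rightarrow> 'a) \<Rightarrow> ('g list \<Rightarrow> complex) \<Rightarrow> 'a" where
  "free_eval A f p = (\<Oplus>\<^bsub>A\<^esub>u\<in>{u. p u \<noteq> 0}. p u \<odot>\<^bsub>A\<^esub> list_prod A (map f u))"

definition End_alg :: "(complex, 'a, 'm) module_scheme \<Rightarrow> (complex, 'a \<Rightarrow> 'a) module" where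
  "End_alg M =
     \<lparr>carrier = {T \<in> carrier M \<rightarrow>\<^sub>E carrier M.
        (\<forall>x\<in>carrier M. \<forall>y\<in>carrier M. T (x \<oplus>\<^bsub>M\<^esub> y) = T x \<oplus>\<^bsub>M\<^esub> T y) \<and>
        (\<forall>c. \<forall>x\<in>carrier M. T (c \<odot>\<^bsub>M\<^esub> x) = c \<odot>\<^bsub>M\<^esub> T x)},
      monoid.mult = compose (carrier M),
      one = (\<lambda>x\<in>carrier M. x),
      zero = (\<lambda>x\<in>carrier M. \<zero>\<^bsub>M\<^esub>),
      add = (\<lambda>S T. \<lambda>x\<in>carrier M. S x \<oplus>\<^bsub>M\<^esub> T x),
      smult = (\<lambda>c T. \<lambda>x\<in>carrier M. c \<odot>\<^bsub>M\<^esub> T x)\<rparr>"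


lemma free_alg_assoc:
  fixes p q r :: "'g list \<Rightarrow> complex"
  shows "(\<Sum>k\<le>length u. (\<Sum>m\<le>length (take k u). p (take m (take k u)) * q (drop m (take k u))) * r (drop k u))
       = (\<Sum>k\<le>length u. p (take k u) * (\<Sum>m\<le>length (drop k u). q (take m (drop k u)) * r (drop m (drop k u))))"
proof -
  have "(\<Sum>k\<le>length u. (\<Sum>m\<le>length (take k u). p (take m (take k u)) * q (drop m (take k u))) * r (drop k u))
     = (\<Sum>(k,m)\<in>(SIGMA k:{..length u}. {..k}). p (take m u) * q (drop m (take k u)) * r (drop k u))"
    by (subst sum.Sigma[symmetric]) (auto simp: sum_distrib_right min_def intro!: sum.cong)
  also have "\<dots> = (\<Sum>(k,m)\<in>(SIGMA k:{..length u}. {..length u - k}). p (take k u) * q (take m (drop k u)) * r (drop m (drop k u)))"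
    by (rule sum.reindex_bij_witness[where i = "\<lambda>(k,m). (k+m,k)" and j = "\<lambda>(k,m). (m,k-m)"])
       (auto simp: take_drop add.commute)
  also have "\<dots> = (\<Sum>k\<le>length u. p (take k u) * (\<Sum>m\<le>length (drop k u). q (take m (drop k u)) * r (drop m (drop k u))))"
    by (subst sum.Sigma[symmetric]) (auto simp: sum_distrib_left mult.assoc intro!: sum.cong)
  finally show ?thesis .
qed

lemma ring_free_alg: "ring (free_alg X)"
proof (rule ringI)
  show "abelian_group (free_alg X)"
  proof (rule abelian_groupI)
    fix p q assume "p \<in> carrier (free_alg X)" "q \<in> carrier (free_alg X)"
    moreover have "{u. p u + q u \<noteq> 0} \<subseteq> {u. p u \<noteq> 0} \<union> {u. q u \<noteq> 0}" by auto
    ultimately show "p \<oplus>\<^bsub>free_alg X\<^esub> q \<in> carrier (free_alg X)"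
      unfolding free_alg_def by (auto intro: finite_subset)
  next
    fix p assume p: "p \<in> carrier (free_alg X)"
    show "\<exists>q\<in>carrier (free_alg X). q \<oplus>\<^bsub>free_alg X\<^esub> p = \<zero>\<^bsub>free_alg X\<^esub>"
      by (rule bexI[of _ "\<lambda>u. - p u"]) (use p in \<open>auto simp: free_alg_def\<close>)
  qed (auto simp: free_alg_def add_ac)
  show "monoid (free_alg X)"
  proof (rule monoidI)
    fix p q assume pq: "p \<in> carrier (free_alg X)" "q \<in> carrier (free_alg X)"
    have "{u. (\<Sum>k\<le>length u. p (take k u) * q (drop k u)) \<noteq> 0}
        \<subseteq> (\<lambda>(x,y). x @ y) ` ({u. p u \<noteq> 0} \<times> {u. q u \<noteq> 0})" (is "?A \<subseteq> ?B")
    proof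
      fix u assume "u \<in> ?A"
      then obtain k where "p (take k u) * q (drop k u) \<noteq> 0" by (auto elim: sum.not_neutral_contains_not_neutral)
      thus "u \<in> ?B" by (intro rev_image_eqI[of "(take k u, drop k u)"]) auto
    qed
    moreover have "finite ?B" using pq by (auto simp: free_alg_def)
    moreover have "?B \<subseteq> lists X" using pq by (fastforce simp: free_alg_def subset_iff)
    ultimately show "p \<otimes>\<^bsub>free_alg X\<^esub> q \<in> carrier (free_alg X)"
      unfolding free_alg_def by (auto intro: finite_subset)
  next
    fix p assume "p \<in> carrier (free_alg X)"
    have "(\<Sum>k\<le>length u. (if take k u = [] then 1 else 0) * p (drop k u)) = p u" for u :: "'a list"
    proof -
      have "(\<Sum>k\<le>length u. (if take k u = [] then 1 else 0) * p (drop k u)) = (\<Sum>k\<in>{0}. p (drop k u))"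
        by (rule sum.mono_neutral_cong_right) auto
      thus ?thesis by simp
    qed
    thus "\<one>\<^bsub>free_alg X\<^esub> \<otimes>\<^bsub>free_alg X\<^esub> p = p" by (simp add: free_alg_def)
    have "(\<Sum>k\<le>length u. p (take k u) * (if drop k u = [] then 1 else 0)) = p u" for u :: "'a list"
    proof -
      have "(\<Sum>k\<le>length u. p (take k u) * (if drop k u = [] then 1 else 0)) = (\<Sum>k\<in>{length u}. p (take k u))"
        by (rule sum.mono_neutral_cong_right) auto
      thus ?thesis by simp
    qed
    thus "p \<otimes>\<^bsub>free_alg X\<^esub> \<one>\<^bsub>free_alg X\<^esub> = p" by (simp add: free_alg_def)
  next
    fix p q r assume "p \<in> carrier (free_alg X)"
    show "p \<otimes>\<^bsub>free_alg X\<^esub> q \<otimes>\<^bsub>free_alg X\<^esub> r = p \<otimes>\<^bsub>free_alg X\<^esub> (q \<otimes>\<^bsub>free_alg X\<^esub> r)"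
      unfolding free_alg_def using free_alg_assoc[where p = p and q = q and r = r] by (simp add: fun_eq_iff)
  qed (auto simp: free_alg_def)
qed (auto simp: free_alg_def fun_eq_iff sum.distrib algebra_simps)


section \<open>Lie algebras and universal enveloping algebras\<close>

record 'g lie_alg = "'g partial_object" +
  lie_zero :: 'g
  lie_add :: "'g \<Rightarrow> 'g \<Rightarrow> 'g"
  lie_smult :: "complex \<Rightarrow> 'g \<Rightarrow> 'g"
  lie_bracket :: "'g \<Rightarrow> 'g \<Rightarrow> 'g"

definition uea_relations :: "'g lie_alg \<Rightarrow> ('g list \<Rightarrow> complex) set" where
  "uea_relations L = (let T = free_alg (carrier L); v = (\<lambda>x. free_word [x]) in
     {v (lie_add L x y) \<ominus>\<^bsub>T\<^esub> (v x \<oplus>\<^bsub>T\<^esub> v y) | x y. x \<in> carrier L \<and> y \<in> carrier L} \<union>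
     {v (lie_smult L c x) \<ominus>\<^bsub>T\<^esub> c \<odot>\<^bsub>T\<^esub> v x | c x. x \<in> carrier L} \<union>
     {v (lie_bracket L x y) \<ominus>\<^bsub>T\<^esub> (v x \<otimes>\<^bsub>T\<^esub> v y \<ominus>\<^bsub>T\<^esub> v y \<otimes>\<^bsub>T\<^esub> v x)
        | x y. x \<in> carrier L \<and> y \<in> carrier L})"

definition uea_ideal :: "'g lie_alg \<Rightarrow> ('g list \<Rightarrow> complex) set" where
  "uea_ideal L = Idl\<^bsub>free_alg (carrier L)\<^esub> (uea_relations L)"

definition uea :: "'g lie_alg \<Rightarrow> (complex, ('g list \<Rightarrow> complex) set) module" where
  "uea L = alg_quot (free_alg (carrier L)) (uea_ideal L)"

definition uea_gen :: "'g lie_alg \<Rightarrow> 'g \<Rightarrow> ('g list \<Rightarrow> complex) set" where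
  "uea_gen L x = uea_ideal L +>\<^bsub>free_alg (carrier L)\<^esub> free_word [x]"

text \<open>
  The homomorphism from \<open>U(L)\<close> to \<open>A\<close> extending a Lie algebra map \<open>f\<close> from \<open>L\<close> to \<open>A\<close>.
  If \<open>f\<close> is a Lie algebra map, then all representatives of a class have the same value
  under \<^const>\<open>free_eval\<close>, so that the image of the class is a singleton.
\<close>

definition uea_lift ::
  "(complex, 'a, 'm) module_scheme \<Rightarrow> ('g \<Rightarrow> 'a) \<Rightarrow> ('g list \<Rightarrow> complex) set \<Rightarrow> 'a" where
  "uea_lift A f C = the_elem (free_eval A f ` C)"


lemma uea_relations_closed:
  assumes "\<And>x y. x \<in> carrier L \<Longrightarrow> y \<in> carrier L \<Longrightarrow> lie_add L x y \<in> carrier L"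
    and "\<And>c x. x \<in> carrier L \<Longrightarrow> lie_smult L c x \<in> carrier L"
    and "\<And>x y. x \<in> carrier L \<Longrightarrow> y \<in> carrier L \<Longrightarrow> lie_bracket L x y \<in> carrier L"
  shows "uea_relations L \<subseteq> carrier (free_alg (carrier L))"
proof -
  interpret T: ring "free_alg (carrier L)" by (rule ring_free_alg)
  have v: "free_word [x] \<in> carrier (free_alg (carrier L))" if "x \<in> carrier L" for x
    using that by (auto simp: free_alg_def free_word_def)
  have s: "c \<odot>\<^bsub>free_alg (carrier L)\<^esub> p \<in> carrier (free_alg (carrier L))"
    if "p \<in> carrier (free_alg (carrier L))" for c p
    using that by (auto simp: free_alg_def intro: finite_subset)
  show ?thesis
    unfolding uea_relations_def Let_def
    by (auto intro!: v s assms T.minus_closed T.a_closed T.m_closed)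
qed


section \<open>Takiff algebras\<close>

definition lie_dsum :: "'i set \<Rightarrow> ('i \<Rightarrow> 'g lie_alg) \<Rightarrow> ('i \<Rightarrow> 'g) lie_alg" where
  "lie_dsum I L =
     \<lparr>carrier = (\<Pi>\<^sub>E i\<in>I. carrier (L i)),
      lie_zero = (\<lambda>i\<in>I. lie_zero (L i)),
      lie_add = (\<lambda>X Y. \<lambda>i\<in>I. lie_add (L i) (X i) (Y i)),
      lie_smult = (\<lambda>c X. \<lambda>i\<in>I. lie_smult (L i) c (X i)),
      lie_bracket = (\<lambda>X Y. \<lambda>i\<in>I. lie_bracket (L i) (X i) (Y i))\<rparr>"

definition dsum_inj :: "'i set \<Rightarrow> ('i \<Rightarrow> 'g lie_alg) \<Rightarrow> 'i \<Rightarrow> 'g \<Rightarrow> 'i \<Rightarrow> 'g" where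
  "dsum_inj I L i x = (\<lambda>i'\<in>I. if i' = i then x else lie_zero (L i'))"

text \<open>
  The quotient of \<open>g[t_a]\<close> by \<open>t_a^N g[t_a]\<close>, each class being represented by its unique
  representative \<open>\<Sum>k<N. X k \<otimes> t_a^k\<close> of degree less than \<open>N\<close>.  The point \<open>a\<close> only serves to
  name the variable \<open>t_a = t - a\<close> and does not enter the structure.
\<close>

definition takiff :: "'g lie_alg \<Rightarrow> nat \<Rightarrow> (nat \<Rightarrow> 'g) lie_alg" where
  "takiff L N =
     \<lparr>carrier = {..<N} \<rightarrow>\<^sub>E carrier L,
      lie_zero = (\<lambda>k\<in>{..<N}. lie_zero L),
      lie_add = (\<lambda>X Y. \<lambda>k\<in>{..<N}. lie_add L (X k) (Y k)),
      lie_smult = (\<lambda>c X. \<lambda>k\<in>{..<N}. lie_smult L c (X k)),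
      lie_bracket = (\<lambda>X Y. \<lambda>k\<in>{..<N}.
        foldr (lie_add L) (map (\<lambda>p. lie_bracket L (X p) (Y (k - p))) [0..<Suc k]) (lie_zero L))\<rparr>"

definition takiff_elem :: "'g lie_alg \<Rightarrow> nat \<Rightarrow> 'g \<Rightarrow> nat \<Rightarrow> nat \<Rightarrow> 'g" where
  "takiff_elem L N x k = (\<lambda>k'\<in>{..<N}. if k' = k then x else lie_zero L)"

text \<open>
  The Lie superalgebra of endomorphisms of the purely odd space of dimension \<open>n\<close> is purely even
  and hence is the ordinary Lie algebra \<open>gl n\<close>; its basis vector \<open>E^i_j\<close> is the matrix unit
  \<open>mat_unit n i j\<close>.
\<close>

definition gl :: "nat \<Rightarrow> complex mat lie_alg" where
  "gl n = \<lparr>carrier = carrier_mat n n, lie_zero = 0\<^sub>m n n, lie_add = (+), lie_smult = (\<cdot>\<^sub>m),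
           lie_bracket = (\<lambda>X Y. X * Y - Y * X)\<rparr>"

definition mat_unit :: "nat \<Rightarrow> nat \<Rightarrow> nat \<Rightarrow> complex mat" where
  "mat_unit n a b = mat n n (\<lambda>(i, j). if i + 1 = a \<and> j + 1 = b then 1 else 0)"

text \<open>
  \<open>gl_takiff n m c\<close> is the direct sum of the Takiff algebras of \<open>gl n\<close> with truncation orders
  \<open>c 1, \<dots>, c m\<close>, and \<open>gl_takiff_elem n m c a b i k\<close> is the \<open>k\<close>-th power of the \<open>i\<close>-th variable
  times the matrix unit with row \<open>a\<close> and column \<open>b\<close>.
\<close>

definition gl_takiff :: "nat \<Rightarrow> nat \<Rightarrow> (nat \<Rightarrow> nat) \<Rightarrow> (nat \<Rightarrow> nat \<Rightarrow> complex mat) lie_alg" where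
  "gl_takiff n m c = lie_dsum {1..m} (\<lambda>i. takiff (gl n) (c i))"

definition gl_takiff_elem ::
  "nat \<Rightarrow> nat \<Rightarrow> (nat \<Rightarrow> nat) \<Rightarrow> nat \<Rightarrow> nat \<Rightarrow> nat \<Rightarrow> nat \<Rightarrow> nat \<Rightarrow> nat \<Rightarrow> complex mat" where
  "gl_takiff_elem n m c a b i k =
     dsum_inj {1..m} (\<lambda>i. takiff (gl n) (c i)) i (takiff_elem (gl n) (c i) (mat_unit n a b) k)"

text \<open>The linear map sending \<open>gl_takiff_elem n m c a b i k\<close> to \<open>F a b i k\<close>.\<close>

definition gl_takiff_linear ::
  "(complex, 'a, 'm) module_scheme \<Rightarrow> nat \<Rightarrow> nat \<Rightarrow> (nat \<Rightarrow> nat) \<Rightarrow>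
   (nat \<Rightarrow> nat \<Rightarrow> nat \<Rightarrow> nat \<Rightarrow> 'a) \<Rightarrow> (nat \<Rightarrow> nat \<Rightarrow> complex mat) \<Rightarrow> 'a" where
  "gl_takiff_linear A n m c F X =
     finsum A (\<lambda>(i, k, a, b). (X i k $$ (a - 1, b - 1)) \<odot>\<^bsub>A\<^esub> F a b i k)
       {(i, k, a, b). i \<in> {1..m} \<and> k < c i \<and> a \<in> {1..n} \<and> b \<in> {1..n}}"


text \<open>
  \<^const>\<open>genideal\<close> is an intersection that would be \<^const>\<open>UNIV\<close> if no ideal contained the relations;
  this does not happen here.
\<close>

lemma takiff_closed:
  assumes z: "lie_zero L \<in> carrier L"
    and a: "\<And>x y. x \<in> carrier L \<Longrightarrow> y \<in> carrier L \<Longrightarrow> lie_add L x y \<in> carrier L"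
    and b: "\<And>x y. x \<in> carrier L \<Longrightarrow> y \<in> carrier L \<Longrightarrow> lie_bracket L x y \<in> carrier L"
    and "X \<in> carrier (takiff L N)" "Y \<in> carrier (takiff L N)"
  shows "lie_bracket (takiff L N) X Y \<in> carrier (takiff L N)"
proof -
  have fold: "foldr (lie_add L) xs (lie_zero L) \<in> carrier L" if "set xs \<subseteq> carrier L" for xs
    using that by (induction xs) (auto intro: z a)
  have br: "lie_bracket L (X p) (Y (k - p)) \<in> carrier L" if "p \<le> k" "k < N" for p k
    using that assms(4,5) by (intro b) (auto simp: takiff_def PiE_def Pi_def)
  have "foldr (lie_add L) (map (\<lambda>p. lie_bracket L (X p) (Y (k - p))) [0..<Suc k]) (lie_zero L) \<in> carrier L"
    if "k < N" for k
    by (rule fold) (use that br in \<open>auto simp del: upt_Suc\<close>)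
  thus ?thesis by (auto simp: takiff_def simp del: upt_Suc)
qed

lemma uea_gl_takiff_ideal:
  "ideal (uea_ideal (gl_takiff n m c)) (free_alg (carrier (gl_takiff n m c)))"
proof -
  interpret T: ring "free_alg (carrier (gl_takiff n m c))" by (rule ring_free_alg)
  have t: "lie_bracket (takiff (gl n) N) X Y \<in> carrier (takiff (gl n) N)"
    if "X \<in> carrier (takiff (gl n) N)" "Y \<in> carrier (takiff (gl n) N)" for X Y N
    by (rule takiff_closed) (use that in \<open>auto simp: gl_def\<close>)
  have "uea_relations (gl_takiff n m c) \<subseteq> carrier (free_alg (carrier (gl_takiff n m c)))"
  proof (rule uea_relations_closed)
    fix X Y assume "X \<in> carrier (gl_takiff n m c)" "Y \<in> carrier (gl_takiff n m c)"
    thus "lie_bracket (gl_takiff n m c) X Y \<in> carrier (gl_takiff n m c)"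
      by (auto simp: gl_takiff_def lie_dsum_def intro!: t restrict_PiE_iff[THEN iffD2])
  qed (auto simp: gl_takiff_def lie_dsum_def takiff_def gl_def PiE_def Pi_def)
  thus ?thesis unfolding uea_ideal_def by (rule T.genideal_ideal)
qed


section \<open>The exterior algebra and its differential operators\<close>

text \<open>
  The odd variable with upper index \<open>a\<close> and lower index \<open>i\<close> is the pair \<open>(a, i)\<close>.  An element
  \<open>f\<close> of the exterior algebra is given by its coefficients: \<open>f S\<close> is the coefficient of the
  monomial that is the product of the variables in \<open>S\<close> in increasing lexicographic order.
\<close>

definition var_less :: "nat \<times> nat \<Rightarrow> nat \<times> nat \<Rightarrow> bool" where
  "var_less u v \<longleftrightarrow> fst u < fst v \<or> (fst u = fst v \<and> snd u < snd v)"

definition ext_sign :: "(nat \<times> nat) set \<Rightarrow> (nat \<times> nat) set \<Rightarrow> complex" where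
  "ext_sign S T = (-1) ^ card {(s, t). s \<in> S \<and> t \<in> T \<and> var_less t s}"

definition ext_alg :: "nat \<Rightarrow> nat \<Rightarrow> (complex, (nat \<times> nat) set \<Rightarrow> complex) module" where
  "ext_alg d n =
     \<lparr>carrier = {f. \<forall>S. f S \<noteq> 0 \<longrightarrow> S \<subseteq> {1..d} \<times> {1..n}},
      monoid.mult = (\<lambda>f g S. \<Sum>T\<in>Pow S. ext_sign T (S - T) * f T * g (S - T)),
      one = (\<lambda>S. if S = {} then 1 else 0),
      zero = (\<lambda>S. 0),
      add = (\<lambda>f g S. f S + g S),
      smult = (\<lambda>c f S. c * f S)\<rparr>"

definition ext_var :: "nat \<times> nat \<Rightarrow> (nat \<times> nat) set \<Rightarrow> complex" where
  "ext_var v = (\<lambda>S. if S = {v} then 1 else 0)"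

definition mult_op :: "nat \<Rightarrow> nat \<Rightarrow> nat \<times> nat \<Rightarrow> ((nat \<times> nat) set \<Rightarrow> complex) \<Rightarrow> (nat \<times> nat) set \<Rightarrow> complex" where
  "mult_op d n v = (\<lambda>f\<in>carrier (ext_alg d n). ext_var v \<otimes>\<^bsub>ext_alg d n\<^esub> f)"

text \<open>
  The left derivative takes the monomial of \<open>insert v S\<close>, where \<open>v \<notin> S\<close>, to the monomial of \<open>S\<close>
  times the sign obtained from moving \<open>v\<close> to the front.
\<close>

definition deriv_op :: "nat \<Rightarrow> nat \<Rightarrow> nat \<times> nat \<Rightarrow> ((nat \<times> nat) set \<Rightarrow> complex) \<Rightarrow> (nat \<times> nat) set \<Rightarrow> complex" where
  "deriv_op d n v = (\<lambda>f\<in>carrier (ext_alg d n).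
     (\<lambda>S. if v \<in> S then 0 else ext_sign {v} S * f (insert v S)))"

definition diff_ops ::
  "nat \<Rightarrow> nat \<Rightarrow> (complex, ((nat \<times> nat) set \<Rightarrow> complex) \<Rightarrow> (nat \<times> nat) set \<Rightarrow> complex) module" where
  "diff_ops d n = (let E = End_alg (ext_alg d n); V = {1..d} \<times> {1..n} in
     E\<lparr>carrier := alg_generate E (mult_op d n ` V \<union> deriv_op d n ` V)\<rparr>)"


section \<open>The homomorphisms to the algebra of differential operators\<close>

definition block_start :: "(nat \<Rightarrow> nat) \<Rightarrow> nat \<Rightarrow> nat" where
  "block_start c i = (\<Sum>j\<in>{1..<i}. c j)"

definition phi_op ::
  "nat \<Rightarrow> nat \<Rightarrow> (nat \<Rightarrow> nat) \<Rightarrow> nat \<Rightarrow> nat \<Rightarrow> nat \<Rightarrow> nat \<Rightarrow>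
   ((nat \<times> nat) set \<Rightarrow> complex) \<Rightarrow> (nat \<times> nat) set \<Rightarrow> complex" where
  "phi_op d n \<gamma> a b j k = (let D = diff_ops d n in
     \<ominus>\<^bsub>D\<^esub> (\<Oplus>\<^bsub>D\<^esub>r\<in>{block_start \<gamma> j + 1..block_start \<gamma> (j + 1) - k}.
       deriv_op d n (b, r) \<otimes>\<^bsub>D\<^esub> mult_op d n (a, r + k)))"

definition varphi_op ::
  "nat \<Rightarrow> nat \<Rightarrow> (nat \<Rightarrow> nat) \<Rightarrow> nat \<Rightarrow> nat \<Rightarrow> nat \<Rightarrow> nat \<Rightarrow>
   ((nat \<times> nat) set \<Rightarrow> complex) \<Rightarrow> (nat \<times> nat) set \<Rightarrow> complex" where
  "varphi_op d n \<xi> i j a k = (let D = diff_ops d n in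
     (\<Oplus>\<^bsub>D\<^esub>\<alpha>\<in>{block_start \<xi> a + 1..block_start \<xi> (a + 1) - k}.
       mult_op d n (\<alpha> + k, i) \<otimes>\<^bsub>D\<^esub> deriv_op d n (\<alpha>, j)))"

definition phi where
  "phi d n l \<gamma> = uea_lift (diff_ops d n) (gl_takiff_linear (diff_ops d n) d l \<gamma> (phi_op d n \<gamma>))"

definition varphi where
  "varphi d n d' \<xi> = uea_lift (diff_ops d n) (gl_takiff_linear (diff_ops d n) n d' \<xi> (varphi_op d n \<xi>))"


section \<open>Pseudo-differential operators\<close>

text \<open>
  \<open>f i j\<close> is the coefficient of \<open>z^i \<partial>^j\<close>.  The product is determined by
  \<open>(a z^i1 \<partial>^j1) (b z^i2 \<partial>^j2) = \<Sum>k. (j1 gchoose k) i2 (i2 - 1) \<dots> (i2 - k + 1) a b z^(i1+i2-k) \<partial>^(j1+j2-k)\<close>.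
  Only finitely many pairs of nonzero coefficients contribute to a given coefficient of
  the product; the index set is restricted to these pairs because \<^const>\<open>finsum\<close> over an infinite
  set is zero.
\<close>

definition psdo_mult ::
  "(complex, 'a, 'm) module_scheme \<Rightarrow> (int \<Rightarrow> int \<Rightarrow> 'a) \<Rightarrow> (int \<Rightarrow> int \<Rightarrow> 'a) \<Rightarrow> int \<Rightarrow> int \<Rightarrow> 'a" where
  "psdo_mult A f g i j =
     finsum A
       (\<lambda>(i1, j1, i2, j2, k). ((of_int j1 gchoose k) * (\<Prod>s<k. of_int i2 - of_nat s)) \<odot>\<^bsub>A\<^esub> (f i1 j1 \<otimes>\<^bsub>A\<^esub> g i2 j2))
       {(i1, j1, i2, j2, k). f i1 j1 \<noteq> \<zero>\<^bsub>A\<^esub> \<and> g i2 j2 \<noteq> \<zero>\<^bsub>A\<^esub> \<and>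
          i1 + i2 = i + int k \<and> j1 + j2 = j + int k}"

definition psdo :: "(complex, 'a, 'm) module_scheme \<Rightarrow> (int \<Rightarrow> int \<Rightarrow> 'a) ring" where
  "psdo A =
     \<lparr>carrier = {f. (\<forall>i j. f i j \<in> carrier A) \<and>
        (\<exists>r s. \<forall>i j. f i j \<noteq> \<zero>\<^bsub>A\<^esub> \<longrightarrow> i \<le> r \<and> j \<le> s)},
      monoid.mult = psdo_mult A,
      one = (\<lambda>i j. if i = 0 \<and> j = 0 then \<one>\<^bsub>A\<^esub> else \<zero>\<^bsub>A\<^esub>),
      zero = (\<lambda>i j. \<zero>\<^bsub>A\<^esub>),
      add = (\<lambda>f g i j. f i j \<oplus>\<^bsub>A\<^esub> g i j)\<rparr>"

definition psdo_const :: "(complex, 'a, 'm) module_scheme \<Rightarrow> 'a \<Rightarrow> int \<Rightarrow> int \<Rightarrow> 'a" where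
  "psdo_const A x = (\<lambda>i j. if i = 0 \<and> j = 0 then x else \<zero>\<^bsub>A\<^esub>)"

definition psdo_dz :: "(complex, 'a, 'm) module_scheme \<Rightarrow> int \<Rightarrow> int \<Rightarrow> 'a" where
  "psdo_dz A = (\<lambda>i j. if i = 0 \<and> j = 1 then \<one>\<^bsub>A\<^esub> else \<zero>\<^bsub>A\<^esub>)"

text \<open>
  \<open>psdo_frac A x a m\<close> is \<open>x / (z - a)^m\<close> expanded in powers of \<open>u = 1 / z\<close>, using
  \<open>1 / (z - a) = u / (1 - a u)\<close>.
\<close>

definition psdo_frac ::
  "(complex, 'a, 'm) module_scheme \<Rightarrow> 'a \<Rightarrow> complex \<Rightarrow> nat \<Rightarrow> int \<Rightarrow> int \<Rightarrow> 'a" where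
  "psdo_frac A x a m = (\<lambda>i j. if i \<le> 0 \<and> j = 0
     then fps_nth ((fps_X / (1 - fps_const a * fps_X)) ^ m) (nat (- i)) \<odot>\<^bsub>A\<^esub> x else \<zero>\<^bsub>A\<^esub>)"


section \<open>Column determinant and Berezinian over a noncommutative ring\<close>

definition cdet :: "('a, 'm) ring_scheme \<Rightarrow> nat \<Rightarrow> (nat \<times> nat \<Rightarrow> 'a) \<Rightarrow> 'a" where
  "cdet R k M = (\<Oplus>\<^bsub>R\<^esub>\<sigma>\<in>{\<sigma>. \<sigma> permutes {1..k}}.
     [sign \<sigma>] \<cdot>\<^bsub>R\<^esub> list_prod R (map (\<lambda>j. M (\<sigma> j, j)) [1..<k + 1]))"

definition matrix_ring :: "('a, 'm) ring_scheme \<Rightarrow> nat \<Rightarrow> (nat \<times> nat \<Rightarrow> 'a) ring" where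
  "matrix_ring R k = (let K = {1..k} \<times> {1..k} in
     \<lparr>carrier = K \<rightarrow>\<^sub>E carrier R,
      monoid.mult = (\<lambda>M N. \<lambda>(i, j)\<in>K. \<Oplus>\<^bsub>R\<^esub>s\<in>{1..k}. M (i, s) \<otimes>\<^bsub>R\<^esub> N (s, j)),
      one = (\<lambda>(i, j)\<in>K. if i = j then \<one>\<^bsub>R\<^esub> else \<zero>\<^bsub>R\<^esub>),
      zero = (\<lambda>(i, j)\<in>K. \<zero>\<^bsub>R\<^esub>),
      add = (\<lambda>M N. \<lambda>(i, j)\<in>K. M (i, j) \<oplus>\<^bsub>R\<^esub> N (i, j))\<rparr>)"

definition ber_factor :: "('a, 'm) ring_scheme \<Rightarrow> (nat \<times> nat \<Rightarrow> 'a) \<Rightarrow> nat \<Rightarrow> 'a" where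
  "ber_factor R M i =
     inv\<^bsub>R\<^esub> ((inv\<^bsub>matrix_ring R i\<^esub> (restrict M ({1..i} \<times> {1..i}))) (i, i))"

definition Ber :: "('a, 'm) ring_scheme \<Rightarrow> nat \<Rightarrow> (nat \<times> nat \<Rightarrow> 'a) \<Rightarrow> 'a" where
  "Ber R n M = list_prod R (map (\<lambda>i. inv\<^bsub>R\<^esub> (ber_factor R M i)) [1..<n + 1])"


section \<open>Gaudin algebras\<close>

definition jordan_entry :: "nat \<Rightarrow> (nat \<Rightarrow> nat) \<Rightarrow> (nat \<Rightarrow> complex) \<Rightarrow> nat \<Rightarrow> nat \<Rightarrow> complex" where
  "jordan_entry m c w a b = jordan_matrix (map (\<lambda>i. (c i, w i)) [1..<m + 1]) $$ (a - 1, b - 1)"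

definition gaudin_gl_matrix where
  "gaudin_gl_matrix d d' w \<xi> l z \<gamma> =
     (let L = gl_takiff d l \<gamma>; U = uea L; P = psdo U in
      (\<lambda>(a, b). (if a = b then psdo_dz U else \<zero>\<^bsub>P\<^esub>)
        \<ominus>\<^bsub>P\<^esub> psdo_const U (jordan_entry d' \<xi> w a b \<odot>\<^bsub>U\<^esub> \<one>\<^bsub>U\<^esub>)
        \<ominus>\<^bsub>P\<^esub> (\<Oplus>\<^bsub>P\<^esub>i\<in>{1..l}. \<Oplus>\<^bsub>P\<^esub>k\<in>{0..<\<gamma> i}.
             psdo_frac U (uea_gen L (gl_takiff_elem d l \<gamma> a b i k)) (z i) (k + 1))))"

definition gaudin_gl0_matrix where
  "gaudin_gl0_matrix n l z \<gamma> d' w \<xi> =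
     (let L = gl_takiff n d' \<xi>; U = uea L; P = psdo U in
      (\<lambda>(i, j). ((if i = j then psdo_dz U else \<zero>\<^bsub>P\<^esub>)
        \<ominus>\<^bsub>P\<^esub> psdo_const U (jordan_entry l \<gamma> z i j \<odot>\<^bsub>U\<^esub> \<one>\<^bsub>U\<^esub>))
        \<oplus>\<^bsub>P\<^esub> (\<Oplus>\<^bsub>P\<^esub>a\<in>{1..d'}. \<Oplus>\<^bsub>P\<^esub>k\<in>{0..<\<xi> a}.
             psdo_frac U (uea_gen L (gl_takiff_elem n d' \<xi> i j a k)) (w a) (k + 1))))"

definition gaudin_gl where
  "gaudin_gl d d' w \<xi> l z \<gamma> = (let U = uea (gl_takiff d l \<gamma>) in
     alg_generate U
       {cdet (psdo U) d (gaudin_gl_matrix d d' w \<xi> l z \<gamma>) s (int i - 1) | s i. i \<in> {1..d}})"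

definition gaudin_gl0 where
  "gaudin_gl0 n l z \<gamma> d' w \<xi> = (let U = uea (gl_takiff n d' \<xi>) in
     alg_generate U
       {Ber (psdo U) n (gaudin_gl0_matrix n l z \<gamma> d' w \<xi>) s i | s i. i \<le> - int n})"

end

theory Submission
  imports Defs
begin

text \<open>
  Both algebras act on the exterior algebra through matrices of the form constant plus quadratic
  in the odd generators, where the Takiff generators occur only through the resolvents
  \<open>(z - J)\<^sup>-\<^sup>1\<close> of the two Jordan matrices.  Let \<open>om\<close> interchange \<open>z\<close> and \<open>\<partial>\<^sub>z\<close>.  Up to the sign
  \<open>(-1)^d\<close>, the image of the column determinant under \<open>om\<close> is the
  product of the triangular factors \<open>\<Prod>(\<partial>\<^sub>z - Z\<^sub>m\<^sub>m)\<close> and \<open>\<Prod>(W\<^sub>j\<^sub>j - z)\<close> with the Berezinian.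
  These factors are invertible with scalar coefficients, so the coefficients of the determinant and
  of the Berezinian generate the same algebra.

  The product formula compares two evaluations of a noncommutative characteristic polynomial on
  auxiliary odd variables \<open>x (a, 0)\<close>: the determinant is the coefficient of their product when the
  rows act one after another, and the minors of the second matrix appear when its rows and columns
  are added one at a time.

  To work with ring types instead of carrier sets, the identity is proved for series over a ring
  type on which the odd generators act, and is then transported along the surjections from the free
  algebra onto the enveloping algebras and from operators on all functions to differential operators.
\<close>

section \<open>Odd variables\<close>

text \<open>Interchanging \<open>z\<close> and \<open>\<partial>\<^sub>z\<close> reverses products
  only of series whose coefficients commute, so it cannot be applied to a product of matrix entries.
  Both determinants are therefore first put into a nested form (\<open>T1\<close>,
  \<open>T2\<close>) in which the odd generators wrap around the inner factors and keep their order,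
  while scalars and resolvents stand outside; \<open>om\<close> then only moves the latter to the
  other side. The reordering leaves no correction terms because the commutator of a resolvent with
  \<open>D\<close> or \<open>z\<close> cancels the contractions of odd generators. The auxiliary
  variables make this manageable: a row or column becomes one linear form, and these forms commute
  with the even elements \<open>kap\<close> and \<open>kk\<close> although single entries need not.
  The generators of the problem have lower index at least 1, so index 0 is free;
  \<open>gr_cancel\<close> removes the auxiliary variables at the end. The Jordan matrices enter
  through triangularity: \<open>h\<close> is upper triangular, so \<open>kap s\<close> with
  \<open>s\<close> at most \<open>m\<close> contains no \<open>y (b, r)\<close> with
  \<open>r\<close> above \<open>m\<close>, and the second matrix can be built up one row and column
  at a time.\<close>

locale grassmann =
  fixes th :: "nat \<Rightarrow> 'r::ring_1"
  assumes th_anti: "th i * th j = - (th j * th i)"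
    and th_sq: "th i * th i = 0"
begin

definition gr :: "nat list \<Rightarrow> 'r" where "gr as = prod_list (map th as)"

lemma gr_Nil [simp]: "gr [] = 1" and gr_Cons [simp]: "gr (a # as) = th a * gr as"
  and gr_append [simp]: "gr (as @ bs) = gr as * gr bs"
  by (simp_all add: gr_def)

lemma gr_th: "gr as * th i = (-1) ^ length as * (th i * gr as)"
proof (induction as)
  case (Cons a as)
  have "gr (a # as) * th i = th a * ((-1) ^ length as * (th i * gr as))"
    using Cons by (simp add: mult.assoc)
  also have "\<dots> = (-1) ^ length as * (th a * th i * gr as)"
    by (cases "even (length as)") (simp_all add: mult.assoc)
  finally show ?case by (simp add: th_anti[of a i] mult.assoc)
qed simp

text \<open>Passing the right letter across \<open>gr vs\<close> gives the sign
  \<open>(-1) ^ length vs\<close> in both orders, so only the exchange of the two letters themselves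
  is felt.\<close>

lemma gr_swap: "gr (us @ i # vs @ j # ws) = - gr (us @ j # vs @ i # ws)"
proof -
  have *: "th a * gr vs * th b = (-1) ^ length vs * (th a * th b * gr vs)" for a b
    by (cases "even (length vs)") (simp_all add: mult.assoc gr_th)
  have "th i * gr vs * th j = - (th j * gr vs * th i)"
    unfolding * by (simp add: th_anti[of i j])
  hence "gr us * (th i * gr vs * th j) * gr ws = - (gr us * (th j * gr vs * th i) * gr ws)" by simp
  thus ?thesis by (simp add: mult.assoc)
qed

lemma gr_not_distinct:
  assumes "\<not> distinct as" shows "gr as = 0"
proof -
  obtain us vs ws a where "as = us @ [a] @ vs @ [a] @ ws"
    using not_distinct_decomp[OF assms] by blast
  moreover have "th a * gr vs * th a = 0"
    by (cases "even (length vs)")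
       (simp_all add: mult.assoc gr_th, simp_all add: mult.assoc[symmetric] th_sq)
  ultimately show ?thesis by (simp add: mult.assoc) (metis mult.assoc mult_zero_left mult_zero_right)
qed

lemma gr_transpose:
  assumes "distinct as" "i \<in> set as" "j \<in> set as" "i \<noteq> j"
  shows "gr (map (transpose i j) as) = - gr as"
proof -
  have main: "gr (map (transpose i j) as) = - gr as"
    if as: "as = us @ i # vs @ j # ws" and "distinct as" "i \<noteq> j" for i j us vs ws
  proof -
    have "map (transpose i j) us = us" "map (transpose i j) vs = vs" "map (transpose i j) ws = ws"
      using that by (auto intro!: map_idI simp: transpose_def)
    hence "map (transpose i j) as = us @ j # vs @ i # ws" by (simp add: as)
    thus ?thesis unfolding as by (metis gr_swap)
  qed
  obtain us ws where as: "as = us @ i # ws" using assms(2) by (meson split_list)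
  from assms(3,4) as consider "j \<in> set us" | "j \<in> set ws" by auto
  thus ?thesis
  proof cases
    case 1
    then obtain us1 us2 where "us = us1 @ j # us2" by (meson split_list)
    hence "as = us1 @ j # us2 @ i # ws" by (simp add: as)
    from main[OF this] assms show ?thesis by (simp add: transpose_commute)
  next
    case 2
    then obtain us1 us2 where "ws = us1 @ j # us2" by (meson split_list)
    hence "as = us @ i # us1 @ j # us2" by (simp add: as)
    from main[OF this] assms show ?thesis by simp
  qed
qed

lemma gr_permutes:
  assumes "\<sigma> permutes {1..d}"
  shows "gr (map \<sigma> [1..<d+1]) = of_int (sign \<sigma>) * gr [1..<d+1]"
  using assms finite_atLeastAtMost
proof (induction rule: permutes_induct)
  case id
  show ?case by (simp add: sign_id)
next
  case (swap a b p)
  show ?case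
  proof (cases "a = b")
    case False
    have "gr (map (transpose a b) (map p [1..<d+1])) = - gr (map p [1..<d+1])"
    proof (rule gr_transpose)
      show "distinct (map p [1..<d+1])"
        using permutes_inj_on[OF swap(4)] by (simp add: distinct_map)
      have "set (map p [1..<d+1]) = {1..d}"
        using permutes_image[OF swap(4)]
        by (simp add: atLeastLessThanSuc_atLeastAtMost del: upt_Suc)
      thus "a \<in> set (map p [1..<d+1])" "b \<in> set (map p [1..<d+1])" using swap by auto
    qed fact
    moreover have "sign (transpose a b \<circ> p) = - sign p"
      using False permutation_permutes swap(4)
      by (subst sign_compose) (auto simp: permutation_swap_id sign_swap_id)
    ultimately show ?thesis using swap.IH by (simp add: comp_def del: upt_Suc)
  qed (use swap in simp)
qed

text \<open>Words rather than permutations: expanding a product of forms yields all words, and those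
  with a repeated letter disappear only through the factor \<open>gr\<close>.\<close>

definition nlists :: "nat \<Rightarrow> nat \<Rightarrow> nat list set" where
  "nlists d k = {as. set as \<subseteq> {1..d} \<and> length as = k}"

lemma finite_nlists [simp]: "finite (nlists d k)"
  unfolding nlists_def by (rule finite_lists_length_eq) simp

lemma nlists_0 [simp]: "nlists d 0 = {[]}" by (auto simp: nlists_def)

lemma sum_nlists_Suc: "(\<Sum>as\<in>nlists d (Suc k). f as) = (\<Sum>a\<in>{1..d}. \<Sum>as\<in>nlists d k. f (a # as))"
proof -
  have "(\<Sum>as\<in>nlists d (Suc k). f as) = (\<Sum>(a, as)\<in>{1..d} \<times> nlists d k. f (a # as))"
    by (rule sum.reindex_bij_witness[of _ "\<lambda>(a, as). a # as" "\<lambda>as. (hd as, tl as)"])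
       (auto simp: nlists_def length_Suc_conv)
  thus ?thesis by (simp add: sum.cartesian_product)
qed

lemma permutes_nlists:
  "bij_betw (\<lambda>\<sigma>. map \<sigma> [1..<d+1]) {\<sigma>. \<sigma> permutes {1..d}} {as \<in> nlists d d. distinct as}"
  unfolding bij_betw_def
proof
  show "inj_on (\<lambda>\<sigma>. map \<sigma> [1..<d+1]) {\<sigma>. \<sigma> permutes {1..d}}"
  proof (rule inj_onI, clarify)
    fix p q assume p: "p permutes {1..d}" and q: "q permutes {1..d}"
      and eq: "map p [1..<d+1] = map q [1..<d+1]"
    show "p = q"
    proof
      fix i show "p i = q i"
      proof (cases "i \<in> {1..d}")
        case True
        thus ?thesis using eq by (simp add: atLeastLessThanSuc_atLeastAtMost del: upt_Suc)
      next
        case False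
        thus ?thesis using p q by (simp add: permutes_not_in)
      qed
    qed
  qed
  show "(\<lambda>\<sigma>. map \<sigma> [1..<d+1]) ` {\<sigma>. \<sigma> permutes {1..d}} = {as \<in> nlists d d. distinct as}"
  proof (intro equalityI subsetI)
    fix as assume "as \<in> (\<lambda>\<sigma>. map \<sigma> [1..<d+1]) ` {\<sigma>. \<sigma> permutes {1..d}}"
    then obtain p where p: "p permutes {1..d}" "as = map p [1..<d+1]" by auto
    have "set as = p ` {1..d}" using p by (simp add: atLeastLessThanSuc_atLeastAtMost del: upt_Suc)
    also have "\<dots> = {1..d}" using permutes_image[OF p(1)] .
    finally show "as \<in> {as \<in> nlists d d. distinct as}"
      using p permutes_inj_on[OF p(1)] by (simp add: nlists_def distinct_map del: upt_Suc)
  next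
    fix as assume "as \<in> {as \<in> nlists d d. distinct as}"
    hence as: "set as \<subseteq> {1..d}" "length as = d" "distinct as" by (auto simp: nlists_def)
    define p where "p i = (if i \<in> {1..d} then as ! (i - 1) else i)" for i
    have "inj_on p {1..d}"
      using as by (auto simp: inj_on_def p_def nth_eq_iff_index_eq)
    moreover have "p ` {1..d} \<subseteq> {1..d}"
      using as(1) nth_mem[of _ as] as(2) by (fastforce simp: p_def)
    ultimately have "bij_betw p {1..d} {1..d}"
      by (simp add: bij_betw_def endo_inj_surj)
    hence "p permutes {1..d}" by (rule bij_imp_permutes) (simp only: p_def if_False)
    moreover have "as = map p [1..<d+1]"
      by (rule nth_equalityI) (simp_all add: as p_def del: upt_Suc)
    ultimately show "as \<in> (\<lambda>\<sigma>. map \<sigma> [1..<d+1]) ` {\<sigma>. \<sigma> permutes {1..d}}" by blast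
  qed
qed

text \<open>This is where determinants come from: \<open>gr\<close> kills words with a repetition,
  and the others are permutations contributing their sign times the top monomial. The coefficient
  \<open>F\<close> is arbitrary because it will be a product of entries in one use and a nested
  expression in another.\<close>

lemma sum_nlists_gr:
  "(\<Sum>as\<in>nlists d d. gr as * F as)
     = gr [1..<d+1] * (\<Sum>\<sigma> | \<sigma> permutes {1..d}. of_int (sign \<sigma>) * F (map \<sigma> [1..<d+1]))"
proof -
  have "(\<Sum>as\<in>nlists d d. gr as * F as) = (\<Sum>as\<in>{as \<in> nlists d d. distinct as}. gr as * F as)"
    by (rule sum.mono_neutral_right) (auto simp: gr_not_distinct)
  also have "\<dots> = (\<Sum>\<sigma> | \<sigma> permutes {1..d}. gr (map \<sigma> [1..<d+1]) * F (map \<sigma> [1..<d+1]))"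
    by (rule sum.reindex_bij_betw[OF permutes_nlists, symmetric])
  also have "\<dots> = (\<Sum>\<sigma> | \<sigma> permutes {1..d}. gr [1..<d+1] * (of_int (sign \<sigma>) * F (map \<sigma> [1..<d+1])))"
  proof (rule sum.cong[OF refl])
    fix \<sigma> assume "\<sigma> \<in> {\<sigma>. \<sigma> permutes {1..d}}"
    hence "gr (map \<sigma> [1..<d+1]) = of_int (sign \<sigma>) * gr [1..<d+1]" using gr_permutes by blast
    also have "\<dots> = gr [1..<d+1] * of_int (sign \<sigma>)" by (simp only: mult_of_int_commute)
    finally show "gr (map \<sigma> [1..<d+1]) * F (map \<sigma> [1..<d+1]) = gr [1..<d+1] * (of_int (sign \<sigma>) * F (map \<sigma> [1..<d+1]))"
      by (simp only: mult.assoc)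
  qed
  finally show ?thesis by (simp only: sum_distrib_left)
qed

lemma prod_list_forms:
  assumes "\<And>i j k. u i j * th k = th k * u i j"
  shows "prod_list (map (\<lambda>j. \<Sum>i\<in>{1..d}. th i * u i j) js)
    = (\<Sum>as\<in>nlists d (length js). gr as * prod_list (map2 u as js))"
proof (induction js)
  case (Cons j js)
  have com: "u i j * gr as = gr as * u i j" for i as
    by (induction as) (simp_all add: mult.assoc assms flip: mult.assoc[of "u i j"])
  have "th i * u i j * (gr as * b) = th i * gr as * (u i j * b)" for i as b
    by (metis com mult.assoc)
  thus ?case using Cons by (simp add: sum_nlists_Suc sum_distrib_left sum_distrib_right)
      (subst sum.swap, simp add: mult.assoc)
qed simp

end

lemma commute_sumI:
  fixes a :: "'r::ring_1"
  assumes "\<And>i. i \<in> A \<Longrightarrow> a * f i = f i * a"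
  shows "a * sum f A = sum f A * a"
  by (simp add: sum_distrib_left sum_distrib_right assms cong: sum.cong)

lemma commute_multI:
  fixes a :: "'r::ring_1"
  assumes "a * b = b * a" "a * c = c * a"
  shows "a * (b * c) = b * c * a"
  by (metis assms mult.assoc)

text \<open>The derivative of an inverse matrix, for the derivation given by the commutator with
  \<open>c\<close>. It is used with \<open>a = 1\<close> and \<open>a = - 1\<close> for the two
  resolvents, and with \<open>a = 0\<close> to see that an inverse commutes with whatever commutes
  with the matrix.\<close>

lemma derivation_inverse:
  fixes e h :: "nat \<Rightarrow> nat \<Rightarrow> 'r::ring_1"
  assumes fin: "finite I"
    and he: "\<And>r s. r \<in> I \<Longrightarrow> s \<in> I \<Longrightarrow> (\<Sum>t\<in>I. h r t * e t s) = (if r = s then 1 else 0)"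
    and eh: "\<And>r s. r \<in> I \<Longrightarrow> s \<in> I \<Longrightarrow> (\<Sum>t\<in>I. e r t * h t s) = (if r = s then 1 else 0)"
    and ec: "\<And>r s. r \<in> I \<Longrightarrow> s \<in> I \<Longrightarrow> e r s * c - c * e r s = (if r = s then a else 0)"
    and r: "r \<in> I" and s: "s \<in> I"
  shows "h r s * c - c * h r s = - (\<Sum>t\<in>I. h r t * a * h t s)"
proof -
  \<comment> \<open>The product rule applied to \<open>e * h = 1\<close>. The factor
    \<open>e\<close> is removed afterwards by multiplying with \<open>h\<close> from the
    left.\<close>
  have "(\<Sum>u\<in>I. e t u * (h u s * c - c * h u s)) = - (a * h t s)" if t: "t \<in> I" for t
  proof -
    have "(\<Sum>u\<in>I. e t u * (h u s * c - c * h u s))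
        = (\<Sum>u\<in>I. e t u * h u s) * c - c * (\<Sum>u\<in>I. e t u * h u s)
          - (\<Sum>u\<in>I. (e t u * c - c * e t u) * h u s)"
      by (simp add: sum_distrib_left sum_distrib_right sum_subtractf[symmetric] algebra_simps mult.assoc)
    also have "(\<Sum>u\<in>I. (e t u * c - c * e t u) * h u s) = (\<Sum>u\<in>I. if t = u then a * h u s else 0)"
      using t by (intro sum.cong refl) (simp add: ec)
    also have "\<dots> = a * h t s" using fin t by (simp add: sum.delta)
    finally show ?thesis using t s by (simp add: eh)
  qed
  hence "(\<Sum>t\<in>I. h r t * (\<Sum>u\<in>I. e t u * (h u s * c - c * h u s))) = - (\<Sum>t\<in>I. h r t * a * h t s)"
    by (simp add: sum_negf mult.assoc cong: sum.cong)
  moreover have "(\<Sum>t\<in>I. h r t * (\<Sum>u\<in>I. e t u * (h u s * c - c * h u s)))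
      = (\<Sum>u\<in>I. (\<Sum>t\<in>I. h r t * e t u) * (h u s * c - c * h u s))"
    unfolding sum_distrib_left sum_distrib_right mult.assoc by (rule sum.swap)
  moreover have "\<dots> = (\<Sum>u\<in>I. if r = u then h u s * c - c * h u s else 0)"
    using r by (intro sum.cong refl) (simp add: he)
  ultimately show ?thesis using fin r by (simp add: sum.delta)
qed

section \<open>Creation and annihilation operators, and removal of the auxiliary variables\<close>

locale fermions =
  fixes x y :: "nat \<times> nat \<Rightarrow> 'r::ring_1"
  assumes xx: "x u * x v = - (x v * x u)" and x_sq: "x u * x u = 0"
    and yy: "y u * y v = - (y v * y u)" and y_sq: "y u * y u = 0"
    and yx: "y u * x v = (if u = v then 1 else 0) - x v * y u"
begin

abbreviation th :: "nat \<Rightarrow> 'r" where "th a \<equiv> x (a, 0)"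

sublocale grassmann th
  by unfold_locales (rule xx x_sq)+

text \<open>Contraction with \<open>y (a, 0)\<close> strips one letter at a time. Since
  \<open>y (a, 0) * th a + th a * y (a, 0) = 1\<close>, the shorter product \<open>gr as * c\<close>
  splits into two terms. Each of them contains \<open>th a * gr as * c\<close>: in the second one
  \<open>y (a, 0)\<close> passes the remaining letters, which differ from \<open>a\<close>, and then
  \<open>c\<close>.\<close>

lemma gr_cancel:
  assumes "\<And>a. c * x (a, 0) = x (a, 0) * c" "\<And>a. c * y (a, 0) = y (a, 0) * c"
    and "gr as * c = 0" "distinct as"
  shows "c = 0"
  using assms(3,4)
proof (induction as)
  case (Cons a as)
  have "y (a, 0) * gr bs = (-1) ^ length bs * (gr bs * y (a, 0))" if "a \<notin> set bs" for bs
    using that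
  proof (induction bs)
    case (Cons b bs)
    have "y (a, 0) * gr (b # bs) = - (th b * (y (a, 0) * gr bs))"
      using Cons.prems by (simp add: yx mult.assoc[symmetric])
    thus ?case using Cons by (cases "even (length bs)") (simp_all add: mult.assoc)
  qed simp
  hence ygr: "y (a, 0) * gr as = (-1) ^ length as * (gr as * y (a, 0))" using Cons.prems by simp
  have "y (a, 0) * th a + th a * y (a, 0) = 1" by (simp add: yx)
  hence "gr as * c = (y (a, 0) * th a + th a * y (a, 0)) * (gr as * c)" by simp
  also have "\<dots> = y (a, 0) * (th a * gr as * c) + th a * (y (a, 0) * gr as) * c"
    by (simp add: algebra_simps mult.assoc)
  also have "th a * (y (a, 0) * gr as) * c = (-1) ^ length as * (th a * gr as * c * y (a, 0))"
    by (cases "even (length as)") (simp_all add: ygr mult.assoc assms(2))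
  also have "th a * gr as * c = 0" using Cons.prems(1) by simp
  finally show ?case using Cons by simp
qed simp

lemma gr_y: "j \<noteq> 0 \<Longrightarrow> y (i, j) * gr as = (-1) ^ length as * (gr as * y (i, j))"
proof (induction as)
  case (Cons a as)
  have "y (i, j) * gr (a # as) = - (th a * (y (i, j) * gr as))"
    using Cons.prems by (simp add: yx mult.assoc[symmetric])
  thus ?case using Cons by (cases "even (length as)") (simp_all add: mult.assoc)
qed simp

lemma gr_x: "x u * gr as = (-1) ^ length as * (gr as * x u)"
proof (induction as)
  case (Cons a as)
  have "x u * gr (a # as) = - (th a * (x u * gr as))"
    by (simp add: xx[of u] mult.assoc[symmetric])
  thus ?case using Cons by (cases "even (length as)") (simp_all add: mult.assoc)
qed simp

end

locale weyl_fermions = fermions x y for x y :: "nat \<times> nat \<Rightarrow> 'r::ring_1" +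
  fixes z D :: 'r and sc :: "complex \<Rightarrow> 'r"
  assumes Dz: "D * z = z * D + 1"
    and zx: "z * x u = x u * z" and zy: "z * y u = y u * z"
    and Dx: "D * x u = x u * D" and Dy: "D * y u = y u * D"
    and sc_comm: "sc c * a = a * sc c"
    and sc_add: "sc (c + c') = sc c + sc c'" and sc_mult: "sc (c * c') = sc c * sc c'" and sc_1: "sc 1 = 1"

declare One_nat_def [simp del]

lemma commute_prod_list:
  fixes a :: "'r::ring_1"
  assumes "\<And>b. b \<in> set bs \<Longrightarrow> a * b = b * a"
  shows "a * prod_list bs = prod_list bs * a"
  using assms
proof (induction bs)
  case (Cons b bs)
  have "a * (b * prod_list bs) = b * prod_list bs * a"
    using Cons by (intro commute_multI) auto
  thus ?case by simp
qed simp

lemma sum_anticommute: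
  fixes a b :: "'i \<Rightarrow> 'r::ring_1"
  assumes "\<And>i j. i \<in> A \<Longrightarrow> j \<in> B \<Longrightarrow> a i * b j = - (b j * a i)"
  shows "sum a A * sum b B = - (sum b B * sum a A)"
  unfolding sum_distrib_left sum_distrib_right
  unfolding sum_negf[symmetric] by (subst sum.swap) (intro sum.cong refl assms)

lemma sum_square_zero:
  fixes a :: "'i \<Rightarrow> 'r::ring_1"
  assumes "finite A" "\<And>i j. i \<in> A \<Longrightarrow> j \<in> A \<Longrightarrow> a i * a j = - (a j * a i)" "\<And>i. i \<in> A \<Longrightarrow> a i * a i = 0"
  shows "sum a A * sum a A = 0"
  using assms
proof (induction A)
  case (insert i A)
  have "sum a {i} * sum a A = - (sum a A * sum a {i})"
    by (rule sum_anticommute) (rule insert.prems(1); blast)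
  hence "a i * sum a A = - (sum a A * a i)" by simp
  moreover have "a i * a i = 0" by (rule insert.prems(2)) blast
  moreover have "sum a A * sum a A = 0" using insert.IH[OF insert.prems(1) insert.prems(2)] by blast
  ultimately show ?case using insert.hyps by (simp add: distrib_left distrib_right)
qed simp

lemma mult_four_comm:
  fixes a b s t :: "'r::ring_1"
  assumes "a * t = t * a"
  shows "s * a * (t * b) = s * t * (a * b)"
proof -
  have "s * a * (t * b) = s * (a * t) * b" by (simp only: mult.assoc)
  thus ?thesis by (simp only: assms mult.assoc)
qed

text \<open>
  \<open>D\<close> is the derivation \<open>d/dz\<close>; \<open>h\<close> is the inverse of the matrix \<open>D - Z\<close>.
\<close>

locale duality = weyl_fermions x y z D sc
  for x y :: "nat \<times> nat \<Rightarrow> 'r::ring_1" and z D :: 'r and sc :: "complex \<Rightarrow> 'r" +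
  fixes d n :: nat and W Z :: "nat \<Rightarrow> nat \<Rightarrow> complex" and h :: "nat \<Rightarrow> nat \<Rightarrow> 'r"
  assumes Z_tri: "\<And>r s. r \<in> {1..n} \<Longrightarrow> s \<in> {1..n} \<Longrightarrow> s < r \<Longrightarrow> Z r s = 0"
    and W_tri: "\<And>r s. r \<in> {1..d} \<Longrightarrow> s \<in> {1..d} \<Longrightarrow> s < r \<Longrightarrow> W r s = 0"
    and h_tri: "\<And>r s. r \<in> {1..n} \<Longrightarrow> s \<in> {1..n} \<Longrightarrow> s < r \<Longrightarrow> h r s = 0"
    and hx: "\<And>r s u. h r s * x u = x u * h r s" and hy: "\<And>r s u. h r s * y u = y u * h r s"
    and hD: "\<And>r s. h r s * D = D * h r s" and hh: "\<And>r s r' s'. h r s * h r' s' = h r' s' * h r s"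
    and eh: "\<And>r s. r \<in> {1..n} \<Longrightarrow> s \<in> {1..n} \<Longrightarrow>
       (\<Sum>t\<in>{1..n}. ((if r = t then D else 0) - sc (Z r t)) * h t s) = (if r = s then 1 else 0)"
    and he: "\<And>r s. r \<in> {1..n} \<Longrightarrow> s \<in> {1..n} \<Longrightarrow>
       (\<Sum>t\<in>{1..n}. h r t * ((if t = s then D else 0) - sc (Z t s))) = (if r = s then 1 else 0)"
begin

section \<open>Row forms and the even elements that commute with them\<close>

lemma sc_0 [simp]: "sc 0 = 0"
  using sc_add[of 0 0] by simp

text \<open>Even, since it pairs an auxiliary variable with an annihilator. The sum of
  \<open>kap s * x (j, s)\<close> over all \<open>s\<close> is the quadratic part of row
  \<open>j\<close> of \<open>NN\<close> written as a form, so the dependence on the row sits in the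
  last factor alone.\<close>

definition kap :: "nat \<Rightarrow> 'r" where
  "kap s = (\<Sum>b\<in>{1..d}. \<Sum>r\<in>{1..n}. x (b, 0) * y (b, r) * h r s)"

text \<open>An interpolation: \<open>psi 0 j\<close> is the form of row \<open>j\<close> of the
  scalar matrix \<open>W - z\<close>, and \<open>psi n j\<close> that of row \<open>j\<close> of
  \<open>- NN\<close>. Each increase of \<open>m\<close> switches on the odd generators of one more
  column.\<close>

definition psi :: "nat \<Rightarrow> nat \<Rightarrow> 'r" where
  "psi m j = - (th j * z - (\<Sum>i\<in>{1..d}. sc (W j i) * th i)) - (\<Sum>s\<in>{1..m}. kap s * x (j, s))"

lemma hz:
  assumes "r \<in> {1..n}" "s \<in> {1..n}"
  shows "h r s * z - z * h r s = - (\<Sum>t\<in>{1..n}. h r t * h t s)"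
proof -
  have "h r s * z - z * h r s = - (\<Sum>t\<in>{1..n}. h r t * 1 * h t s)"
  proof (rule derivation_inverse[where e = "\<lambda>r s. (if r = s then D else 0) - sc (Z r s)"])
    show "((if r = s then D else 0) - sc (Z r s)) * z - z * ((if r = s then D else 0) - sc (Z r s)) = (if r = s then 1 else 0)" for r s
      using sc_comm[of "Z r s" z] by (simp add: Dz algebra_simps)
  qed (use he eh assms in simp_all)
  thus ?thesis by simp
qed

lemma kap_th: "kap s * th j = th j * kap s"
proof -
  have "th b * y (b, r) * h r s * th j = th j * (th b * y (b, r) * h r s)" if "r \<in> {1..n}" for b r
  proof -
    have *: "y (b, r) * th j = - (th j * y (b, r))" using that by (simp add: yx)
    have "th b * y (b, r) * h r s * th j = th b * (y (b, r) * th j) * h r s"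
      by (simp only: mult.assoc hx)
    also have "\<dots> = - (th b * th j) * y (b, r) * h r s" by (simp add: * mult.assoc)
    also have "- (th b * th j) = th j * th b" by (simp add: xx[of "(b, 0)" "(j, 0)"])
    finally show ?thesis by (simp only: mult.assoc)
  qed
  thus ?thesis unfolding kap_def sum_distrib_left sum_distrib_right by (intro sum.cong refl) auto
qed

lemma kap_h: "kap s * h r t = h r t * kap s"
  unfolding kap_def
  by (rule sym, intro commute_sumI commute_multI hx hy hh)

lemma kap_D: "kap s * D = D * kap s"
  unfolding kap_def
  by (rule sym, intro commute_sumI commute_multI Dx Dy hD[symmetric])

lemma kap_sc: "kap s * sc c = sc c * kap s"
  by (rule sc_comm[symmetric])

lemma kap_x:
  assumes "j \<in> {1..d}" "q \<in> {1..n}"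
  shows "kap t * x (j, q) = x (j, q) * kap t + th j * h q t"
proof -
  have "th b * y (b, r) * h r t * x (j, q) = x (j, q) * (th b * y (b, r) * h r t)
     + (if b = j \<and> r = q then th b * h r t else 0)" for b r
  proof -
    have "th b * y (b, r) * h r t * x (j, q) = th b * (y (b, r) * x (j, q)) * h r t"
      by (simp add: mult.assoc hx)
    also have "\<dots> = (if b = j \<and> r = q then th b * h r t else 0) - th b * x (j, q) * y (b, r) * h r t"
      by (simp add: yx algebra_simps mult.assoc)
    also have "th b * x (j, q) = - (x (j, q) * th b)" by (rule xx)
    finally show ?thesis by (simp add: mult.assoc)
  qed
  hence "kap t * x (j, q) = x (j, q) * kap t
      + (\<Sum>b\<in>{1..d}. \<Sum>r\<in>{1..n}. if b = j \<and> r = q then th b * h r t else 0)"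
    unfolding kap_def sum_distrib_left sum_distrib_right by (simp add: sum.distrib)
  also have "(\<Sum>b\<in>{1..d}. \<Sum>r\<in>{1..n}. if b = j \<and> r = q then th b * h r t else 0)
      = (\<Sum>b\<in>{1..d}. if b = j then th b * h q t else 0)"
    using assms(2) by (intro sum.cong refl) (simp add: sum.delta)
  finally show ?thesis using assms(1) by (simp add: sum.delta)
qed

lemma kap_z:
  assumes "t \<in> {1..n}"
  shows "kap t * z = z * kap t - (\<Sum>q\<in>{1..n}. kap q * h q t)"
proof -
  have "th b * y (b, r) * h r t * z = z * (th b * y (b, r) * h r t)
     - (\<Sum>q\<in>{1..n}. th b * y (b, r) * h r q * h q t)" if "r \<in> {1..n}" for b r
  proof -
    have "h r t * z = z * h r t - (\<Sum>q\<in>{1..n}. h r q * h q t)"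
      using hz[OF that assms] by (simp add: algebra_simps)
    hence "th b * y (b, r) * h r t * z = th b * y (b, r) * (z * h r t)
       - (\<Sum>q\<in>{1..n}. th b * y (b, r) * h r q * h q t)"
      by (simp only: mult.assoc right_diff_distrib sum_distrib_left)
    also have "th b * y (b, r) * (z * h r t) = z * (th b * y (b, r) * h r t)"
      by (simp only: mult.assoc[symmetric] zx) (simp only: mult.assoc zy[symmetric])
    finally show ?thesis .
  qed
  hence "kap t * z = z * kap t - (\<Sum>b\<in>{1..d}. \<Sum>r\<in>{1..n}. \<Sum>q\<in>{1..n}. th b * y (b, r) * h r q * h q t)"
    unfolding kap_def sum_distrib_left sum_distrib_right sum_subtractf[symmetric] by (intro sum.cong refl)
  also have "(\<Sum>b\<in>{1..d}. \<Sum>r\<in>{1..n}. \<Sum>q\<in>{1..n}. th b * y (b, r) * h r q * h q t)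
      = (\<Sum>b\<in>{1..d}. \<Sum>q\<in>{1..n}. \<Sum>r\<in>{1..n}. th b * y (b, r) * h r q * h q t)"
    by (intro sum.cong refl sum.swap)
  also have "\<dots> = (\<Sum>q\<in>{1..n}. \<Sum>b\<in>{1..d}. \<Sum>r\<in>{1..n}. th b * y (b, r) * h r q * h q t)"
    by (rule sum.swap)
  also have "\<dots> = (\<Sum>q\<in>{1..n}. kap q * h q t)" unfolding kap_def sum_distrib_right ..
  finally show ?thesis .
qed

lemma kap_kap: "kap s * kap t = kap t * kap s"
proof -
  have "th b * y (b, r) * h r t * kap s = kap s * (th b * y (b, r) * h r t)" if "r \<in> {1..n}" for b r
  proof -
    have *: "kap s * y (b, r) = y (b, r) * kap s"
    proof -
      have "y (b, r) * (th a * y (a, q) * h q s) = th a * y (a, q) * h q s * y (b, r)" for a q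
      proof -
        have *: "y (b, r) * th a = - (th a * y (b, r))" using that by (simp add: yx)
        have "y (b, r) * (th a * y (a, q) * h q s) = (y (b, r) * th a) * y (a, q) * h q s"
          by (simp only: mult.assoc)
        also have "\<dots> = th a * - (y (b, r) * y (a, q)) * h q s" by (simp add: * mult.assoc)
        also have "- (y (b, r) * y (a, q)) = y (a, q) * y (b, r)" by (simp add: yy[of "(b, r)" "(a, q)"])
        finally show ?thesis by (simp only: mult.assoc hy)
      qed
      thus ?thesis unfolding kap_def sum_distrib_left sum_distrib_right by simp
    qed
    show ?thesis
      by (rule sym, intro commute_multI kap_th * kap_h)
  qed
  hence "(\<Sum>b\<in>{1..d}. \<Sum>r\<in>{1..n}. th b * y (b, r) * h r t * kap s) = (\<Sum>b\<in>{1..d}. \<Sum>r\<in>{1..n}. kap s * (th b * y (b, r) * h r t))"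
    by (intro sum.cong refl) auto
  thus ?thesis by (simp add: kap_def[of t] sum_distrib_left sum_distrib_right)
qed

text \<open>Two corrections cancel. The commutator with \<open>z\<close> produces
  \<open>kap q * h q t\<close> for all \<open>q\<close>, the contractions with
  \<open>x (j, s)\<close> produce \<open>kap s * h s t\<close> for \<open>s\<close> up to
  \<open>m\<close>. As \<open>h\<close> is upper triangular and \<open>t\<close> is at most
  \<open>m\<close>, the first sum also stops at \<open>m\<close>.\<close>

lemma kap_psi:
  assumes "t \<in> {1..m}" "m \<le> n" "j \<in> {1..d}"
  shows "kap t * psi m j = psi m j * kap t"
proof -
  have t: "t \<in> {1..n}" using assms by auto
  have 1: "kap t * (th j * z) = th j * z * kap t - th j * (\<Sum>q\<in>{1..n}. kap q * h q t)"
    by (simp add: mult.assoc[symmetric] kap_th) (simp add: mult.assoc kap_z[OF t] algebra_simps)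
  have 2: "kap t * (\<Sum>i\<in>{1..d}. sc (W j i) * th i) = (\<Sum>i\<in>{1..d}. sc (W j i) * th i) * kap t"
    by (intro commute_sumI commute_multI kap_th kap_sc)
  have "kap t * (kap s * x (j, s)) = kap s * x (j, s) * kap t + th j * (kap s * h s t)" if "s \<in> {1..m}" for s
  proof -
    have "kap t * (kap s * x (j, s)) = kap s * (kap t * x (j, s))"
      by (simp add: mult.assoc[symmetric] kap_kap[of t s])
    also have "kap t * x (j, s) = x (j, s) * kap t + th j * h s t"
      by (rule kap_x) (use that assms in auto)
    also have "kap s * (x (j, s) * kap t + th j * h s t) = kap s * x (j, s) * kap t + (kap s * th j) * h s t"
      by (simp add: algebra_simps mult.assoc)
    finally show ?thesis by (simp add: kap_th mult.assoc)
  qed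
  hence 3: "kap t * (\<Sum>s\<in>{1..m}. kap s * x (j, s)) = (\<Sum>s\<in>{1..m}. kap s * x (j, s)) * kap t
      + th j * (\<Sum>s\<in>{1..m}. kap s * h s t)"
    unfolding sum_distrib_left sum_distrib_right sum.distrib[symmetric] by (rule sum.cong[OF refl])
  have 4: "(\<Sum>q\<in>{1..n}. kap q * h q t) = (\<Sum>s\<in>{1..m}. kap s * h s t)"
    using assms t by (intro sum.mono_neutral_right) (auto simp: h_tri)
  show ?thesis unfolding psi_def by (simp add: algebra_simps 1 2 3 4 mult.assoc)
qed

lemma psi_Suc: "psi (Suc m) j = psi m j - kap (Suc m) * x (j, Suc m)"
  by (simp add: psi_def)

text \<open>By triangularity of \<open>h\<close>, no \<open>kap s\<close> with \<open>s\<close> at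
  most \<open>m\<close> contains an annihilator with lower index \<open>Suc m\<close>, so there is
  nothing to contract with and only the odd signs remain.\<close>

lemma x_psi:
  assumes "m < n" "i \<in> {1..d}" "j \<in> {1..d}"
  shows "x (i, Suc m) * psi m j = - (psi m j * x (i, Suc m))"
proof -
  let ?x = "x (i, Suc m)"
  have xth: "?x * th k = - (th k * ?x)" for k by (rule xx)
  have 1: "?x * (th j * z) = - (th j * z * ?x)"
    by (simp add: mult.assoc[symmetric] xth) (simp add: mult.assoc zx)
  have "?x * (sc (W j k) * th k) = - (sc (W j k) * th k * ?x)" for k
    by (simp add: mult.assoc[symmetric] sc_comm[of _ ?x, symmetric]) (simp add: mult.assoc xth)
  hence 2: "?x * (\<Sum>k\<in>{1..d}. sc (W j k) * th k) = - ((\<Sum>k\<in>{1..d}. sc (W j k) * th k) * ?x)"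
    by (simp add: sum_distrib_left sum_distrib_right sum_negf)
  have "?x * (kap s * x (j, s)) = - (kap s * x (j, s) * ?x)" if "s \<in> {1..m}" for s
  proof -
    have "kap s * ?x = ?x * kap s"
      using kap_x[of i "Suc m" s] assms that by (simp add: h_tri)
    hence "?x * (kap s * x (j, s)) = kap s * (?x * x (j, s))" by (simp add: mult.assoc[symmetric])
    thus ?thesis by (simp add: xx[of "(i, Suc m)" "(j, s)"] mult.assoc)
  qed
  hence 3: "?x * (\<Sum>s\<in>{1..m}. kap s * x (j, s)) = - ((\<Sum>s\<in>{1..m}. kap s * x (j, s)) * ?x)"
    unfolding sum_distrib_left sum_distrib_right sum_negf[symmetric] by (rule sum.cong[OF refl])
  show ?thesis unfolding psi_def by (simp add: algebra_simps 1 2 3)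
qed

lemma psi_0: "j \<in> {1..d} \<Longrightarrow> psi 0 j = (\<Sum>i\<in>{1..d}. th i * (sc (W j i) - (if i = j then z else 0)))"
  unfolding psi_def
  by (simp add: right_diff_distrib sum_subtractf sum.delta sc_comm if_distrib[of "\<lambda>a. _ * a"] cong: if_cong)

text \<open>The rows behave like Grassmann variables although the entries of \<open>NN\<close> do
  not commute; this replaces commutativity in the determinant. In the induction step
  \<open>kap (Suc m)\<close> commutes with \<open>psi (Suc m)\<close> and can be collected on the
  left of a product of two forms; what remains is antisymmetric in \<open>i\<close> and
  \<open>j\<close> by \<open>x_psi\<close>.\<close>

lemma psi_anti:
  assumes "m \<le> n" "i \<in> {1..d}" "j \<in> {1..d}"
  shows "psi m i * psi m j = - (psi m j * psi m i) \<and> psi m i * psi m i = 0"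
  using assms
proof (induction m arbitrary: i j)
  case 0
  have com: "(sc c - (if P then z else 0)) * (sc c' - (if P' then z else 0)) = (sc c' - (if P' then z else 0)) * (sc c - (if P then z else 0))"
    for c c' P P'
  proof -
    have "(sc c - u) * (sc c' - u') = (sc c' - u') * (sc c - u)" if "u * u' = u' * u" for u u'
      using that
      by (simp add: left_diff_distrib right_diff_distrib sc_comm[of c "sc c'"] sc_comm[of c u'] sc_comm[of c' u])
    thus ?thesis by simp
  qed
  have th: "(sc c - (if P then z else 0)) * th k = th k * (sc c - (if P then z else 0))" for c P k
    by (simp add: left_diff_distrib right_diff_distrib zx sc_comm[of c "th k"])
  have "th k * (sc c - (if P then z else 0)) * (th l * (sc c' - (if P' then z else 0)))
     = - (th l * (sc c' - (if P' then z else 0)) * (th k * (sc c - (if P then z else 0))))" for k l c c' P P'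
  proof -
    let ?a = "sc c - (if P then z else 0)" and ?b = "sc c' - (if P' then z else 0)"
    have "th k * ?a * (th l * ?b) = (th k * th l) * (?a * ?b)" by (rule mult_four_comm[OF th])
    moreover have "th l * ?b * (th k * ?a) = (th l * th k) * (?a * ?b)"
      unfolding com[of c P c' P'] by (rule mult_four_comm[OF th])
    ultimately show ?thesis by (simp add: xx[of "(k, 0)" "(l, 0)"])
  qed
  moreover have "th k * (sc c - (if P then z else 0)) * (th k * (sc c - (if P then z else 0))) = 0" for k c P
  proof -
    have "th k * (sc c - (if P then z else 0)) * (th k * (sc c - (if P then z else 0)))
       = (th k * th k) * ((sc c - (if P then z else 0)) * (sc c - (if P then z else 0)))" by (rule mult_four_comm[OF th])
    thus ?thesis by (simp add: x_sq)
  qed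
  ultimately show ?case
    unfolding psi_0[OF 0(2)] psi_0[OF 0(3)]
    by (intro conjI sum_anticommute sum_square_zero finite_atLeastAtMost)
next
  case (Suc m)
  let ?k = "kap (Suc m)" and ?b = "\<lambda>i. x (i, Suc m)"
  have expand: "psi (Suc m) i * psi (Suc m) j = psi m i * psi m j
     - ?k * (?b i * psi m j + psi m i * ?b j) + ?k * ?k * (?b i * ?b j)"
    if "i \<in> {1..d}" "j \<in> {1..d}" for i j
  proof -
    have "psi (Suc m) i * ?k = ?k * psi (Suc m) i" using kap_psi[of "Suc m" "Suc m" i] Suc.prems that by simp
    hence "psi (Suc m) i * psi (Suc m) j = psi (Suc m) i * psi m j - ?k * psi (Suc m) i * ?b j"
      by (simp add: psi_Suc[of m j] right_diff_distrib mult.assoc[symmetric])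
    thus ?thesis by (simp add: psi_Suc[of m i] algebra_simps mult.assoc)
  qed
  have xp: "?b i * psi m j = - (psi m j * ?b i)" if "i \<in> {1..d}" "j \<in> {1..d}" for i j
    using x_psi[of m] Suc.prems that by simp
  have i: "i \<in> {1..d}" and j: "j \<in> {1..d}" and m: "m \<le> n" using Suc.prems by auto
  have IH: "psi m i * psi m j = - (psi m j * psi m i)" "psi m i * psi m i = 0"
    using Suc.IH[OF m i j] by auto
  have bb: "?b i * ?b j = - (?b j * ?b i)" by (rule xx)
  show ?case
  proof
    show "psi (Suc m) i * psi (Suc m) j = - (psi (Suc m) j * psi (Suc m) i)"
      unfolding expand[OF i j] expand[OF j i] xp[OF i j] xp[OF j i] IH bb
      by (simp add: right_diff_distrib distrib_left)
    show "psi (Suc m) i * psi (Suc m) i = 0"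
      unfolding expand[OF i i] xp[OF i i] IH x_sq by simp
  qed
qed

text \<open>Of all ingredients of \<open>psi m j\<close> only \<open>z\<close> fails to commute with
  \<open>D\<close>, which leaves the auxiliary variable in front of \<open>z\<close>.\<close>

lemma D_psi: "j \<in> {1..d} \<Longrightarrow> (D - sc c) * psi m j = psi m j * (D - sc c) - th j"
proof -
  have 1: "D * (th j * z) = th j * z * D + th j"
    by (simp add: mult.assoc[symmetric] Dx) (simp add: mult.assoc Dz algebra_simps)
  have 2: "D * (\<Sum>i\<in>{1..d}. sc (W j i) * th i) = (\<Sum>i\<in>{1..d}. sc (W j i) * th i) * D"
    by (intro commute_sumI commute_multI Dx sc_comm[symmetric])
  have 3: "D * (\<Sum>s\<in>{1..m}. kap s * x (j, s)) = (\<Sum>s\<in>{1..m}. kap s * x (j, s)) * D"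
    by (intro commute_sumI commute_multI Dx kap_D[symmetric])
  have "D * psi m j = psi m j * D - th j"
    unfolding psi_def by (simp add: left_diff_distrib right_diff_distrib 1 2 3)
  thus ?thesis by (simp add: left_diff_distrib right_diff_distrib sc_comm[of c "psi m j"])
qed

end

section \<open>The recursion in the size of the second matrix\<close>

context duality
begin

definition Psi :: "nat \<Rightarrow> nat \<Rightarrow> 'r" where
  "Psi m j = prod_list (map (psi m) [1..<j+1])"

lemma Psi_0 [simp]: "Psi m 0 = 1" and Psi_Suc: "Psi m (Suc j) = Psi m j * psi m (Suc j)"
  by (simp_all add: Psi_def) (simp add: Suc_eq_plus1)

text \<open>
  \<open>\<Sum>k. t^k * FF m j k\<close> is the product of the \<open>psi m i + t * x (i, m + 1)\<close> for \<open>i = 1, \<dots>, j\<close>,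
  where \<open>t\<close> is a central variable.  The index \<open>k\<close> is an integer so that no case distinction
  at \<open>k = 0\<close> is needed.
\<close>

primrec FF :: "nat \<Rightarrow> nat \<Rightarrow> int \<Rightarrow> 'r" where
  "FF m 0 = (\<lambda>k. if k = 0 then 1 else 0)"
| "FF m (Suc j) = (\<lambda>k. FF m j k * psi m (Suc j) + FF m j (k - 1) * x (Suc j, Suc m))"

lemma FF_neg: "k < 0 \<Longrightarrow> FF m j k = 0"
  by (induction j arbitrary: k) auto

lemma FF_large: "int j < k \<Longrightarrow> FF m j k = 0"
  by (induction j arbitrary: k) auto

lemma FF_0: "FF m j 0 = Psi m j"
  by (induction j) (simp_all add: Psi_Suc FF_neg)

text \<open>With \<open>P(t)\<close> the product whose coefficients are \<open>FF m j k\<close>,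
  this says \<open>P(t) * (psi m i + t * x (i, Suc m)) = 0\<close> for a row \<open>i\<close>
  occurring in it: the factors anticommute and square to zero.\<close>

lemma FF_psi:
  assumes "m < n" "j \<le> d" "i \<in> {1..j}"
  shows "FF m j k * psi m i = - (FF m j (k - 1) * x (i, Suc m))"
  using assms(2,3)
proof (induction j arbitrary: i k)
  case (Suc j)
  let ?J = "Suc j"
  have J: "?J \<in> {1..d}" and i: "i \<in> {1..d}" and m: "m \<le> n" using Suc.prems assms by auto
  have E: "FF m ?J k * psi m i = FF m j k * (psi m ?J * psi m i) + FF m j (k - 1) * (x (?J, Suc m) * psi m i)"
    "FF m ?J (k - 1) * x (i, Suc m) = FF m j (k - 1) * (psi m ?J * x (i, Suc m))
       + FF m j (k - 2) * (x (?J, Suc m) * x (i, Suc m))"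
    by (simp_all add: distrib_right mult.assoc)
  show ?case
  proof (cases "i = ?J")
    case True
    show ?thesis unfolding E
      using psi_anti[OF m J J] x_psi[OF assms(1) J J] by (simp only: True x_sq) simp
  next
    case False
    hence ij: "i \<in> {1..j}" "j \<le> d" using Suc.prems by auto
    have IH: "FF m j k * psi m i = - (FF m j (k - 1) * x (i, Suc m))" for k
      using Suc.IH[OF ij(2) ij(1)] .
    have "FF m j k * (psi m ?J * psi m i) = - (FF m j k * psi m i * psi m ?J)"
      using psi_anti[OF m J i] by (simp add: mult.assoc)
    also have "\<dots> = FF m j (k - 1) * (x (i, Suc m) * psi m ?J)"
      by (simp add: IH mult.assoc)
    finally have 1: "FF m j k * (psi m ?J * psi m i) = FF m j (k - 1) * (x (i, Suc m) * psi m ?J)" .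
    have "FF m j (k - 1) * (x (?J, Suc m) * psi m i) = - (FF m j (k - 1) * psi m i * x (?J, Suc m))"
      by (simp add: x_psi[OF assms(1) J i] mult.assoc)
    also have "\<dots> = FF m j (k - 2) * (x (i, Suc m) * x (?J, Suc m))"
      by (simp add: IH mult.assoc)
    finally have 2: "FF m j (k - 1) * (x (?J, Suc m) * psi m i) = FF m j (k - 2) * (x (i, Suc m) * x (?J, Suc m))" .
    have 3: "psi m ?J * x (i, Suc m) = - (x (i, Suc m) * psi m ?J)"
      using x_psi[OF assms(1) i J] by simp
    have 4: "x (?J, Suc m) * x (i, Suc m) = - (x (i, Suc m) * x (?J, Suc m))" by (rule xx)
    show ?thesis unfolding E 1 2 3 4 by simp
  qed
qed simp

text \<open>The polynomial \<open>P(t)\<close> is evaluated at \<open>t = - kap (Suc m)\<close> with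
  the powers on the left. The side matters: \<open>kap (Suc m)\<close> commutes with every
  \<open>psi (Suc m) i\<close>, hence can be drawn to the left of the full product, but it does not
  pass the \<open>psi m i\<close> freely. Any \<open>K\<close> at least \<open>j\<close> will do,
  since \<open>FF\<close> vanishes above degree \<open>j\<close>.\<close>

lemma Psi_Suc_FF:
  assumes "m < n" "j \<le> d" "j \<le> K"
  shows "Psi (Suc m) j = (\<Sum>k\<le>K. (- kap (Suc m)) ^ k * FF m j (int k))"
  using assms(2,3)
proof (induction j)
  case 0
  have "(\<Sum>k\<le>K. (- kap (Suc m)) ^ k * FF m 0 (int k)) = (\<Sum>k\<le>K. if k = 0 then 1 else 0)"
    by (intro sum.cong refl) simp
  thus ?case by (simp add: sum.delta)
next
  case (Suc j)
  let ?k = "kap (Suc m)" and ?b = "x (Suc j, Suc m)"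
  have com: "?k * Psi (Suc m) j = Psi (Suc m) j * ?k"
    unfolding Psi_def using kap_psi[of "Suc m" "Suc m"] Suc.prems assms(1)
    by (intro commute_prod_list) auto
  have IH: "Psi (Suc m) j = (\<Sum>k\<le>K. (- ?k) ^ k * FF m j (int k))" using Suc by simp
  obtain L where K: "K = Suc L" using Suc.prems by (cases K) auto
  have "Psi (Suc m) (Suc j) = Psi (Suc m) j * psi m (Suc j) + (- ?k) * (Psi (Suc m) j * ?b)"
    by (simp add: Psi_Suc psi_Suc right_diff_distrib mult.assoc[symmetric] com)
  also have "(- ?k) * (Psi (Suc m) j * ?b) = (\<Sum>k\<le>K. (- ?k) ^ Suc k * (FF m j (int k) * ?b))"
    unfolding IH sum_distrib_left sum_distrib_right by (simp add: mult.assoc)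
  also have "\<dots> = (\<Sum>k\<le>L. (- ?k) ^ Suc k * (FF m j (int k) * ?b))"
    using Suc.prems by (simp add: K FF_large)
  also have "\<dots> = (\<Sum>k\<le>K. (- ?k) ^ k * (FF m j (int k - 1) * ?b))"
    unfolding K sum.atMost_Suc_shift by (simp add: FF_neg)
  also have "Psi (Suc m) j * psi m (Suc j) = (\<Sum>k\<le>K. (- ?k) ^ k * (FF m j (int k) * psi m (Suc j)))"
    unfolding IH sum_distrib_right by (simp add: mult.assoc)
  finally show ?case by (simp add: distrib_left sum.distrib)
qed

context
  fixes m s
  assumes m: "m < n" and s_def: "s = D - sc (Z (Suc m) (Suc m))"
begin

text \<open>A triangular matrix and its inverse have mutually inverse diagonal entries.\<close>

lemma s_h: "s * h (Suc m) (Suc m) = 1" and h_s: "h (Suc m) (Suc m) * s = 1"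
proof -
  have M: "Suc m \<in> {1..n}" using m by auto
  have "(\<Sum>t\<in>{1..n}. ((if Suc m = t then D else 0) - sc (Z (Suc m) t)) * h t (Suc m))
     = (\<Sum>t\<in>{Suc m}. ((if Suc m = t then D else 0) - sc (Z (Suc m) t)) * h t (Suc m))"
  proof (rule sum.mono_neutral_right)
    show "\<forall>t\<in>{1..n} - {Suc m}. ((if Suc m = t then D else 0) - sc (Z (Suc m) t)) * h t (Suc m) = 0"
    proof
      fix t assume t: "t \<in> {1..n} - {Suc m}"
      show "((if Suc m = t then D else 0) - sc (Z (Suc m) t)) * h t (Suc m) = 0"
        using t M Z_tri[of "Suc m" t] h_tri[of t "Suc m"] by (cases "t < Suc m") auto
    qed
  qed (use M in auto)
  with eh[OF M M] show "s * h (Suc m) (Suc m) = 1" by (simp add: s_def)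
  thus "h (Suc m) (Suc m) * s = 1"
    by (simp add: s_def left_diff_distrib right_diff_distrib hD sc_comm[of "Z (Suc m) (Suc m)"])
qed

lemma s_psi: "j \<in> {1..d} \<Longrightarrow> s * psi m j * h (Suc m) (Suc m) = psi m j - th j * h (Suc m) (Suc m)"
  using D_psi[of j "Z (Suc m) (Suc m)" m]
  by (simp only: s_def[symmetric] left_diff_distrib[of "psi m j * s"]) (simp add: s_h mult.assoc)

text \<open>The failure of \<open>psi m j\<close> and \<open>kap (Suc m)\<close> to commute is a
  conjugation by \<open>s\<close>: the term \<open>th j * h (Suc m) (Suc m)\<close> from contracting
  with \<open>x (j, Suc m)\<close> is the one that \<open>D\<close> produces when it is moved across
  \<open>psi m j\<close>.\<close>

lemma psi_kap:
  assumes "j \<in> {1..d}"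
  shows "psi m j * kap (Suc m) = kap (Suc m) * (s * psi m j * h (Suc m) (Suc m))"
proof -
  let ?k = "kap (Suc m)" and ?b = "x (j, Suc m)" and ?si = "h (Suc m) (Suc m)"
  have "psi (Suc m) j * ?k = ?k * psi (Suc m) j" using kap_psi[of "Suc m" "Suc m" j] m assms by simp
  hence "psi m j * ?k = ?k * psi m j - ?k * (?k * ?b - ?b * ?k)"
    by (simp add: psi_Suc algebra_simps)
  also have "?k * ?b - ?b * ?k = th j * ?si" using kap_x[OF assms, of "Suc m" "Suc m"] m by simp
  finally show ?thesis by (simp add: s_psi[OF assms] right_diff_distrib)
qed

lemma b_kap:
  assumes "j \<in> {1..d}"
  shows "x (j, Suc m) * kap (Suc m) = kap (Suc m) * x (j, Suc m) - th j * h (Suc m) (Suc m)"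
  using kap_x[OF assms, of "Suc m" "Suc m"] m by simp

text \<open>The coefficient of \<open>t^k\<close> in
  \<open>P(t) * (kap + t) = (kap + t) * s * P(t) * s\<^sup>-\<^sup>1\<close>, where
  \<open>kap\<close> means \<open>kap (Suc m)\<close>. It follows factor by factor from
  \<open>psi_kap\<close> and \<open>b_kap\<close>.\<close>

lemma FF_kap:
  assumes "j \<le> d"
  shows "FF m j k * kap (Suc m) + FF m j (k - 1)
    = kap (Suc m) * (s * FF m j k * h (Suc m) (Suc m)) + s * FF m j (k - 1) * h (Suc m) (Suc m)"
  using assms
proof (induction j arbitrary: k)
  case 0
  show ?case by (auto simp: s_h)
next
  case (Suc j)
  let ?k = "kap (Suc m)" and ?b = "x (Suc j, Suc m)" and ?si = "h (Suc m) (Suc m)" and ?p = "psi m (Suc j)"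
  let ?th = "th (Suc j) * ?si"
  let ?q = "?p - ?th"
  have J: "Suc j \<in> {1..d}" using Suc.prems by simp
  have IH: "FF m j k * ?k + FF m j (k - 1) = ?k * (s * FF m j k * ?si) + s * FF m j (k - 1) * ?si" for k
    using Suc by simp
  have pk: "?p * ?k = ?k * ?q" using psi_kap[OF J] s_psi[OF J] by simp
  have bk: "?b * ?k = ?k * ?b - ?th" using b_kap[OF J] .
  have q: "?q = s * ?p * ?si" using s_psi[OF J] by simp
  have siq: "?si * ?q = ?p * ?si" unfolding q by (simp add: mult.assoc[symmetric] h_s)
  have sib: "?si * ?b = ?b * ?si" by (rule hx)
  have com: "?k * ?p = ?p * ?k + ?k * ?th" using pk by (simp add: right_diff_distrib)
  have "FF m (Suc j) k * ?k + FF m (Suc j) (k - 1)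
      = FF m j k * (?p * ?k) + FF m j (k - 1) * (?b * ?k) + FF m j (k - 1) * ?p + FF m j (k - 2) * ?b"
    by (simp add: distrib_right mult.assoc add.assoc)
  also have "\<dots> = (FF m j k * ?k + FF m j (k - 1)) * ?q + (FF m j (k - 1) * ?k + FF m j (k - 1 - 1)) * ?b"
    unfolding pk bk by (simp add: distrib_right distrib_left right_diff_distrib mult.assoc)
  also have "\<dots> = (?k * (s * FF m j k * ?si) + s * FF m j (k - 1) * ?si) * ?q
      + (?k * (s * FF m j (k - 1) * ?si) + s * FF m j (k - 2) * ?si) * ?b"
    unfolding IH by simp
  also have "\<dots> = ?k * (s * (FF m j k * (?si * ?q))) + s * (FF m j (k - 1) * (?si * ?q))
      + ?k * (s * (FF m j (k - 1) * (?si * ?b))) + s * (FF m j (k - 2) * (?si * ?b))"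
    by (simp only: distrib_right mult.assoc add.assoc)
  also have "\<dots> = ?k * (s * FF m (Suc j) k * ?si) + s * FF m (Suc j) (k - 1) * ?si"
    unfolding siq sib by (simp add: distrib_right distrib_left mult.assoc add_ac)
  finally show ?case .
qed

text \<open>Minus the value of \<open>(P(t) - P(0)) / t\<close> at \<open>t = - kap (Suc m)\<close>,
  powers on the left, for the product over all \<open>d\<close> rows. It takes the place of an
  adjugate: \<open>Phi_psi\<close> and \<open>Psi_Phi\<close> are the two relations from which a row
  annihilated by most columns of the second matrix is assembled.\<close>

definition Phi :: 'r where
  "Phi = - (\<Sum>k\<le>d. (- kap (Suc m)) ^ k * FF m d (int k + 1))"

lemma Phi_psi:
  assumes "j \<in> {1..d}"
  shows "Phi * psi m j = Psi (Suc m) d * x (j, Suc m)"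
proof -
  have "Phi * psi m j = - (\<Sum>k\<le>d. (- kap (Suc m)) ^ k * (FF m d (int k + 1) * psi m j))"
    unfolding Phi_def by (simp add: sum_distrib_right mult.assoc)
  also have "\<dots> = (\<Sum>k\<le>d. (- kap (Suc m)) ^ k * FF m d (int k)) * x (j, Suc m)"
    using FF_psi[OF m, of d j] assms by (simp add: sum_distrib_right mult.assoc sum_negf)
  also have "\<dots> = Psi (Suc m) d * x (j, Suc m)"
    using Psi_Suc_FF[OF m, of d d] by simp
  finally show ?thesis .
qed

text \<open>\<open>FF_kap\<close> at \<open>k + 1\<close> turns \<open>Phi * kap (Suc m)\<close>
  into a telescoping sum. Its upper end vanishes because the degree exceeds \<open>d\<close>, and
  its lower end is the conjugate of \<open>FF m d 0 = Psi m d\<close>.\<close>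

lemma Psi_Phi: "Psi (Suc m) d - Phi * kap (Suc m) = s * Psi m d * h (Suc m) (Suc m)"
proof -
  let ?k = "kap (Suc m)" and ?si = "h (Suc m) (Suc m)"
  let ?G = "\<lambda>k. s * FF m d k * ?si"
  have P: "Psi (Suc m) d = (\<Sum>k\<le>d. (- ?k) ^ k * FF m d (int k))" using Psi_Suc_FF[OF m, of d d] by simp
  have FK: "FF m d (int k + 1) * ?k = ?k * ?G (int k + 1) + ?G (int k) - FF m d (int k)" for k
    using FF_kap[of d "int k + 1"] by (simp add: algebra_simps)
  have "Phi * ?k = - (\<Sum>k\<le>d. (- ?k) ^ k * (FF m d (int k + 1) * ?k))"
    unfolding Phi_def by (simp add: sum_distrib_right mult.assoc)
  also have "\<dots> = (\<Sum>k\<le>d. (- ?k) ^ Suc k * ?G (int (Suc k)) - (- ?k) ^ k * ?G (int k)) + Psi (Suc m) d"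
    unfolding FK P sum_negf[symmetric] sum.distrib[symmetric]
    by (intro sum.cong refl)
       (simp only: power_Suc2 right_diff_distrib distrib_left mult.assoc of_nat_Suc add.commute[of 1], simp)
  also have "(\<Sum>k\<le>d. (- ?k) ^ Suc k * ?G (int (Suc k)) - (- ?k) ^ k * ?G (int k))
     = (- ?k) ^ Suc d * ?G (int (Suc d)) - (- ?k) ^ 0 * ?G (int 0)"
    using sum_Suc_diff[of 0 d "\<lambda>k. (- ?k) ^ k * ?G (int k)"] by (simp add: atMost_atLeast0)
  also have "\<dots> = - (s * Psi m d * ?si)" by (simp add: FF_large FF_0)
  finally show ?thesis by simp
qed

end

end

lemma sum_mult_delta:
  fixes f :: "'i \<Rightarrow> 'r::ring_1"
  assumes "finite A" "k \<in> A"
  shows "(\<Sum>i\<in>A. f i * (if i = k then 1 else 0)) = f k" "(\<Sum>i\<in>A. (if i = k then 1 else 0) * f i) = f k"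
    "(\<Sum>i\<in>A. f i * (if k = i then 1 else 0)) = f k" "(\<Sum>i\<in>A. (if k = i then 1 else 0) * f i) = f k"
proof -
  have 1: "(\<Sum>i\<in>A. f i * (if i = k then 1 else 0)) = (\<Sum>i\<in>A. if i = k then f i else 0)"
    by (intro sum.cong refl) simp
  have 2: "(\<Sum>i\<in>A. (if i = k then 1 else 0) * f i) = (\<Sum>i\<in>A. if i = k then f i else 0)"
    by (intro sum.cong refl) simp
  show "(\<Sum>i\<in>A. f i * (if i = k then 1 else 0)) = f k" "(\<Sum>i\<in>A. (if i = k then 1 else 0) * f i) = f k"
    unfolding 1 2 using assms by (simp_all add: sum.delta)
  thus "(\<Sum>i\<in>A. f i * (if k = i then 1 else 0)) = f k" "(\<Sum>i\<in>A. (if k = i then 1 else 0) * f i) = f k"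
    by (simp_all add: eq_commute[of k])
qed

lemma prod_list_neg: "prod_list (map (\<lambda>j. - f j) js) = (-1) ^ length js * prod_list (map f js)" for f :: "'a \<Rightarrow> 'r::ring_1"
proof (induction js)
  case (Cons j js)
  thus ?case by (cases "even (length js)") simp_all
qed simp

context duality
begin

text \<open>With the resolvent of \<open>W\<close> for \<open>K\<close> this is the matrix under the
  Berezinian.\<close>

definition M2 :: "(nat \<Rightarrow> nat \<Rightarrow> 'r) \<Rightarrow> nat \<Rightarrow> nat \<Rightarrow> 'r" where
  "M2 K j k = (if j = k then D else 0) - sc (Z j k) + (\<Sum>a\<in>{1..d}. \<Sum>b\<in>{1..d}. x (b, j) * y (a, k) * K a b)"

text \<open>What the matrix \<open>M1\<close> of the column determinant becomes when
  \<open>z\<close> and \<open>D\<close> trade places; its determinant is read along rows.\<close>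

definition NN :: "nat \<Rightarrow> nat \<Rightarrow> 'r" where
  "NN j i = (if j = i then z else 0) - sc (W j i) + (\<Sum>r\<in>{1..n}. \<Sum>s\<in>{1..n}. y (i, r) * x (j, s) * h r s)"

text \<open>The row \<open>Y\<close> satisfies \<open>Y * M2 = T * (0, ..., 0, 1)\<close> on the
  leading block of size \<open>Suc m\<close>, so it is \<open>T\<close> times the last row of the
  inverse of that block. Its last entry is \<open>Psi (Suc m) d\<close> by \<open>Psi_Phi\<close>.
  Pairing \<open>Y * M2\<close> with the last column \<open>X\<close> of the inverse gives
  \<open>Y (Suc m)\<close> in one order and \<open>T * X (Suc m)\<close> in the other.\<close>

lemma Psi_step:
  assumes m: "m < n"
    and Kz: "\<And>a b. K a b * z = z * K a b"
    and K: "\<And>a i. a \<in> {1..d} \<Longrightarrow> i \<in> {1..d} \<Longrightarrow>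
      (\<Sum>b\<in>{1..d}. K a b * ((if b = i then z else 0) - sc (W b i))) = (if a = i then 1 else 0)"
    and X: "\<And>j. j \<in> {1..Suc m} \<Longrightarrow> (\<Sum>k\<in>{1..Suc m}. M2 K j k * X k) = (if j = Suc m then 1 else 0)"
  shows "Psi (Suc m) d = (D - sc (Z (Suc m) (Suc m))) * Psi m d * X (Suc m)"
proof -
  let ?M = "Suc m"
  define s where "s = D - sc (Z ?M ?M)"
  note s_h = s_h[OF m s_def] and Phi_psi = Phi_psi[OF m s_def] and Psi_Phi = Psi_Phi[OF m s_def]
  define P where "P = Phi m"
  define T where "T = s * Psi m d"
  \<comment> \<open>For \<open>j\<close> at most \<open>m\<close> the second summand vanishes by
    triangularity, so these entries are multiples of \<open>kap j\<close>; together they complete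
    \<open>psi m\<close> back to \<open>psi 0\<close> in the next step.\<close>
  define Y where "Y j = P * kap j + T * h ?M j" for j
  have M: "?M \<in> {1..n}" using m by simp
  have YM: "Y ?M = Psi ?M d" using Psi_Phi by (simp add: Y_def T_def P_def algebra_simps)
  have a: "(\<Sum>j\<in>{1..?M}. Y j * x (b, j)) = P * (\<Sum>i\<in>{1..d}. th i * (sc (W b i) - (if i = b then z else 0)))"
    if b: "b \<in> {1..d}" for b
  proof -
    have "(\<Sum>j\<in>{1..m}. Y j * x (b, j)) = (\<Sum>j\<in>{1..m}. P * (kap j * x (b, j)))"
      using m M by (intro sum.cong refl) (simp add: Y_def h_tri mult.assoc)
    hence "(\<Sum>j\<in>{1..?M}. Y j * x (b, j)) = P * psi m b + P * (\<Sum>j\<in>{1..m}. kap j * x (b, j))"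
      using Phi_psi[OF b] by (simp add: YM P_def sum_distrib_left)
    also have "\<dots> = P * psi 0 b" by (simp add: psi_def algebra_simps)
    finally show ?thesis by (simp only: psi_0[OF b])
  qed
  \<comment> \<open>The contribution of \<open>D - Z\<close>: it is inverted by \<open>h\<close>
    inside \<open>kap\<close> and inside the second summand of \<open>Y\<close>.\<close>
  have b: "(\<Sum>j\<in>{1..?M}. Y j * ((if j = k then D else 0) - sc (Z j k)))
      = P * (\<Sum>b\<in>{1..d}. th b * y (b, k)) + T * (if ?M = k then 1 else 0)" if k: "k \<in> {1..?M}" for k
  proof -
    have hsum: "(\<Sum>j\<in>{1..?M}. h r j * ((if j = k then D else 0) - sc (Z j k))) = (if r = k then 1 else 0)"
      if r: "r \<in> {1..n}" for r
    proof -
      have "(\<Sum>j\<in>{1..n}. h r j * ((if j = k then D else 0) - sc (Z j k)))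
         = (\<Sum>j\<in>{1..?M}. h r j * ((if j = k then D else 0) - sc (Z j k)))"
        using m k by (intro sum.mono_neutral_right) (auto simp: Z_tri)
      thus ?thesis using he[OF r, of k] m k by simp
    qed
    have "(\<Sum>j\<in>{1..?M}. kap j * ((if j = k then D else 0) - sc (Z j k)))
      = (\<Sum>j\<in>{1..?M}. \<Sum>b\<in>{1..d}. \<Sum>r\<in>{1..n}. th b * y (b, r) * (h r j * ((if j = k then D else 0) - sc (Z j k))))"
      unfolding kap_def sum_distrib_right by (simp only: mult.assoc)
    also have "\<dots> = (\<Sum>b\<in>{1..d}. \<Sum>r\<in>{1..n}. \<Sum>j\<in>{1..?M}. th b * y (b, r) * (h r j * ((if j = k then D else 0) - sc (Z j k))))"
      by (subst sum.swap) (intro sum.cong refl sum.swap)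
    also have "\<dots> = (\<Sum>b\<in>{1..d}. \<Sum>r\<in>{1..n}. th b * y (b, r) * (if r = k then 1 else 0))"
      unfolding sum_distrib_left[symmetric] by (intro sum.cong refl) (simp only: hsum)
    also have "\<dots> = (\<Sum>b\<in>{1..d}. th b * y (b, k))"
      using k m by (intro sum.cong refl sum_mult_delta) auto
    finally have "(\<Sum>j\<in>{1..?M}. kap j * ((if j = k then D else 0) - sc (Z j k))) = (\<Sum>b\<in>{1..d}. th b * y (b, k))" .
    thus ?thesis unfolding Y_def distrib_right sum.distrib mult.assoc sum_distrib_left[symmetric] hsum[OF M] by simp
  qed
  \<comment> \<open>The contribution of the odd part: by the step on \<open>x (b, j)\<close> the row
    contracts to a multiple of \<open>W - z\<close>, which \<open>K\<close> cancels. The result is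
    the negative of the first term coming from \<open>D - Z\<close>.\<close>
  have c: "(\<Sum>j\<in>{1..?M}. Y j * (\<Sum>a\<in>{1..d}. \<Sum>b\<in>{1..d}. x (b, j) * y (a, k) * K a b))
      = - (P * (\<Sum>a\<in>{1..d}. th a * y (a, k)))" for k
  proof -
    let ?u = "\<lambda>b i. (if b = i then z else 0) - sc (W b i)"
    have uK: "?u b i * K a b = K a b * ?u b i" for a b i
      by (simp add: left_diff_distrib right_diff_distrib Kz sc_comm[of _ "K a b"])
    have uy: "?u b i * y v = y v * ?u b i" for b i v
      by (simp add: left_diff_distrib right_diff_distrib zy sc_comm[of _ "y v"])
    have "(\<Sum>j\<in>{1..?M}. Y j * (\<Sum>a\<in>{1..d}. \<Sum>b\<in>{1..d}. x (b, j) * y (a, k) * K a b))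
      = (\<Sum>j\<in>{1..?M}. \<Sum>a\<in>{1..d}. \<Sum>b\<in>{1..d}. Y j * x (b, j) * (y (a, k) * K a b))"
      by (simp only: sum_distrib_left mult.assoc)
    also have "\<dots> = (\<Sum>a\<in>{1..d}. \<Sum>b\<in>{1..d}. \<Sum>j\<in>{1..?M}. Y j * x (b, j) * (y (a, k) * K a b))"
      by (subst sum.swap) (intro sum.cong refl sum.swap)
    also have "\<dots> = (\<Sum>a\<in>{1..d}. \<Sum>b\<in>{1..d}. P * (\<Sum>i\<in>{1..d}. th i * (sc (W b i) - (if i = b then z else 0))) * (y (a, k) * K a b))"
      unfolding sum_distrib_right[symmetric] by (intro sum.cong refl) (simp only: a)
    also have "\<dots> = - (P * (\<Sum>a\<in>{1..d}. \<Sum>b\<in>{1..d}. \<Sum>i\<in>{1..d}. th i * y (a, k) * (K a b * ?u b i)))"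
    proof -
      have "P * (\<Sum>i\<in>{1..d}. th i * (sc (W b i) - (if i = b then z else 0))) * (y (a, k) * K a b)
        = - (P * (\<Sum>i\<in>{1..d}. th i * y (a, k) * (K a b * ?u b i)))" for a b
      proof -
        have "th i * (sc (W b i) - (if i = b then z else 0)) * (y (a, k) * K a b) = - (th i * y (a, k) * (K a b * ?u b i))" for i
        proof -
          have "th i * ?u b i * (y (a, k) * K a b) = th i * y (a, k) * (?u b i * K a b)"
            by (rule mult_four_comm[OF uy])
          moreover have "sc (W b i) - (if i = b then z else 0) = - ?u b i" by auto
          ultimately show ?thesis by (simp only: uK mult_minus_left mult_minus_right)
        qed
        thus ?thesis by (simp only: sum_distrib_left sum_distrib_right mult.assoc sum_negf[symmetric] mult_minus_right[symmetric])
      qed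
      thus ?thesis by (simp add: sum_distrib_left sum_negf)
    qed
    also have "(\<Sum>a\<in>{1..d}. \<Sum>b\<in>{1..d}. \<Sum>i\<in>{1..d}. th i * y (a, k) * (K a b * ?u b i))
       = (\<Sum>a\<in>{1..d}. \<Sum>i\<in>{1..d}. th i * y (a, k) * (\<Sum>b\<in>{1..d}. K a b * ?u b i))"
      unfolding sum_distrib_left by (intro sum.cong refl sum.swap)
    also have "\<dots> = (\<Sum>a\<in>{1..d}. \<Sum>i\<in>{1..d}. th i * y (a, k) * (if a = i then 1 else 0))"
      by (intro sum.cong refl) (simp only: K)
    also have "\<dots> = (\<Sum>a\<in>{1..d}. th a * y (a, k))"
      by (intro sum.cong refl sum_mult_delta) auto
    finally show ?thesis .
  qed
  have YM2: "(\<Sum>j\<in>{1..?M}. Y j * M2 K j k) = T * (if ?M = k then 1 else 0)" if k: "k \<in> {1..?M}" for k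
    unfolding M2_def distrib_left sum.distrib b[OF k] c by simp
  have "Psi ?M d = (\<Sum>j\<in>{1..?M}. Y j * (if j = ?M then 1 else 0))"
    by (subst sum_mult_delta) (simp_all add: YM)
  also have "\<dots> = (\<Sum>j\<in>{1..?M}. \<Sum>k\<in>{1..?M}. Y j * M2 K j k * X k)"
    by (intro sum.cong refl) (simp only: X[symmetric] sum_distrib_left mult.assoc)
  also have "\<dots> = (\<Sum>k\<in>{1..?M}. (\<Sum>j\<in>{1..?M}. Y j * M2 K j k) * X k)"
    unfolding sum_distrib_right by (rule sum.swap)
  also have "\<dots> = (\<Sum>k\<in>{1..?M}. T * ((if ?M = k then 1 else 0) * X k))"
    by (intro sum.cong refl) (simp only: YM2 mult.assoc)
  also have "\<dots> = T * X ?M"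
    unfolding sum_distrib_left[symmetric] by (subst sum_mult_delta) auto
  finally show ?thesis by (simp add: T_def s_def)
qed

text \<open>Each step adds a factor \<open>D - Z\<close> on the far left and an inverse entry on the
  far right, hence the reversed list in front.\<close>

lemma Psi_prod:
  assumes Kz: "\<And>a b. K a b * z = z * K a b"
    and K: "\<And>a i. a \<in> {1..d} \<Longrightarrow> i \<in> {1..d} \<Longrightarrow>
      (\<Sum>b\<in>{1..d}. K a b * ((if b = i then z else 0) - sc (W b i))) = (if a = i then 1 else 0)"
    and X: "\<And>m j. m \<in> {1..n} \<Longrightarrow> j \<in> {1..m} \<Longrightarrow> (\<Sum>k\<in>{1..m}. M2 K j k * X m k) = (if j = m then 1 else 0)"
    and m: "m \<le> n"
  shows "Psi m d = prod_list (map (\<lambda>m. D - sc (Z m m)) (rev [1..<m+1])) * Psi 0 d * prod_list (map (\<lambda>m. X m m) [1..<m+1])"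
  using m
proof (induction m)
  case (Suc m)
  have "Psi (Suc m) d = (D - sc (Z (Suc m) (Suc m))) * Psi m d * X (Suc m) (Suc m)"
  proof (rule Psi_step[where K = K and X = "X (Suc m)"])
    show "m < n" using Suc.prems by simp
    fix j assume "j \<in> {1..Suc m}"
    thus "(\<Sum>k\<in>{1..Suc m}. M2 K j k * X (Suc m) k) = (if j = Suc m then 1 else 0)"
      using Suc.prems by (intro X) auto
  qed (rule Kz K; assumption?)+
  thus ?case using Suc by (simp add: mult.assoc, simp only: Suc_eq_plus1)
qed simp

text \<open>Read from the right. Row \<open>j\<close> of the upper triangular \<open>W - z\<close>
  involves only variables with index at least \<open>j\<close>, and those above \<open>j\<close>
  already occur in the product of the later rows, so only the diagonal entry survives. The induction
  therefore runs over final segments of the rows.\<close>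

lemma Psi_zero:
  "Psi 0 d = prod_list (map (\<lambda>j. sc (W j j) - z) [1..<d+1]) * gr [1..<d+1]"
proof -
  let ?v = "\<lambda>j. sc (W j j) - z"
  have vth: "?v j * th i = th i * ?v j" for i j
    using sc_comm[of "W j j" "th i"] zx[of "(i, 0)"] by (simp add: algebra_simps)
  have "prod_list (map (psi 0) [d + 1 - k..<d+1]) = prod_list (map ?v [d + 1 - k..<d+1]) * gr [d + 1 - k..<d+1]"
    if "k \<le> d" for k
    using that
  proof (induction k)
    case (Suc k)
    let ?j = "d - k"
    let ?L = "[d + 1 - k..<d+1]"
    have j: "?j \<in> {1..d}" using Suc.prems by auto
    have "d + 1 - Suc k = ?j" "d + 1 - k = Suc ?j" "?j < d + 1" using Suc.prems by auto
    hence L: "[d + 1 - Suc k..<d+1] = ?j # ?L" by (simp only: upt_conv_Cons)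
    have "psi 0 ?j * gr ?L = (\<Sum>i\<in>{1..d}. if i = ?j then th ?j * ?v ?j * gr ?L else 0)"
      unfolding psi_0[OF j] sum_distrib_right
    proof (intro sum.cong refl)
      fix i assume i: "i \<in> {1..d}"
      consider "i = ?j" | "i < ?j" | "?j < i" by linarith
      thus "th i * (sc (W ?j i) - (if i = ?j then z else 0)) * gr ?L = (if i = ?j then th ?j * ?v ?j * gr ?L else 0)"
      proof cases
        case 2
        thus ?thesis using W_tri[OF j i] by simp
      next
        case 3
        have "i \<in> set ?L" using 3 i Suc.prems by auto
        hence "gr (i # ?L) = 0" by (intro gr_not_distinct) simp
        hence "th i * gr ?L = 0" by simp
        moreover have "th i * sc (W ?j i) * gr ?L = sc (W ?j i) * (th i * gr ?L)"
          by (simp add: sc_comm[of _ "th i"] mult.assoc[symmetric])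
        ultimately show ?thesis using 3 by simp
      qed simp
    qed
    also have "\<dots> = ?v ?j * gr (?j # ?L)" using j by (simp add: sum.delta vth mult.assoc[symmetric])
    finally have *: "psi 0 ?j * gr ?L = ?v ?j * gr (?j # ?L)" .
    have "psi 0 ?j * prod_list (map ?v ?L) = prod_list (map ?v ?L) * psi 0 ?j"
    proof (intro commute_prod_list)
      fix b assume "b \<in> set (map ?v ?L)"
      then obtain l where b: "b = ?v l" by auto
      have "b * z = z * b" by (simp add: b left_diff_distrib right_diff_distrib sc_comm[of _ z])
      hence 1: "b * (sc c - (if Q then z else 0)) = (sc c - (if Q then z else 0)) * b" for c Q
        by (simp add: left_diff_distrib right_diff_distrib sc_comm[of c b])
      have 2: "b * th i = th i * b" for i by (simp add: b vth)
      show "psi 0 ?j * b = b * psi 0 ?j"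
        unfolding psi_0[OF j] by (rule sym, intro commute_sumI commute_multI 1 2)
    qed
    moreover have "?v ?j * prod_list (map ?v ?L) = prod_list (map ?v ?L) * ?v ?j"
    proof (intro commute_prod_list)
      fix b assume "b \<in> set (map ?v ?L)"
      then obtain l where b: "b = ?v l" by auto
      show "?v ?j * b = b * ?v ?j"
        using sc_comm[of "W l l" z] sc_comm[of "W ?j ?j" z] sc_comm[of "W ?j ?j" "sc (W l l)"]
        by (simp add: b left_diff_distrib right_diff_distrib)
    qed
    ultimately have "psi 0 ?j * (prod_list (map ?v ?L) * gr ?L) = ?v ?j * prod_list (map ?v ?L) * gr (?j # ?L)"
      using * by (simp add: mult.assoc[symmetric]) (simp add: mult.assoc)
    moreover have "prod_list (map (psi 0) ?L) = prod_list (map ?v ?L) * gr ?L" using Suc by simp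
    ultimately show ?case unfolding L by simp
  qed simp
  from this[of d] show ?thesis by (simp add: Psi_def)
qed

lemma psi_NN: "j \<in> {1..d} \<Longrightarrow> psi n j = (\<Sum>i\<in>{1..d}. th i * (- NN j i))"
proof -
  assume j: "j \<in> {1..d}"
  have "(\<Sum>s\<in>{1..n}. kap s * x (j, s)) = (\<Sum>s\<in>{1..n}. \<Sum>i\<in>{1..d}. \<Sum>r\<in>{1..n}. th i * (y (i, r) * x (j, s) * h r s))"
    unfolding kap_def sum_distrib_right by (simp only: mult.assoc hx)
  also have "\<dots> = (\<Sum>i\<in>{1..d}. \<Sum>s\<in>{1..n}. \<Sum>r\<in>{1..n}. th i * (y (i, r) * x (j, s) * h r s))"
    by (rule sum.swap)
  also have "\<dots> = (\<Sum>i\<in>{1..d}. th i * (\<Sum>r\<in>{1..n}. \<Sum>s\<in>{1..n}. y (i, r) * x (j, s) * h r s))"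
    unfolding sum_distrib_left by (intro sum.cong refl sum.swap)
  finally have *: "(\<Sum>s\<in>{1..n}. kap s * x (j, s)) = \<dots>" .
  have "psi n j = psi 0 j - (\<Sum>s\<in>{1..n}. kap s * x (j, s))" by (simp add: psi_def)
  also have "\<dots> = (\<Sum>i\<in>{1..d}. th i * (- NN j i))"
    unfolding psi_0[OF j] * NN_def sum_subtractf[symmetric]
    by (intro sum.cong refl) (simp add: right_diff_distrib distrib_left eq_commute[of j])
  finally show ?thesis .
qed

lemma NN_th: "NN j i * th k = th k * NN j i" and NN_y: "NN j i * y (k, 0) = y (k, 0) * NN j i"
proof -
  have 1: "y (i, r) * x (j, s) * h r s * th k = th k * (y (i, r) * x (j, s) * h r s)" if "r \<in> {1..n}" "s \<in> {1..n}" for r s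
  proof -
    have "y (i, r) * x (j, s) * h r s * th k = y (i, r) * (x (j, s) * th k) * h r s" by (simp only: mult.assoc hx)
    also have "x (j, s) * th k = - (th k * x (j, s))" by (rule xx)
    also have "y (i, r) * - (th k * x (j, s)) * h r s = - (y (i, r) * th k) * x (j, s) * h r s" by (simp add: mult.assoc)
    also have "- (y (i, r) * th k) = th k * y (i, r)" using that by (simp add: yx)
    finally show ?thesis by (simp only: mult.assoc)
  qed
  have 2: "y (i, r) * x (j, s) * h r s * y (k, 0) = y (k, 0) * (y (i, r) * x (j, s) * h r s)" if "r \<in> {1..n}" "s \<in> {1..n}" for r s
  proof -
    have "y (i, r) * x (j, s) * h r s * y (k, 0) = y (i, r) * (x (j, s) * y (k, 0)) * h r s" by (simp only: mult.assoc hy)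
    also have "x (j, s) * y (k, 0) = - (y (k, 0) * x (j, s))" using that by (simp add: yx)
    also have "y (i, r) * - (y (k, 0) * x (j, s)) * h r s = - (y (i, r) * y (k, 0)) * x (j, s) * h r s" by (simp add: mult.assoc)
    also have "- (y (i, r) * y (k, 0)) = y (k, 0) * y (i, r)" by (simp add: yy[of "(i, r)"])
    finally show ?thesis by (simp only: mult.assoc)
  qed
  have 3: "(\<Sum>r\<in>{1..n}. \<Sum>s\<in>{1..n}. y (i, r) * x (j, s) * h r s) * th k = th k * (\<Sum>r\<in>{1..n}. \<Sum>s\<in>{1..n}. y (i, r) * x (j, s) * h r s)"
    "(\<Sum>r\<in>{1..n}. \<Sum>s\<in>{1..n}. y (i, r) * x (j, s) * h r s) * y (k, 0) = y (k, 0) * (\<Sum>r\<in>{1..n}. \<Sum>s\<in>{1..n}. y (i, r) * x (j, s) * h r s)"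
    by (rule sym, intro commute_sumI, rule sym, (rule 1 2; assumption))+
  show "NN j i * th k = th k * NN j i" "NN j i * y (k, 0) = y (k, 0) * NN j i"
    unfolding NN_def by (simp_all add: distrib_left distrib_right left_diff_distrib right_diff_distrib 3 zx zy sc_comm)
qed

text \<open>Both sides are the coefficient of the top monomial \<open>gr [1..<d+1]\<close> in
  \<open>Psi n d\<close>, found once from the recursion and once by expanding the rows of
  \<open>- NN\<close>, whence the sign \<open>(-1) ^ d\<close>. All factors commute with the
  auxiliary variables and their annihilators, so \<open>gr_cancel\<close> applies.\<close>

theorem rdet_eq_prod:
  assumes Kz: "\<And>a b. K a b * z = z * K a b"
    and K: "\<And>a i. a \<in> {1..d} \<Longrightarrow> i \<in> {1..d} \<Longrightarrow>
      (\<Sum>b\<in>{1..d}. K a b * ((if b = i then z else 0) - sc (W b i))) = (if a = i then 1 else 0)"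
    and X: "\<And>m j. m \<in> {1..n} \<Longrightarrow> j \<in> {1..m} \<Longrightarrow> (\<Sum>k\<in>{1..m}. M2 K j k * X m k) = (if j = m then 1 else 0)"
    and Xth: "\<And>m k. m \<in> {1..n} \<Longrightarrow> X m m * th k = th k * X m m" "\<And>m k. m \<in> {1..n} \<Longrightarrow> X m m * y (k, 0) = y (k, 0) * X m m"
  shows "(-1) ^ d * (\<Sum>\<sigma> | \<sigma> permutes {1..d}. of_int (sign \<sigma>) * prod_list (map (\<lambda>j. NN j (\<sigma> j)) [1..<d+1]))
    = prod_list (map (\<lambda>m. D - sc (Z m m)) (rev [1..<n+1])) * prod_list (map (\<lambda>j. sc (W j j) - z) [1..<d+1])
      * prod_list (map (\<lambda>m. X m m) [1..<n+1])"
    (is "?e * ?R = ?P * ?Q * ?B")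
proof -
  have com: "c * prod_list (map f js) = prod_list (map f js) * c" if "\<And>j. j \<in> set js \<Longrightarrow> c * f j = f j * c" for c :: 'r and f :: "nat \<Rightarrow> 'r" and js
    using that by (intro commute_prod_list) auto
  have comth: "th k * ?e = ?e * th k" "th k * ?R = ?R * th k" "th k * ?P = ?P * th k" "th k * ?Q = ?Q * th k" "th k * ?B = ?B * th k"
    and comy: "y (k, 0) * ?e = ?e * y (k, 0)" "y (k, 0) * ?R = ?R * y (k, 0)" "y (k, 0) * ?P = ?P * y (k, 0)"
      "y (k, 0) * ?Q = ?Q * y (k, 0)" "y (k, 0) * ?B = ?B * y (k, 0)" for k
    by (cases "even d"; simp; fail |
        (intro commute_sumI commute_multI com; simp add: NN_th NN_y mult_of_int_commute; fail) |
        (rule com; simp add: left_diff_distrib right_diff_distrib sc_comm Dx Dy zx zy Xth; fail))+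
  have gr: "gr as * c = c * gr as" if "\<And>k. th k * c = c * th k" for c as
    unfolding gr_def by (rule sym, rule commute_prod_list) (auto simp: that)
  let ?G = "gr [1..<d+1]"
  have "?G * (?P * ?Q * ?B) = ?P * (?Q * ?G) * ?B"
    using gr[of ?P, OF comth(3)] gr[of ?Q, OF comth(4)] by (simp only: mult.assoc[symmetric]) (simp only: mult.assoc)
  also have "\<dots> = Psi n d" using Psi_prod[OF Kz K X order_refl] by (simp only: Psi_zero mult.assoc)
  also have "Psi n d = prod_list (map (\<lambda>j. \<Sum>i\<in>{1..d}. th i * (- NN j i)) [1..<d+1])"
    unfolding Psi_def by (rule arg_cong[where f = prod_list]) (rule map_cong[OF refl], rule psi_NN, auto)
  also have "\<dots> = (\<Sum>as\<in>nlists d d. gr as * prod_list (map2 (\<lambda>i j. - NN j i) as [1..<d+1]))"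
    using prod_list_forms[of "\<lambda>i j. - NN j i" d "[1..<d+1]"] by (simp add: NN_th del: upt_Suc)
  also have "\<dots> = ?G * (\<Sum>\<sigma> | \<sigma> permutes {1..d}. of_int (sign \<sigma>) * prod_list (map2 (\<lambda>i j. - NN j i) (map \<sigma> [1..<d+1]) [1..<d+1]))"
    by (rule sum_nlists_gr)
  also have "(\<Sum>\<sigma> | \<sigma> permutes {1..d}. of_int (sign \<sigma>) * prod_list (map2 (\<lambda>i j. - NN j i) (map \<sigma> [1..<d+1]) [1..<d+1]))
     = (\<Sum>\<sigma> | \<sigma> permutes {1..d}. ?e * (of_int (sign \<sigma>) * prod_list (map (\<lambda>j. NN j (\<sigma> j)) [1..<d+1])))"
  proof (intro sum.cong refl)
    fix \<sigma> :: "nat \<Rightarrow> nat"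
    have "map2 (\<lambda>i j. - NN j i) (map \<sigma> js) js = map (\<lambda>j. - NN j (\<sigma> j)) js" for js by (induction js) auto
    hence "prod_list (map2 (\<lambda>i j. - NN j i) (map \<sigma> [1..<d+1]) [1..<d+1]) = ?e * prod_list (map (\<lambda>j. NN j (\<sigma> j)) [1..<d+1])"
      by (simp add: prod_list_neg del: upt_Suc)
    thus "of_int (sign \<sigma>) * prod_list (map2 (\<lambda>i j. - NN j i) (map \<sigma> [1..<d+1]) [1..<d+1])
      = ?e * (of_int (sign \<sigma>) * prod_list (map (\<lambda>j. NN j (\<sigma> j)) [1..<d+1]))"
      by (cases "even d") (simp_all del: upt_Suc)
  qed
  also have "\<dots> = ?e * ?R" by (simp only: sum_distrib_left)
  finally have "?G * (?e * ?R - ?P * ?Q * ?B) = 0" by (simp add: right_diff_distrib)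
  hence "?e * ?R - ?P * ?Q * ?B = 0"
  proof (rule gr_cancel[rotated 2])
    fix a
    show "(?e * ?R - ?P * ?Q * ?B) * th a = th a * (?e * ?R - ?P * ?Q * ?B)"
      unfolding left_diff_distrib right_diff_distrib
      by (rule arg_cong2[where f = minus]) (rule sym, intro commute_multI comth)+
    show "(?e * ?R - ?P * ?Q * ?B) * y (a, 0) = y (a, 0) * (?e * ?R - ?P * ?Q * ?B)"
      unfolding left_diff_distrib right_diff_distrib
      by (rule arg_cong2[where f = minus]) (rule sym, intro commute_multI comy)+
  qed simp
  thus ?thesis by simp
qed

end

section \<open>Nested forms of the column determinant\<close>

primrec app_list :: "('a \<Rightarrow> 'b \<Rightarrow> 'r \<Rightarrow> 'r) \<Rightarrow> 'a list \<Rightarrow> 'b list \<Rightarrow> 'r::ring_1" where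
  "app_list T [] bs = 1"
| "app_list T (a # as) bs = T a (hd bs) (app_list T as (tl bs))"

context weyl_fermions
begin

lemma yx_conj_th:
  assumes "r \<noteq> 0" "s \<noteq> 0"
  shows "c * th k = th k * c \<Longrightarrow> y (b, r) * c * x (a, s) * th k = th k * (y (b, r) * c * x (a, s))"
    and "c * y (k, 0) = y (k, 0) * c \<Longrightarrow> y (b, r) * c * x (a, s) * y (k, 0) = y (k, 0) * (y (b, r) * c * x (a, s))"
proof -
  assume c: "c * th k = th k * c"
  have "y (b, r) * c * x (a, s) * th k = y (b, r) * c * (x (a, s) * th k)" by (simp only: mult.assoc)
  also have "\<dots> = - (y (b, r) * (c * th k) * x (a, s))" by (simp add: xx[of "(a, s)"] mult.assoc)
  also have "\<dots> = - (y (b, r) * th k) * c * x (a, s)" by (simp add: c mult.assoc)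
  also have "- (y (b, r) * th k) = th k * y (b, r)" using assms by (simp add: yx)
  finally show "y (b, r) * c * x (a, s) * th k = th k * (y (b, r) * c * x (a, s))" by (simp only: mult.assoc)
next
  assume c: "c * y (k, 0) = y (k, 0) * c"
  have 1: "x (a, s) * y (k, 0) = - (y (k, 0) * x (a, s))" using assms by (simp add: yx)
  have "y (b, r) * c * x (a, s) * y (k, 0) = y (b, r) * c * (x (a, s) * y (k, 0))" by (simp only: mult.assoc)
  also have "\<dots> = - (y (b, r) * (c * y (k, 0)) * x (a, s))" by (simp add: 1 mult.assoc)
  also have "\<dots> = - (y (b, r) * y (k, 0)) * c * x (a, s)" by (simp add: c mult.assoc)
  also have "- (y (b, r) * y (k, 0)) = y (k, 0) * y (b, r)" by (simp add: yy[of "(b, r)"])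
  finally show "y (b, r) * c * x (a, s) * y (k, 0) = y (k, 0) * (y (b, r) * c * x (a, s))" by (simp only: mult.assoc)
qed

lemma commute_gr: "(\<And>k. c * th k = th k * c) \<Longrightarrow> c * gr as = gr as * c"
  unfolding gr_def by (rule commute_prod_list) auto

lemma y_gr_th: "r \<noteq> 0 \<Longrightarrow> y (b, r) * gr as * th a = - (th a * gr as * y (b, r))"
proof -
  assume r: "r \<noteq> 0"
  have "y (b, r) * th a = - (th a * y (b, r))" using r by (simp add: yx)
  hence "y (b, r) * (th a * gr as) = - ((-1) ^ length as * (th a * gr as * y (b, r)))"
    by (cases "even (length as)") (simp_all add: mult.assoc[symmetric], simp_all add: mult.assoc gr_y[OF r])
  thus ?thesis by (cases "even (length as)") (simp_all add: mult.assoc gr_th)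
qed

end

text \<open>Here \<open>g\<close> is to be the resolvent \<open>(z - Z)\<^sup>-\<^sup>1\<close>, and
  \<open>gD\<close> is its derivative with respect to \<open>z\<close> written as a
  commutator.\<close>

locale column_det = weyl_fermions x y z D sc
  for x y :: "nat \<times> nat \<Rightarrow> 'r::ring_1" and z D :: 'r and sc :: "complex \<Rightarrow> 'r" +
  fixes d n :: nat and W :: "nat \<Rightarrow> nat \<Rightarrow> complex" and g :: "nat \<Rightarrow> nat \<Rightarrow> 'r"
  assumes gx: "\<And>r s u. g r s * x u = x u * g r s" and gy: "\<And>r s u. g r s * y u = y u * g r s"
    and gg: "\<And>r s r' s'. g r s * g r' s' = g r' s' * g r s"
    and gD: "\<And>r s. r \<in> {1..n} \<Longrightarrow> s \<in> {1..n} \<Longrightarrow> g r s * D = D * g r s + (\<Sum>q\<in>{1..n}. g r q * g q s)"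
begin

definition uu :: "nat \<Rightarrow> nat \<Rightarrow> 'r" where "uu a b = (if a = b then D else 0) - sc (W a b)"

definition M1 :: "nat \<Rightarrow> nat \<Rightarrow> 'r" where
  "M1 a b = uu a b + (\<Sum>r\<in>{1..n}. \<Sum>s\<in>{1..n}. y (b, r) * x (a, s) * g r s)"

text \<open>The product \<open>M1 a b * Y\<close> rearranged: \<open>y\<close> stays in front, but
  \<open>x\<close> and the resolvent are put behind \<open>Y\<close>. In this shape the scalar part
  stands on the far left and the resolvent on the far right.\<close>

definition T1 :: "nat \<Rightarrow> nat \<Rightarrow> 'r \<Rightarrow> 'r" where
  "T1 a b Y = uu a b * Y + (\<Sum>r\<in>{1..n}. \<Sum>s\<in>{1..n}. y (b, r) * Y * x (a, s) * g r s)"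

definition kk :: "nat \<Rightarrow> 'r" where
  "kk t = (\<Sum>a\<in>{1..d}. \<Sum>s\<in>{1..n}. th a * x (a, s) * g t s)"

lemma uu_th: "uu a b * th k = th k * uu a b" and uu_y: "uu a b * y u = y u * uu a b"
  by (simp_all add: uu_def left_diff_distrib right_diff_distrib Dx Dy sc_comm)

lemma T1_commute:
  "Y * th k = th k * Y \<Longrightarrow> T1 a b Y * th k = th k * T1 a b Y"
  "Y * y (k, 0) = y (k, 0) * Y \<Longrightarrow> T1 a b Y * y (k, 0) = y (k, 0) * T1 a b Y"
proof -
  assume Y: "Y * th k = th k * Y"
  have "y (b, r) * Y * x (a, s) * g r s * th k = th k * (y (b, r) * Y * x (a, s) * g r s)" if "r \<in> {1..n}" "s \<in> {1..n}" for r s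
    using that by (intro commute_multI[symmetric] yx_conj_th(1)[symmetric] gx[symmetric] Y) auto
  hence "(\<Sum>r\<in>{1..n}. \<Sum>s\<in>{1..n}. y (b, r) * Y * x (a, s) * g r s) * th k = th k * (\<Sum>r\<in>{1..n}. \<Sum>s\<in>{1..n}. y (b, r) * Y * x (a, s) * g r s)"
    unfolding sum_distrib_left sum_distrib_right by (intro sum.cong refl)
  thus "T1 a b Y * th k = th k * T1 a b Y"
    unfolding T1_def distrib_left distrib_right by (simp add: mult.assoc Y) (simp add: mult.assoc[symmetric] uu_th)
next
  assume Y: "Y * y (k, 0) = y (k, 0) * Y"
  have "y (b, r) * Y * x (a, s) * g r s * y (k, 0) = y (k, 0) * (y (b, r) * Y * x (a, s) * g r s)" if "r \<in> {1..n}" "s \<in> {1..n}" for r s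
    using that by (intro commute_multI[symmetric] yx_conj_th(2)[symmetric] gy[symmetric] Y) auto
  hence "(\<Sum>r\<in>{1..n}. \<Sum>s\<in>{1..n}. y (b, r) * Y * x (a, s) * g r s) * y (k, 0) = y (k, 0) * (\<Sum>r\<in>{1..n}. \<Sum>s\<in>{1..n}. y (b, r) * Y * x (a, s) * g r s)"
    unfolding sum_distrib_left sum_distrib_right by (intro sum.cong refl)
  thus "T1 a b Y * y (k, 0) = y (k, 0) * T1 a b Y"
    unfolding T1_def distrib_left distrib_right by (simp add: mult.assoc Y) (simp add: mult.assoc[symmetric] uu_y)
qed

lemma M1_T1: "M1 a b = T1 a b 1" by (simp add: M1_def T1_def)

lemma app_T1_commute:
  "app_list T1 as bs * th k = th k * app_list T1 as bs" "app_list T1 as bs * y (k, 0) = y (k, 0) * app_list T1 as bs"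
  by (induction as arbitrary: bs) (simp_all add: T1_commute)

lemma kk_th: "kk t * th k = th k * kk t"
proof -
  have "th k * (th a * x (a, s) * g t s) = th a * x (a, s) * g t s * th k" for a s
  proof -
    have "th a * x (a, s) * g t s * th k = th a * (x (a, s) * th k) * g t s" by (simp only: mult.assoc gx)
    also have "\<dots> = - (th a * th k) * x (a, s) * g t s" by (simp add: xx[of "(a, s)"] mult.assoc)
    also have "- (th a * th k) = th k * th a" by (simp add: xx[of "(a, 0)"])
    finally show ?thesis by (simp only: mult.assoc)
  qed
  thus ?thesis unfolding kk_def sum_distrib_left sum_distrib_right by simp
qed

lemma kk_kk: "kk s * kk t = kk t * kk s"
proof -
  have 1: "kk t * (x (a, q)) = x (a, q) * kk t" for a q
  proof -
    have "x (a, q) * (th b * x (b, r) * g t r) = th b * x (b, r) * g t r * x (a, q)" for b r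
    proof -
      have "th b * x (b, r) * g t r * x (a, q) = th b * (x (b, r) * x (a, q)) * g t r" by (simp only: mult.assoc gx)
      also have "\<dots> = - (th b * x (a, q)) * x (b, r) * g t r" by (simp add: xx[of "(b, r)"] mult.assoc)
      also have "- (th b * x (a, q)) = x (a, q) * th b" by (simp add: xx[of "(b, 0)"])
      finally show ?thesis by (simp only: mult.assoc)
    qed
    thus ?thesis unfolding kk_def sum_distrib_left sum_distrib_right by simp
  qed
  have 2: "kk t * g q r = g q r * kk t" for q r
    unfolding kk_def by (rule sym, intro commute_sumI commute_multI gx gg)
  have "kk t * kk s = kk s * kk t"
    unfolding kk_def[of s] by (intro commute_sumI commute_multI kk_th 1 2)
  thus ?thesis ..
qed

lemma kk_y:
  assumes "b \<in> {1..d}" "r \<in> {1..n}"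
  shows "kk t * y (b, r) = y (b, r) * kk t + th b * g t r"
proof -
  have "th a * x (a, s) * g t s * y (b, r) = y (b, r) * (th a * x (a, s) * g t s)
     + (if a = b \<and> s = r then th b * g t r else 0)" for a s
  proof -
    have 1: "x (a, s) * y (b, r) = (if a = b \<and> s = r then 1 else 0) - y (b, r) * x (a, s)"
      using yx[of "(b, r)" "(a, s)"] by (auto simp: algebra_simps)
    have 2: "th a * y (b, r) = - (y (b, r) * th a)" using assms by (simp add: yx)
    have "th a * x (a, s) * g t s * y (b, r) = th a * (x (a, s) * y (b, r)) * g t s" by (simp only: mult.assoc gy)
    also have "\<dots> = (if a = b \<and> s = r then th b * g t r else 0) - (th a * y (b, r)) * x (a, s) * g t s"
      unfolding 1 by (simp add: left_diff_distrib right_diff_distrib mult.assoc)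
    finally show ?thesis unfolding 2 by (simp add: mult.assoc)
  qed
  hence "kk t * y (b, r) = y (b, r) * kk t
      + (\<Sum>a\<in>{1..d}. \<Sum>s\<in>{1..n}. if a = b \<and> s = r then th b * g t r else 0)"
    unfolding kk_def sum_distrib_left sum_distrib_right by (simp add: sum.distrib)
  also have "(\<Sum>a\<in>{1..d}. \<Sum>s\<in>{1..n}. if a = b \<and> s = r then th b * g t r else 0)
      = (\<Sum>a\<in>{1..d}. if a = b then th b * g t r else 0)"
    using assms(2) by (intro sum.cong refl) (simp add: sum.delta)
  finally show ?thesis using assms(1) by (simp add: sum.delta)
qed

lemma kk_D:
  assumes "t \<in> {1..n}"
  shows "kk t * D = D * kk t + (\<Sum>q\<in>{1..n}. g t q * kk q)"
proof -
  have "th a * x (a, s) * g t s * D = D * (th a * x (a, s) * g t s) + (\<Sum>q\<in>{1..n}. g t q * (th a * x (a, s) * g q s))"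
    if "s \<in> {1..n}" for a s
  proof -
    have "th a * x (a, s) * g t s * D = th a * x (a, s) * D * g t s + (\<Sum>q\<in>{1..n}. th a * x (a, s) * (g t q * g q s))"
      by (simp only: mult.assoc gD[OF assms that] distrib_left sum_distrib_left)
    also have "th a * x (a, s) * D = D * (th a * x (a, s))" by (rule sym, intro commute_multI Dx)
    also have "(\<Sum>q\<in>{1..n}. th a * x (a, s) * (g t q * g q s)) = (\<Sum>q\<in>{1..n}. g t q * (th a * x (a, s) * g q s))"
    proof (intro sum.cong refl)
      fix q
      have "g t q * (th a * x (a, s)) = th a * x (a, s) * g t q" by (intro commute_multI gx)
      thus "th a * x (a, s) * (g t q * g q s) = g t q * (th a * x (a, s) * g q s)" by (simp only: mult.assoc[symmetric])
    qed
    finally show ?thesis by (simp only: mult.assoc)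
  qed
  hence "kk t * D = D * kk t + (\<Sum>a\<in>{1..d}. \<Sum>s\<in>{1..n}. \<Sum>q\<in>{1..n}. g t q * (th a * x (a, s) * g q s))"
    unfolding kk_def sum_distrib_left sum_distrib_right sum.distrib[symmetric] by (intro sum.cong refl)
  also have "(\<Sum>a\<in>{1..d}. \<Sum>s\<in>{1..n}. \<Sum>q\<in>{1..n}. g t q * (th a * x (a, s) * g q s))
     = (\<Sum>q\<in>{1..n}. \<Sum>a\<in>{1..d}. \<Sum>s\<in>{1..n}. g t q * (th a * x (a, s) * g q s))"
    by (subst sum.swap[of _ "{1..n}" "{1..n}"], rule sum.swap)
  finally show ?thesis unfolding kk_def sum_distrib_left .
qed

lemma form_M1:
  "(\<Sum>a\<in>{1..d}. th a * M1 a b) = (\<Sum>a\<in>{1..d}. th a * uu a b) - (\<Sum>r\<in>{1..n}. y (b, r) * kk r)"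
proof -
  have "(\<Sum>a\<in>{1..d}. \<Sum>r\<in>{1..n}. \<Sum>s\<in>{1..n}. th a * (y (b, r) * x (a, s) * g r s))
     = (\<Sum>a\<in>{1..d}. \<Sum>r\<in>{1..n}. \<Sum>s\<in>{1..n}. - (y (b, r) * (th a * x (a, s) * g r s)))"
  proof (intro sum.cong refl)
    fix a r s assume "r \<in> {1..n}"
    hence "th a * y (b, r) = - (y (b, r) * th a)" by (simp add: yx)
    thus "th a * (y (b, r) * x (a, s) * g r s) = - (y (b, r) * (th a * x (a, s) * g r s))"
      by (simp add: mult.assoc[symmetric])
  qed
  also have "\<dots> = - (\<Sum>r\<in>{1..n}. y (b, r) * kk r)"
    unfolding kk_def sum_distrib_left sum_negf by (subst sum.swap) (rule refl)
  finally show ?thesis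
    unfolding M1_def distrib_left sum.distrib by (simp only: sum_distrib_left diff_conv_add_uminus)
qed

text \<open>Moving \<open>kk t\<close> across \<open>D\<close> gives \<open>th b\<close> times the
  sum of \<open>g t q * kk q\<close>, and moving it across the annihilators \<open>y (b, r)\<close>
  gives the same sum; the two enter \<open>form_M1\<close> with opposite signs.\<close>

lemma kk_form:
  assumes t: "t \<in> {1..n}" and b: "b \<in> {1..d}"
  shows "kk t * (\<Sum>a\<in>{1..d}. th a * M1 a b) = (\<Sum>a\<in>{1..d}. th a * M1 a b) * kk t"
proof -
  have "kk t * (th a * uu a b) = th a * uu a b * kk t + (if a = b then th b * (\<Sum>q\<in>{1..n}. g t q * kk q) else 0)" for a
  proof -
    have "kk t * uu a b = uu a b * kk t + (if a = b then (\<Sum>q\<in>{1..n}. g t q * kk q) else 0)"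
      by (simp add: uu_def left_diff_distrib right_diff_distrib kk_D[OF t] sc_comm[of _ "kk t"])
    hence "th a * (kk t * uu a b) = th a * uu a b * kk t + (if a = b then th b * (\<Sum>q\<in>{1..n}. g t q * kk q) else 0)"
      by (simp add: distrib_left mult.assoc)
    thus ?thesis by (simp only: mult.assoc[symmetric] kk_th)
  qed
  hence 1: "kk t * (\<Sum>a\<in>{1..d}. th a * uu a b) = (\<Sum>a\<in>{1..d}. th a * uu a b) * kk t + th b * (\<Sum>q\<in>{1..n}. g t q * kk q)"
    unfolding sum_distrib_left[of "kk t"] sum_distrib_right using b by (simp add: sum.distrib sum.delta)
  have "kk t * (y (b, r) * kk r) = y (b, r) * kk r * kk t + th b * (g t r * kk r)" if r: "r \<in> {1..n}" for r
  proof -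
    have "kk t * (y (b, r) * kk r) = (kk t * y (b, r)) * kk r" by (simp only: mult.assoc)
    also have "\<dots> = y (b, r) * (kk t * kk r) + th b * (g t r * kk r)"
      unfolding kk_y[OF b r] by (simp only: distrib_right mult.assoc)
    finally show ?thesis by (simp only: kk_kk[of t r] mult.assoc)
  qed
  hence 2: "kk t * (\<Sum>r\<in>{1..n}. y (b, r) * kk r) = (\<Sum>r\<in>{1..n}. y (b, r) * kk r) * kk t + th b * (\<Sum>q\<in>{1..n}. g t q * kk q)"
    unfolding sum_distrib_left sum_distrib_right sum.distrib[symmetric] by (intro sum.cong refl)
  show ?thesis unfolding form_M1 left_diff_distrib right_diff_distrib 1 2 by simp
qed

text \<open>As \<open>kk r\<close> commutes with all later column forms, it can be carried to the
  far right. Its factors \<open>x\<close> and \<open>g\<close> then stand behind the inner value,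
  exactly as \<open>T1\<close> prescribes, while \<open>th a\<close> returns to the front.\<close>

lemma prod_form_M1:
  assumes "set bs \<subseteq> {1..d}"
  shows "prod_list (map (\<lambda>b. \<Sum>a\<in>{1..d}. th a * M1 a b) bs) = (\<Sum>as\<in>nlists d (length bs). gr as * app_list T1 as bs)"
  using assms
proof (induction bs)
  case (Cons b bs)
  let ?X = "prod_list (map (\<lambda>b. \<Sum>a\<in>{1..d}. th a * M1 a b) bs)"
  have b: "b \<in> {1..d}" using Cons.prems by simp
  have kX: "kk t * ?X = ?X * kk t" if "t \<in> {1..n}" for t
    using Cons.prems kk_form[OF that] by (intro commute_prod_list) auto
  have X: "?X = (\<Sum>as\<in>nlists d (length bs). gr as * app_list T1 as bs)" using Cons by simp
  have "(\<Sum>r\<in>{1..n}. y (b, r) * kk r) * ?X = (\<Sum>r\<in>{1..n}. y (b, r) * ?X * kk r)"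
    unfolding sum_distrib_right by (intro sum.cong refl) (simp only: mult.assoc kX)
  also have "\<dots> = (\<Sum>r\<in>{1..n}. \<Sum>a\<in>{1..d}. \<Sum>s\<in>{1..n}. \<Sum>as\<in>nlists d (length bs). y (b, r) * (gr as * app_list T1 as bs) * (th a * x (a, s) * g r s))"
    unfolding X kk_def sum_distrib_left sum_distrib_right by (rule refl)
  also have "\<dots> = (\<Sum>r\<in>{1..n}. \<Sum>a\<in>{1..d}. \<Sum>s\<in>{1..n}. \<Sum>as\<in>nlists d (length bs). - (th a * gr as * (y (b, r) * app_list T1 as bs * x (a, s) * g r s)))"
  proof (intro sum.cong refl)
    fix r a s as assume r: "r \<in> {1..n}"
    let ?Y = "app_list T1 as bs"
    have "y (b, r) * (gr as * ?Y) * (th a * x (a, s) * g r s) = y (b, r) * gr as * (?Y * th a) * (x (a, s) * g r s)"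
      by (simp only: mult.assoc)
    also have "\<dots> = (y (b, r) * gr as * th a) * (?Y * (x (a, s) * g r s))" by (simp only: app_T1_commute mult.assoc)
    also have "y (b, r) * gr as * th a = - (th a * gr as * y (b, r))" using r by (intro y_gr_th) auto
    finally show "y (b, r) * (gr as * ?Y) * (th a * x (a, s) * g r s) = - (th a * gr as * (y (b, r) * ?Y * x (a, s) * g r s))"
      by (simp add: mult.assoc)
  qed
  also have "\<dots> = (\<Sum>a\<in>{1..d}. \<Sum>r\<in>{1..n}. \<Sum>s\<in>{1..n}. \<Sum>as\<in>nlists d (length bs). - (th a * gr as * (y (b, r) * app_list T1 as bs * x (a, s) * g r s)))"
    by (rule sum.swap)
  also have "\<dots> = (\<Sum>a\<in>{1..d}. \<Sum>r\<in>{1..n}. \<Sum>as\<in>nlists d (length bs). \<Sum>s\<in>{1..n}. - (th a * gr as * (y (b, r) * app_list T1 as bs * x (a, s) * g r s)))"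
    by (intro sum.cong refl sum.swap)
  also have "\<dots> = (\<Sum>a\<in>{1..d}. \<Sum>as\<in>nlists d (length bs). \<Sum>r\<in>{1..n}. \<Sum>s\<in>{1..n}. - (th a * gr as * (y (b, r) * app_list T1 as bs * x (a, s) * g r s)))"
    by (intro sum.cong refl sum.swap)
  also have "\<dots> = - (\<Sum>a\<in>{1..d}. \<Sum>as\<in>nlists d (length bs). th a * gr as * (\<Sum>r\<in>{1..n}. \<Sum>s\<in>{1..n}. y (b, r) * app_list T1 as bs * x (a, s) * g r s))"
    by (simp only: sum_negf sum_distrib_left)
  finally have 2: "(\<Sum>r\<in>{1..n}. y (b, r) * kk r) * ?X = \<dots>" .
  have "(\<Sum>a\<in>{1..d}. th a * uu a b) * ?X = (\<Sum>a\<in>{1..d}. \<Sum>as\<in>nlists d (length bs). th a * gr as * (uu a b * app_list T1 as bs))"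
    unfolding X sum_product
  proof (intro sum.cong refl)
    fix a as
    have "uu a b * gr as = gr as * uu a b" by (intro commute_gr uu_th)
    thus "th a * uu a b * (gr as * app_list T1 as bs) = th a * gr as * (uu a b * app_list T1 as bs)"
      by (rule mult_four_comm)
  qed
  hence 1: "(\<Sum>a\<in>{1..d}. th a * uu a b) * ?X = (\<Sum>a\<in>{1..d}. \<Sum>as\<in>nlists d (length bs). th a * gr as * (uu a b * app_list T1 as bs))" .
  have "prod_list (map (\<lambda>b. \<Sum>a\<in>{1..d}. th a * M1 a b) (b # bs)) = (\<Sum>a\<in>{1..d}. th a * M1 a b) * ?X" by simp
  also have "\<dots> = (\<Sum>a\<in>{1..d}. th a * uu a b) * ?X - (\<Sum>r\<in>{1..n}. y (b, r) * kk r) * ?X"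
    by (simp only: left_diff_distrib[symmetric] form_M1[of b, symmetric])
  also have "\<dots> = (\<Sum>a\<in>{1..d}. \<Sum>as\<in>nlists d (length bs). th a * gr as * T1 a b (app_list T1 as bs))"
    unfolding 1 2 by (simp only: diff_minus_eq_add sum.distrib[symmetric] T1_def distrib_left)
  finally have "prod_list (map (\<lambda>b. \<Sum>a\<in>{1..d}. th a * M1 a b) (b # bs))
    = (\<Sum>a\<in>{1..d}. \<Sum>as\<in>nlists d (length bs). th a * gr as * T1 a b (app_list T1 as bs))" .
  thus ?case by (simp add: sum_nlists_Suc)
qed simp

text \<open>Two ways of writing the product of the column forms, compared at the top monomial. The
  identity holds for the alternating sums only; single summands differ.\<close>

theorem cdet_eq_app:
  "(\<Sum>\<sigma> | \<sigma> permutes {1..d}. of_int (sign \<sigma>) * prod_list (map (\<lambda>j. M1 (\<sigma> j) j) [1..<d+1]))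
   = (\<Sum>\<sigma> | \<sigma> permutes {1..d}. of_int (sign \<sigma>) * app_list T1 (map \<sigma> [1..<d+1]) [1..<d+1])" (is "?L = ?R")
proof -
  have th: "M1 a b * th k = th k * M1 a b" and y: "M1 a b * y (k, 0) = y (k, 0) * M1 a b" for a b k
    unfolding M1_T1 by (intro T1_commute; simp)+
  have m: "map2 M1 (map \<sigma> js) js = map (\<lambda>j. M1 (\<sigma> j) j) js" for \<sigma> js by (induction js) auto
  let ?G = "gr [1..<d+1]"
  have sub: "set [1..<d+1] \<subseteq> {1..d}" by auto
  have "?G * ?L = prod_list (map (\<lambda>b. \<Sum>a\<in>{1..d}. th a * M1 a b) [1..<d+1])"
    using prod_list_forms[of M1 d "[1..<d+1]", OF th] sum_nlists_gr[of "\<lambda>as. prod_list (map2 M1 as [1..<d+1])" d]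
    by (simp add: m del: upt_Suc)
  also have "\<dots> = ?G * ?R"
    using prod_form_M1[OF sub] sum_nlists_gr[of "\<lambda>as. app_list T1 as [1..<d+1]" d]
    by (simp del: upt_Suc)
  finally have "?G * (?L - ?R) = 0" by (simp add: right_diff_distrib)
  hence "?L - ?R = 0"
  proof (rule gr_cancel[rotated 2])
    have int: "c * of_int i = of_int i * c" for c :: 'r and i by (simp add: mult_of_int_commute)
    fix a
    have "th a * ?L = ?L * th a" "th a * ?R = ?R * th a"
      by (intro commute_sumI commute_multI int commute_prod_list; auto simp: th app_T1_commute)+
    thus "(?L - ?R) * th a = th a * (?L - ?R)" by (simp only: left_diff_distrib right_diff_distrib)
    have "y (a, 0) * ?L = ?L * y (a, 0)" "y (a, 0) * ?R = ?R * y (a, 0)"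
      by (intro commute_sumI commute_multI int commute_prod_list; auto simp: y app_T1_commute)+
    thus "(?L - ?R) * y (a, 0) = y (a, 0) * (?L - ?R)" by (simp only: left_diff_distrib right_diff_distrib)
  qed simp
  thus ?thesis by simp
qed

end

context duality
begin

definition ww :: "nat \<Rightarrow> nat \<Rightarrow> 'r" where "ww a b = (if a = b then z else 0) - sc (W a b)"

text \<open>The mirror image of \<open>T1\<close> when \<open>D\<close> and \<open>z\<close> are
  exchanged: the scalar part passes from the left to the right, the resolvent from the right to the
  left, and the odd generators stay in their order around \<open>Y\<close>.\<close>

definition T2 :: "nat \<Rightarrow> nat \<Rightarrow> 'r \<Rightarrow> 'r" where
  "T2 a b Y = Y * ww a b + (\<Sum>r\<in>{1..n}. \<Sum>s\<in>{1..n}. h r s * (y (b, r) * Y * x (a, s)))"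

lemma ww_th: "ww a b * th k = th k * ww a b" and ww_y: "ww a b * y u = y u * ww a b" and ww_x: "ww a b * x u = x u * ww a b"
  by (simp_all add: ww_def left_diff_distrib right_diff_distrib zx zy sc_comm)

lemma ww_ww: "ww a b * ww a' b' = ww a' b' * ww a b"
proof -
  have *: "ww a b * c = c * ww a b" if "z * c = c * z" for a b c
    by (simp add: ww_def left_diff_distrib right_diff_distrib that sc_comm[of _ c])
  show ?thesis by (intro * *[symmetric] refl)
qed

lemma T2_commute:
  "Y * th k = th k * Y \<Longrightarrow> T2 a b Y * th k = th k * T2 a b Y"
  "Y * y (k, 0) = y (k, 0) * Y \<Longrightarrow> T2 a b Y * y (k, 0) = y (k, 0) * T2 a b Y"
proof -
  assume Y: "Y * th k = th k * Y"
  have "th k * (h r s * (y (b, r) * Y * x (a, s))) = h r s * (y (b, r) * Y * x (a, s)) * th k" if "r \<in> {1..n}" "s \<in> {1..n}" for r s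
    using that by (intro commute_multI hx[symmetric] yx_conj_th(1)[OF _ _ Y, symmetric]) auto
  hence 1: "th k * (\<Sum>r\<in>{1..n}. \<Sum>s\<in>{1..n}. h r s * (y (b, r) * Y * x (a, s))) = (\<Sum>r\<in>{1..n}. \<Sum>s\<in>{1..n}. h r s * (y (b, r) * Y * x (a, s))) * th k"
    by (intro commute_sumI)
  have 2: "th k * (Y * ww a b) = Y * ww a b * th k" by (intro commute_multI Y[symmetric] ww_th[symmetric])
  show "T2 a b Y * th k = th k * T2 a b Y"
    unfolding T2_def distrib_left distrib_right 1 2 ..
next
  assume Y: "Y * y (k, 0) = y (k, 0) * Y"
  have "y (k, 0) * (h r s * (y (b, r) * Y * x (a, s))) = h r s * (y (b, r) * Y * x (a, s)) * y (k, 0)" if "r \<in> {1..n}" "s \<in> {1..n}" for r s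
    using that by (intro commute_multI hy[symmetric] yx_conj_th(2)[OF _ _ Y, symmetric]) auto
  hence 1: "y (k, 0) * (\<Sum>r\<in>{1..n}. \<Sum>s\<in>{1..n}. h r s * (y (b, r) * Y * x (a, s))) = (\<Sum>r\<in>{1..n}. \<Sum>s\<in>{1..n}. h r s * (y (b, r) * Y * x (a, s))) * y (k, 0)"
    by (intro commute_sumI)
  have 2: "y (k, 0) * (Y * ww a b) = Y * ww a b * y (k, 0)" by (intro commute_multI Y[symmetric] ww_y[symmetric])
  show "T2 a b Y * y (k, 0) = y (k, 0) * T2 a b Y"
    unfolding T2_def distrib_left distrib_right 1 2 ..
qed

lemma app_T2_commute:
  "app_list (\<lambda>i j. T2 j i) as bs * th k = th k * app_list (\<lambda>i j. T2 j i) as bs"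
  "app_list (\<lambda>i j. T2 j i) as bs * y (k, 0) = y (k, 0) * app_list (\<lambda>i j. T2 j i) as bs"
  by (induction as arbitrary: bs) (simp_all add: T2_commute)

text \<open>In the quadruple sum an exchange of the two operators swaps two annihilators on the left
  and two creators on the right, so the signs cancel; the mixed terms are simply
  interchanged.\<close>

lemma T2_T2: "T2 a b (T2 a' b' Y) = T2 a' b' (T2 a b Y)"
proof -
  have E: "T2 a b (T2 a' b' Y) = Y * (ww a' b' * ww a b)
     + (\<Sum>r\<in>{1..n}. \<Sum>s\<in>{1..n}. h r s * (y (b', r) * Y * x (a', s))) * ww a b
     + (\<Sum>r\<in>{1..n}. \<Sum>s\<in>{1..n}. h r s * (y (b, r) * Y * x (a, s))) * ww a' b'
     + (\<Sum>r\<in>{1..n}. \<Sum>s\<in>{1..n}. \<Sum>r'\<in>{1..n}. \<Sum>s'\<in>{1..n}.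
          h r s * h r' s' * (y (b, r) * y (b', r') * Y * x (a', s') * x (a, s)))" for a b a' b'
  proof -
    have 1: "h r s * (y (b, r) * (Y * ww a' b') * x (a, s)) = h r s * (y (b, r) * Y * x (a, s)) * ww a' b'" for r s
      by (simp only: mult.assoc ww_x)
    have 2: "h r s * (y (b, r) * (h r' s' * c) * x') = h r s * h r' s' * (y (b, r) * c * x')" for r s r' s' c x'
      by (simp only: mult.assoc[symmetric]) (simp only: mult.assoc hy[symmetric])
    have "(\<Sum>r\<in>{1..n}. \<Sum>s\<in>{1..n}. h r s * (y (b, r) * T2 a' b' Y * x (a, s)))
      = (\<Sum>r\<in>{1..n}. \<Sum>s\<in>{1..n}. h r s * (y (b, r) * Y * x (a, s))) * ww a' b'
       + (\<Sum>r\<in>{1..n}. \<Sum>s\<in>{1..n}. \<Sum>r'\<in>{1..n}. \<Sum>s'\<in>{1..n}.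
          h r s * h r' s' * (y (b, r) * (y (b', r') * Y * x (a', s')) * x (a, s)))"
      unfolding T2_def distrib_left distrib_right sum.distrib 1 sum_distrib_left sum_distrib_right 2 ..
    thus ?thesis unfolding T2_def[of a b] by (simp add: T2_def distrib_right mult.assoc add_ac)
  qed
  have S: "(\<Sum>r\<in>{1..n}. \<Sum>s\<in>{1..n}. \<Sum>r'\<in>{1..n}. \<Sum>s'\<in>{1..n}. F r s r' s')
    = (\<Sum>r\<in>{1..n}. \<Sum>s\<in>{1..n}. \<Sum>r'\<in>{1..n}. \<Sum>s'\<in>{1..n}. F r' s' r s)" for F :: "nat \<Rightarrow> nat \<Rightarrow> nat \<Rightarrow> nat \<Rightarrow> 'r"
    unfolding sum.cartesian_product
    by (rule sum.reindex_bij_witness[of _ "\<lambda>(r, s, r', s'). (r', s', r, s)" "\<lambda>(r, s, r', s'). (r', s', r, s)"]) auto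
  have Q: "h r s * h r' s' * (y (b, r) * y (b', r') * Y * x (a', s') * x (a, s))
     = h r' s' * h r s * (y (b', r') * y (b, r) * Y * x (a, s) * x (a', s'))" for r s r' s'
  proof -
    have "y (b, r) * y (b', r') * Y * x (a', s') * x (a, s) = (y (b, r) * y (b', r')) * Y * (x (a', s') * x (a, s))"
      by (simp only: mult.assoc)
    also have "\<dots> = y (b', r') * y (b, r) * Y * x (a, s) * x (a', s')"
      by (simp add: yy[of "(b, r)"] xx[of "(a', s')"] mult.assoc)
    finally show ?thesis by (simp only: hh[of r s r' s'])
  qed
  show ?thesis
    unfolding E[of a b a' b'] E[of a' b' a b] ww_ww[of a' b' a b]
    by (subst S) (simp only: Q add_ac)
qed

text \<open>Here the product grows on the right, so the factor \<open>kap s\<close> of the new row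
  is carried to the left across the earlier rows. The new \<open>y\<close> and \<open>x\<close> thus
  enclose the earlier value, which forces the reversed lists.\<close>

lemma prod_form_NN:
  assumes "set js \<subseteq> {1..d}"
  shows "prod_list (map (\<lambda>j. \<Sum>i\<in>{1..d}. th i * NN j i) (rev js))
    = (\<Sum>as\<in>nlists d (length js). gr (rev as) * app_list (\<lambda>i j. T2 j i) as js)"
  using assms
proof (induction js)
  case (Cons j js)
  let ?X = "prod_list (map (\<lambda>j. \<Sum>i\<in>{1..d}. th i * NN j i) (rev js))"
  let ?Y = "\<lambda>as. app_list (\<lambda>i j. T2 j i) as js"
  have j: "j \<in> {1..d}" using Cons.prems by simp
  have chi: "(\<Sum>i\<in>{1..d}. th i * NN j i) = (\<Sum>i\<in>{1..d}. th i * ww j i) + (\<Sum>s\<in>{1..n}. kap s * x (j, s))"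
    if "j \<in> {1..d}" for j
  proof -
    have "(\<Sum>i\<in>{1..d}. th i * NN j i) = - psi n j" by (simp add: psi_NN[OF that] sum_negf)
    also have "\<dots> = - psi 0 j + (\<Sum>s\<in>{1..n}. kap s * x (j, s))" by (simp add: psi_def)
    also have "- psi 0 j = (\<Sum>i\<in>{1..d}. th i * ww j i)"
      unfolding psi_0[OF that] sum_negf[symmetric] by (intro sum.cong refl) (auto simp: ww_def algebra_simps)
    finally show ?thesis .
  qed
  have kX: "kap t * ?X = ?X * kap t" if "t \<in> {1..n}" for t
  proof -
    have "kap t * (\<Sum>i\<in>{1..d}. th i * NN j i) = (\<Sum>i\<in>{1..d}. th i * NN j i) * kap t" if "j \<in> {1..d}" for j
      using kap_psi[OF \<open>t \<in> {1..n}\<close> order_refl that] by (simp add: psi_NN[OF that] sum_negf)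
    thus ?thesis using Cons.prems by (intro commute_prod_list) auto
  qed
  have X: "?X = (\<Sum>as\<in>nlists d (length js). gr (rev as) * ?Y as)" using Cons by simp
  have "?X * (\<Sum>i\<in>{1..d}. th i * ww j i) = (\<Sum>as\<in>nlists d (length js). \<Sum>i\<in>{1..d}. gr (rev (i # as)) * (?Y as * ww j i))"
    unfolding X sum_product
    by (intro sum.cong refl) (simp only: mult_four_comm[OF app_T2_commute(1)] rev.simps gr_append gr_Cons gr_Nil mult_1_right)
  also have "\<dots> = (\<Sum>i\<in>{1..d}. \<Sum>as\<in>nlists d (length js). gr (rev (i # as)) * (?Y as * ww j i))" by (rule sum.swap)
  finally have 1: "?X * (\<Sum>i\<in>{1..d}. th i * ww j i) = \<dots>" .
  have "?X * (\<Sum>s\<in>{1..n}. kap s * x (j, s)) = (\<Sum>s\<in>{1..n}. kap s * ?X * x (j, s))"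
    unfolding sum_distrib_left by (intro sum.cong refl) (simp only: kX mult.assoc[symmetric])
  also have "\<dots> = (\<Sum>s\<in>{1..n}. \<Sum>as\<in>nlists d (length js). \<Sum>i\<in>{1..d}. \<Sum>r\<in>{1..n}.
      th i * y (i, r) * h r s * (gr (rev as) * ?Y as) * x (j, s))"
    unfolding X kap_def sum_distrib_left sum_distrib_right by (rule refl)
  also have "\<dots> = (\<Sum>s\<in>{1..n}. \<Sum>as\<in>nlists d (length js). \<Sum>i\<in>{1..d}. \<Sum>r\<in>{1..n}.
      gr (rev (i # as)) * (h r s * (y (i, r) * ?Y as * x (j, s))))"
  proof (intro sum.cong refl)
    fix s i r as assume r: "r \<in> {1..n}"
    let ?g = "gr (rev as)"
    have hg: "h r s * ?g = ?g * h r s" by (intro commute_gr hx)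
    have "th i * (y (i, r) * ?g) = (th i * ?g) * ((-1) ^ length as * y (i, r))"
      using r by (cases "even (length as)") (simp_all add: gr_y mult.assoc)
    also have "th i * ?g = (-1) ^ length as * (?g * th i)" by (simp add: gr_x)
    finally have "th i * (y (i, r) * ?g) = ?g * th i * y (i, r)" by (cases "even (length as)") simp_all
    hence *: "th i * y (i, r) * ?g = ?g * th i * y (i, r)" by (simp only: mult.assoc)
    have "th i * y (i, r) * h r s * (?g * ?Y as) * x (j, s) = th i * y (i, r) * (h r s * ?g) * ?Y as * x (j, s)"
      by (simp only: mult.assoc)
    also have "\<dots> = (th i * y (i, r) * ?g) * (h r s * ?Y as * x (j, s))" by (simp only: hg mult.assoc)
    also have "\<dots> = ?g * th i * (y (i, r) * h r s * ?Y as * x (j, s))" unfolding * by (simp only: mult.assoc)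
    also have "y (i, r) * h r s = h r s * y (i, r)" by (simp only: hy)
    finally show "th i * y (i, r) * h r s * (?g * ?Y as) * x (j, s) = gr (rev (i # as)) * (h r s * (y (i, r) * ?Y as * x (j, s)))"
      by (simp add: mult.assoc)
  qed
  also have "\<dots> = (\<Sum>s\<in>{1..n}. \<Sum>i\<in>{1..d}. \<Sum>as\<in>nlists d (length js). \<Sum>r\<in>{1..n}.
      gr (rev (i # as)) * (h r s * (y (i, r) * ?Y as * x (j, s))))"
    by (intro sum.cong refl sum.swap)
  also have "\<dots> = (\<Sum>i\<in>{1..d}. \<Sum>s\<in>{1..n}. \<Sum>as\<in>nlists d (length js). \<Sum>r\<in>{1..n}.
      gr (rev (i # as)) * (h r s * (y (i, r) * ?Y as * x (j, s))))"
    by (rule sum.swap)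
  also have "\<dots> = (\<Sum>i\<in>{1..d}. \<Sum>as\<in>nlists d (length js). \<Sum>s\<in>{1..n}. \<Sum>r\<in>{1..n}.
      gr (rev (i # as)) * (h r s * (y (i, r) * ?Y as * x (j, s))))"
    by (intro sum.cong refl sum.swap)
  also have "\<dots> = (\<Sum>i\<in>{1..d}. \<Sum>as\<in>nlists d (length js). gr (rev (i # as)) * (\<Sum>r\<in>{1..n}. \<Sum>s\<in>{1..n}.
      h r s * (y (i, r) * ?Y as * x (j, s))))"
    unfolding sum_distrib_left by (intro sum.cong refl sum.swap)
  finally have 2: "?X * (\<Sum>s\<in>{1..n}. kap s * x (j, s)) = \<dots>" .
  have "prod_list (map (\<lambda>j. \<Sum>i\<in>{1..d}. th i * NN j i) (rev (j # js))) = ?X * (\<Sum>i\<in>{1..d}. th i * NN j i)" by simp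
  also have "\<dots> = (\<Sum>i\<in>{1..d}. \<Sum>as\<in>nlists d (length js). gr (rev (i # as)) * T2 j i (?Y as))"
    unfolding chi[OF j] distrib_left 1 2 by (simp only: sum.distrib[symmetric] T2_def distrib_left)
  finally show ?case by (simp only: list.size add_0_right add_Suc_right sum_nlists_Suc app_list.simps list.sel)
qed simp

theorem rdet_eq_app:
  "(\<Sum>\<sigma> | \<sigma> permutes {1..d}. of_int (sign \<sigma>) * prod_list (map (\<lambda>j. NN j (\<sigma> j)) [1..<d+1]))
   = (\<Sum>\<sigma> | \<sigma> permutes {1..d}. of_int (sign \<sigma>) * app_list (\<lambda>i j. T2 j i) (rev (map \<sigma> [1..<d+1])) (rev [1..<d+1]))" (is "?L = ?R")
proof -
  have m: "map2 (\<lambda>i j. NN j i) (map \<sigma> js) js = map (\<lambda>j. NN j (\<sigma> j)) js" for \<sigma> js by (induction js) auto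
  let ?G = "gr [1..<d+1]"
  let ?F = "\<lambda>as. app_list (\<lambda>i j. T2 j i) as (rev [1..<d+1])"
  have sub: "set (rev [1..<d+1]) \<subseteq> {1..d}" by auto
  have "?G * ?L = prod_list (map (\<lambda>j. \<Sum>i\<in>{1..d}. th i * NN j i) [1..<d+1])"
    using prod_list_forms[of "\<lambda>i j. NN j i" d "[1..<d+1]", OF NN_th] sum_nlists_gr[of "\<lambda>as. prod_list (map2 (\<lambda>i j. NN j i) as [1..<d+1])" d]
    by (simp add: m del: upt_Suc)
  also have "\<dots> = (\<Sum>as\<in>nlists d d. gr (rev as) * ?F as)"
    using prod_form_NN[OF sub] by (simp del: upt_Suc)
  also have "\<dots> = (\<Sum>as\<in>nlists d d. gr as * ?F (rev as))"
    by (rule sum.reindex_bij_witness[of _ rev rev]) (auto simp: nlists_def)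
  also have "\<dots> = ?G * ?R" by (rule sum_nlists_gr)
  finally have "?G * (?L - ?R) = 0" by (simp add: right_diff_distrib)
  hence "?L - ?R = 0"
  proof (rule gr_cancel[rotated 2])
    have int: "c * of_int i = of_int i * c" for c :: 'r and i by (simp add: mult_of_int_commute)
    fix a
    have "th a * ?L = ?L * th a" "th a * ?R = ?R * th a"
      by (intro commute_sumI commute_multI int commute_prod_list; auto simp: NN_th app_T2_commute)+
    thus "(?L - ?R) * th a = th a * (?L - ?R)" by (simp only: left_diff_distrib right_diff_distrib)
    have "y (a, 0) * ?L = ?L * y (a, 0)" "y (a, 0) * ?R = ?R * y (a, 0)"
      by (intro commute_sumI commute_multI int commute_prod_list; auto simp: NN_y app_T2_commute)+
    thus "(?L - ?R) * y (a, 0) = y (a, 0) * (?L - ?R)" by (simp only: left_diff_distrib right_diff_distrib)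
  qed simp
  thus ?thesis by simp
qed

end

section \<open>From the column determinant to the row determinant\<close>

lemma app_list_foldr:
  "length as = length bs \<Longrightarrow> app_list T as bs = foldr (\<lambda>(a, b). T a b) (zip as bs) 1"
  by (induction as bs rule: list_induct2) auto

text \<open>The pairs \<open>(\<sigma> j, j)\<close> and the pairs of \<open>j\<close> with its
  preimage form the same set, and the order of application is immaterial for commuting
  operators.\<close>

lemma app_list_inverse:
  assumes comm: "\<And>a b a' b' Y. T a b (T a' b' Y) = T a' b' (T a b Y)" and s: "\<sigma> permutes {1..d}"
  shows "app_list (\<lambda>i j. T j i) (rev (map (Hilbert_Choice.inv \<sigma>) [1..<d+1])) (rev [1..<d+1])
    = app_list T (map \<sigma> [1..<d+1]) [1..<d+1]"
proof -
  let ?J = "[1..<d+1]" and ?i = "Hilbert_Choice.inv \<sigma>" and ?f = "\<lambda>(a, b). T a b"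
  let ?ps = "map (\<lambda>j. (\<sigma> j, j)) ?J" and ?qs = "map (\<lambda>j. (j, ?i j)) ?J"
  have J: "set ?J = {1..d}" by auto
  have z: "zip (map \<sigma> js) js = map (\<lambda>j. (\<sigma> j, j)) js" for js :: "nat list" by (induction js) auto
  have 1: "app_list T (map \<sigma> ?J) ?J = foldr ?f ?ps 1"
    by (simp add: app_list_foldr z del: upt_Suc)
  have "foldr (\<lambda>(a, b). T b a) (zip (rev (map ?i js)) (rev js)) c = foldr ?f (rev (map (\<lambda>j. (j, ?i j)) js)) c" for js c
  proof (induction js arbitrary: c)
    case (Cons j js)
    have "zip (rev (map ?i (j # js))) (rev (j # js)) = zip (rev (map ?i js)) (rev js) @ [(?i j, j)]" by simp
    thus ?case using Cons by (simp only: foldr_append) simp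
  qed simp
  hence 2: "app_list (\<lambda>i j. T j i) (rev (map ?i ?J)) (rev ?J) = fold ?f ?qs 1"
    by (simp only: app_list_foldr length_rev length_map foldr_conv_fold rev_rev_ident)
  have bij: "\<sigma> (?i j) = j" "?i (\<sigma> j) = j" for j
    using s by (simp_all add: permutes_inverses)
  have "set ?ps = set ?qs"
  proof (intro equalityI subsetI)
    fix p assume "p \<in> set ?ps"
    then obtain j where j: "j \<in> {1..d}" "p = (\<sigma> j, j)" using J by auto
    hence "\<sigma> j \<in> {1..d}" using permutes_in_image[OF s] by blast
    thus "p \<in> set ?qs" using j J by (auto simp: bij image_iff)
  next
    fix p assume "p \<in> set ?qs"
    then obtain j where j: "j \<in> {1..d}" "p = (j, ?i j)" using J by auto
    hence "?i j \<in> {1..d}" using permutes_in_image[OF permutes_inv[OF s]] by blast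
    thus "p \<in> set ?ps" using j J by (auto simp: bij image_iff)
  qed
  moreover have "distinct ?ps" "distinct ?qs" by (auto simp: distinct_map inj_on_def)
  ultimately have "mset ?qs = mset (rev ?ps)" by (simp only: mset_rev) (simp only: set_eq_iff_mset_eq_distinct)
  moreover have "?f p \<circ> ?f q = ?f q \<circ> ?f p" for p q
    by (cases p; cases q) (simp add: fun_eq_iff comm)
  ultimately have "fold ?f ?qs = fold ?f (rev ?ps)" by (intro fold_multiset_equiv) auto
  thus ?thesis by (simp only: 1 2 foldr_conv_fold)
qed

text \<open>No multiplicativity of \<open>om\<close> is assumed in general. The rules are the ones
  that carry \<open>T1\<close> to \<open>T2\<close>: a scalar factor on the left and a resolvent on
  the right change sides, the odd generators do not.\<close>

locale gaudin_pair = duality x y z D sc d n W Z h + column_det x y z D sc d n W g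
  for x y :: "nat \<times> nat \<Rightarrow> 'r::ring_1" and z D :: 'r and sc :: "complex \<Rightarrow> 'r"
    and d n :: nat and W Z :: "nat \<Rightarrow> nat \<Rightarrow> complex" and h g :: "nat \<Rightarrow> nat \<Rightarrow> 'r" +
  fixes om :: "'r \<Rightarrow> 'r"
  assumes om_add: "om (a + b) = om a + om b" and om_1: "om 1 = 1"
    and om_D: "om (D * a) = om a * z" and om_sc: "om (sc c * a) = sc c * om a"
    and om_g: "r \<in> {1..n} \<Longrightarrow> s \<in> {1..n} \<Longrightarrow> om (y u * a * x v * g r s) = h r s * (y u * om a * x v)"
begin

lemma om_0: "om 0 = 0" and om_minus: "om (- a) = - om a" and om_diff: "om (a - b) = om a - om b"
proof -
  show 0: "om 0 = 0" using om_add[of 0 0] by simp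
  have m: "om (- a) = - om a" for a using om_add[of a "- a"] 0 by (simp add: eq_neg_iff_add_eq_0 add.commute)
  show "om (- a) = - om a" by (rule m)
  show "om (a - b) = om a - om b" using om_add[of a "- b"] m[of b] by simp
qed

lemma om_sum: "om (sum f A) = (\<Sum>i\<in>A. om (f i))"
  by (induction A rule: infinite_finite_induct) (simp_all add: om_0 om_add)

lemma om_T1: "om (T1 a b Y) = T2 a b (om Y)"
proof -
  have "om (uu a b * Y) = om Y * ww a b"
    using sc_comm[of "W a b" "om Y"]
    by (simp add: uu_def ww_def left_diff_distrib right_diff_distrib om_diff om_D om_sc om_0)
  moreover have "om (\<Sum>r\<in>{1..n}. \<Sum>s\<in>{1..n}. y (b, r) * Y * x (a, s) * g r s)
    = (\<Sum>r\<in>{1..n}. \<Sum>s\<in>{1..n}. h r s * (y (b, r) * om Y * x (a, s)))"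
    unfolding om_sum by (intro sum.cong refl om_g)
  ultimately show ?thesis by (simp only: T1_def T2_def om_add)
qed

lemma om_app: "om (app_list T1 as bs) = app_list T2 as bs"
  by (induction as arbitrary: bs) (simp_all add: om_1 om_T1)

text \<open>Between the nested forms, \<open>om\<close> replaces \<open>T1\<close> by
  \<open>T2\<close>. Commutation of the \<open>T2\<close> turns the column reading for
  \<open>\<sigma>\<close> into the row reading for its inverse, which has the same sign.\<close>

theorem om_cdet:
  "om (\<Sum>\<sigma> | \<sigma> permutes {1..d}. of_int (sign \<sigma>) * prod_list (map (\<lambda>j. M1 (\<sigma> j) j) [1..<d+1]))
    = (\<Sum>\<sigma> | \<sigma> permutes {1..d}. of_int (sign \<sigma>) * prod_list (map (\<lambda>j. NN j (\<sigma> j)) [1..<d+1]))"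
proof -
  have "of_int (sign \<sigma>) = (1 :: 'r) \<or> of_int (sign \<sigma>) = (- 1 :: 'r)" for \<sigma> :: "nat \<Rightarrow> nat"
    by (cases \<sigma> rule: sign_cases) auto
  hence sg: "om (of_int (sign \<sigma>) * a) = of_int (sign \<sigma>) * om a" for \<sigma> :: "nat \<Rightarrow> nat" and a
    by (metis mult_1 mult_minus1 om_minus)
  let ?J = "[1..<d+1]"
  let ?F = "\<lambda>\<sigma>. of_int (sign \<sigma>) * app_list (\<lambda>i j. T2 j i) (rev (map \<sigma> ?J)) (rev ?J)"
  have "om (\<Sum>\<sigma> | \<sigma> permutes {1..d}. of_int (sign \<sigma>) * prod_list (map (\<lambda>j. M1 (\<sigma> j) j) ?J))
      = (\<Sum>\<sigma> | \<sigma> permutes {1..d}. of_int (sign \<sigma>) * app_list T2 (map \<sigma> ?J) ?J)"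
    unfolding cdet_eq_app om_sum sg om_app ..
  also have "\<dots> = (\<Sum>\<sigma> | \<sigma> permutes {1..d}. ?F (Hilbert_Choice.inv \<sigma>))"
  proof (intro sum.cong refl)
    fix \<sigma> assume "\<sigma> \<in> {\<sigma>. \<sigma> permutes {1..d}}"
    hence s: "\<sigma> permutes {1..d}" by simp
    have "permutation \<sigma>" using s finite_atLeastAtMost by (auto simp: permutation_permutes)
    hence "sign (Hilbert_Choice.inv \<sigma>) = sign \<sigma>" by (rule sign_inverse)
    thus "of_int (sign \<sigma>) * app_list T2 (map \<sigma> ?J) ?J = ?F (Hilbert_Choice.inv \<sigma>)"
      using app_list_inverse[of T2, OF T2_T2 s] by (simp only:)
  qed
  also have "\<dots> = (\<Sum>\<sigma> | \<sigma> permutes {1..d}. ?F \<sigma>)"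
    by (rule sum_permutations_inverse[symmetric])
  finally show ?thesis by (simp only: rdet_eq_app)
qed

end

section \<open>Pseudo-differential operators over a ring type\<close>

text \<open>A complex algebra as a ring type. Scalars sit inside it through the central embedding
  \<open>cs\<close>, so scalar multiplication is ordinary multiplication and all ring lemmas of the
  type class apply.\<close>

class calg = ring_1 +
  fixes cs :: "complex \<Rightarrow> 'a"
  assumes cs_add: "cs (a + b) = cs a + cs b" and cs_mult: "cs (a * b) = cs a * cs b"
    and cs_1: "cs 1 = 1" and cs_comm: "cs a * x = x * cs a"
begin

lemma cs_0 [simp]: "cs 0 = 0"
  using cs_add[of 0 0] by simp

lemma cs_left_comm: "x * (cs a * y) = cs a * (x * y)"
  by (metis cs_comm mult.assoc)

lemma cs_sum: "cs (sum f A) = (\<Sum>i\<in>A. cs (f i))"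
  by (induction A rule: infinite_finite_induct) (simp_all add: cs_add)

end

text \<open>The coefficient of \<open>z^(i-k) \<partial>^(j-k)\<close> when
  \<open>\<partial>^j\<close> is moved to the right of \<open>z^i\<close>.\<close>

definition pc :: "nat \<Rightarrow> int \<Rightarrow> int \<Rightarrow> complex" where
  "pc k j i = (of_int j gchoose k) * (\<Prod>s<k. of_int i - of_nat s)"

lemma pc_gbinomial: "pc k j i = fact k * (of_int j gchoose k) * (of_int i gchoose k)"
  by (simp add: pc_def gbinomial_prod_rev atLeast0LessThan)

text \<open>This symmetry makes the exchange of the two exponents reverse products of series with
  commuting coefficients; see \<open>om_mult\<close>.\<close>

lemma pc_sym: "pc k j i = pc k i j"
  by (simp add: pc_gbinomial)

lemma pc_0 [simp]: "pc 0 j i = 1"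
  by (simp add: pc_def)

lemma pc_left_0: "k > 0 \<Longrightarrow> pc k 0 i = 0" and pc_right_0: "k > 0 \<Longrightarrow> pc k j 0 = 0"
  by (auto simp: pc_gbinomial gr0_conv_Suc)

lemma sum_triangle_swap: "(\<Sum>k\<le>m. \<Sum>q\<le>m - k. F k q) = (\<Sum>q\<le>m. \<Sum>k\<le>m - q. F k q)" for m :: nat
proof -
  have "(\<Sum>(k, q)\<in>(SIGMA k:{..m}. {..m - k}). F k q) = (\<Sum>(q, k)\<in>(SIGMA q:{..m}. {..m - q}). F k q)"
    by (rule sum.reindex_bij_witness[of _ "\<lambda>(a, b). (b, a)" "\<lambda>(a, b). (b, a)"]) auto
  thus ?thesis by (simp add: sum.Sigma)
qed

text \<open>Both sides are expanded by the Vandermonde convolution, on the left in the exponents of the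
  derivation and on the right in those of the variable.\<close>

lemma pc_assoc:
  "(\<Sum>k\<le>m. pc k j1 i2 * pc (m - k) (j1 + j2 - int k) i3) = (\<Sum>k\<le>m. pc k j2 i3 * pc (m - k) j1 (i2 + i3 - int k))"
proof -
  let ?a = "of_int j1 :: complex" and ?b = "of_int i2 :: complex" and ?c = "of_int j2 :: complex" and ?e = "of_int i3 :: complex"
  \<comment> \<open>The number of ways to contract \<open>m\<close> pairs in a product of three
    monomials: \<open>k\<close> between \<open>\<partial>^j1\<close> and \<open>z^i2\<close>,
    \<open>q\<close> between \<open>\<partial>^j2\<close> and \<open>z^i3\<close>, and the other
    \<open>m - k - q\<close> between \<open>\<partial>^j1\<close> and \<open>z^i3\<close>. Both
    bracketings count these.\<close>
  define H where "H k q = fact (m - k) * fact (m - q) / fact (m - k - q) * (?b gchoose k) * (?e gchoose (m - k)) * (?a gchoose (m - q)) * (?c gchoose q)" for k q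
  have L: "pc k j1 i2 * pc (m - k) (j1 + j2 - int k) i3 = (\<Sum>q\<le>m - k. H k q)" if k: "k \<le> m" for k
  proof -
    have "(of_int (j1 + j2 - int k) gchoose (m - k) :: complex) = (\<Sum>q\<le>m - k. (?c gchoose q) * ((?a - of_nat k) gchoose (m - k - q)))"
      using gbinomial_Vandermonde[of ?c "?a - of_nat k" "m - k"] by (simp add: algebra_simps atLeast0AtMost)
    hence "pc k j1 i2 * pc (m - k) (j1 + j2 - int k) i3
       = (\<Sum>q\<le>m - k. fact k * (?a gchoose k) * (?b gchoose k) * (fact (m - k) * ((?c gchoose q) * ((?a - of_nat k) gchoose (m - k - q))) * (?e gchoose (m - k))))"
      by (simp only: pc_gbinomial sum_distrib_left sum_distrib_right)
    also have "\<dots> = (\<Sum>q\<le>m - k. H k q)"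
    proof (intro sum.cong refl)
      fix q assume q: "q \<in> {..m - k}"
      have 1: "(?a gchoose k) * ((?a - of_nat k) gchoose (m - k - q)) = (?a gchoose (m - q)) * of_nat ((m - q) choose k)"
      proof -
        have e: "m - q - k = m - k - q" "k \<le> m - q" using q k by auto
        show ?thesis unfolding binomial_gbinomial e(1)[symmetric] by (rule gbinomial_trinomial_revision[OF e(2), symmetric])
      qed
      have 2: "fact k * (of_nat ((m - q) choose k) :: complex) = fact (m - q) / fact (m - k - q)"
      proof -
        have e: "m - q - k = m - k - q" "k \<le> m - q" using q k by auto
        show ?thesis unfolding e(1)[symmetric] using e(2) by (simp add: binomial_fact)
      qed
      have "fact k * (?a gchoose k) * (?b gchoose k) * (fact (m - k) * ((?c gchoose q) * ((?a - of_nat k) gchoose (m - k - q))) * (?e gchoose (m - k)))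
        = fact k * ((?a gchoose k) * ((?a - of_nat k) gchoose (m - k - q))) * ((?b gchoose k) * fact (m - k) * (?c gchoose q) * (?e gchoose (m - k)))"
        by (simp only: mult_ac)
      also have "\<dots> = (fact k * of_nat ((m - q) choose k)) * ((?a gchoose (m - q)) * (?b gchoose k) * fact (m - k) * (?c gchoose q) * (?e gchoose (m - k)))"
        unfolding 1 by (simp only: mult_ac)
      finally show "fact k * (?a gchoose k) * (?b gchoose k) * (fact (m - k) * ((?c gchoose q) * ((?a - of_nat k) gchoose (m - k - q))) * (?e gchoose (m - k))) = H k q"
        unfolding 2 H_def by (simp add: mult_ac)
    qed
    finally show ?thesis .
  qed
  have R: "pc q j2 i3 * pc (m - q) j1 (i2 + i3 - int q) = (\<Sum>k\<le>m - q. H k q)" if q: "q \<le> m" for q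
  proof -
    have "(of_int (i2 + i3 - int q) gchoose (m - q) :: complex) = (\<Sum>k\<le>m - q. (?b gchoose k) * ((?e - of_nat q) gchoose (m - q - k)))"
      using gbinomial_Vandermonde[of ?b "?e - of_nat q" "m - q"] by (simp add: algebra_simps atLeast0AtMost)
    hence "pc q j2 i3 * pc (m - q) j1 (i2 + i3 - int q)
       = (\<Sum>k\<le>m - q. fact q * (?c gchoose q) * (?e gchoose q) * (fact (m - q) * (?a gchoose (m - q)) * ((?b gchoose k) * ((?e - of_nat q) gchoose (m - q - k)))))"
      by (simp only: pc_gbinomial sum_distrib_left sum_distrib_right)
    also have "\<dots> = (\<Sum>k\<le>m - q. H k q)"
    proof (intro sum.cong refl)
      fix k assume k: "k \<in> {..m - q}"
      have 1: "(?e gchoose q) * ((?e - of_nat q) gchoose (m - q - k)) = (?e gchoose (m - k)) * of_nat ((m - k) choose q)"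
      proof -
        have e: "m - k - q = m - q - k" "q \<le> m - k" using q k by auto
        show ?thesis unfolding binomial_gbinomial e(1)[symmetric] by (rule gbinomial_trinomial_revision[OF e(2), symmetric])
      qed
      have 2: "fact q * (of_nat ((m - k) choose q) :: complex) = fact (m - k) / fact (m - k - q)"
      proof -
        have "q \<le> m - k" using q k by auto
        thus ?thesis by (simp add: binomial_fact)
      qed
      have "fact q * (?c gchoose q) * (?e gchoose q) * (fact (m - q) * (?a gchoose (m - q)) * ((?b gchoose k) * ((?e - of_nat q) gchoose (m - q - k))))
        = fact q * ((?e gchoose q) * ((?e - of_nat q) gchoose (m - q - k))) * ((?c gchoose q) * fact (m - q) * (?a gchoose (m - q)) * (?b gchoose k))"
        by (simp only: mult_ac)
      also have "\<dots> = (fact q * of_nat ((m - k) choose q)) * ((?e gchoose (m - k)) * (?c gchoose q) * fact (m - q) * (?a gchoose (m - q)) * (?b gchoose k))"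
        unfolding 1 by (simp only: mult_ac)
      finally show "fact q * (?c gchoose q) * (?e gchoose q) * (fact (m - q) * (?a gchoose (m - q)) * ((?b gchoose k) * ((?e - of_nat q) gchoose (m - q - k)))) = H k q"
        unfolding 2 H_def by (simp add: mult_ac)
    qed
    finally show ?thesis .
  qed
  have "(\<Sum>k\<le>m. pc k j1 i2 * pc (m - k) (j1 + j2 - int k) i3) = (\<Sum>k\<le>m. \<Sum>q\<le>m - k. H k q)"
    by (intro sum.cong refl) (simp add: L)
  also have "\<dots> = (\<Sum>q\<le>m. \<Sum>k\<le>m - q. H k q)" by (rule sum_triangle_swap)
  also have "\<dots> = (\<Sum>k\<le>m. pc k j2 i3 * pc (m - k) j1 (i2 + i3 - int k))"
    by (intro sum.cong refl) (simp add: R)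
  finally show ?thesis .
qed

section \<open>Series with exponents bounded above, and their product\<close>

definition bnd :: "int \<Rightarrow> (int \<Rightarrow> int \<Rightarrow> 'a::zero) \<Rightarrow> bool" where
  "bnd R f \<longleftrightarrow> (\<forall>i j. f i j \<noteq> 0 \<longrightarrow> i \<le> R \<and> j \<le> R)"

lemma bndD: "bnd R f \<Longrightarrow> R < i \<or> R < j \<Longrightarrow> f i j = 0"
  unfolding bnd_def by force

lemma bnd_mono: "bnd R f \<Longrightarrow> R \<le> R' \<Longrightarrow> bnd R' f"
  unfolding bnd_def by (meson order_trans)

definition pidx :: "(int \<Rightarrow> int \<Rightarrow> 'a::zero) \<Rightarrow> (int \<Rightarrow> int \<Rightarrow> 'a) \<Rightarrow> int \<Rightarrow> int \<Rightarrow> (int \<times> int \<times> int \<times> int \<times> nat) set" where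
  "pidx f g i j = {(i1, j1, i2, j2, k). f i1 j1 \<noteq> 0 \<and> g i2 j2 \<noteq> 0 \<and> i1 + i2 = i + int k \<and> j1 + j2 = j + int k}"

definition pmul :: "(int \<Rightarrow> int \<Rightarrow> 'a::calg) \<Rightarrow> (int \<Rightarrow> int \<Rightarrow> 'a) \<Rightarrow> int \<Rightarrow> int \<Rightarrow> 'a" where
  "pmul f g i j = (\<Sum>(i1, j1, i2, j2, k)\<in>pidx f g i j. cs (pc k j1 i2) * (f i1 j1 * g i2 j2))"

text \<open>The exponents of one factor together with \<open>k\<close> determine those of the other,
  and the upper bound of either factor bounds the other from below. A coefficient of a product is
  therefore a sum over a fixed box of exponents, whatever the supports; \<open>pmul_box1\<close> and
  \<open>pmul_box2\<close> use this to compare sums for different factors.\<close>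

lemma pidx_bij:
  assumes f: "bnd R f" and g: "bnd R g" and c: "c \<le> i - R" "c \<le> j - R" and K: "2 * R - i \<le> int K"
  shows "bij_betw (\<lambda>(i1, j1, i2, j2, k). (i1, j1, k)) (pidx f g i j)
      {(i1, j1, k) \<in> {c..R} \<times> {c..R} \<times> {..K}. f i1 j1 \<noteq> 0 \<and> g (i + int k - i1) (j + int k - j1) \<noteq> 0}"
    and "bij_betw (\<lambda>(i1, j1, i2, j2, k). (i2, j2, k)) (pidx f g i j)
      {(i2, j2, k) \<in> {c..R} \<times> {c..R} \<times> {..K}. f (i + int k - i2) (j + int k - j2) \<noteq> 0 \<and> g i2 j2 \<noteq> 0}"
proof -
  have ineq: "c \<le> i1 \<and> i1 \<le> R \<and> c \<le> j1 \<and> j1 \<le> R \<and> c \<le> i2 \<and> i2 \<le> R \<and> c \<le> j2 \<and> j2 \<le> R \<and> k \<le> K"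
    if "f i1 j1 \<noteq> 0" "g i2 j2 \<noteq> 0" "i1 + i2 = i + int k" "j1 + j2 = j + int k" for i1 j1 i2 j2 k
  proof -
    have "i1 \<le> R" "j1 \<le> R" "i2 \<le> R" "j2 \<le> R" using f g that(1,2) by (auto simp: bnd_def)
    thus ?thesis using that(3,4) c K by linarith
  qed
  show "bij_betw (\<lambda>(i1, j1, i2, j2, k). (i1, j1, k)) (pidx f g i j)
      {(i1, j1, k) \<in> {c..R} \<times> {c..R} \<times> {..K}. f i1 j1 \<noteq> 0 \<and> g (i + int k - i1) (j + int k - j1) \<noteq> 0}"
  proof (rule bij_betw_byWitness[where f' = "\<lambda>(i1, j1, k). (i1, j1, i + int k - i1, j + int k - j1, k)"])
    show "(\<lambda>(i1, j1, i2, j2, k). (i1, j1, k)) ` pidx f g i j \<subseteq> {(i1, j1, k) \<in> {c..R} \<times> {c..R} \<times> {..K}. f i1 j1 \<noteq> 0 \<and> g (i + int k - i1) (j + int k - j1) \<noteq> 0}"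
    proof clarsimp
      fix i1 j1 i2 j2 k assume "(i1, j1, i2, j2, k) \<in> pidx f g i j"
      hence a: "f i1 j1 \<noteq> 0" "g i2 j2 \<noteq> 0" "i1 + i2 = i + int k" "j1 + j2 = j + int k" by (auto simp: pidx_def)
      hence "i + int k - i1 = i2" "j + int k - j1 = j2" by auto
      thus "c \<le> i1 \<and> i1 \<le> R \<and> c \<le> j1 \<and> j1 \<le> R \<and> k \<le> K \<and> f i1 j1 \<noteq> 0 \<and> g (i + int k - i1) (j + int k - j1) \<noteq> 0"
        using ineq[OF a] a(1,2) by simp
    qed
  qed (auto simp: pidx_def)
  show "bij_betw (\<lambda>(i1, j1, i2, j2, k). (i2, j2, k)) (pidx f g i j)
      {(i2, j2, k) \<in> {c..R} \<times> {c..R} \<times> {..K}. f (i + int k - i2) (j + int k - j2) \<noteq> 0 \<and> g i2 j2 \<noteq> 0}"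
  proof (rule bij_betw_byWitness[where f' = "\<lambda>(i2, j2, k). (i + int k - i2, j + int k - j2, i2, j2, k)"])
    show "(\<lambda>(i1, j1, i2, j2, k). (i2, j2, k)) ` pidx f g i j \<subseteq> {(i2, j2, k) \<in> {c..R} \<times> {c..R} \<times> {..K}. f (i + int k - i2) (j + int k - j2) \<noteq> 0 \<and> g i2 j2 \<noteq> 0}"
    proof clarsimp
      fix i1 j1 i2 j2 k assume "(i1, j1, i2, j2, k) \<in> pidx f g i j"
      hence a: "f i1 j1 \<noteq> 0" "g i2 j2 \<noteq> 0" "i1 + i2 = i + int k" "j1 + j2 = j + int k" by (auto simp: pidx_def)
      hence "i + int k - i2 = i1" "j + int k - j2 = j1" by auto
      thus "c \<le> i2 \<and> i2 \<le> R \<and> c \<le> j2 \<and> j2 \<le> R \<and> k \<le> K \<and> f (i + int k - i2) (j + int k - j2) \<noteq> 0 \<and> g i2 j2 \<noteq> 0"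
        using ineq[OF a] a(1,2) by simp
    qed
  qed (auto simp: pidx_def)
qed

lemma finite_pidx: "bnd R f \<Longrightarrow> bnd R g \<Longrightarrow> finite (pidx f g i j)"
  using pidx_bij(1)[of R f g "min (i - R) (j - R)" i j "nat (2 * R - i)"]
  by (rule bij_betw_finite[THEN iffD2]) (auto intro: finite_subset[of _ "{min (i - R) (j - R)..R} \<times> {min (i - R) (j - R)..R} \<times> {..nat (2 * R - i)}"])

lemma pmul_box1:
  assumes "bnd R f" "bnd R g" "c \<le> i - R" "c \<le> j - R" "2 * R - i \<le> int K"
  shows "pmul f g i j = (\<Sum>i1\<in>{c..R}. \<Sum>j1\<in>{c..R}. \<Sum>k\<le>K.
     cs (pc k j1 (i + int k - i1)) * (f i1 j1 * g (i + int k - i1) (j + int k - j1)))"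
proof -
  let ?F = "\<lambda>(i1, j1, k). cs (pc k j1 (i + int k - i1)) * (f i1 j1 * g (i + int k - i1) (j + int k - j1))"
  have "pmul f g i j = (\<Sum>t\<in>pidx f g i j. ?F ((\<lambda>(i1, j1, i2, j2, k). (i1, j1, k)) t))"
    unfolding pmul_def
  proof (rule sum.cong[OF refl])
    fix t assume "t \<in> pidx f g i j"
    moreover obtain i1 j1 i2 j2 k where t: "t = (i1, j1, i2, j2, k)" by (metis surj_pair)
    ultimately have "i + int k - i1 = i2" "j + int k - j1 = j2" by (auto simp: pidx_def)
    thus "(case t of (i1, j1, i2, j2, k) \<Rightarrow> cs (pc k j1 i2) * (f i1 j1 * g i2 j2)) = ?F (case t of (i1, j1, i2, j2, k) \<Rightarrow> (i1, j1, k))"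
      by (simp add: t)
  qed
  also have "\<dots> = (\<Sum>t\<in>{(i1, j1, k) \<in> {c..R} \<times> {c..R} \<times> {..K}. f i1 j1 \<noteq> 0 \<and> g (i + int k - i1) (j + int k - j1) \<noteq> 0}. ?F t)"
    by (rule sum.reindex_bij_betw[OF pidx_bij(1)[OF assms]])
  also have "\<dots> = (\<Sum>t\<in>{c..R} \<times> {c..R} \<times> {..K}. ?F t)"
    by (rule sum.mono_neutral_left) auto
  finally show ?thesis by (simp add: sum.cartesian_product)
qed

lemma pmul_box2:
  assumes "bnd R f" "bnd R g" "c \<le> i - R" "c \<le> j - R" "2 * R - i \<le> int K"
  shows "pmul f g i j = (\<Sum>i2\<in>{c..R}. \<Sum>j2\<in>{c..R}. \<Sum>k\<le>K.
     cs (pc k (j + int k - j2) i2) * (f (i + int k - i2) (j + int k - j2) * g i2 j2))"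
proof -
  let ?F = "\<lambda>(i2, j2, k). cs (pc k (j + int k - j2) i2) * (f (i + int k - i2) (j + int k - j2) * g i2 j2)"
  have "pmul f g i j = (\<Sum>t\<in>pidx f g i j. ?F ((\<lambda>(i1, j1, i2, j2, k). (i2, j2, k)) t))"
    unfolding pmul_def
  proof (rule sum.cong[OF refl])
    fix t assume "t \<in> pidx f g i j"
    moreover obtain i1 j1 i2 j2 k where t: "t = (i1, j1, i2, j2, k)" by (metis surj_pair)
    ultimately have "i + int k - i2 = i1" "j + int k - j2 = j1" by (auto simp: pidx_def)
    thus "(case t of (i1, j1, i2, j2, k) \<Rightarrow> cs (pc k j1 i2) * (f i1 j1 * g i2 j2)) = ?F (case t of (i1, j1, i2, j2, k) \<Rightarrow> (i2, j2, k))"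
      by (simp add: t)
  qed
  also have "\<dots> = (\<Sum>t\<in>{(i2, j2, k) \<in> {c..R} \<times> {c..R} \<times> {..K}. f (i + int k - i2) (j + int k - j2) \<noteq> 0 \<and> g i2 j2 \<noteq> 0}. ?F t)"
    by (rule sum.reindex_bij_betw[OF pidx_bij(2)[OF assms]])
  also have "\<dots> = (\<Sum>t\<in>{c..R} \<times> {c..R} \<times> {..K}. ?F t)"
    by (rule sum.mono_neutral_left) auto
  finally show ?thesis by (simp add: sum.cartesian_product)
qed

lemma pmul_nonzeroE:
  assumes "pmul f g i j \<noteq> 0"
  obtains i1 j1 i2 j2 k where "f i1 j1 \<noteq> 0" "g i2 j2 \<noteq> 0" "i1 + i2 = i + int k" "j1 + j2 = j + int k" "cs (pc k j1 i2) * (f i1 j1 * g i2 j2) \<noteq> 0"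
proof -
  have "\<exists>t\<in>pidx f g i j. (\<lambda>(i1, j1, i2, j2, k). cs (pc k j1 i2) * (f i1 j1 * g i2 j2)) t \<noteq> 0"
    using assms unfolding pmul_def by (meson sum.not_neutral_contains_not_neutral)
  thus ?thesis using that by (force simp: pidx_def)
qed

lemma bnd_pmul:
  assumes "bnd R f" "bnd R g" shows "bnd (2 * R) (pmul f g)"
  unfolding bnd_def
proof (intro allI impI)
  fix i j assume "pmul f g i j \<noteq> 0"
  then obtain i1 j1 i2 j2 k where *: "f i1 j1 \<noteq> 0" "g i2 j2 \<noteq> 0" "i1 + i2 = i + int k" "j1 + j2 = j + int k"
    by (rule pmul_nonzeroE)
  have "i1 \<le> R" "j1 \<le> R" "i2 \<le> R" "j2 \<le> R" using assms *(1,2) by (auto simp: bnd_def)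
  thus "i \<le> 2 * R \<and> j \<le> 2 * R" using *(3,4) by linarith
qed

lemma sum_square_triangle:
  fixes F :: "nat \<Rightarrow> nat \<Rightarrow> 'a::comm_monoid_add"
  assumes "\<And>k l. K < k + l \<Longrightarrow> F k l = 0"
  shows "(\<Sum>l\<le>K. \<Sum>k\<le>K. F k l) = (\<Sum>m\<le>K. \<Sum>k\<le>m. F k (m - k))"
proof -
  have "(\<Sum>l\<le>K. \<Sum>k\<le>K. F k l) = (\<Sum>(k, l)\<in>{..K} \<times> {..K}. F k l)"
    by (subst sum.swap) (simp add: sum.cartesian_product)
  also have "\<dots> = (\<Sum>(k, l)\<in>{(k, l). k + l \<le> K}. F k l)"
    by (intro sum.mono_neutral_right) (auto, metis assms not_le)
  also have "\<dots> = (\<Sum>m\<le>K. \<Sum>k\<le>m. F k (m - k))" by (rule sum.triangle_reindex_eq)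
  finally show ?thesis .
qed

text \<open>Either bracketing becomes a sum over the exponents of the first and third factor and
  over two contraction numbers \<open>k\<close>, \<open>l\<close>. The middle factor then depends on
  \<open>k + l\<close> only, and for a fixed sum \<open>m\<close> the coefficients agree by
  \<open>pc_assoc\<close>.\<close>

lemma pmul_assoc:
  fixes f g h :: "int \<Rightarrow> int \<Rightarrow> 'a::calg"
  assumes "bnd R f" "bnd R g" "bnd R h"
  shows "pmul (pmul f g) h i j = pmul f (pmul g h) i j"
proof -
  \<comment> \<open>One bound for the three factors and both partial products; a product doubles the
    bound.\<close>
  define Q where "Q = 2 * max R 0"
  have Q: "bnd Q f" "bnd Q g" "bnd Q h" "bnd Q (pmul f g)" "bnd Q (pmul g h)" "0 \<le> Q"
  proof -
    have *: "bnd (max R 0) f" "bnd (max R 0) g" "bnd (max R 0) h" using assms by (auto intro: bnd_mono)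
    show "bnd Q f" "bnd Q g" "bnd Q h" by (rule bnd_mono[OF *(1)] bnd_mono[OF *(2)] bnd_mono[OF *(3)], simp add: Q_def)+
    show "bnd Q (pmul f g)" "bnd Q (pmul g h)" unfolding Q_def using * by (auto intro: bnd_pmul)
  qed (simp add: Q_def)
  \<comment> \<open>Chosen so low, and \<open>K\<close> so large, that the same box serves the outer
    coefficient at \<open>(i, j)\<close> and all inner coefficients at the shifted positions in
    \<open>c'\<close>.\<close>
  define c where "c = min i j - 2 * Q"
  define K where "K = nat (4 * Q - min i j)"
  have c: "c \<le> i - Q" "c \<le> j - Q" "2 * Q - i \<le> int K" using Q(6) by (auto simp: c_def K_def)
  have c': "c \<le> i + int l - i' - Q" "c \<le> j + int l - j' - Q" "2 * Q - (i + int l - i') \<le> int K"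
    if "i' \<in> {c..Q}" "j' \<in> {c..Q}" for l i' j'
    using that Q(6) by (auto simp: c_def K_def)
  define G where "G i1 j1 i3 j3 m = f i1 j1 * (g (i + int m - i1 - i3) (j + int m - j1 - j3) * h i3 j3)" for i1 j1 i3 j3 m
  \<comment> \<open>With more than \<open>K\<close> contractions the exponent of the middle factor
    exceeds its bound, so the square of pairs \<open>(k, l)\<close> can be cut to a
    triangle.\<close>
  have G0: "G i1 j1 i3 j3 m = 0" if "K < m" "i1 \<in> {c..Q}" "i3 \<in> {c..Q}" for i1 j1 i3 j3 m
  proof -
    have "Q < i + int m - i1 - i3" using that Q(6) by (auto simp: K_def)
    thus ?thesis using bndD[OF Q(2)] by (simp add: G_def)
  qed
  have L: "pmul (pmul f g) h i j = (\<Sum>i3\<in>{c..Q}. \<Sum>j3\<in>{c..Q}. \<Sum>l\<le>K. \<Sum>i1\<in>{c..Q}. \<Sum>j1\<in>{c..Q}. \<Sum>k\<le>K.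
      cs (pc l (j + int l - j3) i3 * pc k j1 (i + int l - i3 + int k - i1)) * G i1 j1 i3 j3 (k + l))"
  proof -
    have "cs (pc l (j + int l - j3) i3) * (pmul f g (i + int l - i3) (j + int l - j3) * h i3 j3)
      = (\<Sum>i1\<in>{c..Q}. \<Sum>j1\<in>{c..Q}. \<Sum>k\<le>K. cs (pc l (j + int l - j3) i3 * pc k j1 (i + int l - i3 + int k - i1)) * G i1 j1 i3 j3 (k + l))"
      if "i3 \<in> {c..Q}" "j3 \<in> {c..Q}" for i3 j3 l
      unfolding pmul_box1[OF Q(1,2) c'[OF that]] sum_distrib_left sum_distrib_right
      by (intro sum.cong refl) (simp add: G_def cs_mult mult.assoc algebra_simps)
    thus ?thesis unfolding pmul_box2[OF Q(4,3) c] by (intro sum.cong refl) auto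
  qed
  have R: "pmul f (pmul g h) i j = (\<Sum>i1\<in>{c..Q}. \<Sum>j1\<in>{c..Q}. \<Sum>l\<le>K. \<Sum>i3\<in>{c..Q}. \<Sum>j3\<in>{c..Q}. \<Sum>k\<le>K.
      cs (pc l j1 (i + int l - i1) * pc k (j + int l - j1 + int k - j3) i3) * G i1 j1 i3 j3 (k + l))"
  proof -
    have "cs (pc l j1 (i + int l - i1)) * (f i1 j1 * pmul g h (i + int l - i1) (j + int l - j1))
      = (\<Sum>i3\<in>{c..Q}. \<Sum>j3\<in>{c..Q}. \<Sum>k\<le>K. cs (pc l j1 (i + int l - i1) * pc k (j + int l - j1 + int k - j3) i3) * G i1 j1 i3 j3 (k + l))"
      if "i1 \<in> {c..Q}" "j1 \<in> {c..Q}" for i1 j1 l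
      unfolding pmul_box2[OF Q(2,3) c'[OF that]] sum_distrib_left sum_distrib_right
      by (intro sum.cong refl) (simp add: G_def cs_mult mult.assoc cs_left_comm[of "f i1 j1"] algebra_simps)
    thus ?thesis unfolding pmul_box1[OF Q(1,5) c] by (intro sum.cong refl) auto
  qed
  have inner: "(\<Sum>l\<le>K. \<Sum>k\<le>K. cs (pc l (j + int l - j3) i3 * pc k j1 (i + int l - i3 + int k - i1)) * G i1 j1 i3 j3 (k + l))
      = (\<Sum>l\<le>K. \<Sum>k\<le>K. cs (pc l j1 (i + int l - i1) * pc k (j + int l - j1 + int k - j3) i3) * G i1 j1 i3 j3 (k + l))"
    if "i1 \<in> {c..Q}" "i3 \<in> {c..Q}" for i1 j1 i3 j3
  proof -
    have "(\<Sum>l\<le>K. \<Sum>k\<le>K. cs (pc l (j + int l - j3) i3 * pc k j1 (i + int l - i3 + int k - i1)) * G i1 j1 i3 j3 (k + l))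
       = (\<Sum>m\<le>K. \<Sum>k\<le>m. cs (pc (m - k) (j + int (m - k) - j3) i3 * pc k j1 (i + int (m - k) - i3 + int k - i1)) * G i1 j1 i3 j3 (k + (m - k)))"
      by (rule sum_square_triangle) (simp add: G0[OF _ that])
    also have "\<dots> = (\<Sum>m\<le>K. \<Sum>k\<le>m. cs (pc (m - k) j1 (i + int (m - k) - i1) * pc k (j + int (m - k) - j1 + int k - j3) i3) * G i1 j1 i3 j3 (k + (m - k)))"
    proof (rule sum.cong[OF refl])
      fix m assume "m \<in> {..K}"
      have "(\<Sum>k\<le>m. pc (m - k) (j + int (m - k) - j3) i3 * pc k j1 (i + int (m - k) - i3 + int k - i1))
        = (\<Sum>k\<le>m. pc k j1 (i + int m - i1 - i3) * pc (m - k) (j1 + (j + int m - j1 - j3) - int k) i3)"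
        by (intro sum.cong refl) (simp add: of_nat_diff algebra_simps)
      also have "\<dots> = (\<Sum>k\<le>m. pc k (j + int m - j1 - j3) i3 * pc (m - k) j1 (i + int m - i1 - i3 + i3 - int k))"
        by (rule pc_assoc)
      also have "\<dots> = (\<Sum>k\<le>m. pc (m - k) j1 (i + int (m - k) - i1) * pc k (j + int (m - k) - j1 + int k - j3) i3)"
        by (intro sum.cong refl) (simp add: of_nat_diff algebra_simps)
      finally have *: "(\<Sum>k\<le>m. cs (pc (m - k) (j + int (m - k) - j3) i3 * pc k j1 (i + int (m - k) - i3 + int k - i1)))
        = (\<Sum>k\<le>m. cs (pc (m - k) j1 (i + int (m - k) - i1) * pc k (j + int (m - k) - j1 + int k - j3) i3))"
        by (simp only: cs_sum[symmetric])
      have G: "(\<Sum>k\<le>m. cs (F k) * G i1 j1 i3 j3 (k + (m - k))) = (\<Sum>k\<le>m. cs (F k)) * G i1 j1 i3 j3 m" for F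
        unfolding sum_distrib_right by (intro sum.cong refl) simp
      show "(\<Sum>k\<le>m. cs (pc (m - k) (j + int (m - k) - j3) i3 * pc k j1 (i + int (m - k) - i3 + int k - i1)) * G i1 j1 i3 j3 (k + (m - k)))
         = (\<Sum>k\<le>m. cs (pc (m - k) j1 (i + int (m - k) - i1) * pc k (j + int (m - k) - j1 + int k - j3) i3) * G i1 j1 i3 j3 (k + (m - k)))"
        unfolding G * ..
    qed
    also have "\<dots> = (\<Sum>l\<le>K. \<Sum>k\<le>K. cs (pc l j1 (i + int l - i1) * pc k (j + int l - j1 + int k - j3) i3) * G i1 j1 i3 j3 (k + l))"
      by (rule sum_square_triangle[symmetric]) (simp add: G0[OF _ that])
    finally show ?thesis .
  qed
  let ?B = "{c..Q}"
  have "pmul (pmul f g) h i j = (\<Sum>(i3, j3)\<in>?B \<times> ?B. \<Sum>l\<le>K. \<Sum>(i1, j1)\<in>?B \<times> ?B. \<Sum>k\<le>K.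
      cs (pc l (j + int l - j3) i3 * pc k j1 (i + int l - i3 + int k - i1)) * G i1 j1 i3 j3 (k + l))"
    unfolding L by (simp only: sum.cartesian_product[symmetric])
  also have "\<dots> = (\<Sum>(i3, j3)\<in>?B \<times> ?B. \<Sum>(i1, j1)\<in>?B \<times> ?B. \<Sum>l\<le>K. \<Sum>k\<le>K.
      cs (pc l (j + int l - j3) i3 * pc k j1 (i + int l - i3 + int k - i1)) * G i1 j1 i3 j3 (k + l))"
    unfolding case_prod_unfold by (intro sum.cong refl sum.swap)
  also have "\<dots> = (\<Sum>(i3, j3)\<in>?B \<times> ?B. \<Sum>(i1, j1)\<in>?B \<times> ?B. \<Sum>l\<le>K. \<Sum>k\<le>K.
      cs (pc l j1 (i + int l - i1) * pc k (j + int l - j1 + int k - j3) i3) * G i1 j1 i3 j3 (k + l))"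
    unfolding case_prod_unfold by (intro sum.cong refl inner) auto
  also have "\<dots> = (\<Sum>(i1, j1)\<in>?B \<times> ?B. \<Sum>(i3, j3)\<in>?B \<times> ?B. \<Sum>l\<le>K. \<Sum>k\<le>K.
      cs (pc l j1 (i + int l - i1) * pc k (j + int l - j1 + int k - j3) i3) * G i1 j1 i3 j3 (k + l))"
    unfolding case_prod_unfold by (rule sum.swap)
  also have "\<dots> = (\<Sum>(i1, j1)\<in>?B \<times> ?B. \<Sum>l\<le>K. \<Sum>(i3, j3)\<in>?B \<times> ?B. \<Sum>k\<le>K.
      cs (pc l j1 (i + int l - i1) * pc k (j + int l - j1 + int k - j3) i3) * G i1 j1 i3 j3 (k + l))"
    unfolding case_prod_unfold by (intro sum.cong refl sum.swap)
  also have "\<dots> = pmul f (pmul g h) i j"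
    unfolding R by (simp only: sum.cartesian_product[symmetric])
  finally show ?thesis .
qed

section \<open>The ring type of pseudo-differential series, scalar series and the exchange
  \<open>om\<close>\<close>

typedef (overloaded) 'a psd = "{f :: int \<Rightarrow> int \<Rightarrow> 'a::calg. \<exists>R. bnd R f}" morphisms cf Psd
  by (rule exI[of _ "\<lambda>i j. 0"]) (auto simp: bnd_def)

lemma psd_eqI: "(\<And>i j. cf f i j = cf g i j) \<Longrightarrow> f = g"
  by (rule cf_inject[THEN iffD1]) (intro ext)

lemma cf_Psd: "bnd R f \<Longrightarrow> cf (Psd f) = f"
  by (rule Psd_inverse) auto

lemma bnd_cf: obtains R where "0 \<le> R" "bnd R (cf f)"
proof -
  obtain R where "bnd R (cf f)" using cf[of f] by auto
  hence "bnd (max R 0) (cf f)" by (rule bnd_mono) simp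
  thus ?thesis using that[of "max R 0"] by simp
qed

lemma bnd_cf2: obtains R where "0 \<le> R" "bnd R (cf f)" "bnd R (cf g)"
proof -
  obtain R1 R2 where "0 \<le> R1" "bnd R1 (cf f)" "0 \<le> R2" "bnd R2 (cf g)" by (meson bnd_cf)
  moreover from this have "bnd (max R1 R2) (cf f)" "bnd (max R1 R2) (cf g)" by (auto intro: bnd_mono)
  ultimately show ?thesis using that[of "max R1 R2"] by simp
qed

instantiation psd :: (calg) ring_1
begin

definition zero_psd :: "'a psd" where "0 = Psd (\<lambda>i j. 0)"
definition one_psd :: "'a psd" where "1 = Psd (\<lambda>i j. if i = 0 \<and> j = 0 then 1 else 0)"
definition plus_psd :: "'a psd \<Rightarrow> 'a psd \<Rightarrow> 'a psd" where "f + g = Psd (\<lambda>i j. cf f i j + cf g i j)"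
definition uminus_psd :: "'a psd \<Rightarrow> 'a psd" where "- f = Psd (\<lambda>i j. - cf f i j)"
definition minus_psd :: "'a psd \<Rightarrow> 'a psd \<Rightarrow> 'a psd" where "f - g = Psd (\<lambda>i j. cf f i j - cf g i j)"
definition times_psd :: "'a psd \<Rightarrow> 'a psd \<Rightarrow> 'a psd" where "f * g = Psd (pmul (cf f) (cf g))"

lemma cf_0: "cf (0 :: 'a psd) = (\<lambda>i j. 0)"
  unfolding zero_psd_def by (rule cf_Psd[of 0]) (simp add: bnd_def)

lemma cf_1: "cf (1 :: 'a psd) = (\<lambda>i j. if i = 0 \<and> j = 0 then 1 else 0)"
  unfolding one_psd_def by (rule cf_Psd[of 0]) (simp add: bnd_def)

lemma cf_add: "cf (f + g :: 'a psd) = (\<lambda>i j. cf f i j + cf g i j)"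
proof -
  obtain R where "bnd R (cf f)" "bnd R (cf g)" by (rule bnd_cf2)
  thus ?thesis unfolding plus_psd_def by (intro cf_Psd[of R]) (auto simp: bnd_def, (metis add.right_neutral)+)
qed

lemma cf_minus: "cf (- f :: 'a psd) = (\<lambda>i j. - cf f i j)"
proof -
  obtain R where "bnd R (cf f)" by (rule bnd_cf)
  thus ?thesis unfolding uminus_psd_def by (intro cf_Psd[of R]) (auto simp: bnd_def)
qed

lemma cf_diff: "cf (f - g :: 'a psd) = (\<lambda>i j. cf f i j - cf g i j)"
proof -
  obtain R where "bnd R (cf f)" "bnd R (cf g)" by (rule bnd_cf2)
  thus ?thesis unfolding minus_psd_def by (intro cf_Psd[of R]) (auto simp: bnd_def, (metis diff_0_right)+)
qed

lemma cf_mult: "cf (f * g :: 'a psd) = pmul (cf f) (cf g)"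
proof -
  obtain R where "bnd R (cf f)" "bnd R (cf g)" by (rule bnd_cf2)
  thus ?thesis unfolding times_psd_def by (intro cf_Psd[of "2 * R"] bnd_pmul)
qed

instance
proof
  fix a b c :: "'a psd"
  obtain R1 R2 where R1: "0 \<le> R1" "bnd R1 (cf a)" "bnd R1 (cf b)" and R2: "0 \<le> R2" "bnd R2 (cf c)"
    by (meson bnd_cf bnd_cf2)
  define R where "R = max R1 R2"
  have R: "0 \<le> R" "bnd R (cf a)" "bnd R (cf b)" "bnd R (cf c)"
    using R1 R2 by (auto simp: R_def intro: bnd_mono)
  show "a * b * c = a * (b * c)"
    by (rule psd_eqI) (simp add: cf_mult pmul_assoc[OF R(2-4)])
  have Ra: "bnd R (cf (a + b))" "bnd R (cf (b + c))"
    using R by (auto simp: cf_add bnd_def, (metis add.right_neutral)+)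
  show "(a + b) * c = a * c + b * c"
  proof (rule psd_eqI)
    fix i j
    have c: "min (i - R) (j - R) \<le> i - R" "min (i - R) (j - R) \<le> j - R" "2 * R - i \<le> int (nat (2 * R - i))" by auto
    show "cf ((a + b) * c) i j = cf (a * c + b * c) i j"
      unfolding cf_add cf_mult pmul_box1[OF Ra(1)[unfolded cf_add] R(4) c] pmul_box1[OF R(2) R(4) c] pmul_box1[OF R(3) R(4) c]
      by (simp add: sum.distrib[symmetric] distrib_left distrib_right)
  qed
  show "a * (b + c) = a * b + a * c"
  proof (rule psd_eqI)
    fix i j
    have c: "min (i - R) (j - R) \<le> i - R" "min (i - R) (j - R) \<le> j - R" "2 * R - i \<le> int (nat (2 * R - i))" by auto
    show "cf (a * (b + c)) i j = cf (a * b + a * c) i j"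
      unfolding cf_add cf_mult pmul_box1[OF R(2) Ra(2)[unfolded cf_add] c] pmul_box1[OF R(2) R(3) c] pmul_box1[OF R(2) R(4) c]
      by (simp add: sum.distrib[symmetric] distrib_left distrib_right)
  qed
  have one: "bnd R (cf (1 :: 'a psd))" using R by (auto simp: cf_1 bnd_def)
  show "1 * a = a"
  proof (rule psd_eqI)
    fix i j
    have "cf (1 * a) i j = (\<Sum>t\<in>pidx (cf 1) (cf a) i j. (\<lambda>(i1, j1, i2, j2, k). cs (pc k j1 i2) * (cf 1 i1 j1 * cf a i2 j2)) t)"
      by (simp add: cf_mult pmul_def)
    \<comment> \<open>Only the contraction number 0 survives, because a constant left factor has
      \<open>\<partial>\<close>-exponent 0. The case of a vanishing coefficient is separate since
      the index set contains only pairs of nonzero coefficients.\<close>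
    also have "\<dots> = (\<Sum>t\<in>(if cf a i j = 0 then {} else {(0, 0, i, j, 0)}). (\<lambda>(i1, j1, i2, j2, k). cs (pc k j1 i2) * (cf 1 i1 j1 * cf a i2 j2)) t)"
    proof (rule sum.mono_neutral_right)
      show "finite (pidx (cf 1) (cf a) i j)" by (rule finite_pidx[OF one R(2)])
      show "(if cf a i j = 0 then {} else {(0, 0, i, j, 0)}) \<subseteq> pidx (cf 1) (cf a) i j" by (auto simp: pidx_def cf_1)
      show "\<forall>t\<in>pidx (cf 1) (cf a) i j - (if cf a i j = 0 then {} else {(0, 0, i, j, 0)}). (\<lambda>(i1, j1, i2, j2, k). cs (pc k j1 i2) * (cf 1 i1 j1 * cf a i2 j2)) t = 0"
      proof clarify
        fix i1 j1 i2 j2 k assume a: "(i1, j1, i2, j2, k) \<in> pidx (cf 1) (cf a) i j" "(i1, j1, i2, j2, k) \<notin> (if cf a i j = 0 then {} else {(0, 0, i, j, 0)})"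
        have 0: "i1 = 0" "j1 = 0" "i2 = i + int k" "j2 = j + int k" "cf a i2 j2 \<noteq> 0" using a(1) by (auto simp: pidx_def cf_1 split: if_splits)
        hence "k > 0" using a(2) by (cases k) auto
        thus "cs (pc k j1 i2) * (cf 1 i1 j1 * cf a i2 j2) = 0" by (simp add: 0 pc_left_0)
      qed
    qed
    also have "\<dots> = cf a i j" by (simp add: cf_1 cs_1)
    finally show "cf (1 * a) i j = cf a i j" .
  qed
  show "a * 1 = a"
  proof (rule psd_eqI)
    fix i j
    have "cf (a * 1) i j = (\<Sum>t\<in>pidx (cf a) (cf 1) i j. (\<lambda>(i1, j1, i2, j2, k). cs (pc k j1 i2) * (cf a i1 j1 * cf 1 i2 j2)) t)"
      by (simp add: cf_mult pmul_def)
    also have "\<dots> = (\<Sum>t\<in>(if cf a i j = 0 then {} else {(i, j, 0, 0, 0)}). (\<lambda>(i1, j1, i2, j2, k). cs (pc k j1 i2) * (cf a i1 j1 * cf 1 i2 j2)) t)"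
    proof (rule sum.mono_neutral_right)
      show "finite (pidx (cf a) (cf 1) i j)" by (rule finite_pidx[OF R(2) one])
      show "(if cf a i j = 0 then {} else {(i, j, 0, 0, 0)}) \<subseteq> pidx (cf a) (cf 1) i j" by (auto simp: pidx_def cf_1)
      show "\<forall>t\<in>pidx (cf a) (cf 1) i j - (if cf a i j = 0 then {} else {(i, j, 0, 0, 0)}). (\<lambda>(i1, j1, i2, j2, k). cs (pc k j1 i2) * (cf a i1 j1 * cf 1 i2 j2)) t = 0"
      proof clarify
        fix i1 j1 i2 j2 k assume a: "(i1, j1, i2, j2, k) \<in> pidx (cf a) (cf 1) i j" "(i1, j1, i2, j2, k) \<notin> (if cf a i j = 0 then {} else {(i, j, 0, 0, 0)})"
        have 0: "i2 = 0" "j2 = 0" "i1 = i + int k" "j1 = j + int k" "cf a i1 j1 \<noteq> 0" using a(1) by (auto simp: pidx_def cf_1 split: if_splits)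
        hence "k > 0" using a(2) by (cases k) auto
        thus "cs (pc k j1 i2) * (cf a i1 j1 * cf 1 i2 j2) = 0" by (simp add: 0 pc_right_0)
      qed
    qed
    also have "\<dots> = cf a i j" by (simp add: cf_1 cs_1)
    finally show "cf (a * 1) i j = cf a i j" .
  qed
  show "(0 :: 'a psd) \<noteq> 1"
  proof
    assume "(0 :: 'a psd) = 1"
    hence "cf (0 :: 'a psd) 0 0 = cf 1 0 0" by simp
    thus False by (simp add: cf_0 cf_1)
  qed
qed (auto intro!: psd_eqI simp: cf_0 cf_add cf_minus cf_diff add_ac)

end

definition kc :: "'a::calg \<Rightarrow> 'a psd" where "kc a = Psd (\<lambda>i j. if i = 0 \<and> j = 0 then a else 0)"
definition psc :: "complex \<Rightarrow> 'a::calg psd" where "psc c = kc (cs c)"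
definition mono_psd :: "int \<Rightarrow> int \<Rightarrow> 'a::calg psd" where "mono_psd p q = Psd (\<lambda>i j. if i = p \<and> j = q then 1 else 0)"
abbreviation zz :: "'a::calg psd" where "zz \<equiv> mono_psd 1 0"
abbreviation dd :: "'a::calg psd" where "dd \<equiv> mono_psd 0 1"
abbreviation dinv :: "'a::calg psd" where "dinv \<equiv> mono_psd 0 (-1)"
definition om :: "'a::calg psd \<Rightarrow> 'a psd" where "om f = Psd (\<lambda>i j. cf f j i)"
definition zf :: "complex fps \<Rightarrow> 'a::calg psd" where
  "zf F = Psd (\<lambda>i j. if i \<le> 0 \<and> j = 0 then cs (fps_nth F (nat (- i))) else 0)"

lemma cf_kc: "cf (kc a) = (\<lambda>i j. if i = 0 \<and> j = 0 then a else 0)"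
  unfolding kc_def by (rule cf_Psd[of 0]) (auto simp: bnd_def)

lemma cf_mono: "cf (mono_psd p q) = (\<lambda>i j. if i = p \<and> j = q then 1 else 0)"
  unfolding mono_psd_def by (rule cf_Psd[of "max p q"]) (auto simp: bnd_def)

lemma cf_om: "cf (om f) = (\<lambda>i j. cf f j i)"
proof -
  obtain R where "bnd R (cf f)" by (rule bnd_cf)
  thus ?thesis unfolding om_def by (intro cf_Psd[of R]) (auto simp: bnd_def)
qed

lemma cf_zf: "cf (zf F) = (\<lambda>i j. if i \<le> 0 \<and> j = 0 then cs (fps_nth F (nat (- i))) else 0)"
  unfolding zf_def by (rule cf_Psd[of 0]) (auto simp: bnd_def split: if_splits)

lemma om_om [simp]: "om (om f) = f" by (rule psd_eqI) (simp add: cf_om)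
lemma om_plus: "om (f + g) = om f + om g" by (rule psd_eqI) (simp add: cf_om cf_add)
lemma om_minus': "om (f - g) = om f - om g" by (rule psd_eqI) (simp add: cf_om cf_diff)
lemma om_zero [simp]: "om 0 = 0" by (rule psd_eqI) (simp add: cf_om cf_0)
lemma om_one [simp]: "om 1 = 1" by (rule psd_eqI) (simp add: cf_om cf_1)
lemma om_mono [simp]: "om (mono_psd p q) = mono_psd q p" by (rule psd_eqI) (auto simp: cf_om cf_mono)
lemma om_kc [simp]: "om (kc a) = kc a" by (rule psd_eqI) (simp add: cf_om cf_kc)

lemma mono_psd_0 [simp]: "mono_psd 0 0 = 1" by (rule psd_eqI) (simp add: cf_mono cf_1)

lemma pmul_single:
  assumes "finite A" "A \<subseteq> pidx f g i j"
    and "\<And>i1 j1 i2 j2 k. (i1, j1, i2, j2, k) \<in> pidx f g i j \<Longrightarrow> (i1, j1, i2, j2, k) \<notin> A \<Longrightarrow> cs (pc k j1 i2) * (f i1 j1 * g i2 j2) = 0"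
    and "bnd R f" "bnd R g"
  shows "pmul f g i j = (\<Sum>(i1, j1, i2, j2, k)\<in>A. cs (pc k j1 i2) * (f i1 j1 * g i2 j2))"
  unfolding pmul_def
  by (rule sum.mono_neutral_right) (use assms finite_pidx in \<open>auto\<close>)

lemma cf_kc_mult: "cf (kc a * f) i j = a * cf f i j"
proof -
  obtain R where R: "bnd R (cf (kc a))" "bnd R (cf f)" by (rule bnd_cf2)
  let ?A = "if a = 0 \<or> cf f i j = 0 then {} else {(0, 0, i, j, 0::nat)}"
  have "cf (kc a * f) i j = (\<Sum>(i1, j1, i2, j2, k)\<in>?A. cs (pc k j1 i2) * (cf (kc a) i1 j1 * cf f i2 j2))"
    unfolding cf_mult
  proof (rule pmul_single[OF _ _ _ R])
    show "?A \<subseteq> pidx (cf (kc a)) (cf f) i j" by (auto simp: pidx_def cf_kc)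
    fix i1 j1 i2 j2 k assume t: "(i1, j1, i2, j2, k) \<in> pidx (cf (kc a)) (cf f) i j" "(i1, j1, i2, j2, k) \<notin> ?A"
    have 0: "i1 = 0" "j1 = 0" "a \<noteq> 0" "i2 = i + int k" "j2 = j + int k" "cf f i2 j2 \<noteq> 0" using t(1) by (auto simp: pidx_def cf_kc split: if_splits)
    hence "k > 0" using t(2) by (cases k) auto
    thus "cs (pc k j1 i2) * (cf (kc a) i1 j1 * cf f i2 j2) = 0" by (simp add: 0 pc_left_0)
  qed simp
  thus ?thesis by (auto simp: cf_kc cs_1)
qed

lemma cf_mult_kc: "cf (f * kc a) i j = cf f i j * a"
proof -
  obtain R where R: "bnd R (cf f)" "bnd R (cf (kc a))" by (rule bnd_cf2)
  let ?A = "if a = 0 \<or> cf f i j = 0 then {} else {(i, j, 0, 0, 0::nat)}"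
  have "cf (f * kc a) i j = (\<Sum>(i1, j1, i2, j2, k)\<in>?A. cs (pc k j1 i2) * (cf f i1 j1 * cf (kc a) i2 j2))"
    unfolding cf_mult
  proof (rule pmul_single[OF _ _ _ R])
    show "?A \<subseteq> pidx (cf f) (cf (kc a)) i j" by (auto simp: pidx_def cf_kc)
    fix i1 j1 i2 j2 k assume t: "(i1, j1, i2, j2, k) \<in> pidx (cf f) (cf (kc a)) i j" "(i1, j1, i2, j2, k) \<notin> ?A"
    have 0: "i2 = 0" "j2 = 0" "a \<noteq> 0" "i1 = i + int k" "j1 = j + int k" "cf f i1 j1 \<noteq> 0" using t(1) by (auto simp: pidx_def cf_kc split: if_splits)
    hence "k > 0" using t(2) by (cases k) auto
    thus "cs (pc k j1 i2) * (cf f i1 j1 * cf (kc a) i2 j2) = 0" by (simp add: 0 pc_right_0)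
  qed simp
  thus ?thesis by (auto simp: cf_kc cs_1)
qed

lemma kc_add: "kc (a + b) = kc a + kc b" by (rule psd_eqI) (simp add: cf_kc cf_add)
lemma kc_mult: "kc (a * b) = kc a * kc b" by (rule psd_eqI) (simp add: cf_kc_mult, simp add: cf_kc)
lemma kc_0 [simp]: "kc 0 = 0" by (rule psd_eqI) (simp add: cf_kc cf_0)
lemma kc_1 [simp]: "kc 1 = 1" by (rule psd_eqI) (simp add: cf_kc cf_1)
lemma kc_minus: "kc (- a) = - kc a" by (rule psd_eqI) (simp add: cf_kc cf_minus)
lemma kc_diff: "kc (a - b) = kc a - kc b" by (rule psd_eqI) (simp add: cf_kc cf_diff)
lemma kc_sum: "kc (sum f A) = (\<Sum>i\<in>A. kc (f i))"
  by (induction A rule: infinite_finite_induct) (simp_all add: kc_add)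

lemma kc_comm: "(\<And>i j. a * cf f i j = cf f i j * a) \<Longrightarrow> kc a * f = f * kc a"
  by (rule psd_eqI) (simp add: cf_kc_mult cf_mult_kc)

lemma psc_comm: "psc c * f = f * psc c"
  unfolding psc_def by (rule kc_comm) (rule cs_comm)

lemma psc_add: "psc (a + b) = psc a + psc b" and psc_mult: "psc (a * b) = psc a * psc b" and psc_1 [simp]: "psc 1 = 1"
  and psc_0 [simp]: "psc 0 = 0" and om_psc [simp]: "om (psc a) = psc a"
  by (simp_all add: psc_def cs_add cs_mult kc_add kc_mult cs_1)

lemma om_mult:
  assumes "\<And>i j i' j'. cf f i j * cf g i' j' = cf g i' j' * cf f i j"
  shows "om (f * g) = om g * om f"
proof (rule psd_eqI)
  fix i j
  show "cf (om (f * g)) i j = cf (om g * om f) i j"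
    unfolding cf_om cf_mult pmul_def
    by (rule sum.reindex_bij_witness[of _ "\<lambda>(i1, j1, i2, j2, k). (j2, i2, j1, i1, k)" "\<lambda>(i1, j1, i2, j2, k). (j2, i2, j1, i1, k)"])
       (auto simp: pidx_def pc_sym assms add.commute)
qed

lemma kc_mono: "kc a * mono_psd p q = mono_psd p q * kc a"
  by (rule kc_comm) (simp add: cf_mono)

lemma om_mono_mult: "om (mono_psd p q * f) = om f * mono_psd q p"
  using om_mult[of "mono_psd p q" f] by (simp add: cf_mono)

lemma om_mult_zf: "om (f * zf F) = om (zf F) * om f"
  by (rule om_mult) (simp add: cf_zf cs_comm)

lemma om_kc_mult: "om (kc a * f) = kc a * om f" and om_mult_kc: "om (f * kc a) = om f * kc a"
  by (rule psd_eqI, simp add: cf_om cf_kc_mult cf_mult_kc)+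

lemma cf_mono_mult:
  "cf (mono_psd a b * mono_psd c e) i j =
     (if a + c - i = b + e - j \<and> i \<le> a + c then cs (pc (nat (a + c - i)) b c) else 0)"
proof -
  obtain R where R: "bnd R (cf (mono_psd a b :: 'a psd))" "bnd R (cf (mono_psd c e :: 'a psd))" by (rule bnd_cf2)
  let ?P = "a + c - i = b + e - j \<and> i \<le> a + c"
  let ?A = "if ?P then {(a, b, c, e, nat (a + c - i))} else {}"
  have "cf (mono_psd a b * mono_psd c e :: 'a psd) i j
     = (\<Sum>(i1, j1, i2, j2, k)\<in>?A. cs (pc k j1 i2) * (cf (mono_psd a b) i1 j1 * cf (mono_psd c e) i2 j2))"
    unfolding cf_mult
    by (rule pmul_single[OF _ _ _ R]) (auto simp: pidx_def cf_mono split: if_splits)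
  thus ?thesis by (simp add: cf_mono)
qed

lemma dd_zz: "dd * zz = zz * dd + 1"
proof (rule psd_eqI)
  fix i j :: int
  have p2: "pc k 1 1 = 0" if "k \<ge> 2" for k
  proof -
    have "(1 :: complex) gchoose k = of_nat (1 choose k)" by (simp add: binomial_gbinomial)
    thus ?thesis using that by (simp add: pc_gbinomial binomial_eq_0)
  qed
  have p1: "pc (Suc 0) 1 1 = 1" by (simp add: pc_gbinomial)
  consider "i = 1" "j = 1" | "i = 0" "j = 0" | "i = j" "i < 0" | "i = j" "i > 1" | "i \<noteq> j" by linarith
  thus "cf (dd * zz) i j = cf (zz * dd + 1) i j"
  proof cases
    case 3
    hence "nat (1 - i) \<ge> 2" "nat (1 - i) > 0" by auto
    thus ?thesis using 3 by (simp add: cf_add cf_mono_mult cf_1 p2 pc_left_0)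
  qed (simp_all add: cf_add cf_mono_mult cf_1 p1 cs_1 pc_left_0)
qed

lemma dd_dinv [simp]: "dd * dinv = 1" and dinv_dd [simp]: "dinv * dd = 1"
  and mono_zz: "mono_psd (-1) 0 * zz = 1" and zz_mono: "zz * mono_psd (-1) 0 = 1"
proof -
  have p: "pc (nat (- i)) a 0 = (if i = 0 then 1 else 0)" "pc (nat (- i)) 0 a = (if i = 0 then 1 else 0)" if "i \<le> 0" for i a
    using that by (auto simp: pc_left_0 pc_right_0)
  show "dd * dinv = 1" "dinv * dd = 1" "mono_psd (-1) 0 * zz = 1" "zz * mono_psd (-1) 0 = 1"
    by (rule psd_eqI, auto simp: cf_mono_mult cf_1 p cs_1)+
qed

lemma zf_1 [simp]: "zf 1 = 1"
  by (rule psd_eqI) (auto simp: cf_zf cf_1 cs_1)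

lemma zf_add: "zf (F + G) = zf F + zf G"
  by (rule psd_eqI) (simp add: cf_zf cf_add cs_add)

lemma zf_X: "zf fps_X = mono_psd (-1) 0"
  by (rule psd_eqI) (auto simp: cf_zf cf_mono cs_1 fps_X_def nat_eq_iff2)

lemma zf_const: "zf (fps_const c) = psc c"
  by (rule psd_eqI) (auto simp: cf_zf cf_kc psc_def)

lemma zf_mult: "zf (F * G) = (zf F * zf G :: 'a::calg psd)"
proof (rule psd_eqI)
  fix i j :: int
  have b: "bnd 0 (cf (zf F :: 'a psd))" "bnd 0 (cf (zf G :: 'a psd))" by (auto simp: bnd_def cf_zf split: if_splits)
  define c where "c = min i (min j 0)"
  have c: "c \<le> i - 0" "c \<le> j - 0" "2 * 0 - i \<le> int (nat (- i))" "c \<le> 0" by (auto simp: c_def)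
  let ?f = "cf (zf F :: 'a psd)" and ?g = "cf (zf G :: 'a psd)"
  have "cf (zf F * zf G :: 'a psd) i j = (\<Sum>i1\<in>{c..0}. \<Sum>j1\<in>{c..0}. \<Sum>k\<le>nat (- i).
     cs (pc k j1 (i + int k - i1)) * (?f i1 j1 * ?g (i + int k - i1) (j + int k - j1)))"
    unfolding cf_mult by (rule pmul_box1[OF b c(1-3)])
  also have "\<dots> = (\<Sum>i1\<in>{c..0}. \<Sum>j1\<in>{c..0}. \<Sum>k\<le>nat (- i). if k = 0 then ?f i1 j1 * ?g (i - i1) (j - j1) else 0)"
    by (intro sum.cong refl) (auto simp: cf_zf pc_left_0 cs_1)
  also have "\<dots> = (\<Sum>i1\<in>{c..0}. \<Sum>j1\<in>{c..0}. if j1 = 0 then ?f i1 0 * ?g (i - i1) j else 0)"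
    by (intro sum.cong refl) (auto simp: cf_zf sum.delta)
  also have "\<dots> = (\<Sum>i1\<in>{c..0}. ?f i1 0 * ?g (i - i1) j)"
    using c(4) by (simp add: sum.delta)
  also have "\<dots> = cf (zf (F * G) :: 'a psd) i j"
  proof (cases "j = 0")
    case False
    thus ?thesis by (simp add: cf_zf)
  next
    case j: True
    show ?thesis
    proof (cases "i \<le> 0")
      case False
      thus ?thesis by (auto simp: cf_zf intro!: sum.neutral)
    next
      case True
      have ci: "c = i" using True j by (simp add: c_def)
      have "(\<Sum>i1\<in>{c..0}. ?f i1 0 * ?g (i - i1) j) = (\<Sum>k=0..nat (- i). cs (fps_nth F k * fps_nth G (nat (- i) - k)))"
        unfolding ci using True j
        by (intro sum.reindex_bij_witness[of _ "\<lambda>k. - int k" "\<lambda>i1. nat (- i1)"])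
           (auto simp: cf_zf cs_mult nat_diff_distrib' intro!: arg_cong2[where f = "\<lambda>a b. cs (fps_nth F a) * cs (fps_nth G b)"])
      thus ?thesis using True j by (simp add: cf_zf fps_mult_nth cs_sum)
    qed
  qed
  finally show "cf (zf (F * G) :: 'a psd) i j = cf (zf F * zf G) i j" ..
qed

lemma zf_minus: "zf (F - G) = (zf F - zf G :: 'a::calg psd)"
proof -
  have "zf F = (zf (F - G) + zf G :: 'a psd)" by (simp add: zf_add[symmetric])
  thus ?thesis by simp
qed

lemma zf_comm: "zf F * zf G = zf G * zf F"
  by (simp add: zf_mult[symmetric] mult.commute)

lemma zz_zf: "zz * zf F = (zf F * zz :: 'a::calg psd)"
proof -
  have "zz * zf F = zz * zf F * (zf fps_X * zz :: 'a psd)" by (simp add: zf_X mono_zz)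
  also have "\<dots> = zz * (zf F * zf fps_X) * zz" by (simp only: mult.assoc)
  also have "\<dots> = zz * (zf fps_X * zf F) * zz" by (simp only: zf_comm[of F])
  also have "\<dots> = zz * zf fps_X * (zf F * zz)" by (simp only: mult.assoc)
  finally show ?thesis by (simp add: zf_X zz_mono)
qed

text \<open>The power \<open>(z - a)\<^sup>-\<^sup>m\<close> expanded in \<open>1 / z\<close>,
  through the same power series as \<open>psdo_frac\<close>.\<close>

definition fr :: "complex \<Rightarrow> nat \<Rightarrow> 'a::calg psd" where
  "fr a m = zf ((fps_X / (1 - fps_const a * fps_X)) ^ m)"

lemma fr_0 [simp]: "fr a 0 = 1" by (simp add: fr_def)

lemma fr_Suc: "(zz - psc a) * fr a (Suc m) = (fr a m :: 'a::calg psd)"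
proof -
  let ?q = "inverse (1 - fps_const a * fps_X) :: complex fps" and ?G = "(fps_X / (1 - fps_const a * fps_X) :: complex fps)"
  have G: "?G = fps_X * ?q" by (rule fps_divide_unit) simp
  have q: "?q * (1 - fps_const a * fps_X) = 1" by (rule inverse_mult_eq_1) simp
  have "?q - fps_const a * (fps_X * ?q) = ?q * (1 - fps_const a * fps_X)" by (simp add: algebra_simps)
  hence q': "?q - fps_const a * (fps_X * ?q) = 1" using q by simp
  have "zz * zf ?G = (zf ?q :: 'a psd)" unfolding G zf_mult zf_X by (simp only: mult.assoc[symmetric] zz_mono mult_1_left)
  moreover have "psc a * zf ?G = (zf (fps_const a * (fps_X * ?q)) :: 'a psd)" unfolding G by (simp only: zf_mult zf_const)
  ultimately have "(zz - psc a) * zf ?G = (1 :: 'a psd)" by (simp only: left_diff_distrib zf_minus[symmetric] q' zf_1)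
  thus ?thesis by (simp add: fr_def zf_mult mult.assoc[symmetric])
qed

lemma fr_Suc': "fr a (Suc m) * (zz - psc a) = (fr a m :: 'a::calg psd)"
proof -
  have "fr a (Suc m) * (zz - psc a) = (zz - psc a) * (fr a (Suc m) :: 'a psd)"
    by (simp add: fr_def left_diff_distrib right_diff_distrib zz_zf psc_comm)
  thus ?thesis by (simp add: fr_Suc)
qed

section \<open>Inverses by geometric series\<close>

definition pval :: "int \<Rightarrow> 'a::calg psd \<Rightarrow> bool" where
  "pval N f \<longleftrightarrow> (\<forall>i j. cf f i j \<noteq> 0 \<longrightarrow> i \<le> 0 \<and> j \<le> - N)"

lemma pvalD: "pval N f \<Longrightarrow> 0 < i \<or> - N < j \<Longrightarrow> cf f i j = 0"
  unfolding pval_def by force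

lemma pval_mono: "pval N f \<Longrightarrow> N' \<le> N \<Longrightarrow> pval N' f"
  unfolding pval_def by force

lemma pval_0: "pval N 0" by (simp add: pval_def cf_0)

lemma pval_add: "pval N f \<Longrightarrow> pval N g \<Longrightarrow> pval N (f + g)"
  unfolding pval_def cf_add by (metis add.right_neutral)

lemma pval_minus: "pval N f \<Longrightarrow> pval N (- f)"
  unfolding pval_def cf_minus by simp

lemma pval_diff: "pval N f \<Longrightarrow> pval N g \<Longrightarrow> pval N (f - g)"
  using pval_add[OF _ pval_minus] by fastforce

lemma pval_sum: "(\<And>i. i \<in> A \<Longrightarrow> pval N (f i)) \<Longrightarrow> pval N (sum f A)"
  by (induction A rule: infinite_finite_induct) (simp_all add: pval_0 pval_add)

lemma pval_mult:
  assumes "pval M f" "pval N g" shows "pval (M + N) (f * g)"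
  unfolding pval_def cf_mult
proof (intro allI impI)
  fix i j assume "pmul (cf f) (cf g) i j \<noteq> 0"
  then obtain i1 j1 i2 j2 k where *: "cf f i1 j1 \<noteq> 0" "cf g i2 j2 \<noteq> 0" "i1 + i2 = i + int k" "j1 + j2 = j + int k"
    by (rule pmul_nonzeroE)
  have "i1 \<le> 0" "j1 \<le> - M" "i2 \<le> 0" "j2 \<le> - N" using assms *(1,2) by (auto simp: pval_def)
  thus "i \<le> 0 \<and> j \<le> - (M + N)" using *(3,4) by linarith
qed

lemma pval_1: "pval 0 1" by (simp add: pval_def cf_1)
lemma pval_dinv: "pval 1 dinv" by (simp add: pval_def cf_mono)
lemma pval_zf: "pval 0 (zf F)" by (simp add: pval_def cf_zf)
lemma pval_kc: "pval 0 (kc a)" by (simp add: pval_def cf_kc)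

lemma pval_eq_0:
  assumes "\<And>N. pval (int N) f" shows "f = 0"
proof (rule psd_eqI)
  fix i j
  have "- int (nat (1 - j)) < j" by linarith
  hence "cf f i j = 0" by (intro pvalD[OF assms[of "nat (1 - j)"]]) simp
  thus "cf f i j = cf 0 i j" by (simp add: cf_0)
qed

lemma cf_sum: "cf (sum f A) i j = (\<Sum>a\<in>A. cf (f a) i j)"
  by (induction A rule: infinite_finite_induct) (simp_all add: cf_0 cf_add)

primrec mpow :: "nat set \<Rightarrow> (nat \<Rightarrow> nat \<Rightarrow> 'r::ring_1) \<Rightarrow> nat \<Rightarrow> nat \<Rightarrow> nat \<Rightarrow> 'r" where
  "mpow I R 0 = (\<lambda>a b. if a = b then 1 else 0)"
| "mpow I R (Suc m) = (\<lambda>a b. \<Sum>c\<in>I. R a c * mpow I R m c b)"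

lemma mpow_Suc_right:
  assumes "finite I" "a \<in> I" "b \<in> I"
  shows "mpow I R (Suc m) a b = (\<Sum>c\<in>I. mpow I R m a c * R c b)"
  using assms(2)
proof (induction m arbitrary: a)
  case 0
  show ?case using assms 0 by (simp add: sum_mult_delta)
next
  case (Suc m)
  have "mpow I R (Suc (Suc m)) a b = (\<Sum>c\<in>I. R a c * mpow I R (Suc m) c b)" by simp
  also have "\<dots> = (\<Sum>c\<in>I. R a c * (\<Sum>e\<in>I. mpow I R m c e * R e b))"
    by (intro sum.cong refl) (simp only: Suc.IH)
  also have "\<dots> = (\<Sum>c\<in>I. \<Sum>e\<in>I. R a c * mpow I R m c e * R e b)"
    by (simp only: sum_distrib_left mult.assoc)
  also have "\<dots> = (\<Sum>e\<in>I. \<Sum>c\<in>I. R a c * mpow I R m c e * R e b)" by (rule sum.swap)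
  finally show ?case by (simp add: sum_distrib_right)
qed

text \<open>\<open>S\<close> is the sum of all powers of \<open>R\<close>. For
  \<open>\<partial>\<close>-exponent \<open>j\<close> only the powers up to \<open>- j\<close>
  contribute, and the bound 0 on the \<open>z\<close>-exponents in \<open>pval\<close> survives the
  infinite sum, so \<open>S\<close> is again a series. Each equation holds because the difference of
  its sides lies in \<open>pval N\<close> for every \<open>N\<close>.\<close>

lemma geometric_inverse:
  fixes R :: "nat \<Rightarrow> nat \<Rightarrow> 'a::calg psd"
  assumes fin: "finite I" and R: "\<And>a b. pval 1 (R a b)"
  obtains S where "\<And>a b. a \<in> I \<Longrightarrow> b \<in> I \<Longrightarrow> S a b = (if a = b then 1 else 0) + (\<Sum>c\<in>I. R a c * S c b)"
    and "\<And>a b. a \<in> I \<Longrightarrow> b \<in> I \<Longrightarrow> S a b = (if a = b then 1 else 0) + (\<Sum>c\<in>I. S a c * R c b)"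
    and "\<And>a b. pval 0 (S a b)"
proof -
  let ?P = "mpow I R"
  have P: "pval (int m) (?P m a b)" for m a b
  proof (induction m arbitrary: a b)
    case 0
    show ?case by (simp add: pval_1 pval_0)
  next
    case (Suc m)
    have "pval (1 + int m) (R a c * ?P m c b)" for c by (rule pval_mult[OF R Suc.IH])
    thus ?case by (simp add: pval_sum)
  qed
  define S where "S a b = Psd (\<lambda>i j. \<Sum>m\<le>nat (- j). cf (?P m a b) i j)" for a b
  have cfS: "cf (S a b) = (\<lambda>i j. \<Sum>m\<le>nat (- j). cf (?P m a b) i j)" for a b
    unfolding S_def
  proof (rule cf_Psd[of 0], unfold bnd_def, intro allI impI)
    fix i j assume "(\<Sum>m\<le>nat (- j). cf (?P m a b) i j) \<noteq> 0"
    then obtain m where "cf (?P m a b) i j \<noteq> 0" by (meson sum.not_neutral_contains_not_neutral)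
    thus "i \<le> 0 \<and> j \<le> 0" using P[of m a b] unfolding pval_def by force
  qed
  have tail: "pval (int N + 1) (S a b - (\<Sum>m\<le>N. ?P m a b))" for N a b
    unfolding pval_def
  proof (intro allI impI, rule ccontr)
    fix i j assume nz: "cf (S a b - (\<Sum>m\<le>N. ?P m a b)) i j \<noteq> 0" and "\<not> (i \<le> 0 \<and> j \<le> - (int N + 1))"
    hence ij: "0 < i \<or> nat (- j) \<le> N" by auto
    have "(\<Sum>m\<le>nat (- j). cf (?P m a b) i j) = (\<Sum>m\<le>N. cf (?P m a b) i j)"
    proof (cases "0 < i")
      case True
      hence "cf (?P m a b) i j = 0" for m by (intro pvalD[OF P]) auto
      thus ?thesis by simp
    next
      case False
      hence "nat (- j) \<le> N" using ij by simp
      moreover have "cf (?P m a b) i j = 0" if "nat (- j) < m" for m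
        using that by (intro pvalD[OF P]) auto
      ultimately show ?thesis by (intro sum.mono_neutral_left) auto
    qed
    thus False using nz by (simp add: cf_diff cfS cf_sum)
  qed
  show ?thesis
  proof (rule that[of S])
    show "pval 0 (S a b)" for a b
    proof -
      have "pval 0 (S a b - (\<Sum>m\<le>0. ?P m a b))" using tail[of 0 a b] by (rule pval_mono) simp
      hence "pval 0 ((S a b - (\<Sum>m\<le>0. ?P m a b)) + (\<Sum>m\<le>0. ?P m a b))"
        by (rule pval_add) (simp add: pval_0 pval_1)
      thus ?thesis by simp
    qed
    fix a b assume ab: "a \<in> I" "b \<in> I"
    have shift: "(\<Sum>m\<le>Suc N. ?P m a b) = (if a = b then 1 else 0) + (\<Sum>m\<le>N. ?P (Suc m) a b)" for N
      by (simp only: sum.atMost_Suc_shift mpow.simps(1))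
    show "S a b = (if a = b then 1 else 0) + (\<Sum>c\<in>I. R a c * S c b)"
    proof -
      have "pval (int N) (S a b - ((if a = b then 1 else 0) + (\<Sum>c\<in>I. R a c * S c b)))" for N
      proof -
        have "(\<Sum>m\<le>N. ?P (Suc m) a b) = (\<Sum>c\<in>I. R a c * (\<Sum>m\<le>N. ?P m c b))"
          unfolding sum_distrib_left by (subst sum.swap) simp
        hence "S a b - ((if a = b then 1 else 0) + (\<Sum>c\<in>I. R a c * S c b))
          = (S a b - (\<Sum>m\<le>Suc N. ?P m a b)) - (\<Sum>c\<in>I. R a c * (S c b - (\<Sum>m\<le>N. ?P m c b)))"
          unfolding shift by (simp add: right_diff_distrib sum_subtractf)
        moreover have "pval (int N) (S a b - (\<Sum>m\<le>Suc N. ?P m a b))"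
          by (rule pval_mono[OF tail]) simp
        moreover have "pval (int N) (\<Sum>c\<in>I. R a c * (S c b - (\<Sum>m\<le>N. ?P m c b)))"
          by (rule pval_sum, rule pval_mono[OF pval_mult[OF R tail]]) simp
        ultimately show ?thesis by (simp only: pval_diff)
      qed
      from pval_eq_0[OF this] show ?thesis by simp
    qed
    show "S a b = (if a = b then 1 else 0) + (\<Sum>c\<in>I. S a c * R c b)"
    proof -
      have "pval (int N) (S a b - ((if a = b then 1 else 0) + (\<Sum>c\<in>I. S a c * R c b)))" for N
      proof -
        have "(\<Sum>m\<le>N. ?P (Suc m) a b) = (\<Sum>m\<le>N. \<Sum>c\<in>I. ?P m a c * R c b)"
          by (simp only: mpow_Suc_right[OF fin ab])
        also have "\<dots> = (\<Sum>c\<in>I. (\<Sum>m\<le>N. ?P m a c) * R c b)"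
          unfolding sum_distrib_right by (rule sum.swap)
        finally have "S a b - ((if a = b then 1 else 0) + (\<Sum>c\<in>I. S a c * R c b))
          = (S a b - (\<Sum>m\<le>Suc N. ?P m a b)) - (\<Sum>c\<in>I. (S a c - (\<Sum>m\<le>N. ?P m a c)) * R c b)"
          unfolding shift by (simp add: left_diff_distrib sum_subtractf)
        moreover have "pval (int N) (S a b - (\<Sum>m\<le>Suc N. ?P m a b))"
          by (rule pval_mono[OF tail]) simp
        moreover have "pval (int N) (\<Sum>c\<in>I. (S a c - (\<Sum>m\<le>N. ?P m a c)) * R c b)"
          by (rule pval_sum, rule pval_mono[OF pval_mult[OF tail R]]) simp
        ultimately show ?thesis by (simp only: pval_diff)
      qed
      from pval_eq_0[OF this] show ?thesis by simp
    qed
  qed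
qed

text \<open>The geometric series for a matrix of size one.\<close>

lemma unit_one_plus:
  fixes f :: "'a::calg psd"
  assumes "pval 1 f"
  obtains v where "(1 + f) * v = 1" "v * (1 + f) = 1"
proof -
  have *: "a + b = 1" if "a = 1 + - b" for a b :: "'a psd" using that by simp
  show ?thesis
  proof (rule geometric_inverse[of "{1}" "\<lambda>a b. - f"])
    show "pval 1 (- f)" by (rule pval_minus[OF assms])
    fix S :: "nat \<Rightarrow> nat \<Rightarrow> 'a psd"
    assume S1: "\<And>a b. a \<in> {1::nat} \<Longrightarrow> b \<in> {1} \<Longrightarrow> S a b = (if a = b then 1 else 0) + (\<Sum>c\<in>{1}. - f * S c b)"
      and S2: "\<And>a b. a \<in> {1::nat} \<Longrightarrow> b \<in> {1} \<Longrightarrow> S a b = (if a = b then 1 else 0) + (\<Sum>c\<in>{1}. S a c * - f)"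
    have "S 1 1 + f * S 1 1 = 1" by (rule *, subst S1[of 1 1]) simp_all
    moreover have "S 1 1 + S 1 1 * f = 1" by (rule *, subst S2[of 1 1]) simp_all
    ultimately show ?thesis
      by (intro that[of "S 1 1"]) (simp_all only: distrib_left distrib_right mult_1_left mult_1_right)
  qed simp
qed

text \<open>Factoring out the derivation leaves \<open>1 - dinv * u\<close>, a perturbation of 1 in
  \<open>pval 1\<close>. The inverses \<open>V\<close> of the diagonal entries of \<open>X\<close>
  are recorded as well, because the factors of the Berezinian are defined through them; they exist
  since such an entry is 1 plus a term of \<open>pval 1\<close>, times \<open>dinv\<close>.\<close>

lemma dd_matrix_inverse:
  fixes u :: "nat \<Rightarrow> nat \<Rightarrow> 'a::calg psd"
  assumes fin: "finite I" and u: "\<And>a b. pval 0 (u a b)"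
  defines "M \<equiv> \<lambda>a b. (if a = b then dd else 0) - u a b"
  obtains X V where "\<And>a b. a \<in> I \<Longrightarrow> b \<in> I \<Longrightarrow> (\<Sum>c\<in>I. M a c * X c b) = (if a = b then 1 else 0)"
    and "\<And>a b. a \<in> I \<Longrightarrow> b \<in> I \<Longrightarrow> (\<Sum>c\<in>I. X a c * M c b) = (if a = b then 1 else 0)"
    and "\<And>a. a \<in> I \<Longrightarrow> X a a * V a = 1" and "\<And>a. a \<in> I \<Longrightarrow> V a * X a a = 1"
proof -
  define R where "R a b = dinv * u a b" for a b
  have R: "pval 1 (R a b)" for a b
    using pval_mult[OF pval_dinv u] by (simp add: R_def)
  have M: "M a b = dd * ((if a = b then 1 else 0) - R a b)" for a b
    by (simp add: M_def R_def right_diff_distrib mult.assoc[symmetric])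
  obtain S where S1: "\<And>a b. a \<in> I \<Longrightarrow> b \<in> I \<Longrightarrow> S a b = (if a = b then 1 else 0) + (\<Sum>c\<in>I. R a c * S c b)"
    and S2: "\<And>a b. a \<in> I \<Longrightarrow> b \<in> I \<Longrightarrow> S a b = (if a = b then 1 else 0) + (\<Sum>c\<in>I. S a c * R c b)"
    and S0: "\<And>a b. pval 0 (S a b)"
    by (rule geometric_inverse[OF fin, of R], rule R, rule that; assumption)
  define X where "X a b = S a b * dinv" for a b
  have "\<exists>v. X a a * v = 1 \<and> v * X a a = 1" if a: "a \<in> I" for a
  proof -
    have "pval 1 (\<Sum>c\<in>I. R a c * S c a)"
      using pval_mult[OF R S0] by (intro pval_sum) simp
    then obtain v where "(1 + (\<Sum>c\<in>I. R a c * S c a)) * v = 1" "v * (1 + (\<Sum>c\<in>I. R a c * S c a)) = 1"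
      by (rule unit_one_plus)
    moreover have "S a a = 1 + (\<Sum>c\<in>I. R a c * S c a)" by (subst S1[OF a a]) (simp only: if_True refl simp_thms)
    ultimately have v: "S a a * v = 1" "v * S a a = 1" by (simp_all only:)
    have "X a a * (dd * v) = S a a * (dinv * dd) * v" by (simp only: X_def mult.assoc)
    moreover have "(dd * v) * X a a = dd * (v * S a a) * dinv" by (simp only: X_def mult.assoc)
    ultimately have "X a a * (dd * v) = 1" "(dd * v) * X a a = 1" by (simp_all add: v)
    thus ?thesis by blast
  qed
  then obtain V where V: "\<And>a. a \<in> I \<Longrightarrow> X a a * V a = 1" "\<And>a. a \<in> I \<Longrightarrow> V a * X a a = 1" by metis
  show ?thesis
  proof (rule that[of X V])
    fix a b assume ab: "a \<in> I" "b \<in> I"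
    have *: "u - w = v" if "u = v + w" for u v w :: "'a psd" using that by simp
    have "(\<Sum>c\<in>I. ((if a = c then 1 else 0) - R a c) * S c b) = (if a = b then 1 else 0)"
      unfolding left_diff_distrib sum_subtractf sum_mult_delta(4)[OF fin ab(1)] by (rule *[OF S1[OF ab]])
    moreover have "(\<Sum>c\<in>I. M a c * X c b) = dd * (\<Sum>c\<in>I. ((if a = c then 1 else 0) - R a c) * S c b) * dinv"
      by (simp only: M X_def sum_distrib_left sum_distrib_right mult.assoc)
    ultimately show "(\<Sum>c\<in>I. M a c * X c b) = (if a = b then 1 else 0)" by simp
    have "(\<Sum>c\<in>I. S a c * ((if c = b then 1 else 0) - R c b)) = (if a = b then 1 else 0)"
      unfolding right_diff_distrib sum_subtractf sum_mult_delta(1)[OF fin ab(2)] by (rule *[OF S2[OF ab]])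
    moreover have "(\<Sum>c\<in>I. X a c * M c b) = (\<Sum>c\<in>I. S a c * ((if c = b then 1 else 0) - R c b))"
    proof (intro sum.cong refl)
      fix c
      have "X a c * M c b = S a c * (dinv * dd) * ((if c = b then 1 else 0) - R c b)"
        by (simp only: M X_def mult.assoc)
      thus "X a c * M c b = S a c * ((if c = b then 1 else 0) - R c b)" by (simp only: dinv_dd mult_1_right)
    qed
    ultimately show "(\<Sum>c\<in>I. X a c * M c b) = (if a = b then 1 else 0)" by simp
  qed (use V in auto)
qed

section \<open>Change of coefficients and generated subalgebras\<close>

definition alg_hom :: "('a::calg \<Rightarrow> 'b::calg) \<Rightarrow> bool" where
  "alg_hom h \<longleftrightarrow> (\<forall>a b. h (a + b) = h a + h b) \<and> (\<forall>a b. h (a * b) = h a * h b) \<and> (\<forall>c. h (cs c) = cs c)"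

definition pmap :: "('a::calg \<Rightarrow> 'b::calg) \<Rightarrow> 'a psd \<Rightarrow> 'b psd" where
  "pmap h f = Psd (\<lambda>i j. h (cf f i j))"

context
  fixes h :: "'a::calg \<Rightarrow> 'b::calg"
  assumes h: "alg_hom h"
begin

lemma hom_add: "h (a + b) = h a + h b" and hom_mult: "h (a * b) = h a * h b" and hom_cs: "h (cs c) = cs c"
  and hom_0: "h 0 = 0" and hom_1: "h 1 = 1"
  using h unfolding alg_hom_def by (auto, (metis cs_0 cs_1)+)

lemma hom_sum: "h (sum f A) = (\<Sum>i\<in>A. h (f i))"
  by (induction A rule: infinite_finite_induct) (simp_all add: hom_0 hom_add)

lemma cf_pmap: "cf (pmap h f) = (\<lambda>i j. h (cf f i j))"
proof -
  obtain R where "bnd R (cf f)" by (rule bnd_cf)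
  thus ?thesis unfolding pmap_def by (intro cf_Psd[of R]) (auto simp: bnd_def, (metis hom_0)+)
qed

lemma pmap_add: "pmap h (f + g) = pmap h f + pmap h g"
  by (rule psd_eqI) (simp add: cf_pmap cf_add hom_add)

lemma pmap_0: "pmap h 0 = 0"
  by (rule psd_eqI) (simp add: cf_pmap cf_0 hom_0)

lemma pmap_1: "pmap h 1 = 1"
  by (rule psd_eqI) (simp add: cf_pmap cf_1 hom_0 hom_1)

lemma pmap_minus: "pmap h (- f) = - pmap h f"
proof -
  have "h (- a) = - h a" for a using hom_add[of a "- a"] by (simp add: hom_0 eq_neg_iff_add_eq_0 add.commute)
  thus ?thesis by (intro psd_eqI) (simp add: cf_pmap cf_minus)
qed

lemma pmap_diff: "pmap h (f - g) = pmap h f - pmap h g"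
  using pmap_add[of f "- g"] by (simp add: pmap_minus)

lemma pmap_mult: "pmap h (f * g) = pmap h f * pmap h g"
proof (rule psd_eqI)
  fix i j
  obtain R where R: "bnd R (cf f)" "bnd R (cf g)" by (rule bnd_cf2)
  \<comment> \<open>The homomorphism may annihilate coefficients, so the index set for the image can
    be smaller; the terms lost are zero.\<close>
  have "(\<Sum>(i1, j1, i2, j2, k)\<in>pidx (cf f) (cf g) i j. cs (pc k j1 i2) * (h (cf f i1 j1) * h (cf g i2 j2)))
    = (\<Sum>(i1, j1, i2, j2, k)\<in>pidx (\<lambda>i j. h (cf f i j)) (\<lambda>i j. h (cf g i j)) i j. cs (pc k j1 i2) * (h (cf f i1 j1) * h (cf g i2 j2)))"
    by (rule sum.mono_neutral_right[OF finite_pidx[OF R]]) (auto simp: pidx_def hom_0)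
  thus "cf (pmap h (f * g)) i j = cf (pmap h f * pmap h g) i j"
    unfolding cf_pmap cf_mult pmul_def by (simp add: hom_sum case_prod_unfold hom_mult hom_cs)
qed

lemma pmap_sum: "pmap h (sum f A) = (\<Sum>i\<in>A. pmap h (f i))"
  by (induction A rule: infinite_finite_induct) (simp_all add: pmap_0 pmap_add)

lemma pmap_kc: "pmap h (kc a) = kc (h a)"
  by (rule psd_eqI) (simp add: cf_pmap cf_kc hom_0)

lemma pmap_psc: "pmap h (psc c) = psc c"
  by (simp add: psc_def pmap_kc hom_cs)

lemma pmap_mono: "pmap h (mono_psd p q) = mono_psd p q"
  by (rule psd_eqI) (simp add: cf_pmap cf_mono hom_0 hom_1)

lemma pmap_zf: "pmap h (zf F) = zf F"
  by (rule psd_eqI) (simp add: cf_pmap cf_zf hom_0 hom_cs)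

end

inductive_set tgen :: "'a::calg set \<Rightarrow> 'a set" for S where
  one: "1 \<in> tgen S"
| gen: "x \<in> S \<Longrightarrow> x \<in> tgen S"
| add: "x \<in> tgen S \<Longrightarrow> y \<in> tgen S \<Longrightarrow> x + y \<in> tgen S"
| mult: "x \<in> tgen S \<Longrightarrow> y \<in> tgen S \<Longrightarrow> x * y \<in> tgen S"
| cs: "x \<in> tgen S \<Longrightarrow> cs c * x \<in> tgen S"

lemma tgen_cs: "cs c \<in> tgen S"
  using tgen.cs[OF tgen.one, of c S] by simp

lemma tgen_0: "0 \<in> tgen S"
  using tgen_cs[of 0 S] by simp

lemma tgen_sum: "(\<And>i. i \<in> A \<Longrightarrow> f i \<in> tgen S) \<Longrightarrow> sum f A \<in> tgen S"
  by (induction A rule: infinite_finite_induct) (auto intro: tgen_0 tgen.add)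

lemma tgen_minimal: "S \<subseteq> tgen T \<Longrightarrow> tgen S \<subseteq> tgen T"
proof
  fix x assume S: "S \<subseteq> tgen T" and "x \<in> tgen S"
  from this(2) show "x \<in> tgen T" by induction (use S in \<open>auto intro: tgen.intros\<close>)
qed

lemma tgen_image:
  assumes h: "alg_hom h" shows "h ` tgen S = tgen (h ` S)"
proof (intro equalityI subsetI)
  fix y assume "y \<in> h ` tgen S"
  then obtain x where x: "x \<in> tgen S" "y = h x" by auto
  from x(1) show "y \<in> tgen (h ` S)" unfolding x(2)
    by induction (auto simp: hom_1[OF h] hom_add[OF h] hom_mult[OF h] hom_cs[OF h] intro: tgen.intros)
next
  fix y assume "y \<in> tgen (h ` S)"
  thus "y \<in> h ` tgen S"
  proof induction
    case one
    show ?case using hom_1[OF h] tgen.one by (metis image_eqI)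
  next
    case (add x y)
    then obtain x' y' where "x' \<in> tgen S" "x = h x'" "y' \<in> tgen S" "y = h y'" by auto
    thus ?case using hom_add[OF h, of x' y'] by (auto intro!: image_eqI[of _ _ "x' + y'"] tgen.add)
  next
    case (mult x y)
    then obtain x' y' where "x' \<in> tgen S" "x = h x'" "y' \<in> tgen S" "y = h y'" by auto
    thus ?case using hom_mult[OF h, of x' y'] by (auto intro!: image_eqI[of _ _ "x' * y'"] tgen.mult)
  next
    case (cs x c)
    then obtain x' where "x' \<in> tgen S" "x = h x'" by auto
    thus ?case using hom_mult[OF h, of "cs c" x'] hom_cs[OF h, of c] by (auto intro!: image_eqI[of _ _ "cs c * x'"] tgen.cs)
  qed (auto intro: tgen.gen)
qed

text \<open>Series over the subalgebra generated by \<open>S\<close>. Closure under products and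
  under \<open>om\<close> turns an identity between series into an inclusion of generated
  subalgebras.\<close>

definition pcoef :: "'a::calg set \<Rightarrow> 'a psd set" where
  "pcoef S = {f. \<forall>i j. cf f i j \<in> tgen S}"

lemma pcoef_mult: "f \<in> pcoef S \<Longrightarrow> g \<in> pcoef S \<Longrightarrow> f * g \<in> pcoef S"
  unfolding pcoef_def by (auto simp: cf_mult pmul_def intro!: tgen_sum tgen.cs tgen.mult)

lemma pcoef_om: "om f \<in> pcoef S \<longleftrightarrow> f \<in> pcoef S"
  unfolding pcoef_def by (auto simp: cf_om)

lemma pcoef_1: "1 \<in> pcoef S"
  by (auto simp: pcoef_def cf_1 intro: tgen.one tgen_0)

lemma pcoef_diff: "f \<in> pcoef S \<Longrightarrow> g \<in> pcoef S \<Longrightarrow> f - g \<in> pcoef S"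
proof -
  assume fg: "f \<in> pcoef S" "g \<in> pcoef S"
  have m: "cs (-1) = (- 1 :: 'a)" using cs_add[of 1 "-1", where 'a = 'a] by (simp add: cs_1 eq_neg_iff_add_eq_0 add.commute)
  have "cf f i j - cf g i j \<in> tgen S" for i j
  proof -
    have "cf f i j + cs (-1) * cf g i j \<in> tgen S" by (intro tgen.add tgen.cs) (use fg in \<open>simp_all add: pcoef_def\<close>)
    thus ?thesis by (simp add: m)
  qed
  thus ?thesis by (simp add: pcoef_def cf_diff)
qed

lemma pcoef_scalar: "mono_psd p q \<in> pcoef S" "psc c \<in> pcoef S" "zf F \<in> pcoef S"
  by (auto simp: pcoef_def cf_mono cf_kc psc_def cf_zf intro: tgen.one tgen_0 tgen_cs)

section \<open>Resolvents of Jordan matrices\<close>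

text \<open>The number, counted from 1, of the Jordan block that contains position
  \<open>r\<close>.\<close>

definition blk :: "(nat \<Rightarrow> nat) \<Rightarrow> nat \<Rightarrow> nat" where
  "blk c r = (LEAST i. r \<le> block_start c (i + 1))"

lemma block_start_Suc: "1 \<le> i \<Longrightarrow> block_start c (i + 1) = block_start c i + c i"
  unfolding block_start_def Suc_eq_plus1[symmetric] by (rule sum.atLeastLessThan_Suc)

lemma block_start_1 [simp]: "block_start c 1 = 0" and block_start_0 [simp]: "block_start c 0 = 0"
  by (simp_all add: block_start_def)

lemma block_start_mono: "i \<le> j \<Longrightarrow> block_start c i \<le> block_start c j"
  unfolding block_start_def by (rule sum_mono2) auto

lemma block_start_total: "block_start c (m + 1) = (\<Sum>i=1..m. c i)"
proof -
  have "{1..<m + 1} = {1..m}" by auto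
  thus ?thesis by (simp add: block_start_def)
qed

lemma blk_eqI:
  assumes "block_start c i < r" "r \<le> block_start c (i + 1)"
  shows "blk c r = i"
  unfolding blk_def
proof (rule Least_equality)
  show "r \<le> block_start c (i + 1)" by (rule assms(2))
  fix i' assume "r \<le> block_start c (i' + 1)"
  hence "\<not> i' + 1 \<le> i" using block_start_mono[of "i' + 1" i c] assms(1) by auto
  thus "i \<le> i'" by simp
qed

lemma blk_block:
  assumes "r \<in> {1..(\<Sum>i=1..m. c i)}"
  shows "blk c r \<in> {1..m}" "block_start c (blk c r) < r" "r \<le> block_start c (blk c r + 1)"
proof -
  have m: "r \<le> block_start c (m + 1)" using assms by (simp only: block_start_total) simp
  show u: "r \<le> block_start c (blk c r + 1)" unfolding blk_def by (rule LeastI[of _ m]) (rule m)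
  have "blk c r \<le> m" unfolding blk_def by (rule Least_le) (rule m)
  moreover have "blk c r \<noteq> 0" using u assms by (cases "blk c r = 0") auto
  ultimately show b: "blk c r \<in> {1..m}" by simp
  have "\<not> r \<le> block_start c (blk c r - 1 + 1)"
    unfolding blk_def by (rule not_less_Least) (use b in \<open>auto simp: blk_def\<close>)
  thus "block_start c (blk c r) < r" using b by simp
qed

text \<open>Stated for the list of blocks from \<open>p\<close> on, so that the induction can split
  off the first block. The added 1 passes from matrix indices, which start at 0, to positions, which
  start at 1.\<close>

lemma jordan_matrix_entry:
  assumes "1 \<le> p" "p \<le> m + 1" "a < block_start c (m + 1) - block_start c p" "b < block_start c (m + 1) - block_start c p"
  shows "jordan_matrix (map (\<lambda>i. (c i, w i)) [p..<m + 1]) $$ (a, b)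
    = (if a = b then w (blk c (block_start c p + a + 1))
       else if b = a + 1 \<and> blk c (block_start c p + a + 1) = blk c (block_start c p + b + 1) then 1 else 0)"
  using assms
proof (induction "m + 1 - p" arbitrary: p a b)
  case 0
  thus ?case by simp
next
  case (Suc k)
  hence p: "p < m + 1" by simp
  let ?J = "jordan_matrix (map (\<lambda>i. (c i, w i)) [p + 1..<m + 1])"
  let ?N = "block_start c (m + 1) - block_start c (p + 1)"
  have bs: "block_start c (p + 1) = block_start c p + c p" using Suc.prems by (intro block_start_Suc)
  have le: "block_start c (p + 1) \<le> block_start c (m + 1)" using p by (intro block_start_mono) simp
  have l: "[p..<m + 1] = p # [p + 1..<m + 1]" using upt_conv_Cons[OF p] by (simp only: Suc_eq_plus1)
  have "sum_list (map c [q..<m + 1]) = block_start c (m + 1) - block_start c q" if "1 \<le> q" "q \<le> m + 1" for q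
  proof -
    have "(\<Sum>i\<in>{1..<m + 1}. c i) = (\<Sum>i\<in>{1..<q}. c i) + (\<Sum>i\<in>{q..<m + 1}. c i)"
      using that by (intro sum.atLeastLessThan_concat[symmetric]) auto
    thus ?thesis by (simp add: block_start_def sum_list_distinct_conv_sum_set del: upt_Suc)
  qed
  hence N: "sum_list (map c [p + 1..<m + 1]) = ?N" using p by simp
  have dim: "dim_row ?J = ?N" "dim_col ?J = ?N"
    using N by (simp_all add: comp_def del: upt_Suc)
  have eq: "jordan_matrix (map (\<lambda>i. (c i, w i)) [p..<m + 1])
     = four_block_mat (jordan_block (c p) (w p)) (0\<^sub>m (c p) ?N) (0\<^sub>m ?N (c p)) ?J"
    unfolding l list.map jordan_matrix_Cons using N by (simp add: comp_def del: upt_Suc)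
  have first: "blk c (block_start c p + i + 1) = p" if "i < c p" for i
    by (rule blk_eqI) (use that bs in auto)
  have ab: "a < c p + ?N" "b < c p + ?N" using Suc.prems le bs by auto
  have second: "blk c (block_start c p + i + 1) \<noteq> p" if "c p \<le> i" "i < c p + ?N" for i
  proof -
    have "block_start c p + i + 1 \<in> {1..(\<Sum>i=1..m. c i)}" using that le bs by (simp only: block_start_total[symmetric]) auto
    from blk_block(3)[OF this] show ?thesis using that bs by auto
  qed
  have IH: "?J $$ (a - c p, b - c p) = (if a = b then w (blk c (block_start c p + a + 1))
       else if b = a + 1 \<and> blk c (block_start c p + a + 1) = blk c (block_start c p + b + 1) then 1 else 0)"
    if "c p \<le> a" "c p \<le> b"
  proof -
    have e: "block_start c (p + 1) + (i - c p) + 1 = block_start c p + i + 1" if "c p \<le> i" for i using that bs by simp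
    have "k = m + 1 - (p + 1)" using Suc.hyps(2) by simp
    moreover have "1 \<le> p + 1" "p + 1 \<le> m + 1" "a - c p < ?N" "b - c p < ?N" using that p ab by auto
    ultimately have H: "?J $$ (a - c p, b - c p) = (if a - c p = b - c p then w (blk c (block_start c (p + 1) + (a - c p) + 1))
       else if b - c p = a - c p + 1 \<and> blk c (block_start c (p + 1) + (a - c p) + 1) = blk c (block_start c (p + 1) + (b - c p) + 1) then 1 else 0)"
      by (rule Suc.hyps(1))
    have i: "a - c p = b - c p \<longleftrightarrow> a = b" "b - c p = a - c p + 1 \<longleftrightarrow> b = a + 1" using that by auto
    show ?thesis by (rule H[unfolded e[OF that(1)] e[OF that(2)] i])
  qed
  have *: "a < dim_row (jordan_block (c p) (w p)) + dim_row ?J" "b < dim_col (jordan_block (c p) (w p)) + dim_col ?J"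
    using ab dim by auto
  have "(if a < dim_row (jordan_block (c p) (w p))
     then if b < dim_col (jordan_block (c p) (w p)) then jordan_block (c p) (w p) $$ (a, b)
          else 0\<^sub>m (c p) ?N $$ (a, b - dim_col (jordan_block (c p) (w p)))
     else if b < dim_col (jordan_block (c p) (w p)) then 0\<^sub>m ?N (c p) $$ (a - dim_row (jordan_block (c p) (w p)), b)
          else ?J $$ (a - dim_row (jordan_block (c p) (w p)), b - dim_col (jordan_block (c p) (w p))))
     = (if a = b then w (blk c (block_start c p + a + 1))
       else if b = a + 1 \<and> blk c (block_start c p + a + 1) = blk c (block_start c p + b + 1) then 1 else 0)" (is ?E)
  proof (cases "a < c p"; cases "b < c p")
    assume "a < c p" "b < c p"
    thus "?E" using first[of a] first[of b] by auto
  next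
    assume "a < c p" "\<not> b < c p"
    thus "?E" using first[of a] second[of b] ab by auto
  next
    assume "\<not> a < c p" "b < c p"
    thus "?E" using ab dim by auto
  next
    assume "\<not> a < c p" "\<not> b < c p"
    thus "?E" using IH by simp
  qed
  thus ?case unfolding eq by (simp only: index_mat_four_block(1)[OF *])
qed

lemma jordan_entry_eq:
  assumes "a \<in> {1..(\<Sum>i=1..m. c i)}" "b \<in> {1..(\<Sum>i=1..m. c i)}"
  shows "jordan_entry m c w a b = (if a = b then w (blk c a) else if b = a + 1 \<and> blk c a = blk c b then 1 else 0)"
proof -
  have ab: "a - 1 < block_start c (m + 1) - block_start c 1" "b - 1 < block_start c (m + 1) - block_start c 1"
    using assms by (simp_all only: block_start_total block_start_1) auto
  have "a - 1 = b - 1 \<longleftrightarrow> a = b" "b - 1 = a - 1 + 1 \<longleftrightarrow> b = a + 1" "0 + (a - 1) + 1 = a" "0 + (b - 1) + 1 = b"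
    using assms by auto
  thus ?thesis
    unfolding jordan_entry_def jordan_matrix_entry[OF order_refl le_add2 ab] block_start_1 by simp
qed

lemma blk_between:
  assumes "r \<in> {1..(\<Sum>i=1..m. c i)}" "s \<in> {1..(\<Sum>i=1..m. c i)}" "blk c r = blk c s" "r \<le> t" "t \<le> s"
  shows "blk c t = blk c r"
  by (rule blk_eqI) (use blk_block[OF assms(1)] blk_block[OF assms(2)] assms in auto)

text \<open>The inverse of \<open>z - J\<close>: on a block with eigenvalue \<open>\<lambda>\<close>
  and nilpotent part \<open>E\<close> it is the sum of \<open>E^k / (z - \<lambda>)^(k+1)\<close>,
  and \<open>E^k\<close> has its entries where \<open>s - r = k\<close>.\<close>

definition jinv :: "(nat \<Rightarrow> nat) \<Rightarrow> (nat \<Rightarrow> complex) \<Rightarrow> nat \<Rightarrow> nat \<Rightarrow> 'a::calg psd" where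
  "jinv c w r s = (if r \<le> s \<and> blk c r = blk c s then fr (w (blk c r)) (s - r + 1) else 0)"

lemma jinv_0: "\<not> (r \<le> s \<and> blk c r = blk c s) \<Longrightarrow> jinv c w r s = 0"
  by (simp only: jinv_def if_False)

text \<open>A row of \<open>z - J\<close> has at most two nonzero entries, in the columns
  \<open>r\<close> and \<open>r + 1\<close>, and a column at most two, in the rows
  \<open>s - 1\<close> and \<open>s\<close>. Each sum thus reduces to the recursion
  \<open>fr_Suc\<close> or \<open>fr_Suc'\<close>, with separate cases on and off the
  diagonal.\<close>

lemma jinv_inverse:
  fixes c w m
  defines "N \<equiv> \<Sum>i=1..m. c i"
  defines "e \<equiv> \<lambda>r s. (if r = s then zz else 0) - psc (jordan_entry m c w r s) :: 'a::calg psd"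
  assumes r: "r \<in> {1..N}" and s: "s \<in> {1..N}"
  shows "(\<Sum>t\<in>{1..N}. e r t * jinv c w t s) = (if r = s then 1 else 0)"
    and "(\<Sum>t\<in>{1..N}. jinv c w r t * e t s) = (if r = s then 1 else 0)"
proof -
  note bw = blk_between[where m = m and c = c, folded N_def]
  have e: "e a b = (if b = a then zz - psc (w (blk c a)) else 0) - (if b = a + 1 \<and> blk c a = blk c b then 1 else 0)"
    if "a \<in> {1..N}" "b \<in> {1..N}" for a b
    using jordan_entry_eq[of a c m b w] that by (auto simp: e_def N_def)
  have "(\<Sum>t\<in>{1..N}. e r t * jinv c w t s)
    = (\<Sum>t\<in>{1..N}. (if t = r then (zz - psc (w (blk c r))) * jinv c w r s else 0)
        - (if t = r + 1 then (if blk c r = blk c (r + 1) then jinv c w (r + 1) s else 0) else 0))"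
    by (intro sum.cong refl) (auto simp: e[OF r] left_diff_distrib)
  also have "\<dots> = (zz - psc (w (blk c r))) * jinv c w r s
      - (if r + 1 \<le> N \<and> blk c r = blk c (r + 1) then jinv c w (r + 1) s else 0)"
    using r by (simp add: sum_subtractf sum.delta)
  also have "\<dots> = (if r = s then 1 else 0)"
  proof (cases "r < s \<and> blk c r = blk c s")
    case True
    hence b: "blk c (r + 1) = blk c r" using r s by (intro bw[OF r s]) auto
    have n: "s - (r + 1) + 1 = s - r" "r + 1 \<le> s" "r + 1 \<le> N" using True s by auto
    have "jinv c w r s = (fr (w (blk c r)) (s - r + 1) :: 'a psd)" using True by (simp add: jinv_def)
    moreover have "jinv c w (r + 1) s = (fr (w (blk c r)) (s - r) :: 'a psd)"
      unfolding jinv_def b n(1) using True n(2) by simp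
    moreover have "(zz - psc (w (blk c r))) * fr (w (blk c r)) (s - r + 1) = (fr (w (blk c r)) (s - r) :: 'a psd)"
      using fr_Suc[of "w (blk c r)" "s - r"] by (simp only: Suc_eq_plus1)
    ultimately show ?thesis using True b n(3) by simp
  next
    case False
    show ?thesis
    proof (cases "r = s")
      case True
      have "(zz - psc (w (blk c r))) * fr (w (blk c r)) 1 = (1 :: 'a psd)"
        using fr_Suc[of "w (blk c r)" 0] by (simp only: One_nat_def fr_0)
      moreover have "jinv c w r s = (fr (w (blk c r)) 1 :: 'a psd)" "jinv c w (r + 1) s = (0 :: 'a psd)"
        using True by (simp_all add: jinv_def)
      ultimately show ?thesis using True by (simp only: if_True if_False if_cancel diff_0_right simp_thms)
    next
      case rs: False
      have "jinv c w r s = (0 :: 'a psd)" by (rule jinv_0) (use False rs in linarith)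
      moreover have "jinv c w (r + 1) s = (0 :: 'a psd)" if "blk c r = blk c (r + 1)"
        by (rule jinv_0) (use False that in linarith)
      ultimately show ?thesis using rs by (simp only: mult_zero_right if_False split: if_split) simp
    qed
  qed
  finally show "(\<Sum>t\<in>{1..N}. e r t * jinv c w t s) = (if r = s then 1 else 0)" .
  have "(\<Sum>t\<in>{1..N}. jinv c w r t * e t s)
    = (\<Sum>t\<in>{1..N}. (if t = s then jinv c w r s * (zz - psc (w (blk c s))) else 0)
        - (if t = s - 1 then (if 1 < s \<and> blk c (s - 1) = blk c s then jinv c w r (s - 1) else 0) else 0))"
    using s by (intro sum.cong refl) (auto simp: e[OF _ s] right_diff_distrib)
  also have "\<dots> = jinv c w r s * (zz - psc (w (blk c s)))
      - (if 1 < s \<and> blk c (s - 1) = blk c s then jinv c w r (s - 1) else 0)"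
    using s by (auto simp: sum_subtractf sum.delta)
  also have "\<dots> = (if r = s then 1 else 0)"
  proof (cases "r < s \<and> blk c r = blk c s")
    case True
    hence b: "blk c (s - 1) = blk c s" using r s bw[OF r s, of "s - 1"] by auto
    have n: "s - 1 - r + 1 = s - r" "r \<le> s - 1" "1 < s" using True r by auto
    have "jinv c w r s = (fr (w (blk c s)) (s - r + 1) :: 'a psd)" using True by (simp add: jinv_def)
    moreover have "jinv c w r (s - 1) = (fr (w (blk c s)) (s - r) :: 'a psd)"
      unfolding jinv_def b n(1) using True n(2) by simp
    moreover have "fr (w (blk c s)) (s - r + 1) * (zz - psc (w (blk c s))) = (fr (w (blk c s)) (s - r) :: 'a psd)"
      using fr_Suc'[of "w (blk c s)" "s - r"] by (simp only: Suc_eq_plus1)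
    ultimately show ?thesis using True b n(3) by simp
  next
    case False
    show ?thesis
    proof (cases "r = s")
      case True
      have "fr (w (blk c s)) 1 * (zz - psc (w (blk c s))) = (1 :: 'a psd)"
        using fr_Suc'[of "w (blk c s)" 0] by (simp only: One_nat_def fr_0)
      moreover have "jinv c w r s = (fr (w (blk c s)) 1 :: 'a psd)" "jinv c w r (s - 1) = (0 :: 'a psd)"
        using True r by (auto simp add: jinv_def)
      ultimately show ?thesis using True by (simp only: if_True if_False if_cancel diff_0_right simp_thms)
    next
      case rs: False
      have "jinv c w r s = (0 :: 'a psd)" by (rule jinv_0) (use False rs in linarith)
      moreover have "jinv c w r (s - 1) = (0 :: 'a psd)" if "1 < s \<and> blk c (s - 1) = blk c s"
        by (rule jinv_0) (use False that in linarith)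
      ultimately show ?thesis using rs by (simp only: mult_zero_left if_False split: if_split) simp
    qed
  qed
  finally show "(\<Sum>t\<in>{1..N}. jinv c w r t * e t s) = (if r = s then 1 else 0)" .
qed

lemma jinv_zf: "\<exists>F. jinv c w r s = (zf F :: 'a::calg psd)"
proof -
  have "(0 :: 'a psd) = zf 0" using zf_const[of 0] by simp
  thus ?thesis by (auto simp: jinv_def fr_def)
qed

text \<open>For given \<open>r\<close> and \<open>s\<close> the condition singles out the block of
  \<open>r\<close> and the power \<open>k = s - r\<close>. This is how the shifted sums in the two
  homomorphisms lead to resolvent entries.\<close>

lemma jinv_sum:
  assumes "r \<in> {1..(\<Sum>i=1..m. c i)}" "s \<in> {1..(\<Sum>i=1..m. c i)}"
  shows "(\<Sum>i\<in>{1..m}. \<Sum>k\<in>{0..<c i}. if r \<in> {block_start c i + 1..block_start c (i + 1) - k} \<and> s = r + k then fr (w i) (k + 1) else 0)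
    = (jinv c w r s :: 'a::calg psd)"
proof -
  let ?b = "blk c r"
  note br = blk_block[OF assms(1)] and bs = blk_block[OF assms(2)]
  have "(\<Sum>i\<in>{1..m}. \<Sum>k\<in>{0..<c i}. if r \<in> {block_start c i + 1..block_start c (i + 1) - k} \<and> s = r + k then fr (w i) (k + 1) else (0 :: 'a psd))
    = (\<Sum>i\<in>{1..m}. if i = ?b then (\<Sum>k\<in>{0..<c i}. if r \<in> {block_start c i + 1..block_start c (i + 1) - k} \<and> s = r + k then fr (w i) (k + 1) else 0) else 0)"
  proof (intro sum.cong refl)
    fix i
    have "?b = i" if "r \<in> {block_start c i + 1..block_start c (i + 1) - k}" for k
      by (rule blk_eqI) (use that in auto)
    thus "(\<Sum>k\<in>{0..<c i}. if r \<in> {block_start c i + 1..block_start c (i + 1) - k} \<and> s = r + k then fr (w i) (k + 1) else (0 :: 'a psd))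
      = (if i = ?b then (\<Sum>k\<in>{0..<c i}. if r \<in> {block_start c i + 1..block_start c (i + 1) - k} \<and> s = r + k then fr (w i) (k + 1) else 0) else 0)"
    proof (cases "i = ?b")
      case False
      hence "r \<notin> {block_start c i + 1..block_start c (i + 1) - k}" for k
        using \<open>\<And>k. r \<in> {block_start c i + 1..block_start c (i + 1) - k} \<Longrightarrow> ?b = i\<close> by blast
      thus ?thesis using False by (simp only: simp_thms if_False sum.neutral_const)
    qed (simp only: if_True simp_thms)
  qed
  also have "\<dots> = (\<Sum>k\<in>{0..<c ?b}. if r \<in> {block_start c ?b + 1..block_start c (?b + 1) - k} \<and> s = r + k then fr (w ?b) (k + 1) else 0)"
    using br(1) by (simp add: sum.delta)
  also have "\<dots> = (\<Sum>k\<in>{0..<c ?b}. if k = s - r then jinv c w r s else 0)"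
  proof (intro sum.cong refl)
    fix k assume k: "k \<in> {0..<c ?b}"
    show "(if r \<in> {block_start c ?b + 1..block_start c (?b + 1) - k} \<and> s = r + k then fr (w ?b) (k + 1) else 0)
       = (if k = s - r then jinv c w r s else (0 :: 'a psd))"
    proof (cases "k = s - r \<and> r \<le> s")
      case True
      have s': "s = r + k" "r \<le> s" "k = s - r" using True by linarith+
      have "r \<in> {block_start c ?b + 1..block_start c (?b + 1) - k} \<longleftrightarrow> ?b = blk c s"
      proof
        assume "r \<in> {block_start c ?b + 1..block_start c (?b + 1) - k}"
        thus "?b = blk c s" by (intro blk_eqI[symmetric]) (use s'(1) in auto)
      next
        assume b: "?b = blk c s"
        show "r \<in> {block_start c ?b + 1..block_start c (?b + 1) - k}"
          using br(2) bs(3) s'(1) unfolding b by simp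
      qed
      moreover have "(s = r + k) = True" "(k = s - r) = True" "(r \<le> s) = True" using s' by blast+
      ultimately show ?thesis unfolding jinv_def s'(3)[symmetric] by (simp only: simp_thms if_True)
    next
      case False
      have "\<not> s = r + k" using False by auto
      moreover have "jinv c w r s = (0 :: 'a psd)" if "k = s - r" by (rule jinv_0) (use False that in blast)
      ultimately show ?thesis by (cases "k = s - r") (simp_all only: simp_thms if_False if_True)
    qed
  qed
  also have "\<dots> = jinv c w r s"
  proof (cases "s - r \<in> {0..<c ?b}")
    case False
    have "\<not> (r \<le> s \<and> blk c r = blk c s)"
    proof
      assume rs: "r \<le> s \<and> blk c r = blk c s"
      hence "s \<le> block_start c ?b + c ?b" using bs(3) br(1) by (simp add: block_start_Suc)
      thus False using False br(2) rs by auto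
    qed
    hence "jinv c w r s = (0 :: 'a psd)" by (rule jinv_0)
    thus ?thesis by (simp only: if_cancel sum.neutral_const)
  qed (simp add: sum.delta)
  finally show ?thesis .
qed

section \<open>Realisation of the abstract setting by pseudo-differential series\<close>

definition scal :: "'a::calg psd \<Rightarrow> bool" where "scal f \<longleftrightarrow> (\<forall>i j. \<exists>c. cf f i j = cs c)"

lemma scal_zf: "scal (zf F)"
  unfolding scal_def cf_zf by (metis cs_0)

lemma scal_mono: "scal (mono_psd p q)"
  unfolding scal_def cf_mono by (metis cs_0 cs_1)

lemma scal_psc: "scal (psc c)"
  unfolding scal_def psc_def cf_kc by (metis cs_0)

lemma scal_0: "scal 0"
  unfolding scal_def cf_0 by (metis cs_0)

lemma scal_diff: "scal f \<Longrightarrow> scal g \<Longrightarrow> scal (f - g)"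
proof -
  assume fg: "scal f" "scal g"
  have "cs (a - b) = (cs a - cs b :: 'a)" for a b
    using cs_add[of "a - b" b, where 'a = 'a] by (simp add: eq_diff_eq)
  thus ?thesis using fg unfolding scal_def cf_diff by metis
qed

lemma scal_jinv: "scal (jinv c w r s)"
  using jinv_zf[of c w r s] scal_zf by metis

lemma om_mult_scal:
  assumes "scal f" shows "om (f * g) = om g * om f" "om (g * f) = om f * om g"
proof -
  have "cf f i j * c = c * cf f i j" for i j c using assms unfolding scal_def by (metis cs_comm)
  thus "om (f * g) = om g * om f" "om (g * f) = om f * om g" by (simp_all add: om_mult)
qed

lemma kc_scal: "scal f \<Longrightarrow> kc a * f = f * kc a"
  by (rule kc_comm) (metis scal_def cs_comm)

lemma om_sum: "om (sum f A) = (\<Sum>i\<in>A. om (f i))"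
  by (induction A rule: infinite_finite_induct) (simp_all add: om_plus)

lemma jinv_zz: "jinv c w r s * zz = zz * jinv c w r s"
  using jinv_zf[of c w r s] zz_zf by metis

lemma jinv_jinv: "jinv c w r s * jinv c' w' r' s' = jinv c' w' r' s' * jinv c w r s"
  using jinv_zf[of c w r s] jinv_zf[of c' w' r' s'] zf_comm by metis

lemma fermions_kc:
  assumes "fermions X Y"
  shows "fermions (\<lambda>u. kc (X u)) (\<lambda>u. kc (Y u))"
proof -
  interpret fermions X Y by fact
  show ?thesis
  proof unfold_locales
    show "kc (X u) * kc (X v) = - (kc (X v) * kc (X u))" for u v
      unfolding kc_mult[symmetric] kc_minus[symmetric] by (rule arg_cong[OF xx])
    show "kc (Y u) * kc (Y v) = - (kc (Y v) * kc (Y u))" for u v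
      unfolding kc_mult[symmetric] kc_minus[symmetric] by (rule arg_cong[OF yy])
    show "kc (Y u) * kc (X v) = (if u = v then 1 else 0) - kc (X v) * kc (Y u)" for u v
      unfolding kc_mult[symmetric] yx[of u v] kc_diff by simp
  qed (simp_all add: kc_mult[symmetric] x_sq y_sq)
qed

text \<open>The abstract \<open>h\<close> is the image of \<open>g = jinv\<close> under
  \<open>om\<close>. Series with scalar coefficients commute with the odd constants and have their
  products reversed by \<open>om\<close>, so every relation between \<open>h\<close> and the
  derivation is the image of one between \<open>jinv\<close> and \<open>z\<close>.\<close>

lemma gaudin_pair_psd:
  fixes X Y :: "nat \<times> nat \<Rightarrow> 'a::calg"
  assumes XY: "fermions X Y" and d: "(\<Sum>a=1..d'. \<xi> a) = d" and n: "(\<Sum>i=1..l. \<gamma> i) = n"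
  shows "gaudin_pair (\<lambda>u. kc (X u)) (\<lambda>u. kc (Y u)) zz dd psc d n (jordan_entry d' \<xi> w) (jordan_entry l \<gamma> z)
    (\<lambda>r s. om (jinv \<gamma> z r s)) (jinv \<gamma> z) om"
proof -
  interpret F: fermions "\<lambda>u. kc (X u)" "\<lambda>u. kc (Y u)" by (rule fermions_kc[OF XY])
  interpret weyl_fermions "\<lambda>u. kc (X u)" "\<lambda>u. kc (Y u)" zz dd psc
  proof unfold_locales
    show "psc c * a = (a * psc c :: 'a psd)" for c a by (rule psc_comm)
  qed (rule dd_zz kc_mono[symmetric] psc_add psc_mult psc_1)+
  let ?e = "\<lambda>r s. (if r = s then zz else 0) - psc (jordan_entry l \<gamma> z r s) :: 'a psd"
  have se: "scal (?e r s)" for r s by (rule scal_diff[OF _ scal_psc]) (simp add: scal_mono scal_0)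
  have ome: "om (?e r s) = (if r = s then dd else 0) - psc (jordan_entry l \<gamma> z r s)" for r s
    by (simp add: om_minus' if_distrib[of om])
  have je: "jinv \<gamma> z r s * ?e r' s' = ?e r' s' * jinv \<gamma> z r s" for r s r' s'
    using jinv_zz[of \<gamma> z r s, where 'a = 'a] psc_comm[of _ "jinv \<gamma> z r s :: 'a psd"] by (simp add: left_diff_distrib right_diff_distrib)
  note inv = jinv_inverse[where c = \<gamma> and w = z and m = l, unfolded n]
  interpret duality "\<lambda>u. kc (X u)" "\<lambda>u. kc (Y u)" zz dd psc d n "jordan_entry d' \<xi> w" "jordan_entry l \<gamma> z" "\<lambda>r s. om (jinv \<gamma> z r s)"
  proof unfold_locales
    fix r s assume "r \<in> {1..n}" "s \<in> {1..n}" "s < r"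
    thus "jordan_entry l \<gamma> z r s = 0" using jordan_entry_eq[of r \<gamma> l s z] n by simp
    show "om (jinv \<gamma> z r s) = (0 :: 'a psd)" using \<open>s < r\<close> by (subst jinv_0) auto
  next
    fix r s assume "r \<in> {1..d}" "s \<in> {1..d}" "s < r"
    thus "jordan_entry d' \<xi> w r s = 0" using jordan_entry_eq[of r \<xi> d' s w] d by simp
  next
    fix r s u
    have *: "om (jinv \<gamma> z r s) * kc a = kc a * om (jinv \<gamma> z r s)" for a :: 'a
      by (simp only: om_mult_kc[symmetric] om_kc_mult[symmetric] kc_scal[OF scal_jinv])
    show "om (jinv \<gamma> z r s) * kc (X u) = kc (X u) * om (jinv \<gamma> z r s)" "om (jinv \<gamma> z r s) * kc (Y u) = kc (Y u) * om (jinv \<gamma> z r s)"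
      by (rule *)+
  next
    fix r s
    have "om (zz * jinv \<gamma> z r s) = om (jinv \<gamma> z r s) * (dd :: 'a psd)" "om (jinv \<gamma> z r s * zz) = (dd :: 'a psd) * om (jinv \<gamma> z r s)"
      by (simp_all add: om_mult_scal[OF scal_mono])
    thus "om (jinv \<gamma> z r s) * dd = (dd :: 'a psd) * om (jinv \<gamma> z r s)" by (simp add: jinv_zz)
  next
    fix r s r' s'
    have "om (jinv \<gamma> z r' s') * om (jinv \<gamma> z r s) = (om (jinv \<gamma> z r s * jinv \<gamma> z r' s') :: 'a psd)"
      by (rule om_mult_scal(1)[OF scal_jinv, symmetric])
    also have "\<dots> = om (jinv \<gamma> z r s) * om (jinv \<gamma> z r' s')"
      unfolding jinv_jinv[of \<gamma> z r s] by (rule om_mult_scal(1)[OF scal_jinv])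
    finally show "om (jinv \<gamma> z r s) * om (jinv \<gamma> z r' s') = (om (jinv \<gamma> z r' s') * om (jinv \<gamma> z r s) :: 'a psd)" ..
  next
    fix r s assume rs: "r \<in> {1..n}" "s \<in> {1..n}"
    have "(\<Sum>t\<in>{1..n}. ((if r = t then dd else 0) - psc (jordan_entry l \<gamma> z r t)) * om (jinv \<gamma> z t s))
      = om (\<Sum>t\<in>{1..n}. ?e r t * jinv \<gamma> z t s)"
      unfolding om_sum by (intro sum.cong refl) (simp only: je[symmetric] om_mult_scal(1)[OF scal_jinv] ome)
    thus "(\<Sum>t\<in>{1..n}. ((if r = t then dd else 0) - psc (jordan_entry l \<gamma> z r t)) * om (jinv \<gamma> z t s)) = (if r = s then 1 else 0 :: 'a psd)"
      unfolding inv(1)[OF rs] by simp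
    have "(\<Sum>t\<in>{1..n}. om (jinv \<gamma> z r t) * ((if t = s then dd else 0) - psc (jordan_entry l \<gamma> z t s)))
      = om (\<Sum>t\<in>{1..n}. jinv \<gamma> z r t * ?e t s)"
      unfolding om_sum by (intro sum.cong refl) (simp only: je om_mult_scal(1)[OF se] ome)
    thus "(\<Sum>t\<in>{1..n}. om (jinv \<gamma> z r t) * ((if t = s then dd else 0) - psc (jordan_entry l \<gamma> z t s))) = (if r = s then 1 else 0 :: 'a psd)"
      unfolding inv(2)[OF rs] by simp
  qed
  interpret column_det "\<lambda>u. kc (X u)" "\<lambda>u. kc (Y u)" zz dd psc d n "jordan_entry d' \<xi> w" "jinv \<gamma> z"
  proof unfold_locales
    fix r s assume rs: "r \<in> {1..n}" "s \<in> {1..n}"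
    have "jinv \<gamma> z r s * dd - dd * jinv \<gamma> z r s = - (\<Sum>t\<in>{1..n}. jinv \<gamma> z r t * (- 1) * (jinv \<gamma> z t s :: 'a psd))"
    proof (rule derivation_inverse[where e = ?e])
      fix r s
      show "?e r s * dd - dd * ?e r s = (if r = s then - 1 else 0)"
        using psc_comm[of _ "dd :: 'a psd"] by (simp add: left_diff_distrib right_diff_distrib dd_zz)
    qed (rule finite_atLeastAtMost inv rs | assumption)+
    hence "jinv \<gamma> z r s * dd - dd * jinv \<gamma> z r s = (\<Sum>t\<in>{1..n}. jinv \<gamma> z r t * (jinv \<gamma> z t s :: 'a psd))"
      by (simp add: sum_negf)
    thus "jinv \<gamma> z r s * dd = (dd :: 'a psd) * jinv \<gamma> z r s + (\<Sum>q\<in>{1..n}. jinv \<gamma> z r q * jinv \<gamma> z q s)"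
      by (simp add: diff_eq_eq add.commute)
  qed (rule kc_scal[OF scal_jinv, symmetric] jinv_jinv)+
  show ?thesis
  proof unfold_locales
    fix r s u v and a :: "'a psd"
    have "om (kc (Y u) * a * kc (X v) * jinv \<gamma> z r s) = om (jinv \<gamma> z r s) * om (kc (Y u) * a * kc (X v))"
      by (rule om_mult_scal(2)[OF scal_jinv])
    thus "om (kc (Y u) * a * kc (X v) * jinv \<gamma> z r s) = om (jinv \<gamma> z r s) * (kc (Y u) * om a * kc (X v))"
      by (simp only: om_mult_kc om_kc_mult)
  next
    fix c and a :: "'a psd"
    have "om (psc c * a) = om a * om (psc c)" by (rule om_mult_scal(1)[OF scal_psc])
    thus "om (psc c * a) = psc c * om a" using psc_comm[of c "om a"] by simp
  qed (simp_all add: om_plus om_mono_mult)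
qed

text \<open>Differential operators of order at most \<open>m\<close> whose coefficient of
  \<open>\<partial>^m\<close> is the constant scalar \<open>c\<close>. The scalar leading term
  matters because the top coefficient of the column determinant is not among the generators.\<close>

definition ordc :: "int \<Rightarrow> complex \<Rightarrow> 'a::calg psd \<Rightarrow> bool" where
  "ordc m c f \<longleftrightarrow> (\<forall>i j. cf f i j \<noteq> 0 \<longrightarrow> 0 \<le> j \<and> j \<le> m) \<and> (\<forall>i. cf f i m = (if i = 0 then cs c else 0))"

lemma ordc_1: "ordc 0 1 1"
  by (simp add: ordc_def cf_1 cs_1)

lemma ordc_add: "ordc m c f \<Longrightarrow> ordc m c' g \<Longrightarrow> ordc m (c + c') (f + g)"
  unfolding ordc_def cf_add by (auto simp: cs_add, (metis add.right_neutral)+)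

lemma ordc_0: "ordc m 0 0"
  by (simp add: ordc_def cf_0)

lemma ordc_minus: "ordc m c f \<Longrightarrow> ordc m (- c) (- f)"
proof -
  have "cs (- c) = (- cs c :: 'a)" using cs_add[of c "- c", where 'a = 'a] by (simp add: eq_neg_iff_add_eq_0 add.commute)
  thus "ordc m c f \<Longrightarrow> ordc m (- c) (- f)" for f :: "'a psd" unfolding ordc_def cf_minus by auto
qed

lemma ordc_sum: "(\<And>i. i \<in> A \<Longrightarrow> \<exists>c. ordc m c (f i)) \<Longrightarrow> \<exists>c. ordc m c (sum f A)"
  by (induction A rule: infinite_finite_induct) (auto intro: ordc_0 ordc_add)

lemma ordc_mult:
  assumes f: "ordc m c f" and g: "ordc m' c' g"
  shows "ordc (m + m') (c * c') (f * g)"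
proof -
  obtain R where R: "bnd R (cf f)" "bnd R (cf g)" by (rule bnd_cf2)
  have "0 \<le> j \<and> j \<le> m + m'" if "cf (f * g) i j \<noteq> 0" for i j
  proof -
    obtain i1 j1 i2 j2 k where *: "cf f i1 j1 \<noteq> 0" "cf g i2 j2 \<noteq> 0" "j1 + j2 = j + int k" "cs (pc k j1 i2) * (cf f i1 j1 * cf g i2 j2) \<noteq> 0"
      using \<open>cf (f * g) i j \<noteq> 0\<close> unfolding cf_mult by (rule pmul_nonzeroE)
    have j: "0 \<le> j1" "j1 \<le> m" "0 \<le> j2" "j2 \<le> m'" using f g *(1,2) by (auto simp: ordc_def)
    \<comment> \<open>A derivation power can absorb at most as many contractions as its nonnegative
      exponent, as the binomial coefficient vanishes beyond; so no negative powers of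
      \<open>\<partial>\<close> arise.\<close>
    have "int k \<le> j1"
    proof (rule ccontr)
      assume "\<not> int k \<le> j1"
      hence "nat j1 < k" using j by auto
      moreover have "(of_int j1 :: complex) = of_nat (nat j1)" using j by simp
      ultimately have "pc k j1 i2 = 0"
        by (simp add: pc_gbinomial binomial_gbinomial[symmetric] binomial_eq_0)
      thus False using *(4) by simp
    qed
    thus ?thesis using j *(3) by linarith
  qed
  moreover have "cf (f * g) i (m + m') = (if i = 0 then cs (c * c') else 0)" for i
  proof -
    let ?A = "if i = 0 \<and> (cs c :: 'a) \<noteq> 0 \<and> (cs c' :: 'a) \<noteq> 0 then {(0, m, 0, m', 0::nat)} else {}"
    have "cf (f * g) i (m + m') = (\<Sum>(i1, j1, i2, j2, k)\<in>?A. cs (pc k j1 i2) * (cf f i1 j1 * cf g i2 j2))"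
      unfolding cf_mult
    proof (rule pmul_single[OF _ _ _ R])
      show "?A \<subseteq> pidx (cf f) (cf g) i (m + m')" using f g by (auto simp: pidx_def ordc_def)
      fix i1 j1 i2 j2 k assume t: "(i1, j1, i2, j2, k) \<in> pidx (cf f) (cf g) i (m + m')" "(i1, j1, i2, j2, k) \<notin> ?A"
      hence nz: "cf f i1 j1 \<noteq> 0" "cf g i2 j2 \<noteq> 0" "i1 + i2 = i + int k" "j1 + j2 = m + m' + int k" by (auto simp: pidx_def)
      have "j1 \<le> m" "j2 \<le> m'" using f g nz(1,2) by (auto simp: ordc_def)
      hence 1: "j1 = m" "j2 = m'" "k = 0" using nz(4) by linarith+
      hence "i1 = 0" "i2 = 0" using f g nz(1,2) by (auto simp: ordc_def split: if_splits)
      hence "(i1, j1, i2, j2, k) \<in> ?A" using 1 nz f g by (auto simp: ordc_def)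
      thus "cs (pc k j1 i2) * (cf f i1 j1 * cf g i2 j2) = 0" using t(2) by contradiction
    qed simp
    thus ?thesis using f g by (auto simp: ordc_def cs_1 cs_mult)
  qed
  ultimately show ?thesis by (simp add: ordc_def)
qed

definition jle :: "int \<Rightarrow> 'a::calg psd \<Rightarrow> bool" where
  "jle N f \<longleftrightarrow> (\<forall>i j. cf f i j \<noteq> 0 \<longrightarrow> j \<le> N)"

lemma jle_mult: "jle M f \<Longrightarrow> jle N g \<Longrightarrow> jle (M + N) (f * g)"
  unfolding jle_def cf_mult
proof (intro allI impI)
  fix i j assume a: "\<forall>i j. cf f i j \<noteq> 0 \<longrightarrow> j \<le> M" "\<forall>i j. cf g i j \<noteq> 0 \<longrightarrow> j \<le> N" and "pmul (cf f) (cf g) i j \<noteq> 0"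
  from this(3) obtain i1 j1 i2 j2 k where *: "cf f i1 j1 \<noteq> 0" "cf g i2 j2 \<noteq> 0" "j1 + j2 = j + int k"
    by (rule pmul_nonzeroE)
  have "j1 \<le> M" "j2 \<le> N" using a *(1,2) by auto
  thus "j \<le> M + N" using *(3) by linarith
qed

lemma jle_add: "jle N f \<Longrightarrow> jle N g \<Longrightarrow> jle N (f + g)"
  unfolding jle_def cf_add by (metis add.right_neutral)

lemma jle_minus: "jle N f \<Longrightarrow> jle N (- f)"
  unfolding jle_def cf_minus by simp

lemma jle_diff: "jle N f \<Longrightarrow> jle N g \<Longrightarrow> jle N (f - g)"
  using jle_add[OF _ jle_minus] by fastforce

lemma jle_0: "jle N 0"
  by (simp add: jle_def cf_0)

lemma jle_sum: "(\<And>i. i \<in> A \<Longrightarrow> jle N (f i)) \<Longrightarrow> jle N (sum f A)"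
  by (induction A rule: infinite_finite_induct) (auto intro: jle_add jle_0)

lemma jle_prod_list: "(\<And>f. f \<in> set fs \<Longrightarrow> jle N f) \<Longrightarrow> jle (int (length fs) * N) (prod_list fs)"
proof (induction fs)
  case (Cons f fs)
  have "jle (N + int (length fs) * N) (f * prod_list fs)" using Cons by (intro jle_mult) auto
  thus ?case by (simp add: algebra_simps)
qed (simp add: jle_def cf_1)

lemma jle_om_fr: "jle (-1) (om (fr b 1) :: 'a::calg psd)"
proof -
  have "(fps_X / (1 - fps_const b * fps_X) :: complex fps) = fps_X * inverse (1 - fps_const b * fps_X)"
    by (rule fps_divide_unit) simp
  hence "fps_nth (fps_X / (1 - fps_const b * fps_X) :: complex fps) 0 = 0" by simp
  hence "j \<le> -1" if "cf (om (fr b 1) :: 'a psd) i j \<noteq> 0" for i j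
    using that by (cases "j = 0") (auto simp: cf_om fr_def cf_zf split: if_splits)
  thus ?thesis by (simp add: jle_def)
qed

lemma jle_basic: "jle 0 zz" "jle 0 (psc c)" "jle 0 (kc a)" "jle 0 1" "jle 0 (zf F)"
  by (auto simp: jle_def cf_mono cf_kc psc_def cf_1 cf_zf)

context fermions begin

lemma pair_commute:
  assumes "v \<noteq> p" shows "x u * y v * x p = x p * (x u * y v)"
proof -
  have "x u * y v * x p = x u * (y v * x p)" by (rule mult.assoc)
  also have "y v * x p = - (x p * y v)" using yx[of v p] assms by simp
  also have "x u * - (x p * y v) = - (x u * x p) * y v" by (simp add: mult.assoc)
  also have "x u * x p = - (x p * x u)" by (rule xx)
  finally show ?thesis by (simp add: mult.assoc)
qed

lemma pair_commute':
  assumes "u \<noteq> p" shows "x u * y v * y p = y p * (x u * y v)"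
proof -
  have "y p * (x u * y v) = (y p * x u) * y v" by (rule mult.assoc[symmetric])
  also have "y p * x u = - (x u * y p)" using yx[of p u] assms by simp
  also have "- (x u * y p) * y v = - (x u * (y p * y v))" by (simp add: mult.assoc)
  also have "y p * y v = - (y v * y p)" by (rule yy)
  finally show ?thesis by (simp add: mult.assoc)
qed

end

lemma prod_list_inverse:
  fixes f g :: "'b \<Rightarrow> 'r::monoid_mult"
  assumes "\<And>m. m \<in> set ms \<Longrightarrow> g m * f m = 1"
  shows "prod_list (map g (rev ms)) * prod_list (map f ms) = 1"
  using assms
proof (induction ms)
  case (Cons m ms)
  have "prod_list (map g (rev (m # ms))) * prod_list (map f (m # ms))
      = prod_list (map g (rev ms)) * (g m * f m) * prod_list (map f ms)" by (simp add: mult.assoc)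
  thus ?case using Cons by simp
qed simp

lemma pcoef_0: "0 \<in> pcoef S"
  by (simp add: pcoef_def cf_0 tgen_0)

lemma pcoef_uminus: "f \<in> pcoef S \<Longrightarrow> - f \<in> pcoef S"
  using pcoef_diff[OF pcoef_0] by fastforce

lemma pcoef_prod_list: "(\<And>f. f \<in> set fs \<Longrightarrow> f \<in> pcoef S) \<Longrightarrow> prod_list fs \<in> pcoef S"
  by (induction fs) (simp_all add: pcoef_1 pcoef_mult)

lemma ordc_prod_list: "(\<And>f. f \<in> set fs \<Longrightarrow> \<exists>c. ordc 1 c f) \<Longrightarrow> \<exists>c. ordc (int (length fs)) c (prod_list fs)"
proof (induction fs)
  case Nil
  show ?case using ordc_1 by auto
next
  case (Cons f fs)
  then obtain c c' where "ordc 1 c f" "ordc (int (length fs)) c' (prod_list fs)" by fastforce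
  from ordc_mult[OF this] show ?case by auto
qed

lemma ordc_const: "(\<And>i j. cf f i j \<noteq> 0 \<Longrightarrow> j = 0) \<Longrightarrow> ordc 1 0 f"
  unfolding ordc_def by fastforce

lemma ordc_dd: "ordc 1 1 dd"
  by (simp add: ordc_def cf_mono cs_1)

text \<open>Solving \<open>key\<close> for either side expresses \<open>B\<close> through
  \<open>om C\<close> and \<open>om C\<close> through \<open>B\<close>, with factors whose
  coefficients are scalars, so each series has coefficients in the algebra generated by the other.
  Degree bounds show that the listed generators give all coefficients up to scalars:
  \<open>C\<close> has order \<open>d\<close> with scalar top coefficient, and \<open>B\<close> has
  \<open>\<partial>\<close>-degree at most \<open>- n\<close>.\<close>

theorem coefficient_duality:
  fixes X Y :: "nat \<times> nat \<Rightarrow> 'a::calg" and w z :: "nat \<Rightarrow> complex" and \<xi> \<gamma> :: "nat \<Rightarrow> nat"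
  assumes XY: "fermions X Y" and d: "(\<Sum>a=1..d'. \<xi> a) = d" and n: "(\<Sum>i=1..l. \<gamma> i) = n"
  defines "M \<equiv> \<lambda>a b. (if a = b then dd else 0) - psc (jordan_entry d' \<xi> w a b)
      + (\<Sum>r\<in>{1..n}. \<Sum>s\<in>{1..n}. kc (Y (b, r)) * kc (X (a, s)) * jinv \<gamma> z r s)"
    and "N \<equiv> \<lambda>j k. (if j = k then dd else 0) - psc (jordan_entry l \<gamma> z j k)
      + (\<Sum>a\<in>{1..d}. \<Sum>b\<in>{1..d}. kc (X (b, j)) * kc (Y (a, k)) * jinv \<xi> w a b)"
  assumes V: "\<And>m i j. m \<in> {1..n} \<Longrightarrow> i \<in> {1..m} \<Longrightarrow> j \<in> {1..m} \<Longrightarrow> (\<Sum>k\<in>{1..m}. N i k * V m k j) = (if i = j then 1 else 0)"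
    "\<And>m i j. m \<in> {1..n} \<Longrightarrow> i \<in> {1..m} \<Longrightarrow> j \<in> {1..m} \<Longrightarrow> (\<Sum>k\<in>{1..m}. V m i k * N k j) = (if i = j then 1 else 0)"
  defines "C \<equiv> \<Sum>\<sigma> | \<sigma> permutes {1..d}. of_int (sign \<sigma>) * prod_list (map (\<lambda>j. M (\<sigma> j) j) [1..<d+1])"
    and "B \<equiv> prod_list (map (\<lambda>m. V m m m) [1..<n+1])"
  shows "tgen {cf C s (int i - 1) | s i. i \<in> {1..d}} = tgen {cf B s i | s i. i \<le> - int n}"
proof -
  let ?W = "jordan_entry d' \<xi> w" and ?Z = "jordan_entry l \<gamma> z"
  interpret G: gaudin_pair "\<lambda>u. kc (X u)" "\<lambda>u. kc (Y u)" zz dd psc d n ?W ?Z "\<lambda>r s. om (jinv \<gamma> z r s)" "jinv \<gamma> z" om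
    by (rule gaudin_pair_psd[OF XY d n])
  have M: "G.M1 = M" unfolding G.M1_def G.uu_def M_def by (rule refl)
  have N: "G.M2 (jinv \<xi> w) = N" unfolding G.M2_def N_def by (rule refl)
  define R where "R = (\<Sum>\<sigma> | \<sigma> permutes {1..d}. of_int (sign \<sigma>) * prod_list (map (\<lambda>j. G.NN j (\<sigma> j)) [1..<d+1]))"
  have omC: "om C = R" unfolding C_def R_def M[symmetric] by (rule G.om_cdet)
  define P where "P = prod_list (map (\<lambda>m. dd - psc (?Z m m)) (rev [1..<n+1]) :: 'a psd list)"
  define Q where "Q = prod_list (map (\<lambda>j. psc (?W j j) - zz) [1..<d+1] :: 'a psd list)"
  \<comment> \<open>Inverting a product reverses it. \<open>P\<close> is itself in reversed order,
    and the double reversal only matches the shape of \<open>prod_list_inverse\<close>.\<close>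
  define P' where "P' = prod_list (map (\<lambda>m. om (fr (?Z m m) 1)) (rev (rev [1..<n+1])) :: 'a psd list)"
  define Q' where "Q' = prod_list (map (\<lambda>j. - fr (?W j j) 1) (rev [1..<d+1]) :: 'a psd list)"
  \<comment> \<open>The inverse of a leading block commutes with everything that commutes with the
    block: \<open>derivation_inverse\<close> with vanishing right-hand side.\<close>
  have comm: "V m m m * c = c * V m m m" if m: "m \<in> {1..n}" and c: "\<And>j k. j \<in> {1..m} \<Longrightarrow> k \<in> {1..m} \<Longrightarrow> N j k * c = c * N j k" for m c
  proof -
    have mm: "m \<in> {1..m}" using m by simp
    have "V m m m * c - c * V m m m = - (\<Sum>t\<in>{1..m}. V m m t * 0 * V m t m)"
    proof (rule derivation_inverse[where e = N])
      fix r s assume "r \<in> {1..m}" "s \<in> {1..m}"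
      thus "N r s * c - c * N r s = (if r = s then 0 else 0)" using c by simp
    qed (rule finite_atLeastAtMost V m mm | assumption)+
    thus ?thesis by simp
  qed
  have Nc: "N j k * c = c * N j k"
    if c: "\<And>a b. kc (X (b, j)) * kc (Y (a, k)) * c = c * (kc (X (b, j)) * kc (Y (a, k)))" and c': "c = kc c0" for j k c c0
  proof -
    have dc: "dd * c = c * dd" unfolding c' by (rule kc_mono[symmetric])
    have 1: "((if j = k then dd else 0) - psc (?Z j k)) * c = c * ((if j = k then dd else 0) - psc (?Z j k))"
      using dc psc_comm[of "?Z j k" c] by (simp add: left_diff_distrib right_diff_distrib)
    have 2: "c * (kc (X (b, j)) * kc (Y (a, k)) * jinv \<xi> w a b) = kc (X (b, j)) * kc (Y (a, k)) * jinv \<xi> w a b * c" for a b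
      by (rule commute_multI[OF c[symmetric]]) (simp only: c' kc_scal[OF scal_jinv])
    have "c * (\<Sum>a\<in>{1..d}. \<Sum>b\<in>{1..d}. kc (X (b, j)) * kc (Y (a, k)) * jinv \<xi> w a b)
        = (\<Sum>a\<in>{1..d}. \<Sum>b\<in>{1..d}. kc (X (b, j)) * kc (Y (a, k)) * jinv \<xi> w a b) * c"
      by (intro commute_sumI 2)
    thus ?thesis unfolding N_def distrib_left distrib_right 1 by simp
  qed
  have key: "(-1) ^ d * R = P * Q * B"
    unfolding R_def P_def Q_def B_def
  proof (rule G.rdet_eq_prod[where K = "jinv \<xi> w" and X = "\<lambda>m k. V m k m"])
    show "jinv \<xi> w a b * zz = (zz * jinv \<xi> w a b :: 'a psd)" for a b by (rule jinv_zz)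
    show "(\<Sum>b\<in>{1..d}. jinv \<xi> w a b * ((if b = i then zz else 0) - psc (?W b i))) = (if a = i then 1 else (0 :: 'a psd))"
      if "a \<in> {1..d}" "i \<in> {1..d}" for a i
      by (rule jinv_inverse(2)[where c = \<xi> and w = w and m = d', unfolded d, OF that])
    show "(\<Sum>k\<in>{1..m}. G.M2 (jinv \<xi> w) j k * V m k m) = (if j = m then 1 else 0)" if "m \<in> {1..n}" "j \<in> {1..m}" for m j
      unfolding N by (rule V(1)) (use that in auto)
    show "V m m m * kc (X (k, 0)) = kc (X (k, 0)) * V m m m" if "m \<in> {1..n}" for m k
      by (rule comm[OF that Nc], rule G.pair_commute, simp, rule refl)
    show "V m m m * kc (Y (k, 0)) = kc (Y (k, 0)) * V m m m" if "m \<in> {1..n}" for m k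
      by (rule comm[OF that Nc], rule G.pair_commute', simp, rule refl)
  qed
  have P: "P' * P = 1" unfolding P_def P'_def
  proof (rule prod_list_inverse)
    fix m
    have "om ((zz - psc (?Z m m)) * fr (?Z m m) 1) = om (fr (?Z m m) 1) * (om (zz - psc (?Z m m)) :: 'a psd)"
      unfolding fr_def by (rule om_mult_zf)
    thus "om (fr (?Z m m) 1) * (dd - psc (?Z m m)) = (1 :: 'a psd)"
      using fr_Suc[of "?Z m m" 0, where 'a = 'a] by (simp add: om_minus' One_nat_def)
  qed
  have Q: "Q' * Q = 1" unfolding Q_def Q'_def
  proof (rule prod_list_inverse)
    fix j
    have "- fr (?W j j) 1 * (psc (?W j j) - zz) = (fr (?W j j) (Suc 0) * (zz - psc (?W j j)) :: 'a psd)"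
      by (simp add: right_diff_distrib One_nat_def)
    thus "- fr (?W j j) 1 * (psc (?W j j) - zz) = (1 :: 'a psd)" using fr_Suc'[of "?W j j" 0, where 'a = 'a] by (simp add: One_nat_def)
  qed
  define e :: "'a psd" where "e = (-1) ^ d"
  have e: "e = 1 \<or> e = -1" unfolding e_def by (cases "even d") auto
  have ee: "e * e = 1" using e by auto
  have BR: "B = Q' * (P' * (e * R))"
  proof -
    have "Q' * (P' * (P * Q * B)) = Q' * ((P' * P) * (Q * B))" by (simp only: mult.assoc)
    also have "\<dots> = (Q' * Q) * B" unfolding P by (simp only: mult_1_left mult.assoc)
    finally show ?thesis unfolding Q key[symmetric] e_def by simp
  qed
  have RB: "R = e * (P * Q * B)"
    unfolding key[symmetric] e_def[symmetric] mult.assoc[symmetric] ee by simp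
  have pc: "P \<in> pcoef S" "Q \<in> pcoef S" "P' \<in> pcoef S" "Q' \<in> pcoef S" "e \<in> pcoef S" for S
    using e unfolding P_def P'_def Q_def Q'_def
    by (auto intro!: pcoef_prod_list pcoef_diff pcoef_uminus pcoef_scalar pcoef_1 simp: fr_def pcoef_om)
  let ?S1 = "{cf C s (int i - 1) | s i. i \<in> {1..d}}" and ?S2 = "{cf B s i | s i. i \<le> - int n}"
  have sg: "of_int (sign \<sigma>) = (1 :: 'a psd) \<or> of_int (sign \<sigma>) = (- 1 :: 'a psd)" for \<sigma> :: "nat \<Rightarrow> nat"
    by (cases \<sigma> rule: sign_cases) auto
  have zfk: "cf (kc a * kc b * zf F :: 'a psd) i j \<noteq> 0 \<Longrightarrow> j = 0" for a b F i j
    by (auto simp: cf_kc_mult cf_zf mult.assoc split: if_splits)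
  have "\<exists>c. ordc 1 c (M a b)" for a b
  proof -
    obtain c1 where 1: "ordc 1 c1 ((if a = b then dd else 0) :: 'a psd)" using ordc_dd ordc_0 by (cases "a = b") auto
    have 2: "ordc 1 0 (- psc (?W a b) :: 'a psd)"
      by (rule ordc_const) (auto simp: psc_def cf_minus cf_kc split: if_splits)
    have "\<exists>c. ordc 1 c (\<Sum>r\<in>{1..n}. \<Sum>s\<in>{1..n}. kc (Y (b, r)) * kc (X (a, s)) * jinv \<gamma> z r s)"
    proof -
      have "ordc 1 0 (kc (Y (b, r)) * kc (X (a, s)) * jinv \<gamma> z r s)" for r s
      proof (rule ordc_const)
        fix i j assume *: "cf (kc (Y (b, r)) * kc (X (a, s)) * jinv \<gamma> z r s) i j \<noteq> 0"
        obtain F where "jinv \<gamma> z r s = (zf F :: 'a psd)" using jinv_zf by blast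
        thus "j = 0" using zfk * by metis
      qed
      thus ?thesis by (intro ordc_sum) blast
    qed
    then obtain c3 where 3: "ordc 1 c3 (\<Sum>r\<in>{1..n}. \<Sum>s\<in>{1..n}. kc (Y (b, r)) * kc (X (a, s)) * jinv \<gamma> z r s)" by blast
    from ordc_add[OF ordc_add[OF 1 2] 3] show ?thesis unfolding M_def diff_conv_add_uminus by (rule exI)
  qed
  hence "\<exists>c. ordc (int (length (map (\<lambda>j. M (\<sigma> j) j) [1..<d+1]))) c (prod_list (map (\<lambda>j. M (\<sigma> j) j) [1..<d+1]))" for \<sigma>
    by (intro ordc_prod_list) auto
  have "\<exists>c. ordc (int d) c (of_int (sign \<sigma>) * prod_list (map (\<lambda>j. M (\<sigma> j) j) [1..<d+1]))" for \<sigma>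
  proof -
    obtain c where *: "ordc (int d) c (prod_list (map (\<lambda>j. M (\<sigma> j) j) [1..<d+1]))"
      using \<open>\<And>\<sigma>. \<exists>c. ordc (int (length (map (\<lambda>j. M (\<sigma> j) j) [1..<d+1]))) c (prod_list (map (\<lambda>j. M (\<sigma> j) j) [1..<d+1]))\<close>[of \<sigma>] by auto
    show ?thesis using sg[of \<sigma>]
    proof
      assume "of_int (sign \<sigma>) = (1 :: 'a psd)"
      thus ?thesis using * by auto
    next
      assume "of_int (sign \<sigma>) = (- 1 :: 'a psd)"
      thus ?thesis using ordc_minus[OF *] by auto
    qed
  qed
  hence "\<exists>c. ordc (int d) c C" unfolding C_def by (intro ordc_sum) auto
  then obtain c where ordC: "ordc (int d) c C" by blast
  \<comment> \<open>The generators are the coefficients at \<open>\<partial>\<close>-exponents 0 to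
    \<open>d - 1\<close>. At exponent \<open>d\<close> there are only scalars, elsewhere only
    zeros.\<close>
  have C1: "C \<in> pcoef ?S1"
    unfolding pcoef_def
  proof (intro CollectI allI)
    fix i j
    show "cf C i j \<in> tgen ?S1"
    proof (cases "0 \<le> j \<and> j < int d")
      case True
      hence j: "nat j + 1 \<in> {1..d}" "j = int (nat j + 1) - 1" by auto
      have "cf C i j = cf C i (int (nat j + 1) - 1)" using j(2) by (rule arg_cong)
      hence "cf C i j \<in> ?S1" using j(1) by blast
      thus ?thesis by (rule tgen.gen)
    next
      case False
      show ?thesis
      proof (cases "j = int d")
        case True
        thus ?thesis using ordC by (simp add: ordc_def tgen_cs tgen_0)
      next
        case f: False
        have "cf C i j = 0" using ordC f False unfolding ordc_def by force
        thus ?thesis by (simp add: tgen_0)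
      qed
    qed
  qed
  \<comment> \<open>After the exchange no entry has positive \<open>\<partial>\<close>-degree. The
    degree \<open>- n\<close> of \<open>B\<close> comes from the \<open>n\<close> factors of
    \<open>P'\<close>, each a series in negative powers of \<open>\<partial>\<close>.\<close>
  have "jle 0 (G.NN a b)" for a b
  proof -
    have "jle 0 (kc (Y (b, r)) * kc (X (a, s)) * om (jinv \<gamma> z r s))" for r s
    proof -
      obtain F where "jinv \<gamma> z r s = (zf F :: 'a psd)" using jinv_zf by blast
      thus ?thesis by (auto simp: jle_def cf_kc_mult cf_om cf_zf mult.assoc split: if_splits)
    qed
    hence "jle 0 (\<Sum>r\<in>{1..n}. \<Sum>s\<in>{1..n}. kc (Y (b, r)) * kc (X (a, s)) * om (jinv \<gamma> z r s))" by (intro jle_sum)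
    moreover have "jle 0 ((if a = b then zz else 0) - psc (?W a b) :: 'a psd)" by (intro jle_diff) (simp_all add: jle_basic jle_0)
    ultimately show ?thesis unfolding G.NN_def by (intro jle_add)
  qed
  hence "jle (int (length (map (\<lambda>j. G.NN j (\<sigma> j)) [1..<d+1])) * 0) (prod_list (map (\<lambda>j. G.NN j (\<sigma> j)) [1..<d+1]))" for \<sigma>
    by (intro jle_prod_list) auto
  have "jle 0 (of_int (sign \<sigma>) * prod_list (map (\<lambda>j. G.NN j (\<sigma> j)) [1..<d+1]))" for \<sigma>
  proof -
    have *: "jle 0 (prod_list (map (\<lambda>j. G.NN j (\<sigma> j)) [1..<d+1]))"
      using \<open>\<And>\<sigma>. jle (int (length (map (\<lambda>j. G.NN j (\<sigma> j)) [1..<d+1])) * 0) (prod_list (map (\<lambda>j. G.NN j (\<sigma> j)) [1..<d+1]))\<close>[of \<sigma>] by (simp only: mult_zero_right)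
    show ?thesis using sg[of \<sigma>]
    proof
      assume "of_int (sign \<sigma>) = (1 :: 'a psd)"
      thus ?thesis using * by (simp only: mult_1_left)
    next
      assume "of_int (sign \<sigma>) = (- 1 :: 'a psd)"
      thus ?thesis using jle_minus[OF *] by (simp only: mult_minus1)
    qed
  qed
  hence jR: "jle 0 R" unfolding R_def by (intro jle_sum)
  have "jle (int (length (map (\<lambda>m. om (fr (?Z m m) 1)) (rev (rev [1..<n+1])) :: 'a psd list)) * (-1)) P'"
    unfolding P'_def by (intro jle_prod_list) (auto intro: jle_om_fr)
  hence jP: "jle (- int n) P'" by simp
  have "jle (int (length (map (\<lambda>j. - fr (?W j j) 1) (rev [1..<d+1]) :: 'a psd list)) * 0) Q'"
    unfolding Q'_def by (intro jle_prod_list) (auto intro!: jle_minus simp: fr_def jle_basic)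
  hence jQ: "jle 0 Q'" by simp
  have "jle 0 (e * R)" using e jR jle_minus[of 0 R] by auto
  hence "jle (0 + (- int n + 0)) B" unfolding BR by (intro jle_mult jQ jP)
  hence jB: "jle (- int n) B" by simp
  have B2: "B \<in> pcoef ?S2"
    unfolding pcoef_def
  proof (intro CollectI allI)
    fix i j
    show "cf B i j \<in> tgen ?S2"
    proof (cases "j \<le> - int n")
      case True
      hence "cf B i j \<in> ?S2" by blast
      thus ?thesis by (rule tgen.gen)
    next
      case False
      hence "cf B i j = 0" using jB by (auto simp: jle_def)
      thus ?thesis by (simp add: tgen_0)
    qed
  qed
  have "R \<in> pcoef ?S1" using C1 unfolding omC[symmetric] pcoef_om .
  hence "B \<in> pcoef ?S1" unfolding BR by (intro pcoef_mult pc)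
  hence S2: "?S2 \<subseteq> tgen ?S1" unfolding pcoef_def by blast
  have "R \<in> pcoef ?S2" unfolding RB by (intro pcoef_mult pc B2)
  hence "C \<in> pcoef ?S2" unfolding omC[symmetric] pcoef_om .
  hence S1: "?S1 \<subseteq> tgen ?S2" unfolding pcoef_def by blast
  show ?thesis by (intro equalityI tgen_minimal S1 S2)
qed

section \<open>Free algebras and operators on the exterior algebra as ring types\<close>

text \<open>Words over the whole type of letters, because a ring type cannot depend on the carrier
  of a Lie algebra. Words with letters outside the carrier are discarded later by
  \<open>restr\<close>.\<close>

typedef 'g falg = "carrier (free_alg (UNIV :: 'g set))" morphisms fc Falg
  by (rule exI[of _ "\<lambda>u. 0"]) (simp add: free_alg_def)

setup_lifting type_definition_falg

lemma fc_eqI: "fc a = fc b \<Longrightarrow> a = b" by (simp add: fc_inject)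

lemma smult_free_closed: "p \<in> carrier (free_alg X) \<Longrightarrow> c \<odot>\<^bsub>free_alg X\<^esub> p \<in> carrier (free_alg X)"
  by (auto simp: free_alg_def intro: finite_subset)

instantiation falg :: (type) calg
begin

lift_definition zero_falg :: "'a falg" is "\<zero>\<^bsub>free_alg UNIV\<^esub>"
  by (rule ring.ring_simprules[OF ring_free_alg])
lift_definition one_falg :: "'a falg" is "\<one>\<^bsub>free_alg UNIV\<^esub>"
  by (rule ring.ring_simprules[OF ring_free_alg])
lift_definition plus_falg :: "'a falg \<Rightarrow> 'a falg \<Rightarrow> 'a falg" is "add (free_alg UNIV)"
  by (rule ring.ring_simprules[OF ring_free_alg])
lift_definition times_falg :: "'a falg \<Rightarrow> 'a falg \<Rightarrow> 'a falg" is "monoid.mult (free_alg UNIV)"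
  by (rule ring.ring_simprules[OF ring_free_alg])
lift_definition uminus_falg :: "'a falg \<Rightarrow> 'a falg" is "\<lambda>p u. - p u"
  by (simp add: free_alg_def)
definition minus_falg :: "'a falg \<Rightarrow> 'a falg \<Rightarrow> 'a falg" where "minus_falg a b = a + - b"
lift_definition cs_falg :: "complex \<Rightarrow> 'a falg" is "\<lambda>c. c \<odot>\<^bsub>free_alg UNIV\<^esub> \<one>\<^bsub>free_alg UNIV\<^esub>"
  by (rule smult_free_closed) (rule ring.ring_simprules[OF ring_free_alg])

lemma fc_cs_mult: "fc (cs r * a) u = r * fc a u"
proof -
  have "fc (cs r * a) u = (\<Sum>k\<le>length u. (r * (if take k u = [] then 1 else 0)) * fc a (drop k u))"
    by (simp add: times_falg.rep_eq cs_falg.rep_eq free_alg_def)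
  also have "\<dots> = (\<Sum>k\<le>length u. if k = 0 then r * fc a u else 0)"
    by (rule sum.cong) auto
  finally show ?thesis by simp
qed

lemma fc_mult_cs: "fc (a * cs r) u = r * fc a u"
proof -
  have "fc (a * cs r) u = (\<Sum>k\<le>length u. fc a (take k u) * (r * (if drop k u = [] then 1 else 0)))"
    by (simp add: times_falg.rep_eq cs_falg.rep_eq free_alg_def)
  also have "\<dots> = (\<Sum>k\<le>length u. if k = length u then r * fc a u else 0)"
    by (rule sum.cong) auto
  finally show ?thesis by simp
qed

instance
proof
  interpret A: ring "free_alg (UNIV :: 'a set)" by (rule ring_free_alg)
  fix a b c :: "'a falg" and r s :: complex
  show "a * b * c = a * (b * c)" by transfer (rule A.m_assoc)
  show "1 * a = a" by transfer (rule A.l_one)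
  show "a * 1 = a" by transfer (rule A.r_one)
  show "a + b + c = a + (b + c)" by transfer (rule A.a_assoc)
  show "a + b = b + a" by transfer (rule A.a_comm)
  show "0 + a = a" by transfer (rule A.l_zero)
  show "- a + a = 0" by transfer (simp add: free_alg_def)
  show "a - b = a + - b" by (rule minus_falg_def)
  show "(a + b) * c = a * c + b * c" by transfer (rule A.l_distr)
  show "a * (b + c) = a * b + a * c" by transfer (rule A.r_distr)
  show "(0 :: 'a falg) \<noteq> 1" by transfer (auto simp: free_alg_def fun_eq_iff)
  show "cs (r + s) = (cs r + cs s :: 'a falg)" by transfer (auto simp: free_alg_def fun_eq_iff algebra_simps)
  show "cs r * a = a * cs r" by (rule fc_eqI) (simp add: fc_cs_mult fc_mult_cs fun_eq_iff)
  show "cs (r * s) = (cs r * cs s :: 'a falg)"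
    by (rule fc_eqI, rule ext, subst fc_cs_mult) (simp add: cs_falg.rep_eq free_alg_def)
  show "cs 1 = (1 :: 'a falg)" by transfer (simp add: free_alg_def)
qed

end

lemma fc_finite: "finite {u. fc a u \<noteq> 0}"
  using fc[of a] by (simp add: free_alg_def)

lemma fc_add: "fc (a + b) u = fc a u + fc b u" and fc_mult: "fc (a * b) u = (\<Sum>k\<le>length u. fc a (take k u) * fc b (drop k u))"
  and fc_1: "fc 1 u = (if u = [] then 1 else 0)"
  by (simp_all add: plus_falg.rep_eq times_falg.rep_eq one_falg.rep_eq free_alg_def)

definition flet :: "'g \<Rightarrow> 'g falg" where "flet x = Falg (free_word [x])"

lemma fc_flet: "fc (flet x) = free_word [x]"
  unfolding flet_def by (rule Falg_inverse) (simp add: free_alg_def free_word_def)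

definition fev :: "('g \<Rightarrow> 'b::calg) \<Rightarrow> 'g falg \<Rightarrow> 'b" where
  "fev F a = (\<Sum>u | fc a u \<noteq> 0. cs (fc a u) * prod_list (map F u))"

lemma fev_eq:
  assumes "finite U" "{u. fc a u \<noteq> 0} \<subseteq> U"
  shows "fev F a = (\<Sum>u\<in>U. cs (fc a u) * prod_list (map F u))"
  unfolding fev_def by (rule sum.mono_neutral_left) (use assms in auto)

lemma fev_flet: "fev F (flet x) = F x"
  by (subst fev_eq[of "{[x]}"]) (auto simp: fc_flet free_word_def cs_1)

lemma cs_mult_mult: "cs (p * q) * (a * b) = (cs p * a) * (cs q * b)" for a b :: "'b::calg"
  by (simp only: cs_mult mult.assoc cs_left_comm[of a])

lemma fev_hom: "alg_hom (fev F)"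
  unfolding alg_hom_def
proof (intro conjI allI)
  fix a b :: "'a falg" and c :: complex
  let ?A = "{u. fc a u \<noteq> 0}" and ?B = "{u. fc b u \<noteq> 0}"
  have fin: "finite (?A \<union> ?B)" "finite ?A" "finite ?B" by (simp_all add: fc_finite)
  have "fev F (a + b) = (\<Sum>u\<in>?A \<union> ?B. cs (fc (a + b) u) * prod_list (map F u))"
    by (rule fev_eq[OF fin(1)]) (auto simp: fc_add)
  also have "\<dots> = fev F a + fev F b"
    by (simp add: fc_add cs_add distrib_right sum.distrib fev_eq[OF fin(1), of a] fev_eq[OF fin(1), of b])
  finally show "fev F (a + b) = fev F a + fev F b" .
  let ?C = "(\<lambda>(x, y). x @ y) ` (?A \<times> ?B)"
  have C: "finite ?C" using fin by simp
  have "fev F (a * b) = (\<Sum>u\<in>?C. cs (fc (a * b) u) * prod_list (map F u))"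
  proof (rule fev_eq[OF C])
    show "{u. fc (a * b) u \<noteq> 0} \<subseteq> ?C"
    proof
      fix u assume "u \<in> {u. fc (a * b) u \<noteq> 0}"
      then obtain k where "fc a (take k u) * fc b (drop k u) \<noteq> 0"
        by (auto simp: fc_mult elim: sum.not_neutral_contains_not_neutral)
      thus "u \<in> ?C" by (intro rev_image_eqI[of "(take k u, drop k u)"]) auto
    qed
  qed
  \<comment> \<open>Pairs of words are grouped by their concatenation; the pairs over
    \<open>u\<close> correspond to the positions at which \<open>u\<close> can be cut.\<close>
  also have "\<dots> = (\<Sum>u\<in>?C. \<Sum>(x, y)\<in>{p\<in>?A \<times> ?B. (case p of (x, y) \<Rightarrow> x @ y) = u}. cs (fc a x * fc b y) * (prod_list (map F x) * prod_list (map F y)))"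
  proof (intro sum.cong refl)
    fix u
    have "(\<Sum>(x, y)\<in>{p\<in>?A \<times> ?B. (case p of (x, y) \<Rightarrow> x @ y) = u}. cs (fc a x * fc b y) * (prod_list (map F x) * prod_list (map F y)))
      = (\<Sum>k\<in>{k. k \<le> length u \<and> fc a (take k u) \<noteq> 0 \<and> fc b (drop k u) \<noteq> 0}. cs (fc a (take k u) * fc b (drop k u)) * prod_list (map F u))"
      by (rule sum.reindex_bij_witness[of _ "\<lambda>k. (take k u, drop k u)" "\<lambda>(x, y). length x"])
        (auto simp: prod_list.append[symmetric] map_append[symmetric] simp del: prod_list.append map_append)
    also have "\<dots> = (\<Sum>k\<le>length u. cs (fc a (take k u) * fc b (drop k u)) * prod_list (map F u))"
      by (rule sum.mono_neutral_left) auto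
    also have "\<dots> = cs (fc (a * b) u) * prod_list (map F u)"
      by (simp add: fc_mult cs_sum sum_distrib_right)
    finally show "cs (fc (a * b) u) * prod_list (map F u) = (\<Sum>(x, y)\<in>{p\<in>?A \<times> ?B. (case p of (x, y) \<Rightarrow> x @ y) = u}. cs (fc a x * fc b y) * (prod_list (map F x) * prod_list (map F y)))" ..
  qed
  also have "\<dots> = (\<Sum>(x, y)\<in>?A \<times> ?B. cs (fc a x * fc b y) * (prod_list (map F x) * prod_list (map F y)))"
    by (rule sum.image_gen[symmetric]) (use fin in simp)
  also have "\<dots> = (\<Sum>(x, y)\<in>?A \<times> ?B. (cs (fc a x) * prod_list (map F x)) * (cs (fc b y) * prod_list (map F y)))"
    by (intro sum.cong refl) (simp only: split_beta cs_mult_mult)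
  also have "\<dots> = fev F a * fev F b"
    unfolding fev_def sum_product sum.cartesian_product ..
  finally show "fev F (a * b) = fev F a * fev F b" .
  have "fc (cs c) u = c * (if u = [] then 1 else 0)" for u :: "'a list"
    using fc_cs_mult[of c 1 u] by (simp add: fc_1)
  thus "fev F (cs c) = cs c" by (subst fev_eq[of "{[]}"]) auto
qed

text \<open>Coefficients at infinite sets are discarded. The sign \<open>ext_sign\<close> is
  computed by \<open>card\<close>, which is 0 on infinite sets, so the anticommutation of variables
  can fail there.\<close>

definition fin_part :: "('v set \<Rightarrow> complex) \<Rightarrow> 'v set \<Rightarrow> complex" where
  "fin_part f S = (if finite S then f S else 0)"

lemma fin_part_idem [simp]: "fin_part (fin_part f) = fin_part f"
  by (simp add: fin_part_def fun_eq_iff)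

lemma fin_part_linear: "fin_part (\<lambda>S. f S + g S) = (\<lambda>S. fin_part f S + fin_part g S)"
  "fin_part (\<lambda>S. c * f S) = (\<lambda>S. c * fin_part f S)" "fin_part (\<lambda>S. - f S) = (\<lambda>S. - fin_part f S)"
  by (simp_all add: fin_part_def fun_eq_iff)

text \<open>Operators on functions of all finite sets of pairs, so that the variables with lower
  index 0 are available. Invariance under \<open>fin_part\<close> on both sides makes
  \<open>fin_part\<close> the unit of the ring.\<close>

typedef lin = "{T :: ((nat \<times> nat) set \<Rightarrow> complex) \<Rightarrow> (nat \<times> nat) set \<Rightarrow> complex.
    (\<forall>f g. T (\<lambda>S. f S + g S) = (\<lambda>S. T f S + T g S)) \<and> (\<forall>c f. T (\<lambda>S. c * f S) = (\<lambda>S. c * T f S)) \<and>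
    (\<forall>f. T (fin_part f) = T f) \<and> (\<forall>f. fin_part (T f) = T f)}" morphisms ap Lin
  by (rule exI[of _ "\<lambda>f S. 0"]) (simp add: fin_part_def fun_eq_iff)

setup_lifting type_definition_lin

lemma ap_lin: "ap T (\<lambda>S. f S + g S) = (\<lambda>S. ap T f S + ap T g S)" "ap T (\<lambda>S. c * f S) = (\<lambda>S. c * ap T f S)"
  "ap T (fin_part f) = ap T f" "fin_part (ap T f) = ap T f"
  using ap[of T] by auto

lemma lin_eqI: "(\<And>f S. finite S \<Longrightarrow> ap T f S = ap T' f S) \<Longrightarrow> T = T'"
proof -
  assume a: "\<And>f S. finite S \<Longrightarrow> ap T f S = ap T' f S"
  have "ap T f S = ap T' f S" for f S
  proof (cases "finite S")
    case False
    have "fin_part (ap T f) S = 0" "fin_part (ap T' f) S = 0" using False by (simp_all add: fin_part_def)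
    thus ?thesis by (simp only: ap_lin(4))
  qed (rule a)
  thus "T = T'" by (simp add: ap_inject[symmetric] fun_eq_iff)
qed

instantiation lin :: calg
begin

lift_definition zero_lin :: lin is "\<lambda>f S. 0" by (simp add: fin_part_def fun_eq_iff)
lift_definition one_lin :: lin is fin_part by (auto simp: fin_part_def fun_eq_iff)
lift_definition plus_lin :: "lin \<Rightarrow> lin \<Rightarrow> lin" is "\<lambda>T T' f S. T f S + T' f S"
  by (simp add: fin_part_linear add_ac distrib_left)
lift_definition uminus_lin :: "lin \<Rightarrow> lin" is "\<lambda>T f S. - T f S"
  by (simp add: fin_part_linear)
definition minus_lin :: "lin \<Rightarrow> lin \<Rightarrow> lin" where "minus_lin S T = S + - T"
lift_definition times_lin :: "lin \<Rightarrow> lin \<Rightarrow> lin" is "\<lambda>T T' f. T (T' f)" by simp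
lift_definition cs_lin :: "complex \<Rightarrow> lin" is "\<lambda>c f S. c * fin_part f S"
  by (auto simp: fin_part_def fun_eq_iff algebra_simps)

instance
proof
  fix a b c :: lin and r s :: complex
  show "a * b * c = a * (b * c)" by transfer simp
  show "1 * a = a" "a * 1 = a" by (transfer, simp add: fun_eq_iff)+
  show "a + b + c = a + (b + c)" "a + b = b + a" "0 + a = a" "- a + a = 0" by (transfer, simp add: fun_eq_iff)+
  show "a - b = a + - b" by (rule minus_lin_def)
  show "(a + b) * c = a * c + b * c" "a * (b + c) = a * b + a * c" by (transfer, simp add: fun_eq_iff)+
  show "(0 :: lin) \<noteq> 1"
  proof
    assume "(0 :: lin) = 1"
    hence "ap 0 (\<lambda>S. 1) {} = ap 1 (\<lambda>S. 1) {}" by simp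
    thus False by (simp add: zero_lin.rep_eq one_lin.rep_eq fin_part_def)
  qed
  show "cs (r + s) = (cs r + cs s :: lin)" by (transfer, simp add: fun_eq_iff algebra_simps)
  show "cs r * a = a * cs r" by transfer simp
  show "cs (r * s) = (cs r * cs s :: lin)" by transfer (simp add: fin_part_def fun_eq_iff)
  show "cs 1 = (1 :: lin)" by transfer simp
qed

end

lemma ap_ops: "ap (a + b) f S = ap a f S + ap b f S" "ap (- a) f S = - ap a f S" "ap (a - b) f S = ap a f S - ap b f S"
  "ap (a * b) f = ap a (ap b f)" "ap 1 f = fin_part f" "ap 0 f S = 0" "ap (cs c) f S = c * fin_part f S"
proof -
  show "ap (a - b) f S = ap a f S - ap b f S"
    unfolding minus_lin_def plus_lin.rep_eq uminus_lin.rep_eq by simp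
qed (simp_all add: plus_lin.rep_eq uminus_lin.rep_eq times_lin.rep_eq one_lin.rep_eq zero_lin.rep_eq cs_lin.rep_eq)

lift_definition xv :: "nat \<times> nat \<Rightarrow> lin" is
  "\<lambda>v f S. if finite S \<and> v \<in> S then ext_sign {v} (S - {v}) * f (S - {v}) else 0"
  by (auto simp: fin_part_def fun_eq_iff algebra_simps)

lift_definition dv :: "nat \<times> nat \<Rightarrow> lin" is
  "\<lambda>v f S. if finite S \<and> v \<notin> S then ext_sign {v} S * f (insert v S) else 0"
  by (auto simp: fin_part_def fun_eq_iff algebra_simps)

lemma ext_sign_sq: "ext_sign {v} S * (ext_sign {v} S * a) = a"
  unfolding ext_sign_def by (simp add: mult.assoc[symmetric] power_add[symmetric] mult_2[symmetric] del: mult_2)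

lemma ext_sign_insert:
  assumes "finite S" "w \<notin> S"
  shows "ext_sign {v} (insert w S) = (if var_less w v then - ext_sign {v} S else ext_sign {v} S)"
proof -
  have "{(s, t). s \<in> {v} \<and> t \<in> S \<and> var_less t s} = Pair v ` {t\<in>S. var_less t v}" for S by auto
  hence e: "ext_sign {v} S = (-1) ^ card {t\<in>S. var_less t v}" for S
    by (simp add: ext_sign_def card_image inj_on_def)
  have "{t\<in>insert w S. var_less t v} = (if var_less w v then insert w {t\<in>S. var_less t v} else {t\<in>S. var_less t v})" by auto
  thus ?thesis using assms by (simp add: e)
qed

lemma var_less_total: "u \<noteq> v \<Longrightarrow> var_less u v \<longleftrightarrow> \<not> var_less v u"
  by (auto simp: var_less_def prod_eq_iff)

lemma fermions_lin: "fermions xv dv"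
proof
  show sqx: "xv u * xv u = 0" for u by (rule lin_eqI) (simp add: ap_ops xv.rep_eq)
  show sqy: "dv u * dv u = 0" for u by (rule lin_eqI) (simp add: ap_ops dv.rep_eq)
  show "xv u * xv v = - (xv v * xv u)" for u v
  proof (cases "u = v")
    case False
    show ?thesis
    proof (rule lin_eqI)
      fix f and S :: "(nat \<times> nat) set" assume S: "finite S"
      show "ap (xv u * xv v) f S = ap (- (xv v * xv u)) f S"
      proof (cases "u \<in> S \<and> v \<in> S")
        case True
        \<comment> \<open>All signs are compared on a set containing neither variable; reinserting
          them changes the sign for just one of the two orders.\<close>
        define T where "T = S - {u, v}"
        have T: "S = insert u (insert v T)" "finite T" "u \<notin> T" "v \<notin> T" using True S by (auto simp: T_def)
        have D: "S - {u} = insert v T" "S - {v} = insert u T" "insert v T - {v} = T" "insert u T - {u} = T"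
          unfolding T(1) using T(3,4) False by auto
        show ?thesis using T(2-4) True S False var_less_total[OF False]
          by (auto simp: ap_ops xv.rep_eq D ext_sign_insert)
      qed (use S in \<open>auto simp: ap_ops xv.rep_eq\<close>)
    qed
  qed (simp add: sqx)
  show "dv u * dv v = - (dv v * dv u)" for u v
  proof (cases "u = v")
    case False
    show ?thesis
      by (rule lin_eqI) (use False var_less_total[OF False] in \<open>auto simp: ap_ops dv.rep_eq ext_sign_insert insert_commute\<close>)
  qed (simp add: sqy)
  show "dv u * xv v = (if u = v then 1 else 0) - xv v * dv u" for u v
  proof (rule lin_eqI)
    fix f and S :: "(nat \<times> nat) set" assume S: "finite S"
    show "ap (dv u * xv v) f S = ap ((if u = v then 1 else 0) - xv v * dv u) f S"
    proof (cases "u = v")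
      case True
      thus ?thesis using S by (auto simp: ap_ops dv.rep_eq xv.rep_eq fin_part_def ext_sign_sq insert_absorb)
    next
      case False
      show ?thesis
      proof (cases "u \<notin> S \<and> v \<in> S")
        case True
        define T where "T = S - {v}"
        have T: "S = insert v T" "finite T" "u \<notin> T" "v \<notin> T" using True S by (auto simp: T_def)
        have D: "insert u S - {v} = insert u T" "S - {v} = T" unfolding T(1) using T(3,4) False by auto
        have "ext_sign {u} S = (if var_less v u then - ext_sign {u} T else ext_sign {u} T)"
          unfolding T(1) by (rule ext_sign_insert) (use T in auto)
        thus ?thesis using T(2-4) True S False var_less_total[OF False]
          by (auto simp: ap_ops xv.rep_eq dv.rep_eq D ext_sign_insert)
      qed (use S False in \<open>auto simp: ap_ops xv.rep_eq dv.rep_eq\<close>)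
    qed
  qed
qed

section \<open>Transport to rings with carrier sets\<close>

text \<open>A ring with a carrier set as a homomorphic image of a subset \<open>T\<close> of a ring
  type. \<open>T\<close> is a proper parameter because restricting operators to the exterior algebra
  respects products only for operators that preserve it; for enveloping algebras and series
  \<open>T\<close> is everything.\<close>

locale ring_img =
  fixes T :: "'a::ring_1 set" and h :: "'a \<Rightarrow> 'b" and R :: "('b, 'm) ring_scheme" (structure)
  assumes T_0: "0 \<in> T" and T_1: "1 \<in> T" and T_add: "a \<in> T \<Longrightarrow> b \<in> T \<Longrightarrow> a + b \<in> T"
    and T_mult: "a \<in> T \<Longrightarrow> b \<in> T \<Longrightarrow> a * b \<in> T" and T_minus: "a \<in> T \<Longrightarrow> - a \<in> T"
    and carr: "carrier R = h ` T" and h_0: "h 0 = \<zero>" and h_1: "h 1 = \<one>"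
    and h_add: "a \<in> T \<Longrightarrow> b \<in> T \<Longrightarrow> h (a + b) = h a \<oplus> h b"
    and h_mult: "a \<in> T \<Longrightarrow> b \<in> T \<Longrightarrow> h (a * b) = h a \<otimes> h b"
begin

lemma T_sum: "(\<And>i. i \<in> A \<Longrightarrow> f i \<in> T) \<Longrightarrow> sum f A \<in> T"
  by (induction A rule: infinite_finite_induct) (auto intro: T_0 T_add)

lemma T_prod_list: "(\<And>x. x \<in> set xs \<Longrightarrow> x \<in> T) \<Longrightarrow> prod_list xs \<in> T"
  by (induction xs) (auto intro: T_1 T_mult)

lemmas h_ops = h_add[symmetric] h_mult[symmetric] h_0[symmetric] h_1[symmetric]

lemma is_ring: "ring R"
proof (rule ringI)
  show "abelian_group R"
  proof (rule abelian_groupI)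
    fix x assume "x \<in> carrier R"
    then obtain a where a: "a \<in> T" "x = h a" by (auto simp: carr)
    hence "h (- a) \<oplus> x = \<zero>" by (simp add: h_ops T_minus)
    thus "\<exists>y\<in>carrier R. y \<oplus> x = \<zero>" using T_minus[OF a(1)] by (auto simp: carr)
  qed (auto simp: carr h_ops T_add T_0 add_ac)
  show "monoid R" by (rule monoidI) (auto simp: carr h_ops T_mult T_1 mult.assoc)
qed (auto simp: carr h_ops T_add T_mult algebra_simps)

sublocale R: ring R by (rule is_ring)

lemma h_closed: "a \<in> T \<Longrightarrow> h a \<in> carrier R"
  by (simp add: carr)

lemma h_minus: "a \<in> T \<Longrightarrow> h (- a) = \<ominus> h a"
  by (rule R.minus_equality[symmetric]) (simp_all add: h_add[symmetric] T_minus h_0 h_closed)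

lemma h_diff: "a \<in> T \<Longrightarrow> b \<in> T \<Longrightarrow> h (a - b) = h a \<ominus> h b"
  using h_add[OF _ T_minus, of a b] by (simp add: h_minus R.minus_eq)

lemma h_finsum: "(\<And>i. i \<in> A \<Longrightarrow> f i \<in> T) \<Longrightarrow> (\<And>i. i \<in> A \<Longrightarrow> g i = h (f i)) \<Longrightarrow> finsum R g A = h (sum f A)"
proof (induction A rule: infinite_finite_induct)
  case (insert x F)
  have "finsum R g (insert x F) = g x \<oplus> finsum R g F"
    by (rule R.finsum_insert) (use insert in \<open>auto simp: carr\<close>)
  thus ?case using insert by (simp add: h_add T_sum)
qed (simp_all add: R.finsum_infinite h_0)

lemma h_list_prod:
  "(\<And>x. x \<in> set xs \<Longrightarrow> f x \<in> T) \<Longrightarrow> (\<And>x. x \<in> set xs \<Longrightarrow> g x = h (f x)) \<Longrightarrow> list_prod R (map g xs) = h (prod_list (map f xs))"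
proof (induction xs)
  case (Cons x xs)
  have "prod_list (map f xs) \<in> T" by (rule T_prod_list) (use Cons.prems in auto)
  thus ?case using Cons by (simp add: list_prod_def h_mult)
qed (simp add: list_prod_def h_1)

lemma h_sign:
  assumes "a \<in> T" shows "[sign \<sigma>] \<cdot> h a = h (of_int (sign \<sigma>) * a)"
proof -
  have "sign \<sigma> = 1 \<or> sign \<sigma> = - 1" by (cases \<sigma> rule: sign_cases) auto
  thus ?thesis
  proof
    assume "sign \<sigma> = 1"
    thus ?thesis using h_closed[OF assms] by (simp add: add_pow_int_ge One_nat_def)
  next
    assume "sign \<sigma> = - 1"
    thus ?thesis using h_closed[OF assms] by (simp add: add_pow_int_lt h_minus[OF assms] One_nat_def)
  qed
qed

lemma cdet_img:
  assumes N: "\<And>i j. i \<in> {1..k} \<Longrightarrow> j \<in> {1..k} \<Longrightarrow> N i j \<in> T \<and> M (i, j) = h (N i j)"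
  shows "cdet R k M = h (\<Sum>\<sigma> | \<sigma> permutes {1..k}. of_int (sign \<sigma>) * prod_list (map (\<lambda>j. N (\<sigma> j) j) [1..<k+1]))"
  unfolding cdet_def
proof (rule h_finsum)
  fix \<sigma> assume "\<sigma> \<in> {\<sigma>. \<sigma> permutes {1..k}}"
  hence in_k: "\<sigma> j \<in> {1..k}" "j \<in> {1..k}" if "j \<in> set [1..<k+1]" for j
    using that permutes_in_image[of \<sigma> "{1..k}" j] by auto
  have T: "prod_list (map (\<lambda>j. N (\<sigma> j) j) [1..<k+1]) \<in> T"
    by (rule T_prod_list) (use N in_k in auto)
  show "of_int (sign \<sigma>) * prod_list (map (\<lambda>j. N (\<sigma> j) j) [1..<k+1]) \<in> T"
    using T by (cases \<sigma> rule: sign_cases) (auto intro: T_minus)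
  have "list_prod R (map (\<lambda>j. M (\<sigma> j, j)) [1..<k+1]) = h (prod_list (map (\<lambda>j. N (\<sigma> j) j) [1..<k+1]))"
    by (rule h_list_prod) (use N in_k in auto)
  thus "[sign \<sigma>] \<cdot> list_prod R (map (\<lambda>j. M (\<sigma> j, j)) [1..<k+1]) = h (of_int (sign \<sigma>) * prod_list (map (\<lambda>j. N (\<sigma> j) j) [1..<k+1]))"
    by (simp only: h_sign[OF T])
qed

end

section \<open>Matrices, inverses and the Berezinian in an image ring\<close>

locale ring_onto = ring_img UNIV h R
  for h :: "'a::ring_1 \<Rightarrow> 'b" and R :: "('b, 'm) ring_scheme" (structure)
begin

definition himg :: "nat \<Rightarrow> (nat \<Rightarrow> nat \<Rightarrow> 'a) \<Rightarrow> nat \<times> nat \<Rightarrow> 'b" where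
  "himg k A = (\<lambda>(i, j)\<in>{1..k} \<times> {1..k}. h (A i j))"

lemma himg_cong: "(\<And>i j. i \<in> {1..k} \<Longrightarrow> j \<in> {1..k} \<Longrightarrow> A i j = B i j) \<Longrightarrow> himg k A = himg k B"
  unfolding himg_def by (rule ext) (auto simp: restrict_def)

lemma himg_app: "i \<in> {1..k} \<Longrightarrow> j \<in> {1..k} \<Longrightarrow> himg k A (i, j) = h (A i j)"
  by (simp add: himg_def)

lemma himg_out: "q \<notin> {1..k} \<times> {1..k} \<Longrightarrow> himg k A q = undefined"
  by (simp add: himg_def)

lemma himg_carrier: "himg k A \<in> carrier (matrix_ring R k)"
  by (auto simp: himg_def matrix_ring_def Let_def carr)

lemma himg_surj:
  assumes "M \<in> carrier (matrix_ring R k)" obtains A where "M = himg k A"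
proof
  have M: "M \<in> {1..k} \<times> {1..k} \<rightarrow>\<^sub>E carrier R" using assms by (simp add: matrix_ring_def Let_def)
  show "M = himg k (\<lambda>i j. inv_into UNIV h (M (i, j)))"
  proof
    fix p :: "nat \<times> nat"
    obtain i j where p: "p = (i, j)" by (cases p)
    show "M p = himg k (\<lambda>i j. inv_into UNIV h (M (i, j))) p"
    proof (cases "p \<in> {1..k} \<times> {1..k}")
      case True
      hence "M p \<in> range h" using M carr by auto
      thus ?thesis using True by (simp add: himg_def p f_inv_into_f)
    next
      case False
      have "M p = undefined" by (rule PiE_arb[OF M False])
      thus ?thesis using False by (simp add: himg_def)
    qed
  qed
qed

lemma himg_mult: "himg k A \<otimes>\<^bsub>matrix_ring R k\<^esub> himg k B = himg k (\<lambda>i j. \<Sum>s\<in>{1..k}. A i s * B s j)"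
proof
  fix p :: "nat \<times> nat"
  obtain i j where p: "p = (i, j)" by (cases p)
  show "(himg k A \<otimes>\<^bsub>matrix_ring R k\<^esub> himg k B) p = himg k (\<lambda>i j. \<Sum>s\<in>{1..k}. A i s * B s j) p"
  proof (cases "p \<in> {1..k} \<times> {1..k}")
    case True
    have "finsum R (\<lambda>s. himg k A (i, s) \<otimes> himg k B (s, j)) {1..k} = h (\<Sum>s\<in>{1..k}. A i s * B s j)"
      by (rule h_finsum) (use True in \<open>auto simp: himg_def p h_mult\<close>)
    thus ?thesis using True by (simp add: matrix_ring_def Let_def himg_app p)
  next
    case False
    thus ?thesis by (simp add: matrix_ring_def Let_def himg_out)
  qed
qed

lemma himg_one: "\<one>\<^bsub>matrix_ring R k\<^esub> = himg k (\<lambda>i j. if i = j then 1 else 0)"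
  unfolding himg_def matrix_ring_def Let_def by (auto simp: fun_eq_iff restrict_def h_0 h_1)

lemma matrix_monoid: "monoid (matrix_ring R k)"
proof (rule monoidI)
  show "\<one>\<^bsub>matrix_ring R k\<^esub> \<in> carrier (matrix_ring R k)" unfolding himg_one by (rule himg_carrier)
  fix x y z assume "x \<in> carrier (matrix_ring R k)" "y \<in> carrier (matrix_ring R k)"
  then obtain A B where AB: "x = himg k A" "y = himg k B" by (metis himg_surj)
  show "x \<otimes>\<^bsub>matrix_ring R k\<^esub> y \<in> carrier (matrix_ring R k)" unfolding AB himg_mult by (rule himg_carrier)
  assume "z \<in> carrier (matrix_ring R k)"
  then obtain C where C: "z = himg k C" by (metis himg_surj)
  have "(\<Sum>s\<in>{1..k}. (\<Sum>t\<in>{1..k}. A i t * B t s) * C s j) = (\<Sum>t\<in>{1..k}. A i t * (\<Sum>s\<in>{1..k}. B t s * C s j))" for i j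
    unfolding sum_distrib_left sum_distrib_right by (subst sum.swap) (simp add: mult.assoc)
  thus "x \<otimes>\<^bsub>matrix_ring R k\<^esub> y \<otimes>\<^bsub>matrix_ring R k\<^esub> z = x \<otimes>\<^bsub>matrix_ring R k\<^esub> (y \<otimes>\<^bsub>matrix_ring R k\<^esub> z)"
    unfolding AB C himg_mult by simp
next
  fix x assume "x \<in> carrier (matrix_ring R k)"
  then obtain A where A: "x = himg k A" by (metis himg_surj)
  show "\<one>\<^bsub>matrix_ring R k\<^esub> \<otimes>\<^bsub>matrix_ring R k\<^esub> x = x"
    unfolding A himg_one himg_mult
  proof (rule himg_cong)
    fix i j assume "i \<in> {1..k}"
    have "(\<Sum>s\<in>{1..k}. (if i = s then 1 else 0) * A s j) = (\<Sum>s\<in>{1..k}. if i = s then A s j else 0)"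
      by (rule sum.cong) auto
    thus "(\<Sum>s\<in>{1..k}. (if i = s then 1 else 0) * A s j) = A i j" using \<open>i \<in> {1..k}\<close> by simp
  qed
  show "x \<otimes>\<^bsub>matrix_ring R k\<^esub> \<one>\<^bsub>matrix_ring R k\<^esub> = x"
    unfolding A himg_one himg_mult
  proof (rule himg_cong)
    fix i j assume "j \<in> {1..k}"
    have "(\<Sum>s\<in>{1..k}. A i s * (if s = j then 1 else 0)) = (\<Sum>s\<in>{1..k}. if s = j then A i s else 0)"
      by (rule sum.cong) auto
    thus "(\<Sum>s\<in>{1..k}. A i s * (if s = j then 1 else 0)) = A i j" using \<open>j \<in> {1..k}\<close> by simp
  qed
qed

lemma inverse_img:
  assumes "a * b = 1" "b * a = 1" shows "inv (h a) = h b"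
  by (rule R.inv_unique'[symmetric]) (use assms in \<open>auto simp: carr h_mult[symmetric] h_1\<close>)

lemma matrix_inverse_img:
  assumes "\<And>i j. i \<in> {1..k} \<Longrightarrow> j \<in> {1..k} \<Longrightarrow> (\<Sum>s\<in>{1..k}. A i s * B s j) = (if i = j then 1 else 0)"
    "\<And>i j. i \<in> {1..k} \<Longrightarrow> j \<in> {1..k} \<Longrightarrow> (\<Sum>s\<in>{1..k}. B i s * A s j) = (if i = j then 1 else 0)"
  shows "inv\<^bsub>matrix_ring R k\<^esub> (himg k A) = himg k B"
  by (rule monoid.inv_unique'[OF matrix_monoid, symmetric])
     (simp_all only: himg_carrier himg_mult himg_one, (rule himg_cong, rule assms; assumption)+)

text \<open>Inverses in a monoid are unique, so a two-sided inverse exhibited over the ring type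
  determines the inverse in the image. The diagonal entry \<open>V m m m\<close> is inverted in
  \<open>ber_factor\<close> and again in \<open>Ber\<close>; \<open>U m\<close> is the value in
  between.\<close>

lemma Ber_img:
  assumes M: "\<And>i j. i \<in> {1..n} \<Longrightarrow> j \<in> {1..n} \<Longrightarrow> M (i, j) = h (N i j)"
    and V: "\<And>m i j. m \<in> {1..n} \<Longrightarrow> i \<in> {1..m} \<Longrightarrow> j \<in> {1..m} \<Longrightarrow> (\<Sum>k\<in>{1..m}. N i k * V m k j) = (if i = j then 1 else 0)"
    "\<And>m i j. m \<in> {1..n} \<Longrightarrow> i \<in> {1..m} \<Longrightarrow> j \<in> {1..m} \<Longrightarrow> (\<Sum>k\<in>{1..m}. V m i k * N k j) = (if i = j then 1 else 0)"
    and U: "\<And>m. m \<in> {1..n} \<Longrightarrow> V m m m * U m = 1" "\<And>m. m \<in> {1..n} \<Longrightarrow> U m * V m m m = 1"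
  shows "Ber R n M = h (prod_list (map (\<lambda>m. V m m m) [1..<n+1]))"
  unfolding Ber_def
proof (rule h_list_prod)
  fix m assume "m \<in> set [1..<n+1]"
  hence m: "m \<in> {1..n}" by auto
  have "restrict M ({1..m} \<times> {1..m}) = himg m N"
    unfolding himg_def by (rule restrict_ext) (use M m in auto)
  hence "inv\<^bsub>matrix_ring R m\<^esub> (restrict M ({1..m} \<times> {1..m})) = himg m (V m)"
    using matrix_inverse_img[OF V[OF m]] by simp
  hence "ber_factor R M m = inv (h (V m m m))" using m by (simp add: ber_factor_def himg_def)
  also have "\<dots> = h (U m)" by (rule inverse_img[OF U[OF m]])
  finally show "inv (ber_factor R M m) = h (V m m m)" using inverse_img[OF U(2)[OF m] U(1)[OF m]] by simp
qed simp

end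

section \<open>Pseudo-differential series over an image algebra\<close>

locale alg_onto = ring_onto p U
  for p :: "'a::calg \<Rightarrow> 'u" and U :: "(complex, 'u, 'm) module_scheme" (structure) +
  assumes smult: "c \<odot> p a = p (cs c * a)"
begin

definition psd_img :: "'a psd \<Rightarrow> int \<Rightarrow> int \<Rightarrow> 'u" where
  "psd_img f = (\<lambda>i j. p (cf f i j))"

lemma p_sum_0: "(\<And>i. i \<in> A \<Longrightarrow> p (f i) = \<zero>) \<Longrightarrow> p (sum f A) = \<zero>"
  by (induction A rule: infinite_finite_induct) (auto simp: h_0 h_add)

lemma psdo_mult_img: "psdo_mult U (psd_img f) (psd_img g) i j = p (cf (f * g) i j)"
proof -
  obtain B where B: "bnd B (cf f)" "bnd B (cf g)" by (rule bnd_cf2)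
  let ?P = "pidx (cf f) (cf g) i j"
  let ?Q = "{(i1, j1, i2, j2, k). psd_img f i1 j1 \<noteq> \<zero> \<and> psd_img g i2 j2 \<noteq> \<zero> \<and> i1 + i2 = i + int k \<and> j1 + j2 = j + int k}"
  let ?t = "\<lambda>(i1, j1, i2, j2, k). cs (pc k j1 i2) * (cf f i1 j1 * cf g i2 j2)"
  have QP: "?Q \<subseteq> ?P" by (auto simp: pidx_def psd_img_def h_0)
  have fin: "finite ?P" by (rule finite_pidx[OF B])
  have "psdo_mult U (psd_img f) (psd_img g) i j = p (sum ?t ?Q)"
    unfolding psdo_mult_def
    by (rule h_finsum) (auto simp: psd_img_def h_mult[symmetric] smult pc_def)
  \<comment> \<open>The quotient map can annihilate coefficients, so \<open>psdo_mult\<close> sums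
    over fewer tuples than the product upstairs; the additional terms have image zero.\<close>
  also have "p (sum ?t (?P - ?Q)) = \<zero>"
  proof (rule p_sum_0)
    fix q assume q: "q \<in> ?P - ?Q"
    obtain i1 j1 i2 j2 k where e: "q = (i1, j1, i2, j2, k)" by (cases q) auto
    have "p (cf f i1 j1) = \<zero> \<or> p (cf g i2 j2) = \<zero>" using q unfolding e by (auto simp: pidx_def psd_img_def)
    thus "p (?t q) = \<zero>" unfolding e by (auto simp: h_mult h_closed)
  qed
  hence "p (sum ?t ?Q) = p (sum ?t (?P - ?Q)) \<oplus> p (sum ?t ?Q)" by (simp add: h_closed)
  also have "\<dots> = p (sum ?t (?P - ?Q) + sum ?t ?Q)" by (simp add: h_add)
  also have "sum ?t (?P - ?Q) + sum ?t ?Q = sum ?t ?P" by (rule sum.subset_diff[OF QP fin, symmetric])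
  finally show ?thesis by (simp add: cf_mult pmul_def)
qed

lemma psd_surj:
  assumes "g \<in> carrier (psdo U)" obtains f where "g = psd_img f"
proof -
  obtain r s where rs: "\<And>i j. g i j \<noteq> \<zero> \<Longrightarrow> i \<le> r \<and> j \<le> s" and g: "\<And>i j. g i j \<in> carrier U"
    using assms by (auto simp: psdo_def)
  \<comment> \<open>Zero is lifted to zero; an arbitrary preimage would destroy the upper bound on
    the exponents.\<close>
  define f where "f i j = (if g i j = \<zero> then 0 else inv_into UNIV p (g i j))" for i j
  have "bnd (max r s) f" using rs unfolding bnd_def f_def by (smt (verit))
  hence "cf (Psd f) = f" by (rule cf_Psd) 
  moreover have "p (f i j) = g i j" for i j
    using g[of i j] by (auto simp: f_def h_0 carr f_inv_into_f)
  ultimately have "g = psd_img (Psd f)" by (simp add: psd_img_def fun_eq_iff)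
  thus ?thesis by (rule that)
qed

lemma psd_img_carrier: "psd_img f \<in> carrier (psdo U)"
proof -
  obtain B where "bnd B (cf f)" by (rule bnd_cf)
  hence "\<forall>i j. p (cf f i j) \<noteq> \<zero> \<longrightarrow> i \<le> B \<and> j \<le> B" unfolding bnd_def using h_0 by metis
  thus ?thesis unfolding psdo_def psd_img_def by (auto simp: carr)
qed

lemma psdo_onto: "ring_onto psd_img (psdo U)"
proof
  show "carrier (psdo U) = range psd_img" using psd_surj psd_img_carrier by blast
  show "psd_img 0 = \<zero>\<^bsub>psdo U\<^esub>" by (simp add: psd_img_def psdo_def cf_0 h_0)
  show "psd_img 1 = \<one>\<^bsub>psdo U\<^esub>" by (auto simp: psd_img_def psdo_def cf_1 h_0 h_1 fun_eq_iff)
  show "psd_img (f + g) = psd_img f \<oplus>\<^bsub>psdo U\<^esub> psd_img g" for f g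
    by (simp add: psd_img_def psdo_def cf_add h_add)
  show "psd_img (f * g) = psd_img f \<otimes>\<^bsub>psdo U\<^esub> psd_img g" for f g
    by (simp add: psdo_def fun_eq_iff psdo_mult_img) (simp add: psd_img_def)
qed auto

lemma psdo_dz_img: "psdo_dz U = psd_img dd"
  by (auto simp: psdo_dz_def psd_img_def cf_mono h_0 h_1 fun_eq_iff)

lemma psdo_const_img: "psdo_const U (c \<odot> \<one>) = psd_img (psc c)"
  unfolding h_1[symmetric] smult by (auto simp: psdo_const_def psd_img_def psc_def cf_kc h_0 fun_eq_iff)

lemma psdo_frac_img: "psdo_frac U (p a) w m = psd_img (kc a * fr w m)"
  by (auto simp: psdo_frac_def psd_img_def fr_def cf_kc_mult cf_zf smult cs_comm[of _ a] h_0 fun_eq_iff)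

end

lemma alg_generate_img:
  assumes "h 1 = \<one>\<^bsub>A\<^esub>"
    and "\<And>a b. a \<in> tgen S \<Longrightarrow> b \<in> tgen S \<Longrightarrow> h (a + b) = h a \<oplus>\<^bsub>A\<^esub> h b"
    and "\<And>a b. a \<in> tgen S \<Longrightarrow> b \<in> tgen S \<Longrightarrow> h (a * b) = h a \<otimes>\<^bsub>A\<^esub> h b"
    and "\<And>a c. a \<in> tgen S \<Longrightarrow> h (cs c * a) = c \<odot>\<^bsub>A\<^esub> h a"
  shows "alg_generate A (h ` S) = h ` tgen S"
proof (intro equalityI subsetI)
  fix y assume "y \<in> alg_generate A (h ` S)"
  thus "y \<in> h ` tgen S"
  proof induction
    case one
    show ?case using assms(1) tgen.one by (metis image_eqI)
  next
    case (gen x)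
    thus ?case by (auto intro: tgen.gen)
  next
    case (add x y)
    thus ?case using assms(2) by (auto simp: image_iff) (metis tgen.add)
  next
    case (mult x y)
    thus ?case using assms(3) by (auto simp: image_iff) (metis tgen.mult)
  next
    case (smult x c)
    thus ?case using assms(4) by (auto simp: image_iff) (metis tgen.cs)
  qed
next
  fix y assume "y \<in> h ` tgen S"
  then obtain x where x: "x \<in> tgen S" "y = h x" by auto
  from x(1) show "y \<in> alg_generate A (h ` S)" unfolding x(2)
    by induction (auto simp: assms intro: alg_generate.intros)
qed

lemma prod_list_zero: "0 \<in> set xs \<Longrightarrow> prod_list xs = (0 :: 'a::semiring_1)"
  by (induction xs) auto

section \<open>Enveloping algebras as quotients of free algebras, and their homomorphisms\<close>

locale uea_pres =
  fixes L :: "'g lie_alg"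
  assumes add_closed: "x \<in> carrier L \<Longrightarrow> y \<in> carrier L \<Longrightarrow> lie_add L x y \<in> carrier L"
    and smult_closed: "x \<in> carrier L \<Longrightarrow> lie_smult L c x \<in> carrier L"
    and bracket_closed: "x \<in> carrier L \<Longrightarrow> y \<in> carrier L \<Longrightarrow> lie_bracket L x y \<in> carrier L"
begin

abbreviation A where "A \<equiv> free_alg (carrier L)"
abbreviation I where "I \<equiv> uea_ideal L"

text \<open>Respects products because a word has all letters in the carrier exactly when both parts
  of every cut do.\<close>

definition restr :: "'g falg \<Rightarrow> 'g list \<Rightarrow> complex" where
  "restr f = (\<lambda>u. if u \<in> lists (carrier L) then fc f u else 0)"

lemma restr_carrier: "restr f \<in> carrier A"
proof -
  have "{u. restr f u \<noteq> 0} \<subseteq> {u. fc f u \<noteq> 0}" "{u. restr f u \<noteq> 0} \<subseteq> lists (carrier L)" by (auto simp: restr_def)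
  thus ?thesis unfolding free_alg_def using finite_subset[OF _ fc_finite] by auto
qed

lemma restr_surj: "g \<in> carrier A \<Longrightarrow> restr (Falg g) = g"
proof -
  assume g: "g \<in> carrier A"
  hence "fc (Falg g) = g" by (intro Falg_inverse) (auto simp: free_alg_def)
  thus ?thesis using g by (auto simp: restr_def free_alg_def fun_eq_iff)
qed

lemma restr_onto: "ring_onto restr A"
proof
  show "carrier A = range restr" 
  proof (intro equalityI subsetI)
    fix g assume "g \<in> carrier A"
    thus "g \<in> range restr" using restr_surj[of g] by (intro image_eqI[of _ _ "Falg g"]) auto
  qed (auto intro: restr_carrier)
  show "restr 0 = \<zero>\<^bsub>A\<^esub>" by (simp add: restr_def zero_falg.rep_eq free_alg_def fun_eq_iff)
  show "restr 1 = \<one>\<^bsub>A\<^esub>" by (simp add: restr_def one_falg.rep_eq free_alg_def fun_eq_iff)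
  show "restr (f + g) = restr f \<oplus>\<^bsub>A\<^esub> restr g" for f g by (simp add: restr_def fc_add free_alg_def fun_eq_iff)
  show "restr (f * g) = restr f \<otimes>\<^bsub>A\<^esub> restr g" for f g
  proof
    fix u
    have "u \<in> lists (carrier L) \<longleftrightarrow> take k u \<in> lists (carrier L) \<and> drop k u \<in> lists (carrier L)" for k
      by (metis append_in_lists_conv append_take_drop_id)
    hence "(if u \<in> lists (carrier L) then fc f (take k u) * fc g (drop k u) else 0) = restr f (take k u) * restr g (drop k u)" for k
      by (auto simp: restr_def)
    hence "(\<Sum>k\<le>length u. if u \<in> lists (carrier L) then fc f (take k u) * fc g (drop k u) else 0) = (restr f \<otimes>\<^bsub>A\<^esub> restr g) u"
      by (simp add: free_alg_def)
    thus "restr (f * g) u = (restr f \<otimes>\<^bsub>A\<^esub> restr g) u"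
      by (cases "u \<in> lists (carrier L)") (simp_all add: restr_def fc_mult)
  qed
qed auto

sublocale A: ring_onto restr A by (rule restr_onto)

lemma restr_smult: "c \<odot>\<^bsub>A\<^esub> restr a = restr (cs c * a)"
  by (simp add: free_alg_def restr_def fc_cs_mult fun_eq_iff)

lemma restr_flet: "x \<in> carrier L \<Longrightarrow> restr (flet x) = free_word [x]"
  by (auto simp: restr_def fc_flet free_word_def fun_eq_iff)

sublocale I: ideal I A
  unfolding uea_ideal_def
  by (rule A.R.genideal_ideal, rule uea_relations_closed) (rule add_closed smult_closed bracket_closed; assumption)+

lemma I_zero: "\<zero>\<^bsub>A\<^esub> \<in> I"
  by (rule additive_subgroup.zero_closed[OF ideal.axioms(1)[OF I.ideal_axioms]])

lemma I_carrier: "i \<in> I \<Longrightarrow> i \<in> carrier A"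
  by (rule ideal.Icarr[OF I.ideal_axioms])

definition cls :: "'g falg \<Rightarrow> ('g list \<Rightarrow> complex) set" where
  "cls f = I +>\<^bsub>A\<^esub> restr f"

lemma uea_simps: "carrier (uea L) = carrier (A Quot I)" "monoid.mult (uea L) = monoid.mult (A Quot I)"
  "monoid.one (uea L) = monoid.one (A Quot I)" "ring.zero (uea L) = ring.zero (A Quot I)" "ring.add (uea L) = ring.add (A Quot I)"
  "smult (uea L) = (\<lambda>c C. \<Union>p\<in>C. I +>\<^bsub>A\<^esub> (c \<odot>\<^bsub>A\<^esub> p))"
  by (simp_all add: uea_def alg_quot_def)

lemma coset_zero: "x \<in> I \<Longrightarrow> I +>\<^bsub>A\<^esub> x = I"
  by (rule I.a_rcos_const)

lemma cls_onto: "ring_onto cls (uea L)"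
proof
  have hom: "(+>\<^bsub>A\<^esub>) I \<in> Ring.ring_hom A (A Quot I)" by (rule I.rcos_ring_hom)
  show "carrier (uea L) = range cls"
    unfolding uea_simps cls_def by (auto simp: FactRing_def A_RCOSETS_def' A.carr)
  show "cls 0 = \<zero>\<^bsub>uea L\<^esub>" unfolding uea_simps cls_def A.h_0 coset_zero[OF I_zero]
    by (simp add: FactRing_def)
  show "cls 1 = \<one>\<^bsub>uea L\<^esub>" unfolding uea_simps cls_def A.h_1 by (simp add: FactRing_def)
  show "cls (f + g) = cls f \<oplus>\<^bsub>uea L\<^esub> cls g" for f g
    unfolding uea_simps cls_def A.h_add[OF UNIV_I UNIV_I] by (rule ring_hom_add[OF hom]) (rule restr_carrier)+
  show "cls (f * g) = cls f \<otimes>\<^bsub>uea L\<^esub> cls g" for f g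
    unfolding uea_simps cls_def A.h_mult[OF UNIV_I UNIV_I] by (rule ring_hom_mult[OF hom]) (rule restr_carrier)+
qed auto

lemma I_cls: "restr j \<in> I \<Longrightarrow> cls j = \<zero>\<^bsub>uea L\<^esub>"
  unfolding cls_def uea_simps by (simp add: coset_zero FactRing_def)

lemma coset_mem: "p \<in> cls f \<Longrightarrow> \<exists>j. restr j \<in> I \<and> p = restr (j + f)"
proof -
  assume "p \<in> cls f"
  then obtain i where i: "i \<in> I" "p = i \<oplus>\<^bsub>A\<^esub> restr f" by (auto simp: cls_def a_r_coset_def')
  then obtain j where "i = restr j" using restr_surj[OF I_carrier[OF i(1)]] by metis
  thus ?thesis using i A.h_add[of j f] by auto
qed

lemma cls_self: "restr f \<in> cls f"
proof -
  have "restr f = \<zero>\<^bsub>A\<^esub> \<oplus>\<^bsub>A\<^esub> restr f" using restr_carrier by simp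
  thus ?thesis unfolding cls_def a_r_coset_def' using I_zero by blast
qed

lemma cls_alg_onto: "alg_onto cls (uea L)"
proof -
  interpret U: ring_onto cls "uea L" by (rule cls_onto)
  show ?thesis
  proof
    fix c a
    have "I +>\<^bsub>A\<^esub> (c \<odot>\<^bsub>A\<^esub> p) = cls (cs c * a)" if p: "p \<in> cls a" for p
    proof -
      obtain j where j: "restr j \<in> I" "p = restr (j + a)" using coset_mem[OF p] by auto
      have "restr (cs c * j) \<in> I" unfolding A.h_mult[OF UNIV_I UNIV_I] by (rule I.I_l_closed[OF j(1) restr_carrier])
      hence z: "cls (cs c * j) = \<zero>\<^bsub>uea L\<^esub>" by (rule I_cls)
      have "I +>\<^bsub>A\<^esub> (c \<odot>\<^bsub>A\<^esub> p) = cls (cs c * j + cs c * a)" unfolding j(2) restr_smult cls_def by (simp add: distrib_left)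
      also have "\<dots> = cls (cs c * a)" using z by (simp add: U.h_add U.h_closed)
      finally show ?thesis .
    qed
    thus "c \<odot>\<^bsub>uea L\<^esub> cls a = cls (cs c * a)" unfolding uea_simps using cls_self[of a] by auto
  qed
qed

lemma uea_gen_cls: "x \<in> carrier L \<Longrightarrow> uea_gen L x = cls (flet x)"
  by (simp add: uea_gen_def cls_def restr_flet)

context
  fixes F :: "'g \<Rightarrow> 'b::calg"
  assumes F_add: "x \<in> carrier L \<Longrightarrow> y \<in> carrier L \<Longrightarrow> F (lie_add L x y) = F x + F y"
    and F_smult: "x \<in> carrier L \<Longrightarrow> F (lie_smult L c x) = cs c * F x"
    and F_bracket: "x \<in> carrier L \<Longrightarrow> y \<in> carrier L \<Longrightarrow> F (lie_bracket L x y) = F x * F y - F y * F x"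
begin

text \<open>Letters outside the carrier are sent to 0, which makes the value depend on
  \<open>restr f\<close> alone; see \<open>lam_eq\<close>.\<close>

definition lam :: "'g falg \<Rightarrow> 'b" where
  "lam = fev (\<lambda>x. if x \<in> carrier L then F x else 0)"

lemma lam_hom: "alg_hom lam"
  unfolding lam_def by (rule fev_hom)

lemma lam_flet: "x \<in> carrier L \<Longrightarrow> lam (flet x) = F x"
  by (simp add: lam_def fev_flet)

lemma lam_eq: "lam f = (\<Sum>u | restr f u \<noteq> 0. cs (restr f u) * prod_list (map F u))"
proof -
  let ?F = "\<lambda>x. if x \<in> carrier L then F x else 0"
  have "lam f = (\<Sum>u | restr f u \<noteq> 0. cs (fc f u) * prod_list (map ?F u))"
    unfolding lam_def fev_def
  proof (rule sum.mono_neutral_right[OF fc_finite])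
    show "{u. restr f u \<noteq> 0} \<subseteq> {u. fc f u \<noteq> 0}" by (auto simp: restr_def)
    show "\<forall>u\<in>{u. fc f u \<noteq> 0} - {u. restr f u \<noteq> 0}. cs (fc f u) * prod_list (map ?F u) = 0"
    proof
      fix u assume "u \<in> {u. fc f u \<noteq> 0} - {u. restr f u \<noteq> 0}"
      hence "0 \<in> set (map ?F u)" by (auto simp: restr_def image_iff split: if_splits)
      thus "cs (fc f u) * prod_list (map ?F u) = 0" by (simp add: prod_list_zero)
    qed
  qed
  also have "\<dots> = (\<Sum>u | restr f u \<noteq> 0. cs (restr f u) * prod_list (map F u))"
  proof (rule sum.cong)
    fix u assume "u \<in> {u. restr f u \<noteq> 0}"
    hence u: "u \<in> lists (carrier L)" by (auto simp: restr_def split: if_splits)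
    hence m: "map ?F u = map F u" by auto
    have "restr f u = fc f u" using u by (simp add: restr_def)
    thus "cs (fc f u) * prod_list (map ?F u) = cs (restr f u) * prod_list (map F u)" unfolding m by (rule arg_cong[OF sym])
  qed simp
  finally show ?thesis .
qed

text \<open>The restrictions of elements annihilated by \<open>lam\<close> form an ideal that
  contains the defining relations, hence also the ideal generated by them. Since two elements with
  the same restriction have the same value, vanishing passes back to \<open>f\<close>.\<close>

lemma lam_ideal:
  assumes "restr f \<in> I" shows "lam f = 0"
proof -
  note lh = hom_add[OF lam_hom] hom_mult[OF lam_hom] hom_0[OF lam_hom] hom_cs[OF lam_hom]
  define J where "J = {restr f | f. lam f = 0}"
  have lm: "lam (- a) = - lam a" for a using lh(1)[of a "- a"] lh(3) by (simp add: eq_neg_iff_add_eq_0 add.commute)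
  have ld: "lam (a - b) = lam a - lam b" for a b using lh(1)[of a "- b"] lm[of b] by simp
  have "ideal J A"
  proof (rule idealI)
    show "ring A" by (rule ring_free_alg)
    show "subgroup J (add_monoid A)"
    proof (rule group.subgroupI)
      show "group (add_monoid A)" by (rule A.R.a_group)
      show "J \<subseteq> carrier (add_monoid A)" by (auto simp: J_def A.carr)
      show "J \<noteq> {}" using lh(3) by (auto simp: J_def)
      fix a assume "a \<in> J"
      then obtain f where f: "a = restr f" "lam f = 0" by (auto simp: J_def)
      hence "\<ominus>\<^bsub>A\<^esub> a = restr (- f)" "lam (- f) = 0" by (simp_all add: A.h_minus lm)
      thus "inv\<^bsub>add_monoid A\<^esub> a \<in> J" by (auto simp: J_def a_inv_def[symmetric])
      fix b assume "b \<in> J"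
      then obtain g where g: "b = restr g" "lam g = 0" by (auto simp: J_def)
      have "a \<oplus>\<^bsub>A\<^esub> b = restr (f + g)" "lam (f + g) = 0" using f g by (simp_all add: A.h_add lh)
      thus "a \<otimes>\<^bsub>add_monoid A\<^esub> b \<in> J" by (auto simp: J_def)
    qed
    fix a x assume "a \<in> J" "x \<in> carrier A"
    then obtain f g where f: "a = restr f" "lam f = 0" "x = restr g" by (auto simp: J_def A.carr)
    have "x \<otimes>\<^bsub>A\<^esub> a = restr (g * f)" "lam (g * f) = 0" "a \<otimes>\<^bsub>A\<^esub> x = restr (f * g)" "lam (f * g) = 0"
      using f by (simp_all add: A.h_mult lh)
    thus "x \<otimes>\<^bsub>A\<^esub> a \<in> J" "a \<otimes>\<^bsub>A\<^esub> x \<in> J" unfolding J_def by blast+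
  qed
  moreover have "uea_relations L \<subseteq> J"
  proof -
    have v: "free_word [x] = restr (flet x)" if "x \<in> carrier L" for x using restr_flet[OF that] by simp
    have 1: "free_word [lie_add L x y] \<ominus>\<^bsub>A\<^esub> (free_word [x] \<oplus>\<^bsub>A\<^esub> free_word [y]) \<in> J" if "x \<in> carrier L" "y \<in> carrier L" for x y
    proof -
      have "free_word [lie_add L x y] \<ominus>\<^bsub>A\<^esub> (free_word [x] \<oplus>\<^bsub>A\<^esub> free_word [y]) = restr (flet (lie_add L x y) - (flet x + flet y))"
        by (simp add: v that add_closed A.h_add A.h_diff)
      moreover have "lam (flet (lie_add L x y) - (flet x + flet y)) = 0"
        by (simp add: ld lh lam_flet that add_closed F_add)
      ultimately show ?thesis unfolding J_def by blast
    qed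
    have 2: "free_word [lie_smult L c x] \<ominus>\<^bsub>A\<^esub> c \<odot>\<^bsub>A\<^esub> free_word [x] \<in> J" if "x \<in> carrier L" for c x
    proof -
      have "free_word [lie_smult L c x] \<ominus>\<^bsub>A\<^esub> c \<odot>\<^bsub>A\<^esub> free_word [x] = restr (flet (lie_smult L c x) - cs c * flet x)"
        by (simp add: v that smult_closed A.h_diff restr_smult)
      moreover have "lam (flet (lie_smult L c x) - cs c * flet x) = 0"
        by (simp add: ld lh lam_flet that smult_closed F_smult)
      ultimately show ?thesis unfolding J_def by blast
    qed
    have 3: "free_word [lie_bracket L x y] \<ominus>\<^bsub>A\<^esub> (free_word [x] \<otimes>\<^bsub>A\<^esub> free_word [y] \<ominus>\<^bsub>A\<^esub> free_word [y] \<otimes>\<^bsub>A\<^esub> free_word [x]) \<in> J"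
      if "x \<in> carrier L" "y \<in> carrier L" for x y
    proof -
      have "free_word [lie_bracket L x y] \<ominus>\<^bsub>A\<^esub> (free_word [x] \<otimes>\<^bsub>A\<^esub> free_word [y] \<ominus>\<^bsub>A\<^esub> free_word [y] \<otimes>\<^bsub>A\<^esub> free_word [x])
        = restr (flet (lie_bracket L x y) - (flet x * flet y - flet y * flet x))"
        by (simp add: v that bracket_closed A.h_mult A.h_diff)
      moreover have "lam (flet (lie_bracket L x y) - (flet x * flet y - flet y * flet x)) = 0"
        by (simp add: ld lh lam_flet that bracket_closed F_bracket)
      ultimately show ?thesis unfolding J_def by blast
    qed
    show ?thesis unfolding uea_relations_def Let_def using 1 2 3 by blast
  qed
  ultimately have "I \<subseteq> J" unfolding uea_ideal_def by (rule A.R.genideal_minimal)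
  then obtain g where "restr f = restr g" "lam g = 0" using assms by (auto simp: J_def)
  thus ?thesis by (simp add: lam_eq)
qed

text \<open>Representatives of one class differ by an element of the ideal, on which
  \<open>lam\<close> vanishes, so the image of the class under \<open>free_eval\<close> is a
  singleton and \<open>the_elem\<close> returns its element.\<close>

lemma uea_lift_img:
  assumes D: "ring_img T h D" and sm: "\<And>c a. a \<in> T \<Longrightarrow> cs c * a \<in> T \<and> c \<odot>\<^bsub>D\<^esub> h a = h (cs c * a)"
    and \<rho>: "\<And>x. x \<in> carrier L \<Longrightarrow> F x \<in> T \<and> \<rho> x = h (F x)"
  shows "uea_lift D \<rho> (cls f) = h (lam f)"
proof -
  interpret D: ring_img T h D by (rule D)
  have ev: "free_eval D \<rho> (restr g) = h (lam g)" for g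
    unfolding free_eval_def lam_eq
  proof (rule D.h_finsum)
    fix u assume "u \<in> {u. restr g u \<noteq> 0}"
    hence u: "x \<in> carrier L" if "x \<in> set u" for x using that by (auto simp: restr_def split: if_splits)
    have T: "prod_list (map F u) \<in> T" by (rule D.T_prod_list) (use u \<rho> in auto)
    show "cs (restr g u) * prod_list (map F u) \<in> T" using sm[OF T] by blast
    have "list_prod D (map \<rho> u) = h (prod_list (map F u))" by (rule D.h_list_prod) (use u \<rho> in auto)
    thus "restr g u \<odot>\<^bsub>D\<^esub> list_prod D (map \<rho> u) = h (cs (restr g u) * prod_list (map F u))" using sm[OF T] by simp
  qed
  have "free_eval D \<rho> p = h (lam f)" if p: "p \<in> cls f" for p
  proof -
    obtain j where "restr j \<in> I" "p = restr (j + f)" using coset_mem[OF p] by auto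
    thus ?thesis using lam_ideal[of j] by (simp add: ev hom_add[OF lam_hom])
  qed
  hence "free_eval D \<rho> ` cls f \<subseteq> {h (lam f)}" by auto
  moreover have "h (lam f) \<in> free_eval D \<rho> ` cls f" unfolding ev[symmetric] by (rule imageI) (rule cls_self)
  ultimately have "free_eval D \<rho> ` cls f = {h (lam f)}" by auto
  thus ?thesis by (simp add: uea_lift_def)
qed

end

end

section \<open>Representations of Takiff algebras by shifted sums\<close>

lemma sum_quad:
  fixes c :: "nat \<Rightarrow> nat" and n m :: nat and f :: "nat \<Rightarrow> nat \<Rightarrow> nat \<Rightarrow> nat \<Rightarrow> 'a::comm_monoid_add"
  shows "(\<Sum>(i, k, a, b)\<in>{(i, k, a, b). i \<in> {1..m} \<and> k < c i \<and> a \<in> {1..n} \<and> b \<in> {1..n}}. f i k a b)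
    = (\<Sum>i\<in>{1..m}. \<Sum>k<c i. \<Sum>a\<in>{1..n}. \<Sum>b\<in>{1..n}. f i k a b)"
proof -
  have "{(i, k, a, b). i \<in> {1..m} \<and> k < c i \<and> a \<in> {1..n} \<and> b \<in> {1..n}}
      = (SIGMA i:{1..m}. {..<c i} \<times> ({1..n} \<times> {1..n}))" by auto
  moreover have "(\<Sum>i\<in>{1..m}. \<Sum>k<c i. \<Sum>a\<in>{1..n}. \<Sum>b\<in>{1..n}. f i k a b)
      = (\<Sum>i\<in>{1..m}. \<Sum>q\<in>{..<c i} \<times> ({1..n} \<times> {1..n}). case q of (k, a, b) \<Rightarrow> f i k a b)"
    by (simp only: sum.cartesian_product)
  moreover have "\<dots> = (\<Sum>(i, q)\<in>(SIGMA i:{1..m}. {..<c i} \<times> ({1..n} \<times> {1..n})). case q of (k, a, b) \<Rightarrow> f i k a b)"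
    by (rule sum.Sigma) (intro ballI finite_cartesian_product finite_lessThan finite_atLeastAtMost)+
  ultimately show ?thesis by (simp only:)
qed

abbreviation quads :: "nat \<Rightarrow> nat \<Rightarrow> (nat \<Rightarrow> nat) \<Rightarrow> (nat \<times> nat \<times> nat \<times> nat) set" where
  "quads n m c \<equiv> {(i, k, a, b). i \<in> {1..m} \<and> k < c i \<and> a \<in> {1..n} \<and> b \<in> {1..n}}"

lemma finite_quads: "finite (quads n m c)"
proof -
  have "quads n m c = (SIGMA i:{1..m}. SIGMA k:{..<c i}. {1..n} \<times> {1..n})" by auto
  thus ?thesis by simp
qed

lemma quad_product:
  fixes f g :: "nat \<Rightarrow> nat \<Rightarrow> nat \<Rightarrow> nat \<Rightarrow> 'a::semiring_0"
  shows "(\<Sum>(i, k, a, b)\<in>A. f i k a b) * (\<Sum>(i, k, a, b)\<in>B. g i k a b)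
    = (\<Sum>(i, k, a, b)\<in>A. \<Sum>(i', k', a', b')\<in>B. f i k a b * g i' k' a' b')"
  by (simp only: case_prod_unfold sum_product)

lemma quad_swap:
  fixes h :: "nat \<Rightarrow> nat \<Rightarrow> nat \<Rightarrow> nat \<Rightarrow> nat \<Rightarrow> nat \<Rightarrow> nat \<Rightarrow> nat \<Rightarrow> 'a::comm_monoid_add"
  shows "(\<Sum>(i, k, a, b)\<in>A. \<Sum>(i', k', a', b')\<in>B. h i k a b i' k' a' b') = (\<Sum>(i', k', a', b')\<in>B. \<Sum>(i, k, a, b)\<in>A. h i k a b i' k' a' b')"
  unfolding case_prod_unfold by (rule sum.swap)

lemma mat_mult_entry:
  fixes X Y :: "complex mat"
  assumes "X \<in> carrier_mat n n" "Y \<in> carrier_mat n n" "a \<in> {1..n}" "b \<in> {1..n}"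
  shows "(X * Y) $$ (a - 1, b - 1) = (\<Sum>t\<in>{1..n}. X $$ (a - 1, t - 1) * Y $$ (t - 1, b - 1))"
proof -
  have "(X * Y) $$ (a - 1, b - 1) = (\<Sum>t\<in>{0..<n}. X $$ (a - 1, t) * Y $$ (t, b - 1))"
    using assms by (auto simp: scalar_prod_def intro!: sum.cong)
  also have "\<dots> = (\<Sum>t\<in>{1..n}. X $$ (a - 1, t - 1) * Y $$ (t - 1, b - 1))"
    by (rule sum.reindex_bij_witness[of _ "\<lambda>t. t - 1" "\<lambda>t. t + 1"]) auto
  finally show ?thesis .
qed

lemma foldr_mat_entry:
  fixes Xs :: "complex mat list"
  assumes "\<And>X. X \<in> set Xs \<Longrightarrow> X \<in> carrier_mat n n" "i < n" "j < n"
  shows "foldr (+) Xs (0\<^sub>m n n) \<in> carrier_mat n n"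
    and "foldr (+) Xs (0\<^sub>m n n) $$ (i, j) = sum_list (map (\<lambda>X. X $$ (i, j)) Xs)"
proof -
  have *: "foldr (+) Xs (0\<^sub>m n n) \<in> carrier_mat n n \<and> foldr (+) Xs (0\<^sub>m n n) $$ (i, j) = sum_list (map (\<lambda>X. X $$ (i, j)) Xs)"
    using assms
  proof (induction Xs)
    case (Cons X Xs)
    hence "foldr (+) Xs (0\<^sub>m n n) \<in> carrier_mat n n \<and> foldr (+) Xs (0\<^sub>m n n) $$ (i, j) = sum_list (map (\<lambda>X. X $$ (i, j)) Xs)" by auto
    moreover have "X \<in> carrier_mat n n" using Cons.prems by simp
    ultimately show ?case using Cons.prems(2,3) by auto
  qed auto
  show "foldr (+) Xs (0\<^sub>m n n) \<in> carrier_mat n n" "foldr (+) Xs (0\<^sub>m n n) $$ (i, j) = sum_list (map (\<lambda>X. X $$ (i, j)) Xs)"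
    using * by auto
qed

text \<open>The product of matrix polynomials in the variable of the \<open>i\<close>-th summand, at
  degree \<open>k\<close>.\<close>

definition conv :: "nat \<Rightarrow> (nat \<Rightarrow> nat \<Rightarrow> nat \<Rightarrow> nat \<Rightarrow> complex) \<Rightarrow> (nat \<Rightarrow> nat \<Rightarrow> nat \<Rightarrow> nat \<Rightarrow> complex) \<Rightarrow> nat \<Rightarrow> nat \<Rightarrow> nat \<Rightarrow> nat \<Rightarrow> complex" where
  "conv n X Y i k a b = (\<Sum>p\<le>k. \<Sum>t\<in>{1..n}. X i p a t * Y i (k - p) t b)"

definition ent :: "(nat \<Rightarrow> nat \<Rightarrow> complex mat) \<Rightarrow> nat \<Rightarrow> nat \<Rightarrow> nat \<Rightarrow> nat \<Rightarrow> complex" where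
  "ent X i k a b = X i k $$ (a - 1, b - 1)"

context
  fixes n m :: nat and c :: "nat \<Rightarrow> nat"
begin

lemma gl_takiff_carrier: "X \<in> carrier (gl_takiff n m c) \<Longrightarrow> i \<in> {1..m} \<Longrightarrow> k < c i \<Longrightarrow> X i k \<in> carrier_mat n n"
  by (auto simp: gl_takiff_def lie_dsum_def takiff_def gl_def PiE_def Pi_def)

lemma ent_add:
  assumes "X \<in> carrier (gl_takiff n m c)" "Y \<in> carrier (gl_takiff n m c)" "i \<in> {1..m}" "k < c i" "a \<in> {1..n}" "b \<in> {1..n}"
  shows "ent (lie_add (gl_takiff n m c) X Y) i k a b = ent X i k a b + ent Y i k a b"
proof -
  have "lie_add (gl_takiff n m c) X Y i k = X i k + Y i k"
    using assms(3,4) by (simp add: gl_takiff_def lie_dsum_def takiff_def gl_def)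
  thus ?thesis using gl_takiff_carrier[OF assms(1,3,4)] gl_takiff_carrier[OF assms(2,3,4)] assms(5,6)
    by (auto simp: ent_def)
qed

lemma ent_smult:
  assumes "X \<in> carrier (gl_takiff n m c)" "i \<in> {1..m}" "k < c i" "a \<in> {1..n}" "b \<in> {1..n}"
  shows "ent (lie_smult (gl_takiff n m c) r X) i k a b = r * ent X i k a b"
proof -
  have "lie_smult (gl_takiff n m c) r X i k = r \<cdot>\<^sub>m X i k"
    using assms(2,3) by (simp add: gl_takiff_def lie_dsum_def takiff_def gl_def)
  thus ?thesis using gl_takiff_carrier[OF assms(1-3)] assms(4,5) by (auto simp: ent_def)
qed

lemma ent_bracket:
  assumes X: "X \<in> carrier (gl_takiff n m c)" and Y: "Y \<in> carrier (gl_takiff n m c)"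
    and i: "i \<in> {1..m}" "k < c i" and ab: "a \<in> {1..n}" "b \<in> {1..n}"
  shows "ent (lie_bracket (gl_takiff n m c) X Y) i k a b = conv n (ent X) (ent Y) i k a b - conv n (ent Y) (ent X) i k a b"
proof -
  let ?B = "\<lambda>p. X i p * Y i (k - p) - Y i (k - p) * X i p"
  have XY: "X i p \<in> carrier_mat n n" "Y i (k - p) \<in> carrier_mat n n" if "p \<le> k" for p
    using gl_takiff_carrier[OF X i(1), of p] gl_takiff_carrier[OF Y i(1), of "k - p"] that i(2) by auto
  have "lie_bracket (gl_takiff n m c) X Y i k = foldr (+) (map ?B [0..<Suc k]) (0\<^sub>m n n)"
    using i by (simp add: gl_takiff_def lie_dsum_def takiff_def gl_def del: upt_Suc)
  moreover have "foldr (+) (map ?B [0..<Suc k]) (0\<^sub>m n n) $$ (a - 1, b - 1) = sum_list (map (\<lambda>X. X $$ (a - 1, b - 1)) (map ?B [0..<Suc k]))"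
  proof (rule foldr_mat_entry)
    fix Z assume "Z \<in> set (map ?B [0..<Suc k])"
    then obtain p where p: "p \<le> k" "Z = ?B p" by (auto simp: less_Suc_eq_le simp del: upt_Suc)
    show "Z \<in> carrier_mat n n" unfolding p(2) using XY[OF p(1)] by auto
  qed (use ab in auto)
  ultimately have "ent (lie_bracket (gl_takiff n m c) X Y) i k a b = (\<Sum>p\<in>set [0..<Suc k]. ?B p $$ (a - 1, b - 1))"
    unfolding ent_def by (simp only: map_map o_def sum_list_distinct_conv_sum_set[OF distinct_upt])
  also have "set [0..<Suc k] = {..k}" by auto
  also have "(\<Sum>p\<le>k. ?B p $$ (a - 1, b - 1)) = (\<Sum>p\<le>k. (\<Sum>t\<in>{1..n}. ent X i p a t * ent Y i (k - p) t b) - (\<Sum>t\<in>{1..n}. ent Y i (k - p) a t * ent X i p t b))"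
  proof (rule sum.cong[OF refl])
    fix p assume "p \<in> {..k}"
    note xy = XY[of p, simplified, OF this[simplified]]
    have "?B p $$ (a - 1, b - 1) = (X i p * Y i (k - p)) $$ (a - 1, b - 1) - (Y i (k - p) * X i p) $$ (a - 1, b - 1)"
      using xy ab by auto
    thus "?B p $$ (a - 1, b - 1) = (\<Sum>t\<in>{1..n}. ent X i p a t * ent Y i (k - p) t b) - (\<Sum>t\<in>{1..n}. ent Y i (k - p) a t * ent X i p t b)"
      unfolding mat_mult_entry[OF xy ab] mat_mult_entry[OF xy(2,1) ab] ent_def .
  qed
  also have "\<dots> = conv n (ent X) (ent Y) i k a b - (\<Sum>p\<le>k. \<Sum>t\<in>{1..n}. ent Y i (k - p) a t * ent X i p t b)"
    by (simp only: sum_subtractf conv_def)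
  also have "(\<Sum>p\<le>k. \<Sum>t\<in>{1..n}. ent Y i (k - p) a t * ent X i p t b) = conv n (ent Y) (ent X) i k a b"
    unfolding conv_def by (rule sum.reindex_bij_witness[of _ "\<lambda>p. k - p" "\<lambda>p. k - p"]) auto
  finally show ?thesis .
qed

lemma ent_elem:
  assumes "i' \<in> {1..m}" "k' < c i'" "a' \<in> {1..n}" "b' \<in> {1..n}"
  shows "ent (gl_takiff_elem n m c a b i k) i' k' a' b' = (if i' = i \<and> k' = k \<and> a' = a \<and> b' = b then 1 else 0)"
proof -
  have "gl_takiff_elem n m c a b i k i' k' = (if i' = i \<and> k' = k then mat_unit n a b else 0\<^sub>m n n)"
    using assms(1,2) by (cases "i' = i"; cases "k' = k") (simp_all add: gl_takiff_elem_def dsum_inj_def takiff_elem_def takiff_def gl_def)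
  moreover have "a' - 1 < n" "b' - 1 < n" "a' - 1 + 1 = a'" "b' - 1 + 1 = b'" using assms(3,4) by auto
  ultimately show ?thesis by (auto simp: ent_def mat_unit_def)
qed

lemma uea_pres_gl: "uea_pres (gl_takiff n m c)"
proof
  have t: "lie_bracket (takiff (gl n) N) X Y \<in> carrier (takiff (gl n) N)"
    if "X \<in> carrier (takiff (gl n) N)" "Y \<in> carrier (takiff (gl n) N)" for X Y N
    by (rule takiff_closed) (use that in \<open>auto simp: gl_def\<close>)
  fix X Y assume XY: "X \<in> carrier (gl_takiff n m c)" "Y \<in> carrier (gl_takiff n m c)"
  show "lie_bracket (gl_takiff n m c) X Y \<in> carrier (gl_takiff n m c)"
    using XY by (auto simp: gl_takiff_def lie_dsum_def intro!: t restrict_PiE_iff[THEN iffD2])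
  show "lie_add (gl_takiff n m c) X Y \<in> carrier (gl_takiff n m c)"
    using XY by (auto simp: gl_takiff_def lie_dsum_def takiff_def gl_def PiE_def Pi_def)
next
  fix X r assume "X \<in> carrier (gl_takiff n m c)"
  thus "lie_smult (gl_takiff n m c) r X \<in> carrier (gl_takiff n m c)"
    by (auto simp: gl_takiff_def lie_dsum_def takiff_def gl_def PiE_def Pi_def)
qed

context
  fixes e :: "nat \<times> nat \<Rightarrow> nat \<times> nat \<Rightarrow> 'b::calg"
  assumes e: "e u v * e u' v' - e u' v' * e u v = (if v = u' then e u v' else 0) - (if v' = u then e u' v else 0)"
begin

abbreviation rng :: "nat \<Rightarrow> nat \<Rightarrow> nat set" where
  "rng i k \<equiv> {block_start c i + 1..block_start c (i + 1) - k}"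

text \<open>The elements \<open>e u v\<close> multiply under commutators like matrix units indexed
  by pairs. Here the unit at \<open>(a, b)\<close> is tensored with the \<open>k\<close>-th power of
  the nilpotent shift on block \<open>i\<close>, which is how both homomorphisms act.\<close>

definition fe :: "nat \<Rightarrow> nat \<Rightarrow> nat \<Rightarrow> nat \<Rightarrow> 'b" where
  "fe a b i k = (\<Sum>r\<in>rng i k. e (a, r + k) (b, r))"

text \<open>The shift on a block is nilpotent of order the block size, matching the truncation of
  the Takiff algebra.\<close>

lemma fe_0: "1 \<le> i \<Longrightarrow> c i \<le> k \<Longrightarrow> fe a b i k = 0"
  by (simp add: fe_def block_start_Suc)

lemma rng_shift:
  assumes "1 \<le> i" "1 \<le> i'"
  shows "{r'\<in>rng i' k'. r' + k' \<in> rng i k} = (if i = i' then rng i (k + k') else {})"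
proof (cases "i = i'")
  case False
  have "r' + k' \<notin> rng i k" if r': "r' \<in> rng i' k'" for r'
  proof
    assume r: "r' + k' \<in> rng i k"
    have "blk c (r' + k') = i" by (rule blk_eqI) (use r in auto)
    moreover have "blk c (r' + k') = i'" by (rule blk_eqI) (use r' in auto)
    ultimately show False using False by simp
  qed
  thus ?thesis using False by auto
qed auto

lemma fe_prod:
  assumes "1 \<le> i" "1 \<le> i'"
  shows "(\<Sum>r\<in>rng i k. \<Sum>r'\<in>rng i' k'. if (b, r) = (a', r' + k') then e (a, r + k) (b', r') else 0)
    = (if i = i' \<and> b = a' then fe a b' i (k + k') else 0)"
proof (cases "b = a'")
  case True
  have "(\<Sum>r\<in>rng i k. \<Sum>r'\<in>rng i' k'. if (b, r) = (a', r' + k') then e (a, r + k) (b', r') else 0)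
    = (\<Sum>r'\<in>rng i' k'. \<Sum>r\<in>rng i k. if r = r' + k' then e (a, r + k) (b', r') else 0)"
    using True by (subst sum.swap) simp
  also have "\<dots> = (\<Sum>r'\<in>rng i' k'. if r' + k' \<in> rng i k then e (a, r' + k' + k) (b', r') else 0)"
    by (intro sum.cong refl) (simp only: sum.delta finite_atLeastAtMost)
  also have "\<dots> = (\<Sum>r'\<in>{r'\<in>rng i' k'. r' + k' \<in> rng i k}. e (a, r' + k' + k) (b', r'))"
    by (rule sum.inter_filter[symmetric]) simp
  also have "\<dots> = (if i = i' then fe a b' i (k + k') else 0)"
    unfolding rng_shift[OF assms] by (simp add: fe_def add_ac)
  finally show ?thesis using True by simp
qed simp

lemma fe_bracket:
  assumes "1 \<le> i" "1 \<le> i'"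
  shows "fe a b i k * fe a' b' i' k' - fe a' b' i' k' * fe a b i k
    = (if i = i' \<and> b = a' then fe a b' i (k + k') else 0) - (if i' = i \<and> b' = a then fe a' b i' (k' + k) else 0)"
proof -
  have "fe a' b' i' k' * fe a b i k = (\<Sum>r\<in>rng i k. \<Sum>r'\<in>rng i' k'. e (a', r' + k') (b', r') * e (a, r + k) (b, r))"
    unfolding fe_def sum_product by (rule sum.swap)
  hence "fe a b i k * fe a' b' i' k' - fe a' b' i' k' * fe a b i k
    = (\<Sum>r\<in>rng i k. \<Sum>r'\<in>rng i' k'. e (a, r + k) (b, r) * e (a', r' + k') (b', r') - e (a', r' + k') (b', r') * e (a, r + k) (b, r))"
    by (simp only: sum_subtractf) (simp only: fe_def sum_product)
  also have "\<dots> = (\<Sum>r\<in>rng i k. \<Sum>r'\<in>rng i' k'. if (b, r) = (a', r' + k') then e (a, r + k) (b', r') else 0)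
     - (\<Sum>r\<in>rng i k. \<Sum>r'\<in>rng i' k'. if (b', r') = (a, r + k) then e (a', r' + k') (b, r) else 0)"
    by (simp only: e sum_subtractf)
  also have "(\<Sum>r\<in>rng i k. \<Sum>r'\<in>rng i' k'. if (b', r') = (a, r + k) then e (a', r' + k') (b, r) else 0)
     = (\<Sum>r'\<in>rng i' k'. \<Sum>r\<in>rng i k. if (b', r') = (a, r + k) then e (a', r' + k') (b, r) else 0)"
    by (rule sum.swap)
  finally show ?thesis unfolding fe_prod[OF assms] fe_prod[OF assms(2,1)] .
qed

definition glin :: "(nat \<Rightarrow> nat \<Rightarrow> nat \<Rightarrow> nat \<Rightarrow> complex) \<Rightarrow> 'b" where
  "glin X = (\<Sum>(i, k, a, b)\<in>quads n m c. cs (X i k a b) * fe a b i k)"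

lemma glin_cong:
  assumes "\<And>i k a b. i \<in> {1..m} \<Longrightarrow> k < c i \<Longrightarrow> a \<in> {1..n} \<Longrightarrow> b \<in> {1..n} \<Longrightarrow> X i k a b = Y i k a b"
  shows "glin X = glin Y"
  unfolding glin_def by (rule sum.cong) (use assms in auto)

lemma glin_linear: "glin (\<lambda>i k a b. X i k a b + Y i k a b) = glin X + glin Y"
  "glin (\<lambda>i k a b. r * X i k a b) = cs r * glin X"
  unfolding glin_def by (simp_all add: case_prod_unfold cs_add cs_mult distrib_right sum.distrib sum_distrib_left mult.assoc)

text \<open>One of the two contraction terms of the commutator. By \<open>fe_0\<close> the square of
  pairs \<open>(k, k')\<close> may be cut to those with sum below \<open>c i\<close>, and grouping
  by the sum produces the convolution.\<close>

lemma glin_half: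
  "(\<Sum>(i, k, a, b)\<in>quads n m c. \<Sum>(i', k', a', b')\<in>quads n m c.
      cs (X i k a b * Y i' k' a' b') * (if i = i' \<and> b = a' then fe a b' i (k + k') else 0)) = glin (conv n X Y)"
proof -
  have "(\<Sum>(i', k', a', b')\<in>quads n m c. cs (X i k a b * Y i' k' a' b') * (if i = i' \<and> b = a' then fe a b' i (k + k') else 0))
    = (\<Sum>k'<c i. \<Sum>b'\<in>{1..n}. cs (X i k a b * Y i k' b b') * fe a b' i (k + k'))"
    if ib: "i \<in> {1..m}" "b \<in> {1..n}" for i k a b
  proof -
    have "(\<Sum>(i', k', a', b')\<in>quads n m c. cs (X i k a b * Y i' k' a' b') * (if i = i' \<and> b = a' then fe a b' i (k + k') else 0))
      = (\<Sum>q\<in>quads n m c. if (case q of (i', k', a', b') \<Rightarrow> i = i' \<and> b = a') then (case q of (i', k', a', b') \<Rightarrow> cs (X i k a b * Y i' k' a' b') * fe a b' i (k + k')) else 0)"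
      by (rule sum.cong) (auto split: if_splits)
    also have "\<dots> = (\<Sum>q\<in>{q\<in>quads n m c. case q of (i', k', a', b') \<Rightarrow> i = i' \<and> b = a'}. case q of (i', k', a', b') \<Rightarrow> cs (X i k a b * Y i' k' a' b') * fe a b' i (k + k'))"
      by (rule sum.inter_filter[symmetric]) (rule finite_quads)
    also have "\<dots> = (\<Sum>(k', b')\<in>{..<c i} \<times> {1..n}. cs (X i k a b * Y i k' b b') * fe a b' i (k + k'))"
      by (rule sum.reindex_bij_witness[of _ "\<lambda>(k', b'). (i, k', b, b')" "\<lambda>(i', k', a', b'). (k', b')"]) (use ib in auto)
    finally show ?thesis by (simp only: sum.cartesian_product)
  qed
  hence "(\<Sum>(i, k, a, b)\<in>quads n m c. \<Sum>(i', k', a', b')\<in>quads n m c.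
      cs (X i k a b * Y i' k' a' b') * (if i = i' \<and> b = a' then fe a b' i (k + k') else 0))
    = (\<Sum>(i, k, a, b)\<in>quads n m c. \<Sum>k'<c i. \<Sum>b'\<in>{1..n}. cs (X i k a b * Y i k' b b') * fe a b' i (k + k'))"
    by (intro sum.cong refl) auto
  also have "\<dots> = (\<Sum>i\<in>{1..m}. \<Sum>k<c i. \<Sum>a\<in>{1..n}. \<Sum>b\<in>{1..n}. \<Sum>k'<c i. \<Sum>b'\<in>{1..n}. cs (X i k a b * Y i k' b b') * fe a b' i (k + k'))"
    by (rule sum_quad)
  also have "\<dots> = (\<Sum>i\<in>{1..m}. \<Sum>K<c i. \<Sum>a\<in>{1..n}. \<Sum>b'\<in>{1..n}. cs (conv n X Y i K a b') * fe a b' i K)"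
  proof (rule sum.cong[OF refl])
    fix i assume i: "i \<in> {1..m}"
    let ?G = "\<lambda>k k'. \<Sum>a\<in>{1..n}. \<Sum>b'\<in>{1..n}. \<Sum>b\<in>{1..n}. cs (X i k a b * Y i k' b b') * fe a b' i (k + k')"
    have "(\<Sum>k<c i. \<Sum>a\<in>{1..n}. \<Sum>b\<in>{1..n}. \<Sum>k'<c i. \<Sum>b'\<in>{1..n}. cs (X i k a b * Y i k' b b') * fe a b' i (k + k'))
      = (\<Sum>k<c i. \<Sum>k'<c i. ?G k k')"
    proof (rule sum.cong[OF refl])
      fix k
      have "(\<Sum>a\<in>{1..n}. \<Sum>b\<in>{1..n}. \<Sum>k'<c i. \<Sum>b'\<in>{1..n}. cs (X i k a b * Y i k' b b') * fe a b' i (k + k'))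
        = (\<Sum>a\<in>{1..n}. \<Sum>k'<c i. \<Sum>b\<in>{1..n}. \<Sum>b'\<in>{1..n}. cs (X i k a b * Y i k' b b') * fe a b' i (k + k'))"
        by (rule sum.cong[OF refl], rule sum.swap)
      also have "\<dots> = (\<Sum>k'<c i. \<Sum>a\<in>{1..n}. \<Sum>b\<in>{1..n}. \<Sum>b'\<in>{1..n}. cs (X i k a b * Y i k' b b') * fe a b' i (k + k'))"
        by (rule sum.swap)
      also have "\<dots> = (\<Sum>k'<c i. ?G k k')" by (rule sum.cong[OF refl], rule sum.cong[OF refl], rule sum.swap)
      finally show "(\<Sum>a\<in>{1..n}. \<Sum>b\<in>{1..n}. \<Sum>k'<c i. \<Sum>b'\<in>{1..n}. cs (X i k a b * Y i k' b b') * fe a b' i (k + k')) = (\<Sum>k'<c i. ?G k k')" .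
    qed
    also have "\<dots> = (\<Sum>(k, k')\<in>{..<c i} \<times> {..<c i}. ?G k k')" by (rule sum.cartesian_product)
    also have "\<dots> = (\<Sum>(k, k')\<in>{(k, k'). k + k' < c i}. ?G k k')"
    proof (rule sum.mono_neutral_right)
      show "\<forall>q\<in>{..<c i} \<times> {..<c i} - {(k, k'). k + k' < c i}. (case q of (k, k') \<Rightarrow> ?G k k') = 0"
      proof
        fix q assume q: "q \<in> {..<c i} \<times> {..<c i} - {(k, k'). k + k' < c i}"
        obtain k k' where qe: "q = (k, k')" by (cases q)
        have "fe a b i (k + k') = 0" for a b by (rule fe_0) (use i q qe in auto)
        thus "(case q of (k, k') \<Rightarrow> ?G k k') = 0" by (simp add: qe)
      qed
    qed auto
    also have "\<dots> = (\<Sum>K<c i. \<Sum>p\<le>K. ?G p (K - p))" by (rule sum.triangle_reindex)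
    also have "\<dots> = (\<Sum>K<c i. \<Sum>a\<in>{1..n}. \<Sum>b'\<in>{1..n}. cs (conv n X Y i K a b') * fe a b' i K)"
    proof (rule sum.cong[OF refl])
      fix K
      have "(\<Sum>p\<le>K. ?G p (K - p)) = (\<Sum>p\<le>K. \<Sum>a\<in>{1..n}. \<Sum>b'\<in>{1..n}. \<Sum>b\<in>{1..n}. cs (X i p a b * Y i (K - p) b b') * fe a b' i K)"
        by (intro sum.cong refl) simp
      also have "\<dots> = (\<Sum>a\<in>{1..n}. \<Sum>p\<le>K. \<Sum>b'\<in>{1..n}. \<Sum>b\<in>{1..n}. cs (X i p a b * Y i (K - p) b b') * fe a b' i K)"
        by (rule sum.swap)
      also have "\<dots> = (\<Sum>a\<in>{1..n}. \<Sum>b'\<in>{1..n}. \<Sum>p\<le>K. \<Sum>b\<in>{1..n}. cs (X i p a b * Y i (K - p) b b') * fe a b' i K)"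
        by (rule sum.cong[OF refl], rule sum.swap)
      finally show "(\<Sum>p\<le>K. ?G p (K - p)) = (\<Sum>a\<in>{1..n}. \<Sum>b'\<in>{1..n}. cs (conv n X Y i K a b') * fe a b' i K)"
        by (simp only: conv_def cs_sum sum_distrib_right)
    qed
    finally show "(\<Sum>k<c i. \<Sum>a\<in>{1..n}. \<Sum>b\<in>{1..n}. \<Sum>k'<c i. \<Sum>b'\<in>{1..n}. cs (X i k a b * Y i k' b b') * fe a b' i (k + k'))
      = (\<Sum>K<c i. \<Sum>a\<in>{1..n}. \<Sum>b'\<in>{1..n}. cs (conv n X Y i K a b') * fe a b' i K)" .
  qed
  also have "\<dots> = glin (conv n X Y)" unfolding glin_def by (rule sum_quad[symmetric])
  finally show ?thesis .
qed

lemma glin_bracket: "glin X * glin Y - glin Y * glin X = glin (\<lambda>i k a b. conv n X Y i k a b - conv n Y X i k a b)"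
proof -
  let ?Q = "quads n m c"
  have YX: "glin Y * glin X = (\<Sum>(i, k, a, b)\<in>?Q. \<Sum>(i', k', a', b')\<in>?Q. cs (Y i' k' a' b' * X i k a b) * (fe a' b' i' k' * fe a b i k))"
    unfolding glin_def quad_product cs_mult_mult by (rule quad_swap)
  have XY: "glin X * glin Y = (\<Sum>(i, k, a, b)\<in>?Q. \<Sum>(i', k', a', b')\<in>?Q. cs (X i k a b * Y i' k' a' b') * (fe a b i k * fe a' b' i' k'))"
    unfolding glin_def quad_product cs_mult_mult by (rule refl)
  have "glin X * glin Y - glin Y * glin X = (\<Sum>(i, k, a, b)\<in>?Q. \<Sum>(i', k', a', b')\<in>?Q.
      cs (X i k a b * Y i' k' a' b') * (if i = i' \<and> b = a' then fe a b' i (k + k') else 0)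
      - cs (Y i' k' a' b' * X i k a b) * (if i' = i \<and> b' = a then fe a' b i' (k' + k) else 0))"
    unfolding XY YX sum_subtractf[symmetric]
  proof (rule sum.cong[OF refl])
    fix q assume q: "q \<in> ?Q"
    obtain i k a b where qe: "q = (i, k, a, b)" by (cases q) auto
    have "cs (X i k a b * Y i' k' a' b') * (fe a b i k * fe a' b' i' k') - cs (Y i' k' a' b' * X i k a b) * (fe a' b' i' k' * fe a b i k)
      = cs (X i k a b * Y i' k' a' b') * (if i = i' \<and> b = a' then fe a b' i (k + k') else 0)
      - cs (Y i' k' a' b' * X i k a b) * (if i' = i \<and> b' = a then fe a' b i' (k' + k) else 0)"
      if "(i', k', a', b') \<in> ?Q" for i' k' a' b'
    proof -
      have "1 \<le> i" "1 \<le> i'" using q that unfolding qe by auto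
      thus ?thesis unfolding mult.commute[of "Y i' k' a' b'"] right_diff_distrib[symmetric] by (simp only: fe_bracket)
    qed
    thus "(case q of (i, k, a, b) \<Rightarrow> \<Sum>(i', k', a', b')\<in>?Q. cs (X i k a b * Y i' k' a' b') * (fe a b i k * fe a' b' i' k'))
      - (case q of (i, k, a, b) \<Rightarrow> \<Sum>(i', k', a', b')\<in>?Q. cs (Y i' k' a' b' * X i k a b) * (fe a' b' i' k' * fe a b i k))
      = (case q of (i, k, a, b) \<Rightarrow> \<Sum>(i', k', a', b')\<in>?Q.
        cs (X i k a b * Y i' k' a' b') * (if i = i' \<and> b = a' then fe a b' i (k + k') else 0)
        - cs (Y i' k' a' b' * X i k a b) * (if i' = i \<and> b' = a then fe a' b i' (k' + k) else 0))"
      unfolding qe prod.case sum_subtractf[symmetric] by (intro sum.cong refl) (auto simp only: split_paired_all prod.case)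
  qed
  also have "\<dots> = (\<Sum>(i, k, a, b)\<in>?Q. \<Sum>(i', k', a', b')\<in>?Q. cs (X i k a b * Y i' k' a' b') * (if i = i' \<and> b = a' then fe a b' i (k + k') else 0))
    - (\<Sum>(i, k, a, b)\<in>?Q. \<Sum>(i', k', a', b')\<in>?Q. cs (Y i' k' a' b' * X i k a b) * (if i' = i \<and> b' = a then fe a' b i' (k' + k) else 0))"
    by (simp only: case_prod_unfold sum_subtractf)
  also have "(\<Sum>(i, k, a, b)\<in>?Q. \<Sum>(i', k', a', b')\<in>?Q. cs (Y i' k' a' b' * X i k a b) * (if i' = i \<and> b' = a then fe a' b i' (k' + k) else 0))
    = (\<Sum>(i', k', a', b')\<in>?Q. \<Sum>(i, k, a, b)\<in>?Q. cs (Y i' k' a' b' * X i k a b) * (if i' = i \<and> b' = a then fe a' b i' (k' + k) else 0))"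
    by (rule quad_swap)
  also have "(\<Sum>(i, k, a, b)\<in>?Q. \<Sum>(i', k', a', b')\<in>?Q. cs (X i k a b * Y i' k' a' b') * (if i = i' \<and> b = a' then fe a b' i (k + k') else 0))
    - \<dots> = glin (conv n X Y) - glin (conv n Y X)"
    unfolding glin_half ..
  also have "\<dots> = glin (\<lambda>i k a b. conv n X Y i k a b - conv n Y X i k a b)"
    using glin_linear(1)[of "\<lambda>i k a b. conv n X Y i k a b - conv n Y X i k a b" "conv n Y X"] by (simp add: eq_diff_eq)
  finally show ?thesis .
qed

definition gl_rep :: "(nat \<Rightarrow> nat \<Rightarrow> complex mat) \<Rightarrow> 'b" where
  "gl_rep X = glin (ent X)"

lemma gl_rep_lie:
  assumes "X \<in> carrier (gl_takiff n m c)" "Y \<in> carrier (gl_takiff n m c)"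
  shows "gl_rep (lie_add (gl_takiff n m c) X Y) = gl_rep X + gl_rep Y"
    "gl_rep (lie_smult (gl_takiff n m c) r X) = cs r * gl_rep X"
    "gl_rep (lie_bracket (gl_takiff n m c) X Y) = gl_rep X * gl_rep Y - gl_rep Y * gl_rep X"
  unfolding gl_rep_def glin_linear[symmetric] glin_bracket
  by (rule glin_cong, rule ent_add ent_smult ent_bracket, (rule assms | assumption)+)+

lemma gl_rep_elem:
  assumes "i \<in> {1..m}" "k < c i" "a \<in> {1..n}" "b \<in> {1..n}"
  shows "gl_rep (gl_takiff_elem n m c a b i k) = fe a b i k"
proof -
  have "(case q of (i', k', a', b') \<Rightarrow> cs (ent (gl_takiff_elem n m c a b i k) i' k' a' b') * fe a' b' i' k')
    = (if q = (i, k, a, b) then fe a b i k else 0)" if "q \<in> quads n m c" for q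
    using that ent_elem[of _ _ _ _ a b i k] by (auto simp: cs_1 split: if_splits)
  hence "gl_rep (gl_takiff_elem n m c a b i k) = (\<Sum>q\<in>quads n m c. if q = (i, k, a, b) then fe a b i k else 0)"
    unfolding gl_rep_def glin_def by (rule sum.cong[OF refl])
  also have "\<dots> = fe a b i k" using assms finite_quads by (simp add: sum.delta)
  finally show ?thesis .
qed

end

lemma gl_takiff_elem_carrier: "gl_takiff_elem n m c a b i k \<in> carrier (gl_takiff n m c)"
  by (auto simp: gl_takiff_elem_def dsum_inj_def takiff_elem_def takiff_def mat_unit_def gl_def gl_takiff_def lie_dsum_def)

end

text \<open>The form needed for images of Gaudin matrices, whose entries are known only for indices
  in range, where the generators are evaluated.\<close>

theorem coefficient_duality_cong:
  fixes X Y :: "nat \<times> nat \<Rightarrow> 'a::calg" and w z :: "nat \<Rightarrow> complex" and \<xi> \<gamma> :: "nat \<Rightarrow> nat"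
  assumes XY: "fermions X Y" and d: "(\<Sum>a=1..d'. \<xi> a) = d" and n: "(\<Sum>i=1..l. \<gamma> i) = n"
    and M: "\<And>a b. a \<in> {1..d} \<Longrightarrow> b \<in> {1..d} \<Longrightarrow> M a b = (if a = b then dd else 0) - psc (jordan_entry d' \<xi> w a b)
      + (\<Sum>r\<in>{1..n}. \<Sum>s\<in>{1..n}. kc (Y (b, r)) * kc (X (a, s)) * jinv \<gamma> z r s)"
    and N: "\<And>j k. j \<in> {1..n} \<Longrightarrow> k \<in> {1..n} \<Longrightarrow> N j k = (if j = k then dd else 0) - psc (jordan_entry l \<gamma> z j k)
      + (\<Sum>a\<in>{1..d}. \<Sum>b\<in>{1..d}. kc (X (b, j)) * kc (Y (a, k)) * jinv \<xi> w a b)"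
    and V: "\<And>m i j. m \<in> {1..n} \<Longrightarrow> i \<in> {1..m} \<Longrightarrow> j \<in> {1..m} \<Longrightarrow> (\<Sum>k\<in>{1..m}. N i k * V m k j) = (if i = j then 1 else 0)"
    "\<And>m i j. m \<in> {1..n} \<Longrightarrow> i \<in> {1..m} \<Longrightarrow> j \<in> {1..m} \<Longrightarrow> (\<Sum>k\<in>{1..m}. V m i k * N k j) = (if i = j then 1 else 0)"
  shows "tgen {cf (\<Sum>\<sigma> | \<sigma> permutes {1..d}. of_int (sign \<sigma>) * prod_list (map (\<lambda>j. M (\<sigma> j) j) [1..<d+1])) s (int i - 1) | s i. i \<in> {1..d}}
    = tgen {cf (prod_list (map (\<lambda>m. V m m m) [1..<n+1])) s i | s i. i \<le> - int n}"
proof -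
  let ?M = "\<lambda>a b. (if a = b then dd else 0) - psc (jordan_entry d' \<xi> w a b)
      + (\<Sum>r\<in>{1..n}. \<Sum>s\<in>{1..n}. kc (Y (b, r)) * kc (X (a, s)) * jinv \<gamma> z r s)"
  let ?N = "\<lambda>j k. (if j = k then dd else 0) - psc (jordan_entry l \<gamma> z j k)
      + (\<Sum>a\<in>{1..d}. \<Sum>b\<in>{1..d}. kc (X (b, j)) * kc (Y (a, k)) * jinv \<xi> w a b)"
  have C: "(\<Sum>\<sigma> | \<sigma> permutes {1..d}. of_int (sign \<sigma>) * prod_list (map (\<lambda>j. M (\<sigma> j) j) [1..<d+1]))
    = (\<Sum>\<sigma> | \<sigma> permutes {1..d}. of_int (sign \<sigma>) * prod_list (map (\<lambda>j. ?M (\<sigma> j) j) [1..<d+1]))"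
  proof (rule sum.cong[OF refl])
    fix \<sigma> assume "\<sigma> \<in> {\<sigma>. \<sigma> permutes {1..d}}"
    hence "M (\<sigma> j) j = ?M (\<sigma> j) j" if "j \<in> set [1..<d+1]" for j
      using that permutes_in_image[of \<sigma> "{1..d}" j] by (intro M) auto
    hence "map (\<lambda>j. M (\<sigma> j) j) [1..<d+1] = map (\<lambda>j. ?M (\<sigma> j) j) [1..<d+1]" by (rule map_cong[OF refl])
    thus "of_int (sign \<sigma>) * prod_list (map (\<lambda>j. M (\<sigma> j) j) [1..<d+1]) = of_int (sign \<sigma>) * prod_list (map (\<lambda>j. ?M (\<sigma> j) j) [1..<d+1])"
      by (simp only:)
  qed
  have V1: "(\<Sum>k\<in>{1..m}. ?N i k * V m k j) = (if i = j then 1 else 0)" if m: "m \<in> {1..n}" "i \<in> {1..m}" "j \<in> {1..m}" for m i j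
    unfolding V(1)[OF m, symmetric] by (rule sum.cong[OF refl], subst N) (use m in auto)
  have V2: "(\<Sum>k\<in>{1..m}. V m i k * ?N k j) = (if i = j then 1 else 0)" if m: "m \<in> {1..n}" "i \<in> {1..m}" "j \<in> {1..m}" for m i j
    unfolding V(2)[OF m, symmetric] by (rule sum.cong[OF refl], subst N) (use m in auto)
  show ?thesis unfolding C by (rule coefficient_duality[OF XY d n V1 V2])
qed

text \<open>Every pair \<open>(r, s)\<close> with a nonzero resolvent entry occurs for exactly one
  block \<open>i\<close> and one power \<open>k\<close>, so the sum over poles and powers is a
  contraction with the resolvent. This brings both Gaudin matrices to the shape of the
  duality.\<close>

lemma gaudin_jinv:
  fixes E :: "nat \<Rightarrow> nat \<Rightarrow> 'a::calg" and c :: "nat \<Rightarrow> nat"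
  assumes N: "(\<Sum>i=1..m. c i) = N"
  shows "(\<Sum>i\<in>{1..m}. \<Sum>k\<in>{0..<c i}. kc (\<Sum>r\<in>{block_start c i + 1..block_start c (i + 1) - k}. E r (r + k)) * fr (w i) (k + 1))
    = (\<Sum>r\<in>{1..N}. \<Sum>s\<in>{1..N}. kc (E r s) * jinv c w r s)"
proof -
  let ?R = "\<lambda>i k. {block_start c i + 1..block_start c (i + 1) - k}"
  let ?t = "\<lambda>i k r s. if r \<in> ?R i k \<and> s = r + k then kc (E r s) * fr (w i) (k + 1) else 0"
  have "(\<Sum>r\<in>{1..N}. \<Sum>s\<in>{1..N}. kc (E r s) * jinv c w r s) = (\<Sum>r\<in>{1..N}. \<Sum>s\<in>{1..N}. \<Sum>i\<in>{1..m}. \<Sum>k\<in>{0..<c i}. ?t i k r s)"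
  proof (rule sum.cong[OF refl], rule sum.cong[OF refl])
    fix r s assume "r \<in> {1..N}" "s \<in> {1..N}"
    hence rs: "r \<in> {1..(\<Sum>i=1..m. c i)}" "s \<in> {1..(\<Sum>i=1..m. c i)}" by (simp_all only: N)
    show "kc (E r s) * jinv c w r s = (\<Sum>i\<in>{1..m}. \<Sum>k\<in>{0..<c i}. ?t i k r s)"
      unfolding jinv_sum[OF rs, symmetric] sum_distrib_left by (simp only: mult_zero_right if_distrib[of "(*) _"])
  qed
  also have "\<dots> = (\<Sum>r\<in>{1..N}. \<Sum>i\<in>{1..m}. \<Sum>s\<in>{1..N}. \<Sum>k\<in>{0..<c i}. ?t i k r s)"
    by (rule sum.cong[OF refl], rule sum.swap)
  also have "\<dots> = (\<Sum>i\<in>{1..m}. \<Sum>r\<in>{1..N}. \<Sum>s\<in>{1..N}. \<Sum>k\<in>{0..<c i}. ?t i k r s)"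
    by (rule sum.swap)
  also have "\<dots> = (\<Sum>i\<in>{1..m}. \<Sum>r\<in>{1..N}. \<Sum>k\<in>{0..<c i}. \<Sum>s\<in>{1..N}. ?t i k r s)"
    by (rule sum.cong[OF refl], rule sum.cong[OF refl], rule sum.swap)
  also have "\<dots> = (\<Sum>i\<in>{1..m}. \<Sum>k\<in>{0..<c i}. \<Sum>r\<in>{1..N}. \<Sum>s\<in>{1..N}. ?t i k r s)"
    by (rule sum.cong[OF refl], rule sum.swap)
  also have "\<dots> = (\<Sum>i\<in>{1..m}. \<Sum>k\<in>{0..<c i}. kc (\<Sum>r\<in>?R i k. E r (r + k)) * fr (w i) (k + 1))"
  proof (rule sum.cong[OF refl], rule sum.cong[OF refl])
    fix i k assume i: "i \<in> {1..m}"
    have "block_start c (i + 1) \<le> block_start c (m + 1)" by (rule block_start_mono) (use i in auto)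
    hence b: "block_start c (i + 1) \<le> N" using N by (simp only: block_start_total)
    have "(\<Sum>r\<in>{1..N}. \<Sum>s\<in>{1..N}. ?t i k r s) = (\<Sum>r\<in>?R i k. \<Sum>s\<in>{1..N}. ?t i k r s)"
      by (rule sum.mono_neutral_right) (use b in auto)
    also have "\<dots> = (\<Sum>r\<in>?R i k. kc (E r (r + k)) * fr (w i) (k + 1))"
    proof (rule sum.cong[OF refl])
      fix r assume r: "r \<in> ?R i k"
      have "(\<Sum>s\<in>{1..N}. ?t i k r s) = (\<Sum>s\<in>{1..N}. if s = r + k then kc (E r s) * fr (w i) (k + 1) else 0)"
        by (rule sum.cong) (use r in auto)
      moreover have "r + k \<in> {1..N} \<longleftrightarrow> True" using r b by auto
      ultimately show "(\<Sum>s\<in>{1..N}. ?t i k r s) = kc (E r (r + k)) * fr (w i) (k + 1)"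
        by (simp only: sum.delta finite_atLeastAtMost if_True)
    qed
    finally show "(\<Sum>r\<in>{1..N}. \<Sum>s\<in>{1..N}. ?t i k r s) = kc (\<Sum>r\<in>?R i k. E r (r + k)) * fr (w i) (k + 1)"
      by (simp only: kc_sum sum_distrib_right)
  qed
  finally show ?thesis ..
qed

lemma pmap_prod_list: "alg_hom h \<Longrightarrow> pmap h (prod_list fs) = prod_list (map (pmap h) fs)"
  by (induction fs) (simp_all add: pmap_1 pmap_mult)

lemma pmap_cdet:
  fixes h :: "'a::calg \<Rightarrow> 'b::calg" and M :: "nat \<Rightarrow> nat \<Rightarrow> 'a psd"
  assumes h: "alg_hom h"
  shows "pmap h (\<Sum>\<sigma> | \<sigma> permutes {1..d}. of_int (sign \<sigma>) * prod_list (map (\<lambda>j. M (\<sigma> j) j) js))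
    = (\<Sum>\<sigma> | \<sigma> permutes {1..d}. of_int (sign \<sigma>) * prod_list (map (\<lambda>j. pmap h (M (\<sigma> j) j)) js))"
  unfolding pmap_sum[OF h]
proof (rule sum.cong[OF refl])
  fix \<sigma> :: "nat \<Rightarrow> nat"
  have "sign \<sigma> = 1 \<or> sign \<sigma> = - 1" by (cases \<sigma> rule: sign_cases) auto
  hence "pmap h (of_int (sign \<sigma>)) = of_int (sign \<sigma>)" by (auto simp: pmap_1[OF h] pmap_minus[OF h])
  thus "pmap h (of_int (sign \<sigma>) * prod_list (map (\<lambda>j. M (\<sigma> j) j) js)) = of_int (sign \<sigma>) * prod_list (map (\<lambda>j. pmap h (M (\<sigma> j) j)) js)"
    by (simp add: pmap_mult[OF h] pmap_prod_list[OF h] o_def)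
qed

context fermions begin

lemma xy_bracket:
  "x u * y v * (x u' * y v') - x u' * y v' * (x u * y v) = (if v = u' then x u * y v' else 0) - (if v' = u then x u' * y v else 0)"
proof -
  have e: "x u * y v * (x u' * y v') = (if v = u' then x u * y v' else 0) - x u * x u' * (y v * y v')" for u v u' v'
  proof -
    have "x u * y v * (x u' * y v') = x u * (y v * x u') * y v'" by (simp only: mult.assoc)
    also have "\<dots> = (if v = u' then x u * y v' else 0) - x u * x u' * (y v * y v')"
      unfolding yx by (simp add: left_diff_distrib right_diff_distrib mult.assoc)
    finally show ?thesis .
  qed
  have "x u' * x u * (y v' * y v) = - (x u * x u') * - (y v * y v')" using xx[of u' u] yy[of v' v] by (simp only:)
  thus ?thesis unfolding e[of u v] e[of u' v'] by simp
qed

text \<open>\<open>- (y v * x u)\<close> differs from \<open>x u * y v\<close> by a scalar, which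
  does not affect commutators. This accounts for the sign and the order of factors in
  \<open>phi_op\<close>.\<close>

lemma yx_bracket:
  fixes u v u' v'
  defines "q \<equiv> \<lambda>u v. - (y v * x u)"
  shows "q u v * q u' v' - q u' v' * q u v = (if v = u' then q u v' else 0) - (if v' = u then q u' v else 0)"
proof -
  have q: "q u v = x u * y v - (if v = u then 1 else 0)" for u v
    unfolding q_def yx by simp
  have "q u v * q u' v' - q u' v' * q u v = x u * y v * (x u' * y v') - x u' * y v' * (x u * y v)"
    unfolding q by (simp add: left_diff_distrib right_diff_distrib)
  thus ?thesis unfolding xy_bracket q by auto
qed

end

lemma (in alg_onto) gaudin_sum_img:
  "(\<Oplus>\<^bsub>psdo U\<^esub>i\<in>A. \<Oplus>\<^bsub>psdo U\<^esub>k\<in>B i. psdo_frac U (p (x i k)) (w i) (k + 1)) = psd_img (\<Sum>i\<in>A. \<Sum>k\<in>B i. kc (x i k) * fr (w i) (k + 1))"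
proof -
  interpret P: ring_onto psd_img "psdo U" by (rule psdo_onto)
  show ?thesis by (rule P.h_finsum, simp, rule P.h_finsum) (simp_all add: psdo_frac_img)
qed

section \<open>Restriction of operators to the exterior algebra\<close>

definition res :: "nat \<Rightarrow> nat \<Rightarrow> lin \<Rightarrow> ((nat \<times> nat) set \<Rightarrow> complex) \<Rightarrow> (nat \<times> nat) set \<Rightarrow> complex" where
  "res d n T = (\<lambda>f\<in>carrier (ext_alg d n). ap T f)"

definition dops :: "nat \<Rightarrow> nat \<Rightarrow> lin set" where
  "dops d n = tgen (xv ` ({1..d} \<times> {1..n}) \<union> dv ` ({1..d} \<times> {1..n}))"

lemma ext_carrier: "f \<in> carrier (ext_alg d n) \<longleftrightarrow> (\<forall>S. f S \<noteq> 0 \<longrightarrow> S \<subseteq> {1..d} \<times> {1..n})"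
  by (simp add: ext_alg_def)

lemma ext_fin_part: "f \<in> carrier (ext_alg d n) \<Longrightarrow> fin_part f = f"
proof
  fix S assume f: "f \<in> carrier (ext_alg d n)"
  show "fin_part f S = f S"
  proof (cases "finite S")
    case False
    hence "\<not> S \<subseteq> {1..d} \<times> {1..n}" using finite_subset by blast
    hence "f S = 0" using f ext_carrier by blast
    thus ?thesis by (simp add: fin_part_def)
  qed (simp add: fin_part_def)
qed

lemma dops_preserve: "T \<in> dops d n \<Longrightarrow> f \<in> carrier (ext_alg d n) \<Longrightarrow> ap T f \<in> carrier (ext_alg d n)"
  unfolding dops_def
proof (induction arbitrary: f rule: tgen.induct)
  case one
  thus ?case by (simp add: ap_ops ext_fin_part)
next
  case (gen T)
  show ?case unfolding ext_carrier
  proof (intro allI impI)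
    fix S assume nz: "ap T f S \<noteq> 0"
    from gen(1) show "S \<subseteq> {1..d} \<times> {1..n}"
    proof
      assume "T \<in> xv ` ({1..d} \<times> {1..n})"
      then obtain v where v: "v \<in> {1..d} \<times> {1..n}" "T = xv v" by auto
      hence "f (S - {v}) \<noteq> 0" using nz by (simp add: xv.rep_eq split: if_splits)
      hence "S - {v} \<subseteq> {1..d} \<times> {1..n}" using gen(2) ext_carrier by blast
      thus ?thesis using v(1) by blast
    next
      assume "T \<in> dv ` ({1..d} \<times> {1..n})"
      then obtain v where v: "T = dv v" by auto
      hence "f (insert v S) \<noteq> 0" using nz by (simp add: dv.rep_eq split: if_splits)
      hence "insert v S \<subseteq> {1..d} \<times> {1..n}" using gen(2) ext_carrier by blast
      thus ?thesis by blast
    qed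
  qed
next
  case (add a b)
  have ab: "ap a f \<in> carrier (ext_alg d n)" "ap b f \<in> carrier (ext_alg d n)" using add by auto
  show ?case unfolding ext_carrier
  proof (intro allI impI)
    fix S assume "ap (a + b) f S \<noteq> 0"
    hence "ap a f S \<noteq> 0 \<or> ap b f S \<noteq> 0" by (auto simp: ap_ops)
    thus "S \<subseteq> {1..d} \<times> {1..n}" using ab unfolding ext_carrier by blast
  qed
next
  case (mult a b)
  thus ?case by (simp add: ap_ops)
next
  case (cs a c)
  have a: "ap a f \<in> carrier (ext_alg d n)" using cs by auto
  show ?case unfolding ext_carrier
  proof (intro allI impI)
    fix S assume "ap (cs c * a) f S \<noteq> 0"
    hence "ap a f S \<noteq> 0" by (auto simp: ap_ops ap_lin)
    thus "S \<subseteq> {1..d} \<times> {1..n}" using a unfolding ext_carrier by blast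
  qed
qed

lemma res_ops:
  "res d n 1 = \<one>\<^bsub>End_alg (ext_alg d n)\<^esub>" "res d n 0 = \<zero>\<^bsub>End_alg (ext_alg d n)\<^esub>"
  "res d n (a + b) = res d n a \<oplus>\<^bsub>End_alg (ext_alg d n)\<^esub> res d n b"
  "b \<in> dops d n \<Longrightarrow> res d n (a * b) = res d n a \<otimes>\<^bsub>End_alg (ext_alg d n)\<^esub> res d n b"
  "res d n (cs c * a) = c \<odot>\<^bsub>End_alg (ext_alg d n)\<^esub> res d n a"
proof -
  show "res d n 1 = \<one>\<^bsub>End_alg (ext_alg d n)\<^esub>"
    unfolding res_def End_alg_def by (auto intro!: restrict_ext simp: ap_ops ext_fin_part)
  show "res d n 0 = \<zero>\<^bsub>End_alg (ext_alg d n)\<^esub>"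
    unfolding res_def End_alg_def by (auto intro!: restrict_ext simp: ap_ops ext_alg_def)
  show "res d n (a + b) = res d n a \<oplus>\<^bsub>End_alg (ext_alg d n)\<^esub> res d n b"
    unfolding res_def End_alg_def by (auto intro!: restrict_ext simp: ap_ops ext_alg_def)
  show "res d n (cs c * a) = c \<odot>\<^bsub>End_alg (ext_alg d n)\<^esub> res d n a"
    unfolding res_def End_alg_def by (auto intro!: restrict_ext simp: ap_ops ap_lin ext_alg_def)
  assume b: "b \<in> dops d n"
  show "res d n (a * b) = res d n a \<otimes>\<^bsub>End_alg (ext_alg d n)\<^esub> res d n b"
    unfolding res_def End_alg_def using dops_preserve[OF b] by (auto intro!: restrict_ext simp: ap_ops compose_def)
qed

lemma res_xv: "res d n (xv v) = mult_op d n v"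
  unfolding res_def mult_op_def
proof (rule restrict_ext, rule ext)
  fix f S
  have "(ext_var v \<otimes>\<^bsub>ext_alg d n\<^esub> f) S = (\<Sum>T\<in>Pow S. ext_sign T (S - T) * ext_var v T * f (S - T))"
    by (simp add: ext_alg_def)
  also have "\<dots> = (if finite S \<and> v \<in> S then ext_sign {v} (S - {v}) * f (S - {v}) else 0)"
  proof (cases "finite S")
    case True
    have "(\<Sum>T\<in>Pow S. ext_sign T (S - T) * ext_var v T * f (S - T)) = (\<Sum>T\<in>Pow S. if T = {v} then ext_sign {v} (S - {v}) * f (S - {v}) else 0)"
      by (rule sum.cong) (auto simp: ext_var_def)
    thus ?thesis using True by (simp add: sum.delta)
  next
    case False
    hence "infinite (Pow S)" by simp
    thus ?thesis using False by (simp only: sum.infinite simp_thms if_False)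
  qed
  finally show "ap (xv v) f S = (ext_var v \<otimes>\<^bsub>ext_alg d n\<^esub> f) S" by (simp add: xv.rep_eq)
qed

lemma res_dv: "res d n (dv v) = deriv_op d n v"
  unfolding res_def deriv_op_def
proof (rule restrict_ext, rule ext)
  fix f S assume "f \<in> carrier (ext_alg d n)"
  from ext_fin_part[OF this] have "fin_part f (insert v S) = f (insert v S)" by (rule fun_cong)
  thus "ap (dv v) f S = (if v \<in> S then 0 else ext_sign {v} S * f (insert v S))"
    by (auto simp: dv.rep_eq fin_part_def split: if_splits)
qed

lemma diff_ops_sel: "monoid.mult (diff_ops d n) = monoid.mult (End_alg (ext_alg d n))" "monoid.one (diff_ops d n) = monoid.one (End_alg (ext_alg d n))"
  "ring.zero (diff_ops d n) = ring.zero (End_alg (ext_alg d n))" "ring.add (diff_ops d n) = ring.add (End_alg (ext_alg d n))"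
  "smult (diff_ops d n) = smult (End_alg (ext_alg d n))"
  by (simp_all add: diff_ops_def Let_def)

lemma diff_ops_img: "ring_img (dops d n) (res d n) (diff_ops d n)"
proof
  let ?S = "xv ` ({1..d} \<times> {1..n}) \<union> dv ` ({1..d} \<times> {1..n})"
  have "alg_generate (End_alg (ext_alg d n)) (res d n ` ?S) = res d n ` tgen ?S"
    by (rule alg_generate_img) (auto simp: res_ops dops_def)
  moreover have "res d n ` ?S = mult_op d n ` ({1..d} \<times> {1..n}) \<union> deriv_op d n ` ({1..d} \<times> {1..n})"
    by (simp only: image_Un image_image res_xv res_dv)
  ultimately show "carrier (diff_ops d n) = res d n ` dops d n"
    by (simp add: diff_ops_def Let_def dops_def)
  fix a b assume ab: "a \<in> dops d n"
  have m: "cs (-1) = (- 1 :: lin)" using cs_add[of 1 "-1", where 'a = lin] by (simp add: cs_1 eq_neg_iff_add_eq_0 add.commute)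
  show "- a \<in> dops d n" using tgen.cs[OF ab[unfolded dops_def], of "-1"] by (simp add: m dops_def)
  assume "b \<in> dops d n"
  thus "a + b \<in> dops d n" "a * b \<in> dops d n" "res d n (a + b) = res d n a \<oplus>\<^bsub>diff_ops d n\<^esub> res d n b"
    "res d n (a * b) = res d n a \<otimes>\<^bsub>diff_ops d n\<^esub> res d n b"
    using ab by (auto simp: diff_ops_sel res_ops) (auto simp: dops_def intro: tgen.intros)
qed (auto simp: diff_ops_sel res_ops dops_def intro: tgen_0 tgen.one)

lemma diff_ops_smult: "a \<in> dops d n \<Longrightarrow> cs c * a \<in> dops d n \<and> c \<odot>\<^bsub>diff_ops d n\<^esub> res d n a = res d n (cs c * a)"
  by (auto simp: diff_ops_sel res_ops dops_def intro: tgen.cs)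

text \<open>Common to \<open>phi\<close> and \<open>varphi\<close>, which differ in the elements
  \<open>e\<close> playing the role of matrix units. The result replaces \<open>uea_lift\<close> by
  an algebra homomorphism between ring types.\<close>

lemma gl_lift:
  fixes N m :: nat and c :: "nat \<Rightarrow> nat" and e :: "nat \<times> nat \<Rightarrow> nat \<times> nat \<Rightarrow> lin"
  assumes e: "\<And>u v u' v'. e u v * e u' v' - e u' v' * e u v = (if v = u' then e u v' else 0) - (if v' = u then e u' v else 0)"
    and G: "\<And>a b i k. a \<in> {1..N} \<Longrightarrow> b \<in> {1..N} \<Longrightarrow> i \<in> {1..m} \<Longrightarrow> k < c i \<Longrightarrow> fe c e a b i k \<in> dops d n \<and> G a b i k = res d n (fe c e a b i k)"
  obtains \<Lambda> :: "(nat \<Rightarrow> nat \<Rightarrow> complex mat) falg \<Rightarrow> lin" where "alg_hom \<Lambda>"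
    "\<And>a b i k. a \<in> {1..N} \<Longrightarrow> b \<in> {1..N} \<Longrightarrow> i \<in> {1..m} \<Longrightarrow> k < c i \<Longrightarrow> \<Lambda> (flet (gl_takiff_elem N m c a b i k)) = fe c e a b i k"
    "\<And>f. uea_lift (diff_ops d n) (gl_takiff_linear (diff_ops d n) N m c G) (uea_pres.cls (gl_takiff N m c) f) = res d n (\<Lambda> f)"
proof -
  let ?L = "gl_takiff N m c"
  interpret L: uea_pres ?L by (rule uea_pres_gl)
  interpret D: ring_img "dops d n" "res d n" "diff_ops d n" by (rule diff_ops_img)
  define F where "F = gl_rep N m c e"
  have F: "F x = gl_rep N m c e x" for x by (simp only: F_def)
  note gr = gl_rep_lie[where e = e and n = N and m = m and c = c, OF e]
  have l1: "F (lie_add ?L x y) = F x + F y" if "x \<in> carrier ?L" "y \<in> carrier ?L" for x y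
    unfolding F by (rule gr(1)[OF that])
  have l2: "F (lie_smult ?L r x) = cs r * F x" if "x \<in> carrier ?L" for r x
    unfolding F by (rule gr(2)[OF that that])
  have l3: "F (lie_bracket ?L x y) = F x * F y - F y * F x" if "x \<in> carrier ?L" "y \<in> carrier ?L" for x y
    unfolding F by (rule gr(3)[OF that])
  show ?thesis
  proof (rule that)
    show "alg_hom (L.lam F)" by (rule L.lam_hom[where F = F, OF l1 l2 l3])
    show "L.lam F (flet (gl_takiff_elem N m c a b i k)) = fe c e a b i k"
      if "a \<in> {1..N}" "b \<in> {1..N}" "i \<in> {1..m}" "k < c i" for a b i k
      using L.lam_flet[where F = F, OF l1 l2 l3 gl_takiff_elem_carrier] gl_rep_elem[where e = e and n = N and m = m and c = c, OF e that(3,4,1,2)] by (simp add: F_def)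
    show "uea_lift (diff_ops d n) (gl_takiff_linear (diff_ops d n) N m c G) (L.cls f) = res d n (L.lam F f)" for f
    proof (rule L.uea_lift_img[where F = F, OF l1 l2 l3 diff_ops_img diff_ops_smult])
      fix X assume "X \<in> carrier ?L"
      have G': "(case q of (i, k, a, b) \<Rightarrow> cs (ent X i k a b) * fe c e a b i k) \<in> dops d n"
        "(case q of (i, k, a, b) \<Rightarrow> (X i k $$ (a - 1, b - 1)) \<odot>\<^bsub>diff_ops d n\<^esub> G a b i k)
          = res d n (case q of (i, k, a, b) \<Rightarrow> cs (ent X i k a b) * fe c e a b i k)" if q: "q \<in> quads N m c" for q
      proof -
        obtain i k a b where qe: "q = (i, k, a, b)" by (cases q) auto
        have i: "a \<in> {1..N}" "b \<in> {1..N}" "i \<in> {1..m}" "k < c i" using q unfolding qe by auto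
        show "(case q of (i, k, a, b) \<Rightarrow> cs (ent X i k a b) * fe c e a b i k) \<in> dops d n"
          using diff_ops_smult G[OF i] unfolding qe by auto
        show "(case q of (i, k, a, b) \<Rightarrow> (X i k $$ (a - 1, b - 1)) \<odot>\<^bsub>diff_ops d n\<^esub> G a b i k)
          = res d n (case q of (i, k, a, b) \<Rightarrow> cs (ent X i k a b) * fe c e a b i k)"
          using diff_ops_smult[of "fe c e a b i k" d n] G[OF i] unfolding qe by (simp add: ent_def)
      qed
      have "F X \<in> dops d n" unfolding F_def gl_rep_def[where e = e, OF e] glin_def[where e = e, OF e] by (rule D.T_sum) (rule G')
      moreover have "gl_takiff_linear (diff_ops d n) N m c G X = res d n (F X)"
        unfolding F_def gl_rep_def[where e = e, OF e] glin_def[where e = e, OF e] gl_takiff_linear_def by (rule D.h_finsum) (rule G', assumption)+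
      ultimately show "F X \<in> dops d n \<and> gl_takiff_linear (diff_ops d n) N m c G X = res d n (F X)" by blast
    qed auto
  qed
qed

section \<open>The duality\<close>

lemma block_bound:
  assumes "(\<Sum>i=1..m. c i) = N" "i \<in> {1..m}" "r \<in> {block_start c i + 1..block_start c (i + 1) - k}"
  shows "r \<in> {1..N}" "r + k \<in> {1..N}"
proof -
  have "block_start c (i + 1) \<le> block_start c (m + 1)" by (rule block_start_mono) (use assms(2) in auto)
  hence "block_start c (i + 1) \<le> N" using assms(1) by (simp only: block_start_total)
  thus "r \<in> {1..N}" "r + k \<in> {1..N}" using assms(3) by auto
qed

lemma gl_relation_lin:
  "- (dv v * xv u) * - (dv v' * xv u') - - (dv v' * xv u') * - (dv v * xv u)
    = (if v = u' then - (dv v' * xv u) else 0) - (if v' = u then - (dv v * xv u') else 0)"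
  by (rule fermions.yx_bracket[OF fermions_lin])

text \<open>For the odd general linear algebra the matrix index is the lower index of a variable and
  the position in a block is the upper one, so the coordinates of a pair are exchanged before
  \<open>fe\<close> is applied.\<close>

lemma gl_relation_lin_swap:
  "xv (prod.swap u) * dv (prod.swap v) * (xv (prod.swap u') * dv (prod.swap v')) - xv (prod.swap u') * dv (prod.swap v') * (xv (prod.swap u) * dv (prod.swap v))
    = (if v = u' then xv (prod.swap u) * dv (prod.swap v') else 0) - (if v' = u then xv (prod.swap u') * dv (prod.swap v) else 0)"
proof -
  have "prod.swap a = prod.swap b \<longleftrightarrow> a = b" for a b :: "nat \<times> nat" by (auto simp: prod_eq_iff)
  thus ?thesis using fermions.xy_bracket[OF fermions_lin, of "prod.swap u" "prod.swap v" "prod.swap u'" "prod.swap v'"] by (simp only:)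
qed

lemma phi_lift:
  assumes n: "(\<Sum>i=1..l. \<gamma> i) = n"
  obtains \<Lambda> :: "(nat \<Rightarrow> nat \<Rightarrow> complex mat) falg \<Rightarrow> lin" where "alg_hom \<Lambda>"
    "\<And>a b i k. a \<in> {1..d} \<Longrightarrow> b \<in> {1..d} \<Longrightarrow> i \<in> {1..l} \<Longrightarrow> k < \<gamma> i \<Longrightarrow> \<Lambda> (flet (gl_takiff_elem d l \<gamma> a b i k))
      = (\<Sum>r\<in>{block_start \<gamma> i + 1..block_start \<gamma> (i + 1) - k}. - (dv (b, r) * xv (a, r + k)))"
    "\<And>f. phi d n l \<gamma> (uea_pres.cls (gl_takiff d l \<gamma>) f) = res d n (\<Lambda> f)"
proof -
  interpret D: ring_img "dops d n" "res d n" "diff_ops d n" by (rule diff_ops_img)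
  define e where "e = (\<lambda>u v. - (dv v * xv u))"
  have e: "e u v * e u' v' - e u' v' * e u v = (if v = u' then e u v' else 0) - (if v' = u then e u' v else 0)" for u v u' v'
    unfolding e_def by (rule gl_relation_lin)
  have fe: "fe \<gamma> e a b i k = (\<Sum>r\<in>{block_start \<gamma> i + 1..block_start \<gamma> (i + 1) - k}. - (dv (b, r) * xv (a, r + k)))" for a b i k
    unfolding fe_def[where e = e, OF e] by (simp only: e_def)
  have *: "fe \<gamma> e a b i k \<in> dops d n \<and> phi_op d n \<gamma> a b i k = res d n (fe \<gamma> e a b i k)"
    if ab: "a \<in> {1..d}" "b \<in> {1..d}" "i \<in> {1..l}" "k < \<gamma> i" for a b i k
  proof -
    let ?R = "{block_start \<gamma> i + 1..block_start \<gamma> (i + 1) - k}"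
    have in_D: "dv (b, r) \<in> dops d n" "xv (a, r + k) \<in> dops d n" if "r \<in> ?R" for r
      using block_bound[OF n ab(3) that] ab(1,2) unfolding dops_def by (auto intro!: tgen.gen)
    have s: "(\<Sum>r\<in>?R. dv (b, r) * xv (a, r + k)) \<in> dops d n"
      by (intro D.T_sum D.T_mult in_D)
    have "(\<Oplus>\<^bsub>diff_ops d n\<^esub>r\<in>?R. deriv_op d n (b, r) \<otimes>\<^bsub>diff_ops d n\<^esub> mult_op d n (a, r + k)) = res d n (\<Sum>r\<in>?R. dv (b, r) * xv (a, r + k))"
      by (rule D.h_finsum) (simp_all only: D.T_mult D.h_mult in_D res_xv res_dv)
    hence "phi_op d n \<gamma> a b i k = res d n (- (\<Sum>r\<in>?R. dv (b, r) * xv (a, r + k)))"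
      unfolding phi_op_def Let_def by (simp only: D.h_minus[OF s])
    thus ?thesis using D.T_minus[OF s] unfolding fe sum_negf by blast
  qed
  obtain \<Lambda> :: "(nat \<Rightarrow> nat \<Rightarrow> complex mat) falg \<Rightarrow> lin" where L: "alg_hom \<Lambda>"
    "\<And>a b i k. a \<in> {1..d} \<Longrightarrow> b \<in> {1..d} \<Longrightarrow> i \<in> {1..l} \<Longrightarrow> k < \<gamma> i \<Longrightarrow> \<Lambda> (flet (gl_takiff_elem d l \<gamma> a b i k)) = fe \<gamma> e a b i k"
    "\<And>f. uea_lift (diff_ops d n) (gl_takiff_linear (diff_ops d n) d l \<gamma> (phi_op d n \<gamma>)) (uea_pres.cls (gl_takiff d l \<gamma>) f) = res d n (\<Lambda> f)"
    using gl_lift[where e = e and N = d and m = l and c = \<gamma> and G = "phi_op d n \<gamma>" and d = d and n = n, OF e *] by blast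
  show ?thesis by (rule that[of \<Lambda>]) (simp_all only: L fe phi_def)
qed

lemma varphi_lift:
  assumes d: "(\<Sum>a=1..d'. \<xi> a) = d"
  obtains \<Lambda> :: "(nat \<Rightarrow> nat \<Rightarrow> complex mat) falg \<Rightarrow> lin" where "alg_hom \<Lambda>"
    "\<And>i j a k. i \<in> {1..n} \<Longrightarrow> j \<in> {1..n} \<Longrightarrow> a \<in> {1..d'} \<Longrightarrow> k < \<xi> a \<Longrightarrow> \<Lambda> (flet (gl_takiff_elem n d' \<xi> i j a k))
      = (\<Sum>r\<in>{block_start \<xi> a + 1..block_start \<xi> (a + 1) - k}. xv (r + k, i) * dv (r, j))"
    "\<And>f. varphi d n d' \<xi> (uea_pres.cls (gl_takiff n d' \<xi>) f) = res d n (\<Lambda> f)"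
proof -
  interpret D: ring_img "dops d n" "res d n" "diff_ops d n" by (rule diff_ops_img)
  define e where "e = (\<lambda>u v. xv (prod.swap u) * dv (prod.swap v))"
  have e: "e u v * e u' v' - e u' v' * e u v = (if v = u' then e u v' else 0) - (if v' = u then e u' v else 0)" for u v u' v'
    unfolding e_def by (rule gl_relation_lin_swap)
  have fe: "fe \<xi> e i j a k = (\<Sum>r\<in>{block_start \<xi> a + 1..block_start \<xi> (a + 1) - k}. xv (r + k, i) * dv (r, j))" for i j a k
    unfolding fe_def[where e = e, OF e] by (simp only: e_def swap_simp)
  have *: "fe \<xi> e i j a k \<in> dops d n \<and> varphi_op d n \<xi> i j a k = res d n (fe \<xi> e i j a k)"
    if ij: "i \<in> {1..n}" "j \<in> {1..n}" "a \<in> {1..d'}" "k < \<xi> a" for i j a k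
  proof -
    let ?R = "{block_start \<xi> a + 1..block_start \<xi> (a + 1) - k}"
    have in_D: "xv (r + k, i) \<in> dops d n" "dv (r, j) \<in> dops d n" if "r \<in> ?R" for r
      using block_bound[OF d ij(3) that] ij(1,2) unfolding dops_def by (auto intro!: tgen.gen)
    have "varphi_op d n \<xi> i j a k = res d n (\<Sum>r\<in>?R. xv (r + k, i) * dv (r, j))"
      unfolding varphi_op_def Let_def
      by (rule D.h_finsum) (simp_all only: D.T_mult D.h_mult in_D res_xv res_dv)
    moreover have "(\<Sum>r\<in>?R. xv (r + k, i) * dv (r, j)) \<in> dops d n" by (intro D.T_sum D.T_mult in_D)
    ultimately show ?thesis unfolding fe by blast
  qed
  obtain \<Lambda> :: "(nat \<Rightarrow> nat \<Rightarrow> complex mat) falg \<Rightarrow> lin" where L: "alg_hom \<Lambda>"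
    "\<And>i j a k. i \<in> {1..n} \<Longrightarrow> j \<in> {1..n} \<Longrightarrow> a \<in> {1..d'} \<Longrightarrow> k < \<xi> a \<Longrightarrow> \<Lambda> (flet (gl_takiff_elem n d' \<xi> i j a k)) = fe \<xi> e i j a k"
    "\<And>f. uea_lift (diff_ops d n) (gl_takiff_linear (diff_ops d n) n d' \<xi> (varphi_op d n \<xi>)) (uea_pres.cls (gl_takiff n d' \<xi>) f) = res d n (\<Lambda> f)"
    using gl_lift[where e = e and N = n and m = d' and c = \<xi> and G = "varphi_op d n \<xi>" and d = d and n = n, OF e *] by blast
  show ?thesis by (rule that[of \<Lambda>]) (simp_all only: L fe varphi_def)
qed

lemma (in alg_onto) alg_generate_coeffs:
  "alg_generate U {psd_img C (f q) (g q) | q. P q} = p ` tgen {cf C (f q) (g q) | q. P q}"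
proof -
  have "{psd_img C (f q) (g q) | q. P q} = p ` {cf C (f q) (g q) | q. P q}" by (auto simp: psd_img_def)
  thus ?thesis by (simp only:) (rule alg_generate_img, simp_all add: h_1 h_add h_mult smult)
qed

theorem corollary4p7:
  fixes d n d' l :: nat and w z :: "nat \<Rightarrow> complex" and \<xi> \<gamma> :: "nat \<Rightarrow> nat"
  assumes "1 \<le> d" and "1 \<le> n"
    and "1 \<le> d'" and "d' \<le> d" and "1 \<le> l" and "l \<le> n"
    and "\<forall>a\<in>{1..d'}. 1 \<le> \<xi> a" and "(\<Sum>a=1..d'. \<xi> a) = d"
    and "\<forall>i\<in>{1..l}. 1 \<le> \<gamma> i" and "(\<Sum>i=1..l. \<gamma> i) = n"
  shows "phi d n l \<gamma> ` gaudin_gl d d' w \<xi> l z \<gamma> = varphi d n d' \<xi> ` gaudin_gl0 n l z \<gamma> d' w \<xi>"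
proof -
  note d = assms(8) and n = assms(10)
  let ?L1 = "gl_takiff d l \<gamma>" and ?L2 = "gl_takiff n d' \<xi>"
  let ?W = "jordan_entry d' \<xi> w" and ?Z = "jordan_entry l \<gamma> z"
  interpret L1: uea_pres ?L1 by (rule uea_pres_gl)
  interpret L2: uea_pres ?L2 by (rule uea_pres_gl)
  interpret U1: alg_onto L1.cls "uea ?L1" by (rule L1.cls_alg_onto)
  interpret U2: alg_onto L2.cls "uea ?L2" by (rule L2.cls_alg_onto)
  interpret P1: ring_onto U1.psd_img "psdo (uea ?L1)" by (rule U1.psdo_onto)
  interpret P2: ring_onto U2.psd_img "psdo (uea ?L2)" by (rule U2.psdo_onto)
  obtain \<Lambda>1 :: "(nat \<Rightarrow> nat \<Rightarrow> complex mat) falg \<Rightarrow> lin" where h1: "alg_hom \<Lambda>1"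
    and e1: "\<And>a b i k. a \<in> {1..d} \<Longrightarrow> b \<in> {1..d} \<Longrightarrow> i \<in> {1..l} \<Longrightarrow> k < \<gamma> i \<Longrightarrow> \<Lambda>1 (flet (gl_takiff_elem d l \<gamma> a b i k))
      = (\<Sum>r\<in>{block_start \<gamma> i + 1..block_start \<gamma> (i + 1) - k}. - (dv (b, r) * xv (a, r + k)))"
    and phi: "\<And>f. phi d n l \<gamma> (L1.cls f) = res d n (\<Lambda>1 f)"
    using phi_lift[OF n] by blast
  obtain \<Lambda>2 :: "(nat \<Rightarrow> nat \<Rightarrow> complex mat) falg \<Rightarrow> lin" where h2: "alg_hom \<Lambda>2"
    and e2: "\<And>i j a k. i \<in> {1..n} \<Longrightarrow> j \<in> {1..n} \<Longrightarrow> a \<in> {1..d'} \<Longrightarrow> k < \<xi> a \<Longrightarrow> \<Lambda>2 (flet (gl_takiff_elem n d' \<xi> i j a k))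
      = (\<Sum>r\<in>{block_start \<xi> a + 1..block_start \<xi> (a + 1) - k}. xv (r + k, i) * dv (r, j))"
    and varphi: "\<And>f. varphi d n d' \<xi> (L2.cls f) = res d n (\<Lambda>2 f)"
    using varphi_lift[OF d] by blast
  define S1 where "S1 a b = (\<Sum>i\<in>{1..l}. \<Sum>k\<in>{0..<\<gamma> i}. kc (flet (gl_takiff_elem d l \<gamma> a b i k)) * fr (z i) (k + 1))" for a b
  define G where "G a b = (if a = b then dd else 0) - psc (?W a b) - S1 a b" for a b
  define S2 where "S2 i j = (\<Sum>a\<in>{1..d'}. \<Sum>k\<in>{0..<\<xi> a}. kc (flet (gl_takiff_elem n d' \<xi> i j a k)) * fr (w a) (k + 1))" for i j
  \<comment> \<open>The part without derivation, with no positive exponents: the shape required by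
    \<open>dd_matrix_inverse\<close>.\<close>
  define u where "u i j = psc (?Z i j) - S2 i j" for i j
  define H where "H i j = (if i = j then dd else 0) - u i j" for i j
  have H: "H i j = (if i = j then dd else 0) - psc (?Z i j) + S2 i j" for i j
    by (simp add: H_def u_def)
  have "gaudin_gl_matrix d d' w \<xi> l z \<gamma> (a, b) = U1.psd_img (G a b)" for a b
    unfolding gaudin_gl_matrix_def Let_def prod.case L1.uea_gen_cls[OF gl_takiff_elem_carrier] U1.gaudin_sum_img U1.psdo_const_img U1.psdo_dz_img
      G_def S1_def by (simp add: P1.h_diff P1.h_0)
  note Gm = this
  have "gaudin_gl0_matrix n l z \<gamma> d' w \<xi> (i, j) = U2.psd_img (H i j)" for i j
    unfolding gaudin_gl0_matrix_def Let_def prod.case L2.uea_gen_cls[OF gl_takiff_elem_carrier] U2.gaudin_sum_img U2.psdo_const_img U2.psdo_dz_img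
      H S2_def by (simp add: P2.h_diff P2.h_add P2.h_0)
  note Hm = this
  have u: "pval 0 (u i j)" for i j
  proof -
    have "pval (0 + 0) (kc x * fr y k)" for x :: "(nat \<Rightarrow> nat \<Rightarrow> complex mat) falg" and y k
      unfolding fr_def by (rule pval_mult[OF pval_kc pval_zf])
    thus ?thesis unfolding u_def S2_def psc_def by (intro pval_diff pval_kc pval_sum) simp
  qed
  \<comment> \<open>The inverses are needed over the free algebra, before any homomorphism is
    applied, because the Berezinian is formed over the enveloping algebra. Their images under
    \<open>pmap\<close> are then inverse to the image matrix.\<close>
  define Q where "Q m X Y \<longleftrightarrow> (\<forall>i\<in>{1..m}. \<forall>j\<in>{1..m}. (\<Sum>k\<in>{1..m}. H i k * X k j) = (if i = j then 1 else 0))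
      \<and> (\<forall>i\<in>{1..m}. \<forall>j\<in>{1..m}. (\<Sum>k\<in>{1..m}. X i k * H k j) = (if i = j then 1 else 0))
      \<and> (\<forall>i\<in>{1..m}. X i i * Y i = 1 \<and> Y i * X i i = 1)" for m :: nat and X Y
  have "\<exists>X Y. Q m X Y" for m
  proof (rule dd_matrix_inverse[of "{1..m}" u, OF finite_atLeastAtMost u])
    fix X Y
    assume "\<And>a b. a \<in> {1..m} \<Longrightarrow> b \<in> {1..m} \<Longrightarrow> (\<Sum>c\<in>{1..m}. ((if a = c then dd else 0) - u a c) * X c b) = (if a = b then 1 else 0)"
      "\<And>a b. a \<in> {1..m} \<Longrightarrow> b \<in> {1..m} \<Longrightarrow> (\<Sum>c\<in>{1..m}. X a c * ((if c = b then dd else 0) - u c b)) = (if a = b then 1 else 0)"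
      "\<And>a. a \<in> {1..m} \<Longrightarrow> X a a * Y a = 1" "\<And>a. a \<in> {1..m} \<Longrightarrow> Y a * X a a = 1"
    hence "Q m X Y" unfolding Q_def H_def by (intro conjI ballI)
    thus ?thesis by (intro exI)
  qed
  note ex = this
  define V where "V m = (SOME X. \<exists>Y. Q m X Y)" for m
  have ex': "\<exists>Y. Q m (V m) Y" for m unfolding V_def by (rule someI_ex[OF ex])
  define Y where "Y m = (SOME Y. Q m (V m) Y)" for m
  have Q: "Q m (V m) (Y m)" for m unfolding Y_def by (rule someI_ex[OF ex'])
  have V: "(\<Sum>k\<in>{1..m}. H i k * V m k j) = (if i = j then 1 else 0)" "(\<Sum>k\<in>{1..m}. V m i k * H k j) = (if i = j then 1 else 0)"
    if "i \<in> {1..m}" "j \<in> {1..m}" for m i j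
    using Q[of m] that unfolding Q_def by blast+
  have Y: "V m m m * Y m m = 1" "Y m m * V m m m = 1" if "m \<in> {1..n}" for m
    using Q[of m] that unfolding Q_def by auto
  define C where "C = (\<Sum>\<sigma> | \<sigma> permutes {1..d}. of_int (sign \<sigma>) * prod_list (map (\<lambda>j. G (\<sigma> j) j) [1..<d+1]))"
  define B where "B = prod_list (map (\<lambda>m. V m m m) [1..<n+1])"
  have "cdet (psdo (uea ?L1)) d (gaudin_gl_matrix d d' w \<xi> l z \<gamma>) = U1.psd_img C"
    unfolding C_def by (rule P1.cdet_img) (simp add: Gm)
  hence "gaudin_gl d d' w \<xi> l z \<gamma> = L1.cls ` tgen {cf C s (int i - 1) | s i. i \<in> {1..d}}"
    using U1.alg_generate_coeffs[of C fst "\<lambda>q. int (snd q) - 1" "\<lambda>q. snd q \<in> {1..d}"] by (simp add: gaudin_gl_def Let_def)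
  hence phi_eq: "phi d n l \<gamma> ` gaudin_gl d d' w \<xi> l z \<gamma> = res d n ` (\<Lambda>1 ` tgen {cf C s (int i - 1) | s i. i \<in> {1..d}})"
    by (simp only: image_image phi)
  have "Ber (psdo (uea ?L2)) n (gaudin_gl0_matrix n l z \<gamma> d' w \<xi>) = U2.psd_img B"
    unfolding B_def by (rule P2.Ber_img[where N = H and U = "\<lambda>m. Y m m"]) (rule Hm V Y; assumption)+
  hence "gaudin_gl0 n l z \<gamma> d' w \<xi> = L2.cls ` tgen {cf B s i | s i. i \<le> - int n}"
    using U2.alg_generate_coeffs[of B fst snd "\<lambda>q. snd q \<le> - int n"] by (simp add: gaudin_gl0_def Let_def)
  hence varphi_eq: "varphi d n d' \<xi> ` gaudin_gl0 n l z \<gamma> d' w \<xi> = res d n ` (\<Lambda>2 ` tgen {cf B s i | s i. i \<le> - int n})"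
    by (simp only: image_image varphi)
  have "\<Lambda>1 ` {cf C s (int i - 1) | s i. i \<in> {1..d}} = {cf (pmap \<Lambda>1 C) s (int i - 1) | s i. i \<in> {1..d}}"
    unfolding cf_pmap[OF h1] by blast
  hence im1: "\<Lambda>1 ` tgen {cf C s (int i - 1) | s i. i \<in> {1..d}} = tgen {cf (pmap \<Lambda>1 C) s (int i - 1) | s i. i \<in> {1..d}}"
    by (simp only: tgen_image[OF h1])
  have "\<Lambda>2 ` {cf B s i | s i. i \<le> - int n} = {cf (pmap \<Lambda>2 B) s i | s i. i \<le> - int n}"
    unfolding cf_pmap[OF h2] by blast
  hence im2: "\<Lambda>2 ` tgen {cf B s i | s i. i \<le> - int n} = tgen {cf (pmap \<Lambda>2 B) s i | s i. i \<le> - int n}"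
    by (simp only: tgen_image[OF h2])
  \<comment> \<open>The minus sign in the definition of \<open>phi\<close> cancels the one in front
    of the Takiff sum in the column determinant, so the quadratic part enters with a plus
    sign.\<close>
  have "pmap \<Lambda>1 (S1 a b) = - (\<Sum>r\<in>{1..n}. \<Sum>s\<in>{1..n}. kc (dv (b, r)) * kc (xv (a, s)) * jinv \<gamma> z r s)"
    if ab: "a \<in> {1..d}" "b \<in> {1..d}" for a b
  proof -
    have "pmap \<Lambda>1 (S1 a b) = (\<Sum>i\<in>{1..l}. \<Sum>k\<in>{0..<\<gamma> i}. kc (\<Sum>r\<in>{block_start \<gamma> i + 1..block_start \<gamma> (i + 1) - k}. - (dv (b, r) * xv (a, r + k))) * fr (z i) (k + 1))"
      unfolding S1_def pmap_sum[OF h1] pmap_mult[OF h1] pmap_kc[OF h1] fr_def pmap_zf[OF h1]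
      by (rule sum.cong[OF refl], rule sum.cong[OF refl], subst e1) (use ab in auto)
    also have "\<dots> = (\<Sum>r\<in>{1..n}. \<Sum>s\<in>{1..n}. kc (- (dv (b, r) * xv (a, s))) * jinv \<gamma> z r s)"
      by (rule gaudin_jinv[OF n])
    finally show ?thesis by (simp only: kc_minus kc_mult mult_minus_left sum_negf)
  qed
  hence M: "pmap \<Lambda>1 (G a b) = (if a = b then dd else 0) - psc (?W a b)
      + (\<Sum>r\<in>{1..n}. \<Sum>s\<in>{1..n}. kc (dv (b, r)) * kc (xv (a, s)) * jinv \<gamma> z r s)"
    if "a \<in> {1..d}" "b \<in> {1..d}" for a b
    using that by (simp add: G_def pmap_diff[OF h1] pmap_psc[OF h1] pmap_mono[OF h1] pmap_0[OF h1] if_distrib[of "pmap \<Lambda>1"])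
  have "pmap \<Lambda>2 (S2 i j) = (\<Sum>a\<in>{1..d}. \<Sum>b\<in>{1..d}. kc (xv (b, i)) * kc (dv (a, j)) * jinv \<xi> w a b)"
    if ij: "i \<in> {1..n}" "j \<in> {1..n}" for i j
  proof -
    have "pmap \<Lambda>2 (S2 i j) = (\<Sum>a\<in>{1..d'}. \<Sum>k\<in>{0..<\<xi> a}. kc (\<Sum>r\<in>{block_start \<xi> a + 1..block_start \<xi> (a + 1) - k}. xv (r + k, i) * dv (r, j)) * fr (w a) (k + 1))"
      unfolding S2_def pmap_sum[OF h2] pmap_mult[OF h2] pmap_kc[OF h2] fr_def pmap_zf[OF h2]
      by (rule sum.cong[OF refl], rule sum.cong[OF refl], subst e2) (use ij in auto)
    also have "\<dots> = (\<Sum>r\<in>{1..d}. \<Sum>s\<in>{1..d}. kc (xv (s, i) * dv (r, j)) * jinv \<xi> w r s)"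
      by (rule gaudin_jinv[OF d])
    finally show ?thesis by (simp only: kc_mult)
  qed
  hence N: "pmap \<Lambda>2 (H i j) = (if i = j then dd else 0) - psc (?Z i j)
      + (\<Sum>a\<in>{1..d}. \<Sum>b\<in>{1..d}. kc (xv (b, i)) * kc (dv (a, j)) * jinv \<xi> w a b)"
    if "i \<in> {1..n}" "j \<in> {1..n}" for i j
    using that by (simp add: H pmap_add[OF h2] pmap_diff[OF h2] pmap_psc[OF h2] pmap_mono[OF h2] pmap_0[OF h2] if_distrib[of "pmap \<Lambda>2"])
  have one: "pmap \<Lambda>2 (if i = j then 1 else 0) = (if i = j then 1 else 0)" for i j :: nat
    by (simp add: pmap_0[OF h2] pmap_1[OF h2])
  have "tgen {cf (pmap \<Lambda>1 C) s (int i - 1) | s i. i \<in> {1..d}} = tgen {cf (pmap \<Lambda>2 B) s i | s i. i \<le> - int n}"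
    unfolding C_def B_def pmap_cdet[OF h1] pmap_prod_list[OF h2] map_map o_def
  proof (rule coefficient_duality_cong[where V = "\<lambda>m i j. pmap \<Lambda>2 (V m i j)", OF fermions_lin d n M N])
    fix m i j :: nat assume "i \<in> {1..m}" "j \<in> {1..m}"
    note V' = V[OF this]
    show "(\<Sum>k\<in>{1..m}. pmap \<Lambda>2 (H i k) * pmap \<Lambda>2 (V m k j)) = (if i = j then 1 else 0)"
      using arg_cong[OF V'(1), of "pmap \<Lambda>2"] by (simp only: pmap_sum[OF h2] pmap_mult[OF h2] one)
    show "(\<Sum>k\<in>{1..m}. pmap \<Lambda>2 (V m i k) * pmap \<Lambda>2 (H k j)) = (if i = j then 1 else 0)"
      using arg_cong[OF V'(2), of "pmap \<Lambda>2"] by (simp only: pmap_sum[OF h2] pmap_mult[OF h2] one)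
  qed
  thus ?thesis unfolding phi_eq varphi_eq im1 im2 by (rule arg_cong)
qed

end
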